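(* Let $r\geq k\geq 3$ be fixed integers. Then \[S^k_{2r+1}(n)=\binom{r}{k}\left(\frac{n}{r}\right)^k+\Theta(n^{k-2/3})\] as $n\to\infty$; that is, there exist constants $c_1,c_2>0$ and $n_0\in\mathbb{N}$, depending only on $r$ and $k$, such that for all integers $n\geq n_0$, \[\binom{r}{k}\left(\frac{n}{r}\right)^k+c_1 n^{k-2/3}\leq S^k_{2r+1}(n)\leq \binom{r}{k}\left(\frac{n}{r}\right)^k+c_2 n^{k-2/3}.\]
   Context: A regular $(k-1)$-simplex in $\mathbb{R}^d$ is a set of $k$ distinct points of $\mathbb{R}^d$ that are pairwise equidistant (i.e., all $\binom{k}{2}$ pairwise Euclidean distances are equal; the common distance is arbitrary and may differ between simplices). A set $X\subseteq\mathbb{R}^d$ spans a regular $(k-1)$-simplex $\Delta$ if $\Delta\subseteq X$. $S^k_d(n)$ denotes the maximum number of regular $(k-1)$-simplices spanned by a set of $n$ points in $\mathbb{R}^d$, i.e., the maximum over all $n$-point sets $X\subseteq\mathbb{R}^d$ of the number of $k$-element subsets of $X$ that are regular $(k-1)$-simplices. *)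

theory Defs
  imports "HOL-Analysis.Analysis"
begin

definition regular_simplex :: "nat \<Rightarrow> 'a::metric_space set \<Rightarrow> bool" where
  "regular_simplex k \<Delta> \<longleftrightarrow> finite \<Delta> \<and> card \<Delta> = k \<and>
     (\<exists>\<delta>. \<forall>x\<in>\<Delta>. \<forall>y\<in>\<Delta>. x \<noteq> y \<longrightarrow> dist x y = \<delta>)"

definition spanned_simplices :: "nat \<Rightarrow> 'a::metric_space set \<Rightarrow> 'a set set" where
  "spanned_simplices k X = {\<Delta>. \<Delta> \<subseteq> X \<and> regular_simplex k \<Delta>}"

text \<open>In \<open>max_simplices TYPE('d) k n\<close> the parameter \<open>k\<close> is the number of vertices of a simplex
  (its dimension is \<open>k - 1\<close>), and the ambient dimension is \<open>CARD('d)\<close>.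
  The set below is finite and nonempty, so that \<open>Max\<close> is a genuine maximum: see the lemmas
  \<open>max_simplices_attained\<close> and \<open>max_simplices_ge\<close>.\<close>

definition max_simplices :: "'d::finite itself \<Rightarrow> nat \<Rightarrow> nat \<Rightarrow> nat" where
  "max_simplices _ k n =
     Max {card (spanned_simplices k X) | X :: (real ^ 'd) set. finite X \<and> card X = n}"

lemma finite_simplex_counts:
  "finite {card (spanned_simplices k X) | X :: (real ^ 'd::finite) set. finite X \<and> card X = n}"
proof (rule finite_subset)
  have "card (spanned_simplices k X) \<le> 2 ^ n" if "finite X" "card X = n" for X :: "(real ^ 'd) set"
  proof -
    have "card (spanned_simplices k X) \<le> card (Pow X)"
      using that by (intro card_mono) (auto simp: spanned_simplices_def)
    with that show ?thesis
      by (simp add: card_Pow)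
  qed
  then show "{card (spanned_simplices k X) | X :: (real ^ 'd) set. finite X \<and> card X = n} \<subseteq> {..2 ^ n}"
    by auto
qed simp

lemma max_simplices_ge:
  fixes X :: "(real ^ 'd::finite) set"
  assumes "finite X" "card X = n"
  shows "card (spanned_simplices k X) \<le> max_simplices TYPE('d) k n"
  unfolding max_simplices_def using assms by (intro Max_ge finite_simplex_counts) auto

lemma max_simplices_attained:
  "\<exists>X :: (real ^ 'd::finite) set. finite X \<and> card X = n \<and>
     card (spanned_simplices k X) = max_simplices TYPE('d) k n"
proof -
  have "\<not> bounded (UNIV :: (real ^ 'd) set)"
    by (rule not_bounded_UNIV)
  then have "infinite (UNIV :: (real ^ 'd) set)"
    using finite_imp_bounded by blast
  then obtain X :: "(real ^ 'd) set" where "finite X" "card X = n"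
    using infinite_arbitrarily_large by blast
  then have "{card (spanned_simplices k X) | X :: (real ^ 'd) set. finite X \<and> card X = n} \<noteq> {}"
    by blast
  from Max_in[OF finite_simplex_counts this] show ?thesis
    unfolding max_simplices_def by auto
qed

end

theory Submission
  imports Defs
begin

text \<open>
  Upper bound. Two finite sets with all cross distances equal span orthogonal directions, and three points
  on a sphere are not collinear; hence \<open>r + 1\<close> such sets of three points do not fit into dimension
  \<open>2 r + 1\<close>. Consequently the graph of the pairs that lie in many equilateral triangles contains few
  \<open>(r + 1)\<close>-cliques, and the Moon--Moser inequalities force the clique densities to be those of the
  Turan graph as soon as all points have almost the maximal degree (which can be assumed by deleting
  points of small degree). A typical regular \<open>r\<close>-clique \<open>C\<close> then partitions almost all points
  according to the unique vertex of \<open>C\<close> which they can replace, and almost all distances between different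
  parts equal the side of \<open>C\<close>. Making the affine hulls of the parts robust turns this into an exact Lenz
  configuration: orthogonal circles, one of which may be a 2-sphere, that contain all points. In such a
  configuration, simplices with at most one vertex in each part contribute the main term. All others either
  contain an edge of the fixed length inside a part, of which there are \<open>O(n\<^sup>4\<^sup>/\<^sup>3)\<close> by the
  Szemeredi--Trotter theorem since at this distance on the 2-sphere vectors are orthogonal, or are determined
  up to finitely many choices by fewer vertices.

  Lower bound. A balanced Lenz configuration, with an extremal point-line grid projected to the 2-sphere.
\<close>

section \<open>Crossings and incidences\<close>

text \<open>An approximate structure theorem would only give an error of lower order than
  \<open>n ^ k\<close>, while the target is \<open>n powr (k - 2/3)\<close>. So the main term has to
  be captured exactly. The upper bound is therefore an induction on the number of points: deleting a
  vertex of degree below \<open>c * (n - 1) ^ (k - 1)\<close> costs no more than the main term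
  gains, and stability is invoked only when all degrees are nearly extremal, so that every single
  point has to fit into the configuration. The obstacle in the density part is that equilateral
  cliques violate the Moon--Moser exchange condition at size 2, since two edges at a point may have
  different lengths. Hence two complexes run side by side: \<open>heavy_clique\<close>, the clique
  complex of a graph, supplies the edge density, and \<open>regular_clique\<close> satisfies the
  inequality from size 3 on. The obstacle in the geometric part is the odd dimension: one part may
  span three dimensions and still be cut down to a plane by deleting points, so dimension is traded
  against deleted points. The exponent is \<open>4/3 + (k - 2)\<close>: an incidence bound for one
  pair, free choices for the other vertices.\<close>

type_synonym pt = "real \<times> real"

definition seg_slope :: "pt \<times> pt \<Rightarrow> real" where
  "seg_slope e = (snd (snd e) - snd (fst e)) / (fst (snd e) - fst (fst e))"

definition seg_at :: "pt \<times> pt \<Rightarrow> real \<Rightarrow> real" where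
  "seg_at e x = snd (fst e) + seg_slope e * (x - fst (fst e))"

text \<open>An edge is a pair with its left endpoint first, viewed as the graph of an affine
  function. Asking for a common point strictly inside both intervals excludes mere contacts at an
  endpoint, while overlapping collinear edges do count.\<close>

definition seg_cross :: "pt \<times> pt \<Rightarrow> pt \<times> pt \<Rightarrow> bool" where
  "seg_cross e f \<longleftrightarrow> e \<noteq> f \<and> (\<exists>x. fst (fst e) < x \<and> fst (fst f) < x \<and> x < fst (snd e) \<and> x < fst (snd f) \<and>
     seg_at e x = seg_at f x)"

lemma seg_at_left [simp]: "seg_at e (fst (fst e)) = snd (fst e)"
  by (simp add: seg_at_def)

lemma seg_at_right: "fst (fst e) < fst (snd e) \<Longrightarrow> seg_at e (fst (snd e)) = snd (snd e)"
  by (simp add: seg_at_def seg_slope_def)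

lemma seg_cross_sign_change:
  assumes "e \<noteq> f" "a < b" "fst (fst e) \<le> a" "fst (fst f) \<le> a" "b \<le> fst (snd e)" "b \<le> fst (snd f)"
    and "seg_at e a < seg_at f a" "seg_at e b > seg_at f b"
  shows "seg_cross e f"
proof -
  have "\<exists>x. a \<le> x \<and> x \<le> b \<and> seg_at e x - seg_at f x = 0"
    by (rule IVT') (use assms in \<open>auto simp: seg_at_def intro!: continuous_intros\<close>)
  then obtain x where x: "a \<le> x" "x \<le> b" "seg_at e x = seg_at f x" by auto
  then have "x \<noteq> a" "x \<noteq> b" using assms by auto
  then show ?thesis unfolding seg_cross_def using x assms by (intro conjI exI[of _ x]) auto
qed

text \<open>The wedge between two angularly consecutive edges leaving a vertex to the right is charged to the
  leftmost vertex in it. Without crossings, a vertex is charged at most once for each way in which it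
  can lie on the two sides of the wedge.\<close>

lemma plane_graph_edge_bound:
  fixes V :: "pt set" and E :: "(pt \<times> pt) set"
  assumes V: "finite V" "inj_on fst V"
    and E: "E \<subseteq> V \<times> V" "\<And>e. e \<in> E \<Longrightarrow> fst (fst e) < fst (snd e)"
    and nc: "\<And>e f. e \<in> E \<Longrightarrow> f \<in> E \<Longrightarrow> \<not> seg_cross e f"
  shows "card E \<le> 5 * card V"
proof -
  have finE: "finite E" using finite_subset[OF E(1)] V by auto
  have slope_ne: "seg_slope e \<noteq> seg_slope f" if "e \<in> E" "f \<in> E" "fst e = fst f" "e \<noteq> f" for e f
  proof
    assume eq: "seg_slope e = seg_slope f"
    define x where "x = (fst (fst e) + min (fst (snd e)) (fst (snd f))) / 2"
    have "fst (fst e) < min (fst (snd e)) (fst (snd f))" using E(2)[OF that(1)] E(2)[OF that(2)] that(3) by auto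
    then have "fst (fst e) < x" "x < fst (snd e)" "x < fst (snd f)" unfolding x_def by auto
    then have "seg_cross e f" unfolding seg_cross_def using that eq by (auto simp: seg_at_def)
    then show False using nc that by blast
  qed
  define above where "above e = {f \<in> E. fst f = fst e \<and> seg_slope e < seg_slope f}" for e
  define B where "B = {e \<in> E. above e \<noteq> {}}"
  \<comment> \<open>Outside \<open>B\<close> there is at most the steepest edge at each left
    endpoint; this is the fifth \<open>card V\<close>.\<close>
  have tops: "card (E - B) \<le> card V"
  proof (rule card_inj_on_le[where f = fst])
    show "inj_on fst (E - B)"
    proof (rule inj_onI)
      fix e f assume ef: "e \<in> E - B" "f \<in> E - B" "fst e = fst f"
      show "e = f"
      proof (rule ccontr)
        assume "e \<noteq> f"
        then have "seg_slope e \<noteq> seg_slope f" using slope_ne ef by auto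
        then have "f \<in> above e \<or> e \<in> above f" using ef by (auto simp: above_def)
        then show False using ef by (auto simp: B_def)
      qed
    qed
    show "fst ` (E - B) \<subseteq> V" using E by auto
  qed (use V in auto)
  define up where "up e = arg_min_on seg_slope (above e)" for e
  have finab: "finite (above e)" for e using finE by (auto simp: above_def)
  have up: "up e \<in> E" "fst (up e) = fst e" "seg_slope e < seg_slope (up e)" if "e \<in> B" for e
    using arg_min_if_finite(1)[OF finab, of e seg_slope] that unfolding B_def up_def above_def by auto
  have up_min: "seg_slope (up e) \<le> seg_slope f" if "e \<in> B" "f \<in> above e" for e f
    using arg_min_least[OF finab _ that(2), of seg_slope] that unfolding up_def B_def by auto
  \<comment> \<open>The closed wedge between \<open>e\<close> and the next steeper edge
    \<open>up e\<close> at the same vertex, cut off where the first of the two ends. The right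
    endpoint of that edge lies in it, so it is not empty.\<close>
  define T where "T e = {v \<in> V. fst (fst e) < fst v \<and> fst v \<le> fst (snd e) \<and> fst v \<le> fst (snd (up e)) \<and>
       seg_at e (fst v) \<le> snd v \<and> snd v \<le> seg_at (up e) (fst v)}" for e
  have finT: "finite (T e)" for e using V by (auto simp: T_def)
  have le_at: "seg_at e x < seg_at (up e) x" if "e \<in> B" "fst (fst e) < x" for e x
    using up[OF that(1)] that(2) by (simp add: seg_at_def)
  have T_ne: "T e \<noteq> {}" if eB: "e \<in> B" for e
  proof -
    have eE: "e \<in> E" using eB by (auto simp: B_def)
    have l: "fst (fst e) < fst (snd e)" "fst (fst e) < fst (snd (up e))"
      using E(2)[OF eE] E(2)[OF up(1)[OF eB]] up(2)[OF eB] by auto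
    have r: "seg_at e (fst (snd e)) = snd (snd e)" "seg_at (up e) (fst (snd (up e))) = snd (snd (up e))"
      using seg_at_right l up(2)[OF eB] by auto
    have inV: "snd e \<in> V" "snd (up e) \<in> V" using E(1) eE up(1)[OF eB] by auto
    show ?thesis
    proof (cases "fst (snd e) \<le> fst (snd (up e))")
      case True
      then have "snd e \<in> T e" using l r inV le_at[OF eB l(1)] by (auto simp: T_def)
      then show ?thesis by auto
    next
      case False
      then have "snd (up e) \<in> T e" using l r inV le_at[OF eB l(2)] by (auto simp: T_def)
      then show ?thesis by auto
    qed
  qed
  define s where "s e = arg_min_on fst (T e)" for e
  have sT: "s e \<in> T e" if "e \<in> B" for e
    using arg_min_if_finite(1)[OF finT T_ne[OF that]] by (auto simp: s_def)
  have s_min: "fst (s e) \<le> fst v" if "e \<in> B" "v \<in> T e" for e v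
    using arg_min_least[OF finT T_ne[OF that(1)] that(2)] by (auto simp: s_def)
  \<comment> \<open>The flags record whether the charged vertex lies on the lower or on the upper
    side of the wedge. They give four colours, hence \<open>4 * card V\<close>, and settle the
    degenerate cases in which two wedges only touch.\<close>
  define ch where "ch e = (s e, snd (s e) = seg_at e (fst (s e)), snd (s e) = seg_at (up e) (fst (s e)))" for e
  have not_both: "\<not> (snd (s e) = seg_at e (fst (s e)) \<and> snd (s e) = seg_at (up e) (fst (s e)))" if "e \<in> B" for e
    using le_at[OF that, of "fst (s e)"] sT[OF that] by (auto simp: T_def)
  \<comment> \<open>Two wedges at one apex: that of \<open>f\<close> starts at or above
    \<open>up e\<close>, so a common vertex lies on both \<open>up e\<close> and \<open>f\<close>.
    Equal flags then put it on both sides of the wedge of \<open>e\<close>.\<close>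
  have key1: False if ef: "e \<in> B" "f \<in> B" "ch e = ch f" "fst e = fst f" "seg_slope e < seg_slope f" for e f
  proof -
    have sf: "s f = s e" using ef by (auto simp: ch_def)
    have "f \<in> above e" using ef by (auto simp: above_def B_def)
    then have "seg_slope (up e) \<le> seg_slope f" using up_min ef by blast
    moreover have x: "fst (fst e) < fst (s e)" using sT[OF ef(1)] by (auto simp: T_def)
    ultimately have "seg_at (up e) (fst (s e)) \<le> seg_at f (fst (s e))"
      using up(2)[OF ef(1)] ef(4) by (simp add: seg_at_def)
    moreover have "seg_at f (fst (s e)) \<le> snd (s e)" using sT[OF ef(2)] sf by (auto simp: T_def)
    moreover have "snd (s e) \<le> seg_at (up e) (fst (s e))" using sT[OF ef(1)] by (auto simp: T_def)
    ultimately have "snd (s e) = seg_at f (fst (s e))" "snd (s e) = seg_at (up e) (fst (s e))" by auto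
    then show False using not_both[OF ef(1)] ef(3) sf by (auto simp: ch_def)
  qed
  \<comment> \<open>The apex of \<open>f\<close> is left of the charged vertex, so by the leftmost
    choice of \<open>s e\<close> it is outside the wedge of \<open>e\<close>. On the way to
    \<open>s e\<close>, an edge from this apex has to cross a side of the wedge of \<open>e\<close>
    or to meet it exactly at \<open>s e\<close>, and the flags exclude the latter.\<close>
  have key2: False if ef: "e \<in> B" "f \<in> B" "ch e = ch f" "fst (fst e) < fst (fst f)" for e f
  proof -
    have sf: "s f = s e" using ef by (auto simp: ch_def)
    have E': "e \<in> E" "f \<in> E" using ef by (auto simp: B_def)
    note ue = up[OF ef(1)] and uf = up[OF ef(2)]
    have se: "fst (s e) \<le> fst (snd e)" "fst (s e) \<le> fst (snd (up e))"
      "seg_at e (fst (s e)) \<le> snd (s e)" "snd (s e) \<le> seg_at (up e) (fst (s e))"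
      using sT[OF ef(1)] by (auto simp: T_def)
    have sff: "fst (fst f) < fst (s e)" "fst (s e) \<le> fst (snd f)" "fst (s e) \<le> fst (snd (up f))"
      "seg_at f (fst (s e)) \<le> snd (s e)" "snd (s e) \<le> seg_at (up f) (fst (s e))"
      using sT[OF ef(2)] sf by (auto simp: T_def)
    have "fst f \<notin> T e" using s_min[OF ef(1), of "fst f"] sff(1) by auto
    moreover have "fst f \<in> V" using E(1) E' by auto
    ultimately have "snd (fst f) < seg_at e (fst (fst f)) \<or> seg_at (up e) (fst (fst f)) < snd (fst f)"
      using ef(4) se sff by (auto simp: T_def)
    then show False
    proof
      assume a: "seg_at (up e) (fst (fst f)) < snd (fst f)"
      have "seg_at (up e) (fst (s e)) = seg_at f (fst (s e))"
      proof (rule ccontr)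
        assume "\<not> ?thesis"
        then have "seg_at (up e) (fst (s e)) > seg_at f (fst (s e))" using se sff by auto
        then have "seg_cross (up e) f"
          by (intro seg_cross_sign_change[where a = "fst (fst f)" and b = "fst (s e)"]) (use a se sff ue ef in auto)
        then show False using nc ue E' by blast
      qed
      then have "snd (s e) = seg_at f (fst (s e))" "snd (s e) = seg_at (up e) (fst (s e))" using se sff by auto
      then show False using not_both[OF ef(1)] ef(3) sf by (auto simp: ch_def)
    next
      assume a: "snd (fst f) < seg_at e (fst (fst f))"
      have "seg_at (up f) (fst (s e)) = seg_at e (fst (s e))"
      proof (rule ccontr)
        assume "\<not> ?thesis"
        then have "seg_at (up f) (fst (s e)) > seg_at e (fst (s e))" using se sff by auto
        moreover have "seg_at (up f) (fst (fst f)) = snd (fst f)" using seg_at_left[of "up f"] uf(2) by simp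
        ultimately have "seg_cross (up f) e"
          by (intro seg_cross_sign_change[where a = "fst (fst f)" and b = "fst (s e)"]) (use a se sff uf ef in auto)
        then show False using nc uf E' by blast
      qed
      then have "snd (s e) = seg_at e (fst (s e))" "snd (s e) = seg_at (up f) (fst (s e))" using se sff by auto
      then show False using not_both[OF ef(1)] ef(3) sf by (auto simp: ch_def)
    qed
  qed
  have "inj_on ch B"
  proof (rule inj_onI, rule ccontr)
    fix e f assume ef: "e \<in> B" "f \<in> B" "ch e = ch f" "e \<noteq> f"
    have E': "e \<in> E" "f \<in> E" using ef by (auto simp: B_def)
    show False
    proof (cases "fst e = fst f")
      case True
      then have "seg_slope e < seg_slope f \<or> seg_slope f < seg_slope e" using slope_ne[OF E'] ef by auto
      then show False using key1[of e f] key1[of f e] ef True by auto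
    next
      case False
      moreover have "fst e \<in> V" "fst f \<in> V" using E(1) E' by auto
      ultimately have "fst (fst e) \<noteq> fst (fst f)" using inj_onD[OF V(2)] by blast
      then show False using key2[of e f] key2[of f e] ef by (auto simp: neq_iff)
    qed
  qed
  moreover have "ch ` B \<subseteq> V \<times> UNIV" using sT by (auto simp: ch_def T_def)
  ultimately have "card B \<le> card (V \<times> (UNIV :: (bool \<times> bool) set))"
    using V by (intro card_inj_on_le[where f = ch]) auto
  also have "\<dots> = 4 * card V" by (simp add: card_cartesian_product)
  finally have "card B \<le> 4 * card V" .
  moreover have "card E = card B + card (E - B)"
    using finE by (subst card_Un_disjoint[symmetric]) (auto simp: B_def intro!: arg_cong[where f = card])
  ultimately show ?thesis using tops by linarith
qed

section \<open>Crossings in drawings with many edges\<close>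

definition crossings :: "(pt \<times> pt) set \<Rightarrow> ((pt \<times> pt) \<times> (pt \<times> pt)) set" where
  "crossings E = {(e, f). e \<in> E \<and> f \<in> E \<and> seg_cross e f}"

lemma finite_crossings: "finite E \<Longrightarrow> finite (crossings E)"
  by (rule finite_subset[of _ "E \<times> E"]) (auto simp: crossings_def)

text \<open>Removing one edge of a crossing pair destroys at least one element of
  \<open>crossings E\<close>, so induction on the number of edges reduces to the plane case.\<close>

lemma crossings_ge:
  fixes V :: "pt set" and E :: "(pt \<times> pt) set"
  assumes V: "finite V" "inj_on fst V"
    and E: "E \<subseteq> V \<times> V" "\<And>e. e \<in> E \<Longrightarrow> fst (fst e) < fst (snd e)"
  shows "card E \<le> card (crossings E) + 5 * card V"
  using E
proof (induction "card E" arbitrary: E rule: less_induct)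
  case less
  have finE: "finite E" using finite_subset[OF less.prems(1)] V by auto
  show ?case
  proof (cases "crossings E = {}")
    case True
    then have "\<not> seg_cross e f" if "e \<in> E" "f \<in> E" for e f using that unfolding crossings_def by blast
    then have "card E \<le> 5 * card V" by (intro plane_graph_edge_bound[OF V less.prems]) auto
    then show ?thesis by simp
  next
    case False
    then obtain e f where ef: "(e, f) \<in> crossings E" by auto
    then have eE: "e \<in> E" by (auto simp: crossings_def)
    have "card (E - {e}) \<le> card (crossings (E - {e})) + 5 * card V"
      using less.prems by (intro less.hyps card_Diff1_less finE eE) auto
    moreover have "card (crossings (E - {e})) < card (crossings E)"
      using ef finite_crossings[OF finE] by (intro psubset_card_mono) (auto simp: crossings_def)
    ultimately show ?thesis using eE finE by (simp add: card_Diff_singleton)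
  qed
qed

text \<open>The probability that a random subset, containing each point of \<open>V\<close>
  independently with probability \<open>p\<close>, contains \<open>B\<close>.\<close>

lemma sum_Pow_containing:
  fixes p :: real
  assumes "finite V" "B \<subseteq> V"
  shows "(\<Sum>A\<in>Pow V. if B \<subseteq> A then p ^ card A * (1 - p) ^ (card V - card A) else 0) = p ^ card B"
proof -
  have finB: "finite B" using assms finite_subset by auto
  define W where "W = V - B"
  have finW: "finite W" using assms by (auto simp: W_def)
  have cV: "card V = card B + card W" using assms finB
    by (simp add: W_def card_Diff_subset card_mono)
  have "(\<Sum>A\<in>Pow V. if B \<subseteq> A then p ^ card A * (1 - p) ^ (card V - card A) else 0)
      = (\<Sum>A\<in>{A\<in>Pow V. B \<subseteq> A}. p ^ card A * (1 - p) ^ (card V - card A))"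
    using assms by (intro sum.mono_neutral_cong_right) auto
  also have "\<dots> = (\<Sum>A\<in>Pow W. p ^ card B * (p ^ card A * (1 - p) ^ (card W - card A)))"
  proof (rule sum.reindex_bij_witness[where i = "\<lambda>A. B \<union> A" and j = "\<lambda>A. A - B"])
    fix A assume A: "A \<in> {A \<in> Pow V. B \<subseteq> A}"
    then have finA: "finite A" using assms finite_subset by auto
    have "card A = card B + card (A - B)"
      using A finB finA by (simp add: card_Diff_subset card_mono)
    then show "p ^ card B * (p ^ card (A - B) * (1 - p) ^ (card W - card (A - B))) = p ^ card A * (1 - p) ^ (card V - card A)"
      using cV by (simp add: power_add)
  qed (use assms in \<open>auto simp: W_def\<close>)
  also have "\<dots> = p ^ card B * (\<Sum>A\<in>Pow W. p ^ card A * (1 - p) ^ (card W - card A))"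
    by (simp add: sum_distrib_left)
  also have "(\<Sum>A\<in>Pow W. p ^ card A * (1 - p) ^ (card W - card A)) = (\<Sum>A\<in>Pow W. (\<Prod>x\<in>A. p) * (\<Prod>x\<in>W-A. 1 - p))"
    using finW by (intro sum.cong refl) (auto simp: card_Diff_subset finite_subset)
  also have "\<dots> = (\<Prod>x\<in>W. p + (1 - p))"
    using prod_add[OF finW, of "\<lambda>_. p" "\<lambda>_. 1 - p"] by simp
  finally show ?thesis by simp
qed

text \<open>Linearity of expectation for the number of configurations \<open>m\<close> whose vertex
  set \<open>g m\<close> survives in a random set with weights \<open>w\<close>.\<close>

lemma sum_Pow_card_eq:
  fixes w :: "'a set \<Rightarrow> real" and M :: "'b set" and g :: "'b \<Rightarrow> 'a set"
  assumes "finite M" "finite V"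
  shows "(\<Sum>A\<in>Pow V. w A * real (card {m\<in>M. g m \<subseteq> A})) = (\<Sum>m\<in>M. \<Sum>A\<in>Pow V. if g m \<subseteq> A then w A else 0)"
proof -
  have "(\<Sum>A\<in>Pow V. w A * real (card {m\<in>M. g m \<subseteq> A})) = (\<Sum>A\<in>Pow V. \<Sum>m\<in>M. if g m \<subseteq> A then w A else 0)"
    using assms by (intro sum.cong refl) (simp add: sum.If_cases Int_def mult.commute)
  also have "\<dots> = (\<Sum>m\<in>M. \<Sum>A\<in>Pow V. if g m \<subseteq> A then w A else 0)" by (rule sum.swap)
  finally show ?thesis .
qed

text \<open>Amplification by sampling: \<open>crossings_ge\<close> holds for every induced subgraph,
  and in expectation over a random vertex set its terms scale as \<open>p ^ 2\<close> for edges,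
  \<open>p ^ 4\<close> for crossings and \<open>p\<close> for vertices. By \<open>disj\<close> a
  crossing has four different endpoints.\<close>

lemma crossing_lemma:
  fixes V :: "pt set" and E :: "(pt \<times> pt) set"
  assumes V: "finite V" "inj_on fst V"
    and E: "E \<subseteq> V \<times> V" "\<And>e. e \<in> E \<Longrightarrow> fst (fst e) < fst (snd e)"
    and disj: "\<And>e f. e \<in> E \<Longrightarrow> f \<in> E \<Longrightarrow> seg_cross e f \<Longrightarrow> {fst e, snd e} \<inter> {fst f, snd f} = {}"
    and large: "card E \<ge> 10 * card V"
  shows "real (card E) ^ 3 \<le> 200 * real (card V) ^ 2 * real (card (crossings E))"
proof (cases "card V = 0")
  case True
  then have "E = {}" using V E by auto
  then show ?thesis by simp
next
  case False
  have finE: "finite E" using finite_subset[OF E(1)] V by auto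
  define v where "v = real (card V)"
  define e where "e = real (card E)"
  have v0: "v > 0" using False by (simp add: v_def)
  have ev: "e \<ge> 10 * v" using large by (simp add: e_def v_def)
  \<comment> \<open>With this value the expected number of edges \<open>e * p ^ 2\<close> is
    \<open>10 * v * p\<close>, twice the vertex term; \<open>large\<close> makes \<open>p\<close> at
    most 1.\<close>
  define p where "p = 10 * v / e"
  have p: "0 < p" "p \<le> 1" using v0 ev by (auto simp: p_def)
  define w where "w A = p ^ card A * (1 - p) ^ (card V - card A)" for A :: "pt set"
  have w0: "w A \<ge> 0" for A using p by (simp add: w_def)
  define X where "X = crossings E"
  have finX: "finite X" using finite_crossings finE by (simp add: X_def)
  define gE where "gE = (\<lambda>e :: pt \<times> pt. {fst e, snd e})"
  define gX where "gX = (\<lambda>(e, f). gE e \<union> gE f)"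
  have ineq: "real (card {e\<in>E. gE e \<subseteq> A}) \<le> real (card {m\<in>X. gX m \<subseteq> A}) + 5 * real (card {x\<in>V. {x} \<subseteq> A})"
    if A: "A \<subseteq> V" for A
  proof -
    have "card {e\<in>E. gE e \<subseteq> A} \<le> card (crossings {e\<in>E. gE e \<subseteq> A}) + 5 * card A"
    proof (rule crossings_ge)
      show "{e \<in> E. gE e \<subseteq> A} \<subseteq> A \<times> A" by (auto simp: gE_def)
    qed (use V A E finite_subset inj_on_subset in auto)
    moreover have "crossings {e\<in>E. gE e \<subseteq> A} = {m\<in>X. gX m \<subseteq> A}"
      unfolding X_def crossings_def gX_def by auto
    moreover have "A = {x\<in>V. {x} \<subseteq> A}" using A by auto
    ultimately show ?thesis by (metis (no_types, lifting) of_nat_add of_nat_le_iff of_nat_mult of_nat_numeral)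
  qed
  have "(\<Sum>A\<in>Pow V. w A * real (card {e\<in>E. gE e \<subseteq> A}))
      \<le> (\<Sum>A\<in>Pow V. w A * real (card {m\<in>X. gX m \<subseteq> A}) + 5 * (w A * real (card {x\<in>V. {x} \<subseteq> A})))"
  proof (rule sum_mono)
    fix A assume "A \<in> Pow V"
    then show "w A * real (card {e\<in>E. gE e \<subseteq> A})
        \<le> w A * real (card {m\<in>X. gX m \<subseteq> A}) + 5 * (w A * real (card {x\<in>V. {x} \<subseteq> A}))"
      using mult_left_mono[OF ineq[of A] w0[of A]] by (simp add: algebra_simps)
  qed
  also have "\<dots> = (\<Sum>A\<in>Pow V. w A * real (card {m\<in>X. gX m \<subseteq> A})) + 5 * (\<Sum>A\<in>Pow V. w A * real (card {x\<in>V. {x} \<subseteq> A}))"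
    by (simp add: sum.distrib sum_distrib_left)
  also have "(\<Sum>A\<in>Pow V. w A * real (card {x\<in>V. {x} \<subseteq> A})) = v * p"
  proof -
    have "(\<Sum>A\<in>Pow V. if {m} \<subseteq> A then w A else 0) = p" if "m \<in> V" for m
      unfolding w_def using V that by (subst sum_Pow_containing) auto
    then show ?thesis using V by (subst sum_Pow_card_eq) (auto simp: v_def)
  qed
  also have "(\<Sum>A\<in>Pow V. w A * real (card {m\<in>X. gX m \<subseteq> A})) = real (card X) * p ^ 4"
  proof -
    have "(\<Sum>A\<in>Pow V. if gX m \<subseteq> A then w A else 0) = p ^ 4" if "m \<in> X" for m
    proof -
      obtain e f where m1: "m = (e, f)" by (cases m)
      have m: "m = (e, f)" "e \<in> E" "f \<in> E" "seg_cross e f"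
        using that unfolding m1 X_def crossings_def by auto
      have "fst e \<noteq> snd e" "fst f \<noteq> snd f" using E(2)[OF m(2)] E(2)[OF m(3)] by auto
      then have "card (gE e) = 2" "card (gE f) = 2" by (simp_all add: gE_def)
      moreover have "gE e \<inter> gE f = {}" using disj[OF m(2-4)] by (simp add: gE_def)
      moreover have "finite (gE e)" "finite (gE f)" by (simp_all add: gE_def)
      ultimately have "card (gX m) = 4" by (simp add: m1 gX_def card_Un_disjoint)
      moreover have "gX m \<subseteq> V" using m E(1) by (auto simp: gX_def gE_def)
      ultimately show ?thesis unfolding w_def using V by (simp add: sum_Pow_containing)
    qed
    then show ?thesis using V finX by (subst sum_Pow_card_eq) auto
  qed
  also have "(\<Sum>A\<in>Pow V. w A * real (card {e\<in>E. gE e \<subseteq> A})) = e * p ^ 2"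
  proof -
    have "(\<Sum>A\<in>Pow V. if gE m \<subseteq> A then w A else 0) = p ^ 2" if "m \<in> E" for m
    proof -
      have "fst m \<noteq> snd m" using E(2)[OF that] by force
      then have "card (gE m) = 2" by (auto simp: gE_def)
      moreover have "gE m \<subseteq> V" using that E(1) by (auto simp: gE_def)
      ultimately show ?thesis unfolding w_def using V by (simp add: sum_Pow_containing)
    qed
    then show ?thesis using V finE by (subst sum_Pow_card_eq) (auto simp: e_def)
  qed
  finally have main: "e * p ^ 2 \<le> real (card X) * p ^ 4 + 5 * (v * p)" .
  have "e * p = 10 * v" using v0 ev by (simp add: p_def)
  then have "e * p ^ 2 = 10 * v * p" by (simp add: power2_eq_square)
  then have "5 * v * p \<le> real (card X) * p ^ 4" using main by linarith
  then have "5 * v * p \<le> (real (card X) * p ^ 3) * p" by (simp add: power4_eq_xxxx power3_eq_cube mult.assoc)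
  then have "5 * v \<le> real (card X) * p ^ 3" using p by simp
  then have "5 * v \<le> real (card X) * (1000 * v ^ 3 / e ^ 3)" by (simp add: p_def power_divide power_mult_distrib)
  then have "5 * v * e ^ 3 \<le> real (card X) * (1000 * v ^ 3)" using v0 ev by (simp add: field_simps)
  then have "v * (5 * e ^ 3) \<le> v * (1000 * v ^ 2 * real (card X))" by (simp add: power2_eq_square power3_eq_cube algebra_simps)
  then have "5 * e ^ 3 \<le> 1000 * v ^ 2 * real (card X)" using v0 by (simp add: mult_le_cancel_left_pos)
  then show ?thesis by (simp add: e_def v_def X_def mult_ac)
qed

text \<open>Lines are pairs (slope, intercept); the segments of the drawing join consecutive points of a line.\<close>

lemma szemeredi_trotter:
  fixes P :: "pt set" and L :: "(real \<times> real) set" and n :: nat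
  assumes P: "finite P" "inj_on fst P" "card P \<le> n" and L: "finite L" "card L \<le> n"
  shows "real (card {(l, q) \<in> L \<times> P. snd q = fst l * fst q + snd l}) \<le> 17 * real n powr (4/3)"
proof -
  define on where "on l q \<longleftrightarrow> snd q = fst l * fst q + snd l" for l q :: "real \<times> real"
  define I where "I = {(l, q) \<in> L \<times> P. on l q}"
  have finI: "finite I" by (rule finite_subset[of _ "L \<times> P"]) (use P L in \<open>auto simp: I_def\<close>)
  define cons where "cons l p q \<longleftrightarrow> on l p \<and> on l q \<and> fst p < fst q \<and>
     (\<forall>s\<in>P. on l s \<longrightarrow> \<not> (fst p < fst s \<and> fst s < fst q))" for l p q
  define E where "E = {(p, q) \<in> P \<times> P. \<exists>l\<in>L. cons l p q}"
  have finE: "finite E" by (rule finite_subset[of _ "P \<times> P"]) (use P in \<open>auto simp: E_def\<close>)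
  have line_unique: "l = m" if "on l p" "on l q" "on m p" "on m q" "fst p \<noteq> fst q" for l m p q
  proof -
    have "(fst l - fst m) * (fst p - fst q) = 0" using that by (simp add: on_def algebra_simps)
    then have "fst l = fst m" using that by simp
    then show ?thesis using that by (auto simp: on_def prod_eq_iff)
  qed
  have seg_on: "seg_at (p, q) x = fst l * x + snd l" if "on l p" "on l q" "fst p < fst q" for l p q x
  proof -
    have "seg_slope (p, q) = fst l" using that by (simp add: seg_slope_def on_def right_diff_distrib[symmetric])
    then show ?thesis using that by (simp add: seg_at_def on_def algebra_simps)
  qed
  define ln where "ln e = (SOME l. l \<in> L \<and> cons l (fst e) (snd e))" for e
  have ln: "ln e \<in> L" "cons (ln e) (fst e) (snd e)" if "e \<in> E" for e
  proof -
    have "\<exists>l. l \<in> L \<and> cons l (fst e) (snd e)" using that unfolding E_def by (cases e) fastforce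
    from someI_ex[OF this] show "ln e \<in> L" "cons (ln e) (fst e) (snd e)" by (simp_all add: ln_def)
  qed
  have seg_ln: "seg_at e x = fst (ln e) * x + snd (ln e)" if "e \<in> E" for e x
    using seg_on[of "ln e" "fst e" "snd e" x] ln[OF that] by (simp add: cons_def)
  have EP: "fst e \<in> P" "snd e \<in> P" if "e \<in> E" for e using that by (auto simp: E_def)
  \<comment> \<open>Two edges on one line over a common abscissa coincide, because neither may
    contain an endpoint of the other in its interior.\<close>
  have same_line: "e = f" if "e \<in> E" "f \<in> E" "ln e = ln f" "fst (fst e) < x" "fst (fst f) < x" "x < fst (snd e)" "x < fst (snd f)" for e f x
  proof -
    have c: "cons (ln e) (fst e) (snd e)" "cons (ln e) (fst f) (snd f)" using ln that by metis+
    from c have b: "\<And>s. s \<in> P \<Longrightarrow> on (ln e) s \<Longrightarrow> \<not> (fst (fst e) < fst s \<and> fst s < fst (snd e))"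
      "\<And>s. s \<in> P \<Longrightarrow> on (ln e) s \<Longrightarrow> \<not> (fst (fst f) < fst s \<and> fst s < fst (snd f))"
      by (simp_all add: cons_def)
    from c have o: "on (ln e) (fst e)" "on (ln e) (snd e)" "on (ln e) (fst f)" "on (ln e) (snd f)"
      by (simp_all add: cons_def)
    have mem: "fst e \<in> P" "snd e \<in> P" "fst f \<in> P" "snd f \<in> P" using EP that by auto
    have "\<not> (fst (fst e) < fst (fst f) \<and> fst (fst f) < fst (snd e))"
      "\<not> (fst (fst f) < fst (fst e) \<and> fst (fst e) < fst (snd f))"
      "\<not> (fst (fst e) < fst (snd f) \<and> fst (snd f) < fst (snd e))"
      "\<not> (fst (fst f) < fst (snd e) \<and> fst (snd e) < fst (snd f))"
      using b o mem by simp_all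
    then have "fst (fst e) = fst (fst f)" "fst (snd e) = fst (snd f)" using that(4-7) by auto
    then show ?thesis using inj_onD[OF P(2)] EP that by (simp add: prod_eq_iff[of e f])
  qed
  have cross_ln: "ln e \<noteq> ln f" if "e \<in> E" "f \<in> E" "seg_cross e f" for e f
    using same_line[OF that(1,2)] that(3) unfolding seg_cross_def by metis
  \<comment> \<open>On each line the points are joined to their successors, so every incidence
    yields an edge except that of the last point of the line.\<close>
  have "card I \<le> card E + card L"
  proof -
    define J where "J = {(l, p) \<in> I. \<exists>q\<in>P. on l q \<and> fst p < fst q}"
    define nx where "nx l p = arg_min_on fst {q\<in>P. on l q \<and> fst p < fst q}" for l and p :: pt
    have nx: "nx l p \<in> P \<and> cons l p (nx l p)" if "(l, p) \<in> J" for l p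
    proof -
      let ?S = "{q\<in>P. on l q \<and> fst p < fst q}"
      have "\<exists>q\<in>P. on l q \<and> fst p < fst q" using that by (simp add: J_def)
      then have S: "finite ?S" "?S \<noteq> {}" using P(1) by (simp, blast)
      have "nx l p \<in> ?S" using arg_min_if_finite(1)[OF S] by (simp add: nx_def)
      moreover have "fst (nx l p) \<le> fst s" if "s \<in> ?S" for s
        using arg_min_least[OF S that] by (simp add: nx_def)
      ultimately show ?thesis using that unfolding cons_def J_def I_def by force
    qed
    have "card J \<le> card E"
    proof (rule card_inj_on_le[where f = "\<lambda>(l, p). (p, nx l p)"])
      show "inj_on (\<lambda>(l, p). (p, nx l p)) J"
      proof (rule inj_onI)
        fix u v assume uv: "u \<in> J" "v \<in> J" "(case u of (l, p) \<Rightarrow> (p, nx l p)) = (case v of (l, p) \<Rightarrow> (p, nx l p))"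
        obtain l p m q where u: "u = (l, p)" and v: "v = (m, q)" by (metis surj_pair)
        have "q = p" "nx l p = nx m p" using uv(3) u v by auto
        then have "l = m" using nx[of l p] nx[of m p] line_unique[of l p "nx l p" m] uv(1,2) u v
          by (auto simp: cons_def)
        then show "u = v" using u v \<open>q = p\<close> by simp
      qed
      show "(\<lambda>(l, p). (p, nx l p)) ` J \<subseteq> E"
        using nx by (fastforce simp: E_def J_def I_def)
    qed (fact finE)
    moreover have "card (I - J) \<le> card L"
    proof (rule card_inj_on_le[where f = fst])
      show "inj_on fst (I - J)"
      proof (rule inj_onI)
        fix u v assume uv: "u \<in> I - J" "v \<in> I - J" "fst u = fst v"
        obtain l p m q where u: "u = (l, p)" and v: "v = (m, q)" by (metis surj_pair)
        have "m = l" using uv(3) u v by simp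
        have mem: "p \<in> P" "q \<in> P" "on l p" "on l q" using uv u v \<open>m = l\<close> by (simp_all add: I_def)
        then have "\<not> fst p < fst q" "\<not> fst q < fst p" using uv(1,2) u v \<open>m = l\<close> by (auto simp: J_def)
        then have "p = q" using inj_onD[OF P(2)] mem by auto
        then show "u = v" using u v \<open>m = l\<close> by simp
      qed
    qed (use L in \<open>auto simp: I_def\<close>)
    moreover have "card I = card J + card (I - J)"
    proof -
      have "J \<subseteq> I" by (auto simp: J_def)
      then show ?thesis using finI by (metis card_Diff_subset card_mono finite_subset le_add_diff_inverse)
    qed
    ultimately show ?thesis by linarith
  qed
  moreover have "card L \<le> n" using L by simp
  moreover have "real n \<le> real n powr (4/3)"
  proof (cases "n = 0")
    case False
    then have "real n powr 1 \<le> real n powr (4/3)" by (intro powr_mono) auto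
    then show ?thesis using False by simp
  qed simp
  moreover have "real (card E) \<le> 16 * real n powr (4/3)"
  proof (cases "card E \<ge> 10 * card P")
    case False
    then have "real (card E) \<le> 10 * real n" using P(3) by linarith
    then show ?thesis using \<open>real n \<le> real n powr (4/3)\<close> by linarith
  next
    case True
    have "real (card E) ^ 3 \<le> 200 * real (card P) ^ 2 * real (card (crossings E))"
    proof (rule crossing_lemma[OF P(1,2)])
      show "E \<subseteq> P \<times> P" by (auto simp: E_def)
      show "fst (fst e) < fst (snd e)" if "e \<in> E" for e using ln[OF that] by (auto simp: cons_def)
      show "{fst e, snd e} \<inter> {fst f, snd f} = {}" if ef: "e \<in> E" "f \<in> E" "seg_cross e f" for e f
      proof (rule ccontr)
        assume "{fst e, snd e} \<inter> {fst f, snd f} \<noteq> {}"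
        then obtain s where s: "s \<in> {fst e, snd e}" "s \<in> {fst f, snd f}" by blast
        obtain x where x: "fst (fst e) < x" "x < fst (snd e)" "fst (fst f) < x" "x < fst (snd f)"
            "seg_at e x = seg_at f x" using ef(3) unfolding seg_cross_def by auto
        have "on (ln e) s" "on (ln f) s" using s ln[OF ef(1)] ln[OF ef(2)] by (auto simp: cons_def)
        moreover have "on (ln e) (x, seg_at e x)" "on (ln f) (x, seg_at e x)"
          using seg_ln ef x(5) by (auto simp: on_def)
        moreover have "fst s \<noteq> fst (x, seg_at e x)" using s x by auto
        ultimately have "ln e = ln f" by (intro line_unique[of "ln e" s "(x, seg_at e x)" "ln f"])
        then show False using cross_ln ef by blast
      qed
    qed (fact True)
    \<comment> \<open>A crossing is determined by the ordered pair of lines through its edges, since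
      different lines meet only once.\<close>
    also have "real (card (crossings E)) \<le> real n ^ 2"
    proof -
      have "card (crossings E) \<le> card (L \<times> L)"
      proof (rule card_inj_on_le[where f = "\<lambda>(e, f). (ln e, ln f)"])
        show "inj_on (\<lambda>(e, f). (ln e, ln f)) (crossings E)"
        proof (rule inj_onI, clarify)
          fix e1 e2 f1 f2 e1' e2' f1' f2'
          assume a: "((e1, e2), (f1, f2)) \<in> crossings E" "((e1', e2'), (f1', f2')) \<in> crossings E"
            and l: "ln (e1, e2) = ln (e1', e2')" "ln (f1, f2) = ln (f1', f2')"
          define e where "e = (e1, e2)" define f where "f = (f1, f2)"
          define e' where "e' = (e1', e2')" define f' where "f' = (f1', f2')"
          have ef: "e \<in> E" "f \<in> E" "seg_cross e f" "e' \<in> E" "f' \<in> E" "seg_cross e' f'"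
            using a by (auto simp: crossings_def e_def f_def e'_def f'_def)
          have l': "ln e = ln e'" "ln f = ln f'" using l by (auto simp: e_def f_def e'_def f'_def)
          obtain x where x: "fst (fst e) < x" "x < fst (snd e)" "fst (fst f) < x" "x < fst (snd f)"
            "seg_at e x = seg_at f x" using ef(3) unfolding seg_cross_def by auto
          obtain x' where x': "fst (fst e') < x'" "x' < fst (snd e')" "fst (fst f') < x'" "x' < fst (snd f')"
            "seg_at e' x' = seg_at f' x'" using ef(6) unfolding seg_cross_def by auto
          have "x = x'"
          proof (rule ccontr)
            assume "x \<noteq> x'"
            moreover have "on (ln e) (x, seg_at e x)" "on (ln f) (x, seg_at e x)"
              "on (ln e) (x', seg_at e' x')" "on (ln f) (x', seg_at e' x')"
              using seg_ln ef x(5) x'(5) l' by (auto simp: on_def)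
            ultimately have "ln e = ln f" using line_unique[of "ln e" "(x, seg_at e x)" "(x', seg_at e' x')" "ln f"] by auto
            then show False using cross_ln ef by blast
          qed
          then have "e = e'" "f = f'" using same_line[of e e' x] same_line[of f f' x] ef l' x x' by auto
          then show "(e1, e2) = (e1', e2') \<and> (f1, f2) = (f1', f2')" by (auto simp: e_def f_def e'_def f'_def)
        qed
        show "(\<lambda>(e, f). (ln e, ln f)) ` crossings E \<subseteq> L \<times> L" using ln by (auto simp: crossings_def)
      qed (use L in auto)
      also have "\<dots> \<le> n * n" using L by (auto simp: card_cartesian_product intro: mult_mono)
      finally have "real (card (crossings E)) \<le> real (n * n)" by (simp only: of_nat_le_iff)
      then show ?thesis by (simp add: power2_eq_square)
    qed
    finally have "real (card E) ^ 3 \<le> 200 * real (card P) ^ 2 * real n ^ 2" by (simp add: mult_left_mono)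
    also have "\<dots> \<le> 200 * real n ^ 2 * real n ^ 2"
      using P(3) by (intro mult_mono power_mono) auto
    \<comment> \<open>The constant is rounded up to a cube, \<open>200 \<le> 6 ^ 3\<close>, so that
      the cube root can be taken.\<close>
    also have "\<dots> \<le> 6 ^ 3 * real n ^ 4" by (simp add: power2_eq_square power4_eq_xxxx)
    also have "\<dots> = (6 * real n powr (4/3)) ^ 3"
    proof (cases "n = 0")
      case False
      have "(real n powr (4/3)) ^ 3 = real n powr (real 3 * (4/3))" using False by (intro powr_power) simp
      also have "\<dots> = real n powr 4" by simp
      also have "\<dots> = real n ^ 4" using False by (simp add: powr_numeral)
      finally show ?thesis by (simp add: power_mult_distrib)
    qed simp
    finally have "real (card E) \<le> 6 * real n powr (4/3)" by (subst (asm) power_mono_iff) auto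
    then show ?thesis using powr_ge_zero[of "real n" "4/3"] by linarith
  qed
  ultimately have "real (card I) \<le> 17 * real n powr (4/3)" by linarith
  then show ?thesis by (simp add: I_def on_def)
qed

section \<open>Orthogonal pairs of vectors\<close>

text \<open>Finitely many hyperplanes do not cover a subspace. Given \<open>a\<close> for
  \<open>W\<close>, move it along the new vector \<open>w\<close>: each vector of
  \<open>insert w W\<close> excludes at most one multiple.\<close>

lemma exists_nonorthogonal:
  fixes W :: "'a::euclidean_space set"
  assumes "finite W" "subspace D" "W \<subseteq> D" "0 \<notin> W"
  shows "\<exists>a\<in>D. \<forall>w\<in>W. a \<bullet> w \<noteq> 0"
  using assms(1,3,4)
proof (induction W rule: finite_induct)
  case empty
  then show ?case using subspace_0[OF assms(2)] by auto
next
  case (insert w W)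
  then obtain a where a: "a \<in> D" "\<forall>w\<in>W. a \<bullet> w \<noteq> 0" by auto
  have "finite (insert 0 (insert (- (a \<bullet> w) / (w \<bullet> w)) ((\<lambda>v. - (a \<bullet> v) / (w \<bullet> v)) ` W)))"
    using insert by auto
  then obtain e :: real where e: "e \<notin> insert 0 (insert (- (a \<bullet> w) / (w \<bullet> w)) ((\<lambda>v. - (a \<bullet> v) / (w \<bullet> v)) ` W))"
    using ex_new_if_finite[OF infinite_UNIV_char_0] by blast
  have "(a + e *\<^sub>R w) \<bullet> v \<noteq> 0" if "v \<in> insert w W" for v
  proof (cases "w \<bullet> v = 0")
    case True
    then have "v \<in> W" using that insert by auto
    then show ?thesis using True a by (simp add: inner_add_left)
  next
    case False
    have "e \<noteq> - (a \<bullet> v) / (w \<bullet> v)" using e that by auto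
    then show ?thesis using False by (auto simp: inner_add_left field_simps eq_neg_iff_add_eq_0)
  qed
  moreover have "a + e *\<^sub>R w \<in> D" using a insert assms(2) by (auto intro: subspace_add subspace_scale)
  ultimately show ?case by blast
qed

lemma parallel_same_norm:
  fixes x y :: "'a::real_inner"
  assumes "norm x = norm y" "c *\<^sub>R x = d *\<^sub>R y" "c \<noteq> 0" "x \<noteq> 0"
  shows "x = y \<or> x = - y"
proof -
  have x: "x = (d / c) *\<^sub>R y"
    using assms by (metis divideR_right real_vector.scale_scale divide_inverse mult.commute)
  have "norm x = \<bar>d / c\<bar> * norm y" by (subst x) simp
  moreover have "norm y \<noteq> 0" using assms by auto
  ultimately have "\<bar>d / c\<bar> = 1" using assms(1) by (metis mult_cancel_right1)
  then have "d / c = 1 \<or> d / c = -1" by linarith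
  then show ?thesis using x by auto
qed

text \<open>In a generic projective chart of the three-dimensional subspace, vectors become points and their
  orthogonal complements become lines.\<close>

lemma orthogonal_pairs_bound:
  fixes P D :: "'a::euclidean_space set"
  assumes P: "finite P" "card P \<le> n" "P \<subseteq> D" and D: "subspace D" "dim D \<le> 3"
    and norm: "\<And>x. x \<in> P \<Longrightarrow> norm x = \<rho>" and \<rho>: "\<rho> > 0"
  shows "real (card {(x, y) \<in> P \<times> P. x \<bullet> y = 0}) \<le> 70 * real n powr (4/3)"
proof (cases "{(x, y) \<in> P \<times> P. x \<bullet> y = 0} = {}")
  case True
  then show ?thesis by (simp only: True card.empty) simp
next
  case False
  then obtain x0 y0 where xy0: "x0 \<in> P" "y0 \<in> P" "x0 \<bullet> y0 = 0" by blast
  have nz: "x \<noteq> 0" if "x \<in> P" for x using norm[OF that] \<rho> by auto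
  obtain a where a: "a \<in> D" "\<And>x. x \<in> P \<Longrightarrow> a \<bullet> x \<noteq> 0"
    using exists_nonorthogonal[OF P(1) D(1) P(3)] nz by blast
  \<comment> \<open>\<open>a\<close> is the denominator of the chart. The combinations vanish only
    for \<open>x = y\<close> or \<open>x = - y\<close>; a \<open>b\<close> not orthogonal to the
    nonzero ones makes the quotient of \<open>b \<bullet> x\<close> by \<open>a \<bullet> x\<close>
    determine \<open>x\<close> up to sign, which gives the injectivity of \<open>fst\<close>
    required by \<open>szemeredi_trotter\<close>.\<close>
  define W where "W = (\<lambda>(x, y). (a \<bullet> y) *\<^sub>R x - (a \<bullet> x) *\<^sub>R y) ` (P \<times> P) - {0}"
  have "W \<subseteq> D" using P(3) D(1) unfolding W_def by (auto intro!: subspace_diff subspace_scale)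
  moreover have "finite W" using P by (auto simp: W_def)
  ultimately obtain b where b: "b \<in> D" "\<And>w. w \<in> W \<Longrightarrow> b \<bullet> w \<noteq> 0"
    using exists_nonorthogonal[of W D] D(1) unfolding W_def by auto
  have par: "x = y \<or> x = - y" if "x \<in> P" "y \<in> P" "(a \<bullet> y) * (b \<bullet> x) = (a \<bullet> x) * (b \<bullet> y)" for x y
  proof -
    have "b \<bullet> ((a \<bullet> y) *\<^sub>R x - (a \<bullet> x) *\<^sub>R y) = 0" using that by (simp add: inner_diff_right)
    then have "(a \<bullet> y) *\<^sub>R x - (a \<bullet> x) *\<^sub>R y \<notin> W" using b(2) by blast
    then have "(a \<bullet> y) *\<^sub>R x - (a \<bullet> x) *\<^sub>R y = 0" using that unfolding W_def by auto
    then have "(a \<bullet> y) *\<^sub>R x = (a \<bullet> x) *\<^sub>R y" by simp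
    then show ?thesis using parallel_same_norm[of x y] norm nz a that by auto
  qed
  \<comment> \<open>The orthogonal pair \<open>x0\<close>, \<open>y0\<close> gives a nonzero member
    of \<open>W\<close> orthogonal to \<open>a\<close>; a multiple of \<open>a\<close> would be
    orthogonal to it as well.\<close>
  have "b \<notin> span {a}"
  proof
    assume "b \<in> span {a}"
    then obtain c where c: "b = c *\<^sub>R a" by (auto simp: span_singleton)
    define w where "w = (a \<bullet> y0) *\<^sub>R x0 - (a \<bullet> x0) *\<^sub>R y0"
    have "w \<bullet> x0 = (a \<bullet> y0) * (x0 \<bullet> x0)" using xy0 inner_commute[of y0 x0] by (simp add: w_def inner_diff_left)
    then have "w \<bullet> x0 \<noteq> 0" using a xy0 nz by auto
    then have "w \<noteq> 0" by auto
    then have "w \<in> W" unfolding W_def w_def using xy0 by auto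
    then have "b \<bullet> w \<noteq> 0" using b by blast
    moreover have "a \<bullet> w = 0" by (simp add: w_def inner_diff_right)
    ultimately show False using c by simp
  qed
  moreover have "a \<noteq> 0" using a xy0 by force
  ultimately have ind: "independent {b, a}" by (simp add: independent_insert)
  have ab: "a \<noteq> b" using \<open>b \<notin> span {a}\<close> span_base by auto
  obtain B where B: "{b, a} \<subseteq> B" "B \<subseteq> D" "independent B" "D \<subseteq> span B"
    using maximal_independent_subset_extend[of "{b,a}" D] ind a b by auto
  have "card B = dim D" using B by (intro basis_card_eq_dim) auto
  then have cB: "card B \<le> 3" "finite B" using D B independent_imp_finite by auto
  have "\<exists>e. B \<subseteq> {a, b, e}"
  proof -
    have "card (B - {b, a}) \<le> 1" using cB B ab by (simp add: card_Diff_subset)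
    then obtain e where "B - {b, a} \<subseteq> {e}" using cB by (metis card_le_Suc0_iff_eq finite_Diff insertCI subsetI One_nat_def singleton_iff)
    then show ?thesis by blast
  qed
  then obtain e where e: "B \<subseteq> {a, b, e}" by blast
  have "\<exists>\<alpha> \<beta> \<gamma>. y = \<alpha> *\<^sub>R a + \<beta> *\<^sub>R b + \<gamma> *\<^sub>R e" if "y \<in> P" for y
  proof -
    have "y \<in> span {a, b, e}" using that P B e span_mono[OF e] by blast
    then show ?thesis by (auto simp: span_insert span_singleton algebra_simps)
  qed
  then obtain \<alpha> \<beta> \<gamma> where coef: "\<And>y. y \<in> P \<Longrightarrow> y = \<alpha> y *\<^sub>R a + \<beta> y *\<^sub>R b + \<gamma> y *\<^sub>R e" by metis
  \<comment> \<open>Expressing \<open>y\<close> through \<open>a\<close>, \<open>b\<close>,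
    \<open>e\<close> turns orthogonality to \<open>x\<close> into the incidence of the point
    \<open>\<Phi> x\<close> with the line \<open>l y\<close>, provided
    \<open>\<gamma> y \<noteq> 0\<close>; otherwise the line is vertical.\<close>
  define \<Phi> where "\<Phi> x = ((b \<bullet> x) / (a \<bullet> x), (e \<bullet> x) / (a \<bullet> x))" for x
  define l where "l y = (- \<beta> y / \<gamma> y, - \<alpha> y / \<gamma> y)" for y
  have dot: "y \<bullet> x = (a \<bullet> x) * (\<alpha> y + \<beta> y * fst (\<Phi> x) + \<gamma> y * snd (\<Phi> x))" if "x \<in> P" "y \<in> P" for x y
  proof -
    have "y \<bullet> x = \<alpha> y * (a \<bullet> x) + \<beta> y * (b \<bullet> x) + \<gamma> y * (e \<bullet> x)"
      using arg_cong[OF coef[OF that(2)], of "\<lambda>y. y \<bullet> x"] by (simp add: inner_add_left)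
    then show ?thesis using a(2)[OF that(1)] by (simp add: \<Phi>_def field_simps)
  qed
  have fst\<Phi>: "x = y \<or> x = - y" if "x \<in> P" "y \<in> P" "fst (\<Phi> x) = fst (\<Phi> y)" for x y
    using that a(2)[OF that(1)] a(2)[OF that(2)] par[OF that(1,2)] by (simp add: \<Phi>_def field_simps)
  have l_par: "x = y \<or> x = - y" if "x \<in> P" "y \<in> P" "\<gamma> x \<noteq> 0" "\<gamma> y \<noteq> 0" "l x = l y" for x y
  proof -
    have "\<gamma> y * \<beta> x = \<gamma> x * \<beta> y" "\<gamma> y * \<alpha> x = \<gamma> x * \<alpha> y" using that by (auto simp: l_def field_simps)
    then have "\<gamma> y *\<^sub>R (\<alpha> x *\<^sub>R a + \<beta> x *\<^sub>R b + \<gamma> x *\<^sub>R e) = \<gamma> x *\<^sub>R (\<alpha> y *\<^sub>R a + \<beta> y *\<^sub>R b + \<gamma> y *\<^sub>R e)"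
      by (simp add: scaleR_add_right mult.commute)
    then have "\<gamma> y *\<^sub>R x = \<gamma> x *\<^sub>R y" using coef that(1,2) by metis
    then show ?thesis using parallel_same_norm[of x y] norm nz that by auto
  qed
  have sgn: "x = y" if "x \<in> P" "y \<in> P" "x = y \<or> x = - y" "a \<bullet> x > 0 \<longleftrightarrow> a \<bullet> y > 0" for x y
    using that a(2)[of y] by (auto simp: not_less)
  define Q1 where "Q1 = {(x, y) \<in> P \<times> P. x \<bullet> y = 0 \<and> \<gamma> y \<noteq> 0}"
  define Q2 where "Q2 = {(x, y) \<in> P \<times> P. x \<bullet> y = 0 \<and> \<gamma> y = 0}"
  define L where "L = l ` {y \<in> P. \<gamma> y \<noteq> 0}"
  define I where "I = {(l, q) \<in> L \<times> \<Phi> ` P. snd q = fst l * fst q + snd l}"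
  have cI: "real (card I) \<le> 17 * real n powr (4/3)" unfolding I_def
  proof (rule szemeredi_trotter)
    show "inj_on fst (\<Phi> ` P)"
    proof (rule inj_onI)
      fix p q assume pq: "p \<in> \<Phi> ` P" "q \<in> \<Phi> ` P" "fst p = fst q"
      obtain x y where xy: "x \<in> P" "y \<in> P" "p = \<Phi> x" "q = \<Phi> y" using pq(1,2) by blast
      then have "x = y \<or> x = - y" using fst\<Phi> pq(3) by blast
      then show "p = q" using xy by (auto simp: \<Phi>_def)
    qed
    show "card (\<Phi> ` P) \<le> n" using card_image_le[OF P(1), of \<Phi>] P(2) by linarith
    have "card L \<le> card {y \<in> P. \<gamma> y \<noteq> 0}" unfolding L_def using P by (intro card_image_le) auto
    also have "\<dots> \<le> card P" using P by (intro card_mono) auto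
    finally show "card L \<le> n" using P by linarith
  qed (use P in \<open>auto simp: L_def\<close>)
  have finI: "finite I" by (rule finite_subset[of _ "L \<times> \<Phi> ` P"]) (use P in \<open>auto simp: I_def L_def\<close>)
  \<comment> \<open>The chart identifies only antipodal vectors, in both roles; two sign bits undo
    this at the cost of a factor 4.\<close>
  have "card Q1 \<le> card (I \<times> (UNIV :: (bool \<times> bool) set))"
  proof (rule card_inj_on_le[where f = "\<lambda>(x, y). ((l y, \<Phi> x), (a \<bullet> x > 0, a \<bullet> y > 0))"])
    show "inj_on (\<lambda>(x, y). ((l y, \<Phi> x), (a \<bullet> x > 0, a \<bullet> y > 0))) Q1"
    proof (rule inj_onI)
      fix u v assume uv: "u \<in> Q1" "v \<in> Q1"
        "(case u of (x, y) \<Rightarrow> ((l y, \<Phi> x), (a \<bullet> x > 0, a \<bullet> y > 0))) = (case v of (x, y) \<Rightarrow> ((l y, \<Phi> x), (a \<bullet> x > 0, a \<bullet> y > 0)))"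
      obtain x y x' y' where u: "u = (x, y)" and v: "v = (x', y')" by (metis surj_pair)
      have m: "x \<in> P" "y \<in> P" "\<gamma> y \<noteq> 0" "x' \<in> P" "y' \<in> P" "\<gamma> y' \<noteq> 0" using uv u v by (auto simp: Q1_def)
      have e: "l y = l y'" "\<Phi> x = \<Phi> x'" "a \<bullet> x > 0 \<longleftrightarrow> a \<bullet> x' > 0" "a \<bullet> y > 0 \<longleftrightarrow> a \<bullet> y' > 0" using uv(3) u v by auto
      have "x = x' \<or> x = - x'" by (rule fst\<Phi>[OF m(1,4)]) (simp only: e)
      then have "x = x'" by (rule sgn[OF m(1,4) _ e(3)])
      moreover have "y = y'" by (rule sgn[OF m(2,5) l_par[OF m(2,5,3,6) e(1)] e(4)])
      ultimately show "u = v" using u v by simp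
    qed
    show "(\<lambda>(x, y). ((l y, \<Phi> x), (a \<bullet> x > 0, a \<bullet> y > 0))) ` Q1 \<subseteq> I \<times> UNIV"
    proof clarsimp
      fix x y assume "(x, y) \<in> Q1"
      then have m: "x \<in> P" "y \<in> P" "\<gamma> y \<noteq> 0" "y \<bullet> x = 0" by (auto simp: Q1_def inner_commute)
      then have "\<alpha> y + \<beta> y * fst (\<Phi> x) + \<gamma> y * snd (\<Phi> x) = 0" using dot a(2) by simp
      then have "snd (\<Phi> x) = fst (l y) * fst (\<Phi> x) + snd (l y)"
        using m by (simp add: l_def field_simps)
      then show "(l y, \<Phi> x) \<in> I" using m by (auto simp: I_def L_def)
    qed
  qed (use finI in auto)
  then have c1: "card Q1 \<le> 4 * card I" by (simp add: card_cartesian_product mult.commute)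
  \<comment> \<open>On a vertical line the abscissa is fixed, and it determines \<open>x\<close> up
    to sign.\<close>
  have "card Q2 \<le> card (P \<times> (UNIV :: bool set))"
  proof (rule card_inj_on_le[where f = "\<lambda>(x, y). (y, a \<bullet> x > 0)"])
    show "inj_on (\<lambda>(x, y). (y, a \<bullet> x > 0)) Q2"
    proof (rule inj_onI)
      fix u v assume uv: "u \<in> Q2" "v \<in> Q2"
        "(case u of (x, y) \<Rightarrow> (y, a \<bullet> x > 0)) = (case v of (x, y) \<Rightarrow> (y, a \<bullet> x > 0))"
      obtain x y x' y' where u: "u = (x, y)" and v: "v = (x', y')" by (metis surj_pair)
      have y: "y' = y" and s: "a \<bullet> x > 0 \<longleftrightarrow> a \<bullet> x' > 0" using uv(3) u v by auto
      have m: "x \<in> P" "x' \<in> P" "y \<in> P" "\<gamma> y = 0" "y \<bullet> x = 0" "y \<bullet> x' = 0"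
        using uv(1,2) u v y by (auto simp: Q2_def inner_commute)
      then have eq: "\<alpha> y + \<beta> y * fst (\<Phi> x) = 0" "\<alpha> y + \<beta> y * fst (\<Phi> x') = 0"
        using dot[of x y] dot[of x' y] a(2)[of x] a(2)[of x'] by simp_all
      have "\<beta> y \<noteq> 0"
      proof
        assume "\<beta> y = 0"
        then have "y = 0" using eq coef[OF m(3)] m by simp
        then show False using nz m by blast
      qed
      then have "fst (\<Phi> x) = fst (\<Phi> x')" using eq by (metis add_left_cancel mult_left_cancel)
      then have "x = x'" by (intro sgn[OF m(1,2) _ s] fst\<Phi>[OF m(1,2)])
      then show "u = v" using u v y by simp
    qed
  qed (use P in \<open>auto simp: Q2_def\<close>)
  then have c2: "card Q2 \<le> 2 * n" using P(2) by (simp add: card_cartesian_product)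
  have "{(x, y) \<in> P \<times> P. x \<bullet> y = 0} = Q1 \<union> Q2" by (auto simp: Q1_def Q2_def)
  then have "card {(x, y) \<in> P \<times> P. x \<bullet> y = 0} \<le> card Q1 + card Q2" using card_Un_le by metis
  then have "real (card {(x, y) \<in> P \<times> P. x \<bullet> y = 0}) \<le> 4 * real (card I) + 2 * real n" using c1 c2 by linarith
  moreover have "real n \<le> real n powr (4/3)"
  proof (cases "n = 0")
    case False
    then have "real n powr 1 \<le> real n powr (4/3)" by (intro powr_mono) auto
    then show ?thesis using False by simp
  qed simp
  \<comment> \<open>The constant is \<open>70 = 4 * 17 + 2\<close>.\<close>
  ultimately show ?thesis using cI by linarith
qed

section \<open>Lenz configurations\<close>

text \<open>The difference of the two squared distances is affine in \<open>x\<close>, because the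
  quadratic terms cancel. This is how equalities of distances spread from a set to its affine
  hull.\<close>

lemma equidistant_affine_hull:
  fixes A :: "'a::euclidean_space set"
  assumes "\<And>x. x \<in> A \<Longrightarrow> (dist x p)\<^sup>2 - (dist x u)\<^sup>2 = c" "x \<in> affine hull A"
  shows "(dist x p)\<^sup>2 - (dist x u)\<^sup>2 = c"
proof -
  have eq: "(dist x p)\<^sup>2 - (dist x u)\<^sup>2 = (2 *\<^sub>R (u - p)) \<bullet> x + (p \<bullet> p - u \<bullet> u)" for x
    by (simp add: dist_norm power2_norm_eq_inner inner_diff_left inner_diff_right inner_commute algebra_simps)
  have "A \<subseteq> {x. (2 *\<^sub>R (u - p)) \<bullet> x = c - (p \<bullet> p - u \<bullet> u)}" using assms(1) eq by (auto simp: algebra_simps)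
  then have "affine hull A \<subseteq> {x. (2 *\<^sub>R (u - p)) \<bullet> x = c - (p \<bullet> p - u \<bullet> u)}"
    by (rule hull_minimal) (rule affine_hyperplane)
  then show ?thesis using assms(2) eq[of x] by force
qed

lemma equidistant_affine_hull':
  fixes A :: "'a::euclidean_space set"
  assumes "\<And>x. x \<in> A \<Longrightarrow> dist x p = dist x u" "x \<in> affine hull A"
  shows "dist x p = dist x u"
  using equidistant_affine_hull[of A p u 0 x] assms by simp

text \<open>A line meets a sphere in at most two points: along the direction \<open>u\<close> the
  sphere equation is quadratic with root 0 at \<open>x\<close>, which leaves one other root.\<close>

lemma aff_dim_three_on_sphere:
  fixes x y z v :: "'a::euclidean_space"
  assumes "dist x v = s" "dist y v = s" "dist z v = s" "x \<noteq> y" "y \<noteq> z" "x \<noteq> z"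
  shows "aff_dim {x, y, z} \<ge> 2"
proof (rule ccontr)
  assume "\<not> ?thesis"
  then have "collinear {x, y, z}" by (simp add: collinear_aff_dim)
  then obtain u where u: "\<And>a b. a \<in> {x,y,z} \<Longrightarrow> b \<in> {x,y,z} \<Longrightarrow> \<exists>c. a - b = c *\<^sub>R u"
    unfolding collinear_def by blast
  obtain b c where b: "y - x = b *\<^sub>R u" and c: "z - x = c *\<^sub>R u" using u[of y x] u[of z x] by auto
  have key: "a * (u \<bullet> u) = - 2 * (u \<bullet> (x - v))" if "w - x = a *\<^sub>R u" "dist w v = s" "w \<noteq> x" for w a
  proof -
    have w: "w - v = a *\<^sub>R u + (x - v)" using that(1) by (simp add: algebra_simps)
    have "(w - v) \<bullet> (w - v) = (x - v) \<bullet> (x - v)"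
      using that(2) assms(1) by (simp add: dist_norm power2_norm_eq_inner[symmetric])
    then have "a * (a * (u \<bullet> u) + 2 * (u \<bullet> (x - v))) = 0"
      unfolding w by (simp add: inner_add_left inner_add_right inner_commute algebra_simps)
    moreover have "a \<noteq> 0" using that by auto
    ultimately show ?thesis by simp
  qed
  have "b * (u \<bullet> u) = c * (u \<bullet> u)" using key[OF b] key[OF c] assms by simp
  moreover have "u \<noteq> 0" using b assms by auto
  ultimately have "b = c" by simp
  then have "y - x = z - x" using b c by simp
  then show False using assms by simp
qed

lemma dim_orthogonal_family:
  fixes T :: "'i \<Rightarrow> 'a::euclidean_space set"
  assumes "finite I" "\<And>i j x y. i \<in> I \<Longrightarrow> j \<in> I \<Longrightarrow> i \<noteq> j \<Longrightarrow> x \<in> T i \<Longrightarrow> y \<in> T j \<Longrightarrow> x \<bullet> y = 0"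
  shows "dim (\<Union>i\<in>I. T i) = (\<Sum>i\<in>I. dim (T i))"
  using assms
proof (induction I rule: finite_induct)
  case (insert i I)
  have "dim (T i \<union> (\<Union>i\<in>I. T i)) = dim (T i) + dim (\<Union>i\<in>I. T i)"
    using insert.hyps insert.prems by (intro dim_orthogonal_sum) blast
  moreover have "dim (\<Union>i\<in>I. T i) = (\<Sum>i\<in>I. dim (T i))" using insert.prems by (intro insert.IH) blast
  ultimately show ?case using insert.hyps by simp
qed simp

definition equidistant_sets :: "'a::metric_space set \<Rightarrow> 'a set \<Rightarrow> bool" where
  "equidistant_sets A B \<longleftrightarrow> (\<exists>d. \<forall>x\<in>A. \<forall>y\<in>B. dist x y = d)"

lemma equidistant_sets_sym: "equidistant_sets A B \<Longrightarrow> equidistant_sets B A"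
  unfolding equidistant_sets_def by (metis dist_commute)

text \<open>The alternating sum of the four squared distances vanishes, and it equals
  \<open>- 2 * ((x - x') \<bullet> (y - y'))\<close>.\<close>

lemma equidistant_sets_orthogonal:
  fixes A B :: "'a::euclidean_space set"
  assumes "equidistant_sets A B" "x \<in> A" "x' \<in> A" "y \<in> B" "y' \<in> B"
  shows "(x - x') \<bullet> (y - y') = 0"
proof -
  obtain d where d: "\<And>x y. x \<in> A \<Longrightarrow> y \<in> B \<Longrightarrow> dist x y = d" using assms(1) unfolding equidistant_sets_def by blast
  have "(dist x y)\<^sup>2 - (dist x' y)\<^sup>2 - (dist x y')\<^sup>2 + (dist x' y')\<^sup>2 = 0" using d assms by simp
  moreover have "(dist x y)\<^sup>2 - (dist x' y)\<^sup>2 - (dist x y')\<^sup>2 + (dist x' y')\<^sup>2 = - 2 * ((x - x') \<bullet> (y - y'))"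
    by (simp add: dist_norm power2_norm_eq_inner inner_diff_left inner_diff_right inner_commute algebra_simps)
  ultimately show ?thesis by simp
qed

text \<open>The direction spaces of the sets are orthogonal, so their dimensions add.\<close>

lemma aff_dim_equidistant_family:
  fixes U :: "'i \<Rightarrow> 'a::euclidean_space set"
  assumes "finite I" "I \<noteq> {}" "\<And>i. i \<in> I \<Longrightarrow> U i \<noteq> {}"
    and eq: "\<And>i j. i \<in> I \<Longrightarrow> j \<in> I \<Longrightarrow> i \<noteq> j \<Longrightarrow> equidistant_sets (U i) (U j)"
  shows "(\<Sum>i\<in>I. aff_dim (U i)) \<le> aff_dim (\<Union>i\<in>I. U i)"
proof -
  define a where "a i = (SOME x. x \<in> U i)" for i
  have a: "a i \<in> U i" if "i \<in> I" for i using assms(3)[OF that] by (simp add: a_def some_in_eq)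
  obtain i0 where i0: "i0 \<in> I" using assms(2) by blast
  define T where "T i = (\<lambda>x. x - a i) ` U i" for i
  let ?V = "(\<lambda>x. x - a i0) ` (\<Union>i\<in>I. U i)"
  have "dim (\<Union>i\<in>I. T i) = (\<Sum>i\<in>I. dim (T i))"
    using assms(1) equidistant_sets_orthogonal[OF eq] a by (intro dim_orthogonal_family) (auto simp: T_def)
  moreover have "int (dim (T i)) = aff_dim (U i)" if "i \<in> I" for i
    unfolding T_def using a[OF that] by (intro aff_dim_eq_dim_subtract[symmetric] hull_inc)
  ultimately have "(\<Sum>i\<in>I. aff_dim (U i)) = int (dim (\<Union>i\<in>I. T i))" by simp
  also have "dim (\<Union>i\<in>I. T i) \<le> dim ?V"
  proof -
    have "T i \<subseteq> span ?V" if "i \<in> I" for i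
    proof
      fix y assume "y \<in> T i"
      then obtain x where x: "x \<in> U i" "y = x - a i" by (auto simp: T_def)
      have "x - a i0 \<in> span ?V" "a i - a i0 \<in> span ?V" using x a that by (auto intro!: span_base)
      then have "(x - a i0) - (a i - a i0) \<in> span ?V" by (rule span_diff)
      then show "y \<in> span ?V" using x by simp
    qed
    then have "(\<Union>i\<in>I. T i) \<subseteq> span ?V" by blast
    then have "dim (\<Union>i\<in>I. T i) \<le> dim (span ?V)" by (rule dim_subset)
    then show ?thesis by simp
  qed
  also have "int (dim ?V) = aff_dim (\<Union>i\<in>I. U i)"
    using a i0 by (intro aff_dim_eq_dim_subtract[symmetric] hull_inc) auto
  finally show ?thesis by simp
qed

text \<open>In a Lenz configuration each \<open>sphere_part I Z t i\<close> is contained in a 2-sphere.\<close>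

definition sphere_part :: "'i set \<Rightarrow> ('i \<Rightarrow> 'a::metric_space set) \<Rightarrow> real \<Rightarrow> 'i \<Rightarrow> 'a set" where
  "sphere_part I Z t i = {p. \<forall>j\<in>I - {i}. \<forall>z\<in>Z j. dist p z = t}"

text \<open>The sets \<open>Z i\<close> are a core that fixes the geometry: each spans at least a
  plane, with directions orthogonal to those of the others. A single dimension is left over, so at
  most one part is spatial. \<open>card I \<ge> 3\<close> gives every part two others, from which
  \<open>distance_pairs_spatial\<close> computes the radius.\<close>

locale lenz =
  fixes I :: "'i set" and Z :: "'i \<Rightarrow> 'a::euclidean_space set" and t :: real
  assumes I: "finite I" "card I \<ge> 3" "DIM('a) = 2 * card I + 1"
    and Z2: "\<And>i. i \<in> I \<Longrightarrow> aff_dim (Z i) \<ge> 2"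
    and cross: "\<And>i j x y. i \<in> I \<Longrightarrow> j \<in> I \<Longrightarrow> i \<noteq> j \<Longrightarrow> x \<in> Z i \<Longrightarrow> y \<in> Z j \<Longrightarrow> dist x y = t"
    and t: "t > 0"
begin

abbreviation "\<Sigma> \<equiv> sphere_part I Z t"

lemma Z_ne: "i \<in> I \<Longrightarrow> Z i \<noteq> {}"
  using Z2[of i] by auto

lemma Z_subset: "i \<in> I \<Longrightarrow> Z i \<subseteq> \<Sigma> i"
  using cross by (auto simp: sphere_part_def)

lemma \<Sigma>_dist: "p \<in> \<Sigma> i \<Longrightarrow> j \<in> I \<Longrightarrow> j \<noteq> i \<Longrightarrow> z \<in> Z j \<Longrightarrow> dist p z = t"
  by (auto simp: sphere_part_def)

lemma other: "i \<in> I \<Longrightarrow> \<exists>j l. j \<in> I \<and> l \<in> I \<and> j \<noteq> i \<and> l \<noteq> i \<and> j \<noteq> l"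
proof -
  assume "i \<in> I"
  then have "card (I - {i}) \<ge> 2" using I by simp
  then obtain S where "S \<subseteq> I - {i}" "card S = 2" by (meson obtain_subset_with_card_n)
  then show ?thesis by (auto simp: card_2_iff)
qed

text \<open>Replacing \<open>Z i\<close> by \<open>X\<close> keeps all cross distances equal to
  \<open>t\<close>, so the direction spaces stay orthogonal.\<close>

lemma aff_dim_sum_le:
  assumes i: "i \<in> I" and X: "X \<subseteq> \<Sigma> i" "X \<noteq> {}"
  shows "aff_dim X + (\<Sum>j\<in>I-{i}. aff_dim (Z j)) \<le> 2 * int (card I) + 1"
proof -
  define U where "U j = (if j = i then X else Z j)" for j
  have XZ: "equidistant_sets X (Z j)" if "j \<in> I" "j \<noteq> i" for j
    unfolding equidistant_sets_def
  proof (intro exI ballI)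
    fix x z assume "x \<in> X" "z \<in> Z j"
    then show "dist x z = t" using \<Sigma>_dist[of x i j z] X that by auto
  qed
  have ZZ: "equidistant_sets (Z j) (Z l)" if "j \<in> I" "l \<in> I" "j \<noteq> l" for j l
    unfolding equidistant_sets_def by (intro exI[of _ t] ballI cross[OF that])
  have "(\<Sum>j\<in>I. aff_dim (U j)) \<le> aff_dim (\<Union>j\<in>I. U j)"
  proof (rule aff_dim_equidistant_family)
    show "U j \<noteq> {}" if "j \<in> I" for j using that X(2) Z_ne by (simp add: U_def)
    show "equidistant_sets (U j) (U l)" if "j \<in> I" "l \<in> I" "j \<noteq> l" for j l
    proof -
      have "equidistant_sets (Z j) X" if "j \<noteq> i" using equidistant_sets_sym[OF XZ] that \<open>j \<in> I\<close> by blast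
      then show ?thesis using that XZ[of l] ZZ[of j l] unfolding U_def by presburger
    qed
  qed (use I i in auto)
  also have "\<dots> \<le> 2 * int (card I) + 1" using aff_dim_le_DIM[of "\<Union>j\<in>I. U j"] I by simp
  finally show ?thesis
    using I i by (simp add: sum.remove[of I i] U_def)
qed

lemma aff_dim_\<Sigma>: "i \<in> I \<Longrightarrow> aff_dim (\<Sigma> i) \<le> 3"
proof -
  assume i: "i \<in> I"
  then have "aff_dim (\<Sigma> i) + (\<Sum>j\<in>I-{i}. aff_dim (Z j)) \<le> 2 * int (card I) + 1"
    using Z_ne Z_subset by (intro aff_dim_sum_le) blast+
  moreover have "(\<Sum>j\<in>I-{i}. aff_dim (Z j)) \<ge> 2 * (int (card I) - 1)"
  proof -
    have "(\<Sum>j\<in>I-{i}. 2 :: int) \<le> (\<Sum>j\<in>I-{i}. aff_dim (Z j))" using Z2 by (intro sum_mono) auto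
    moreover have "(\<Sum>j\<in>I-{i}. 2 :: int) = 2 * (int (card I) - 1)" using I i by (simp add: of_nat_diff)
    ultimately show ?thesis by (simp only:)
  qed
  ultimately show ?thesis by (smt (verit))
qed

text \<open>Three such \<open>y\<close> lie on a sphere about \<open>x\<close> and span a plane,
  which omits \<open>x\<close> because its points are equidistant from \<open>x\<close> and
  \<open>z\<close>. With \<open>x\<close> they span the hull of \<open>\<Sigma> i\<close>; the
  difference of the squared distances to \<open>z\<close> and to a point \<open>u\<close> of another
  part is constant on them, so all of \<open>\<Sigma> i\<close> has distance \<open>s\<close> from
  \<open>z\<close>. This fails for \<open>z\<close> itself if \<open>i = j\<close>, and otherwise
  for \<open>Z i\<close>, whose points have distance \<open>t\<close> from \<open>z\<close>.\<close>

lemma equilateral_count: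
  assumes ij: "i \<in> I" "j \<in> I" and x: "x \<in> \<Sigma> i" and z: "z \<in> \<Sigma> j" and xz: "dist x z = s" and s: "s > 0" "s \<noteq> t"
  shows "finite {y \<in> \<Sigma> i. dist y x = s \<and> dist y z = s}" (is "finite ?Y") "card {y \<in> \<Sigma> i. dist y x = s \<and> dist y z = s} \<le> 2"
proof -
  obtain l where l: "l \<in> I" "l \<noteq> i" using other[OF ij(1)] by blast
  obtain u where u: "u \<in> Z l" using Z_ne l by blast
  have no3: False if y: "y1 \<in> ?Y" "y2 \<in> ?Y" "y3 \<in> ?Y" "y1 \<noteq> y2" "y2 \<noteq> y3" "y1 \<noteq> y3" for y1 y2 y3
  proof -
    define A where "A = {y1, y2, y3}"
    have A: "\<And>y. y \<in> A \<Longrightarrow> y \<in> \<Sigma> i \<and> dist y x = s \<and> dist y z = s" using y by (auto simp: A_def)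
    have dA: "aff_dim A \<ge> 2" unfolding A_def using y by (intro aff_dim_three_on_sphere[of _ x s]) auto
    have "x \<notin> affine hull A"
    proof
      assume "x \<in> affine hull A"
      then have "dist x x = dist x z" using A by (intro equidistant_affine_hull'[of A x z x]) auto
      then show False using xz s by simp
    qed
    then have "aff_dim (insert x A) \<ge> 3" using dA by (simp add: aff_dim_insert)
    moreover have sub: "insert x A \<subseteq> \<Sigma> i" using A x by auto
    ultimately have "aff_dim (insert x A) = aff_dim (\<Sigma> i)"
      using aff_dim_\<Sigma>[OF ij(1)] aff_dim_subset[OF sub] by linarith
    then have hull: "affine hull (insert x A) = affine hull (\<Sigma> i)" using aff_dim_eq_full_gen[OF sub] by blast
    have all: "dist p z = s" if "p \<in> \<Sigma> i" for p
    proof -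
      have "p \<in> affine hull (insert x A)" using hull hull_inc[OF that] by metis
      moreover have "(dist y z)\<^sup>2 - (dist y u)\<^sup>2 = s\<^sup>2 - t\<^sup>2" if "y \<in> insert x A" for y
        using that A xz \<Sigma>_dist[OF _ l u, of y] sub by auto
      ultimately have "(dist p z)\<^sup>2 - (dist p u)\<^sup>2 = s\<^sup>2 - t\<^sup>2"
        using equidistant_affine_hull[of "insert x A" z u] by blast
      moreover have "dist p u = t" using \<Sigma>_dist[OF that l u] .
      ultimately have "(dist p z)\<^sup>2 = s\<^sup>2" by simp
      then show ?thesis using s by (simp add: power2_eq_iff_nonneg)
    qed
    show False
    proof (cases "i = j")
      case True
      then show False using all[of z] z s by simp
    next
      case False
      obtain w where w: "w \<in> Z i" using Z_ne ij by blast
      then have "dist w z = s" using all Z_subset ij by blast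
      moreover have "dist z w = t" using \<Sigma>_dist[OF z ij(1) False w] .
      ultimately show False using s by (simp add: dist_commute)
    qed
  qed
  have lim: "card S \<le> 2" if "finite S" "S \<subseteq> ?Y" for S
  proof (rule ccontr)
    assume "\<not> card S \<le> 2"
    then have "3 \<le> card S" by linarith
    then obtain S' where "S' \<subseteq> S" "card S' = 3" by (meson obtain_subset_with_card_n)
    then obtain y1 y2 y3 where "S' = {y1,y2,y3}" "y1 \<noteq> y2" "y2 \<noteq> y3" "y1 \<noteq> y3" by (auto simp: card_3_iff)
    then show False using no3[of y1 y2 y3] \<open>S' \<subseteq> S\<close> that by auto
  qed
  show fin: "finite ?Y"
  proof (rule ccontr)
    assume "infinite ?Y"
    then obtain S where "finite S" "card S = 3" "S \<subseteq> ?Y" using infinite_arbitrarily_large by blast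
    then show False using lim[of S] by simp
  qed
  show "card ?Y \<le> 2" using lim[OF fin] by simp
qed

text \<open>Three points of \<open>X\<close> at distance \<open>t\<close> from \<open>x\<close>
  already span the hull of \<open>X\<close>, so being equidistant from \<open>x\<close> and from a
  point \<open>u\<close> of another part extends to \<open>x\<close> itself and gives
  \<open>0 = t\<close>.\<close>

lemma distance_pairs_planar:
  assumes i: "i \<in> I" and X: "X \<subseteq> \<Sigma> i" "finite X" "aff_dim X \<le> 2"
  shows "card {(x, y) \<in> X \<times> X. dist x y = t} \<le> 2 * card X"
proof -
  obtain l where l: "l \<in> I" "l \<noteq> i" using other[OF i] by blast
  obtain u where u: "u \<in> Z l" using Z_ne l by blast
  have "card {y \<in> X. dist x y = t} \<le> 2" if x: "x \<in> X" for x
  proof (rule ccontr)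
    assume "\<not> ?thesis"
    then have "3 \<le> card {y \<in> X. dist x y = t}" by linarith
    then obtain S' where S': "S' \<subseteq> {y \<in> X. dist x y = t}" "card S' = 3" by (meson obtain_subset_with_card_n)
    then obtain y1 y2 y3 where y: "S' = {y1,y2,y3}" "y1 \<noteq> y2" "y2 \<noteq> y3" "y1 \<noteq> y3" by (auto simp: card_3_iff)
    have A: "S' \<subseteq> X" "\<And>y. y \<in> S' \<Longrightarrow> dist y x = t" using S' by (auto simp: dist_commute)
    have "aff_dim S' \<ge> 2" unfolding y(1) using y A(2) by (intro aff_dim_three_on_sphere[of _ x t]) auto
    then have "aff_dim S' = aff_dim X" using X(3) aff_dim_subset[OF A(1)] by linarith
    then have "affine hull S' = affine hull X" using aff_dim_eq_full_gen[OF A(1)] by blast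
    then have "x \<in> affine hull S'" using hull_inc[OF x] by metis
    moreover have "dist y x = dist y u" if "y \<in> S'" for y
      using that A X \<Sigma>_dist[OF _ l u, of y] by auto
    ultimately have "dist x x = dist x u" using equidistant_affine_hull'[of S' x u x] by blast
    moreover have "dist x u = t" using \<Sigma>_dist[OF _ l u, of x] x X by auto
    ultimately show False using t by simp
  qed
  then have "(\<Sum>x\<in>X. card {y \<in> X. dist x y = t}) \<le> (\<Sum>x\<in>X. 2)" by (intro sum_mono)
  moreover have "{(x, y) \<in> X \<times> X. dist x y = t} = Sigma X (\<lambda>x. {y \<in> X. dist x y = t})" by auto
  ultimately show ?thesis using X(2) by (simp add: card_SigmaI)
qed

text \<open>When one part takes the spare dimension, the direction spaces of the parts exhaust the
  space, and this forces \<open>X\<close> onto a sphere of radius \<open>t / sqrt 2\<close>. There,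
  distance \<open>t\<close> means orthogonality of the vectors from the centre, and
  \<open>orthogonal_pairs_bound\<close> applies.\<close>

lemma distance_pairs_spatial:
  assumes i: "i \<in> I" and X: "X \<subseteq> \<Sigma> i" "finite X" "aff_dim X = 3" "card X \<le> n"
  shows "real (card {(x, y) \<in> X \<times> X. dist x y = t}) \<le> 70 * real n powr (4/3)"
proof -
  obtain j l where jl: "j \<in> I" "j \<noteq> i" "l \<in> I" "l \<noteq> i" "j \<noteq> l" using other[OF i] by blast
  obtain u v where u: "u \<in> Z j" and v: "v \<in> Z l" using Z_ne jl by blast
  obtain x0 where x0: "x0 \<in> X" using X(3) by (metis aff_dim_empty ex_in_conv numeral_neq_neg_one)
  define D where "D = span ((\<lambda>x. x - x0) ` X)"
  have dimD: "dim D = 3" using aff_dim_eq_dim_subtract[of x0 X] X(3) hull_inc[OF x0] by (simp add: D_def)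
  obtain w1 w2 where w: "w1 \<in> D" "\<And>w. w \<in> D \<Longrightarrow> orthogonal w2 w" "u - x0 = w1 + w2"
    using orthogonal_subspace_decomp_exists[of "(\<lambda>x. x - x0) ` X" "u - x0"] unfolding D_def by blast
  \<comment> \<open>The foot of the perpendicular from \<open>u\<close> to the affine hull of
    \<open>X\<close>; it turns out to be the centre of the sphere.\<close>
  define c where "c = x0 + w1"
  have uc: "u - c = w2" using w(3) by (simp add: c_def algebra_simps)
  have hullX: "affine hull X = (\<lambda>d. x0 + d) ` D"
    using affine_hull_span_gen[OF hull_inc[OF x0]] by (simp add: D_def)
  have cX: "c \<in> affine hull X" using w(1) by (auto simp: hullX c_def)
  have xcD: "x - c \<in> D" if "x \<in> X" for x
  proof -
    have "x - x0 \<in> D" using that by (auto simp: D_def intro: span_base)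
    then have "(x - x0) - w1 \<in> D" using w(1) unfolding D_def by (rule span_diff)
    then show ?thesis by (simp add: c_def algebra_simps)
  qed
  have uD: "(u - c) \<bullet> d = 0" if "d \<in> D" for d using w(2)[OF that] uc by (simp add: orthogonal_def)
  have dt: "dist x z = t" if "x \<in> X" "m \<in> I" "m \<noteq> i" "z \<in> Z m" for x z m using \<Sigma>_dist that X by blast
  have D_orth: "d \<bullet> (z - z') = 0" if "d \<in> D" "m \<in> I" "m \<noteq> i" "z \<in> Z m" "m' \<in> I" "m' \<noteq> i" "z' \<in> Z m'" for d m m' z z'
  proof -
    have "(x - x0) \<bullet> (z - z') = 0" if "x \<in> X" for x
    proof (rule equidistant_sets_orthogonal[of X "{z, z'}"])
      show "equidistant_sets X {z, z'}" unfolding equidistant_sets_def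
        using dt[OF _ \<open>m \<in> I\<close> \<open>m \<noteq> i\<close> \<open>z \<in> Z m\<close>] dt[OF _ \<open>m' \<in> I\<close> \<open>m' \<noteq> i\<close> \<open>z' \<in> Z m'\<close>] by (intro exI[of _ t]) auto
    qed (use that x0 in auto)
    then have "D \<subseteq> {d. d \<bullet> (z - z') = 0}"
      unfolding D_def by (intro span_minimal subspace_hyperplane2) auto
    then show ?thesis using that by blast
  qed
  have vD: "(v - c) \<bullet> d = 0" if "d \<in> D" for d
    using D_orth[OF that jl(1,2) u jl(3,4) v] uD[OF that] by (simp add: inner_diff_right inner_diff_left inner_commute)
  text \<open>The vectors u - c and v - c are orthogonal to the directions of all parts but one.\<close>
  have ceq: "dist c z = dist c z'" if "m \<in> I" "m \<noteq> i" "z \<in> Z m" "z' \<in> Z m" for z z' m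
    by (rule equidistant_affine_hull'[OF _ cX]) (use dt that in auto)
  have aT: "(p - c) \<bullet> (z - z') = 0" if "p \<in> Z m'" "m' \<in> I" "m' \<noteq> i" "m \<in> I" "m \<noteq> i" "m \<noteq> m'" "z \<in> Z m" "z' \<in> Z m" for p m' m z z'
  proof -
    have "(p - c) \<bullet> (z - z') = ((dist c z)\<^sup>2 - (dist c z')\<^sup>2 - (dist p z)\<^sup>2 + (dist p z')\<^sup>2) / 2"
      by (simp add: dist_norm power2_norm_eq_inner inner_diff_left inner_diff_right inner_commute algebra_simps)
    also have "\<dots> = 0" using ceq[of m z z'] cross[of m' m p z] cross[of m' m p z'] that by simp
    finally show ?thesis .
  qed
  define a where "a m = (SOME z. z \<in> Z m)" for m
  have a: "a m \<in> Z m" if "m \<in> I" for m using Z_ne[OF that] by (simp add: a_def some_in_eq)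
  define T where "T m = (if m = i then D else (\<lambda>z. z - a m) ` Z m)" for m
  have orthT: "x \<bullet> y = 0" if "m \<in> I" "m' \<in> I" "m \<noteq> m'" "x \<in> T m" "y \<in> T m'" for m m' x y
  proof -
    consider "m = i" | "m' = i" | "m \<noteq> i" "m' \<noteq> i" by blast
    then show ?thesis
    proof cases
      case 1
      then show ?thesis using that a D_orth by (auto simp: T_def)
    next
      case 2
      then show ?thesis using that a D_orth by (auto simp: T_def inner_commute)
    next
      case 3
      have "equidistant_sets (Z m) (Z m')" unfolding equidistant_sets_def by (intro exI[of _ t] ballI cross[OF that(1-3)])
      then show ?thesis using 3 that a equidistant_sets_orthogonal[of "Z m" "Z m'"] by (auto simp: T_def)
    qed
  qed
  have dimT: "dim (T m) \<ge> 2" if "m \<in> I" "m \<noteq> i" for m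
    using aff_dim_eq_dim_subtract[of "a m" "Z m"] hull_inc[OF a[OF that(1)]] Z2[OF that(1)] that by (simp add: T_def)
  \<comment> \<open>Three dimensions from \<open>X\<close> and two from each other part add up to
    the whole space.\<close>
  have "dim (\<Union>m\<in>I. T m) = (\<Sum>m\<in>I. dim (T m))" using I orthT by (intro dim_orthogonal_family) blast+
  also have "\<dots> = 3 + (\<Sum>m\<in>I-{i}. dim (T m))" using I i dimD by (simp add: sum.remove[of I i] T_def)
  also have "\<dots> \<ge> 3 + (\<Sum>m\<in>I-{i}. 2)" using dimT by (intro add_left_mono sum_mono) auto
  also have "3 + (\<Sum>m\<in>I-{i}. 2 :: nat) = DIM('a)" using I i by simp
  finally have "dim (\<Union>m\<in>I. T m) = DIM('a)" using dim_subset_UNIV[of "\<Union>m\<in>I. T m"] by linarith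
  then have full: "span (\<Union>m\<in>I. T m) = UNIV" by (simp add: dim_eq_full)
  \<comment> \<open>\<open>v - c\<close> is orthogonal to all direction spaces except that of part
    \<open>l\<close>, and together they span everything, so it lies in the span of
    \<open>T l\<close>; but \<open>u - c\<close> is orthogonal to \<open>T l\<close>.\<close>
  have ab: "(u - c) \<bullet> (v - c) = 0"
  proof -
    obtain b1 b2 where b: "b1 \<in> span (T l)" "\<And>w. w \<in> span (T l) \<Longrightarrow> orthogonal b2 w" "v - c = b1 + b2"
      using orthogonal_subspace_decomp_exists[of "T l" "v - c"] by blast
    have b1: "b1 \<bullet> y = 0" if "m \<in> I" "m \<noteq> l" "y \<in> T m" for y m
    proof -
      have "span (T l) \<subseteq> {x. x \<bullet> y = 0}" using orthT[of l m] that jl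
        by (intro span_minimal subspace_hyperplane2) auto
      then show ?thesis using b(1) by blast
    qed
    have vT: "(v - c) \<bullet> y = 0" if "m \<in> I" "m \<noteq> l" "y \<in> T m" for y m
    proof (cases "m = i")
      case True
      then show ?thesis using vD that by (simp add: T_def)
    next
      case False
      then show ?thesis using aT[OF v jl(3,4)] that a by (auto simp: T_def)
    qed
    have "b2 \<bullet> y = 0" if "y \<in> (\<Union>m\<in>I. T m)" for y
    proof -
      from that obtain m where m: "m \<in> I" "y \<in> T m" by blast
      show ?thesis
      proof (cases "m = l")
        case True
        then show ?thesis using b(2)[OF span_base] m by (auto simp: orthogonal_def)
      next
        case False
        have "b2 = (v - c) - b1" using b(3) by simp
        then show ?thesis using b1[OF m(1) False m(2)] vT[OF m(1) False m(2)] by (simp add: inner_diff_left)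
      qed
    qed
    then have "span (\<Union>m\<in>I. T m) \<subseteq> {x. b2 \<bullet> x = 0}" by (intro span_minimal subspace_hyperplane) auto
    then have "b2 \<bullet> b2 = 0" using full by blast
    then have vb: "v - c = b1" using b(3) by simp
    have "(u - c) \<bullet> y = 0" if "y \<in> T l" for y
      using aT[OF u jl(1,2) jl(3,4)] jl that a by (auto simp: T_def)
    then have "span (T l) \<subseteq> {x. (u - c) \<bullet> x = 0}" by (intro span_minimal subspace_hyperplane) auto
    then show ?thesis using vb b(1) by blast
  qed
  have pyth: "(dist x c)\<^sup>2 + (dist p c)\<^sup>2 = t\<^sup>2" if "x \<in> X" "dist x p = t" "(p - c) \<bullet> (x - c) = 0" for x p
  proof -
    have "(dist x p)\<^sup>2 = (dist x c)\<^sup>2 + (dist p c)\<^sup>2 - 2 * ((p - c) \<bullet> (x - c))"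
      by (simp add: dist_norm power2_norm_eq_inner inner_diff_left inner_diff_right inner_commute algebra_simps)
    then show ?thesis using that by simp
  qed
  have uv: "(dist u c)\<^sup>2 + (dist v c)\<^sup>2 = t\<^sup>2"
  proof -
    have "(dist u v)\<^sup>2 = (dist u c)\<^sup>2 + (dist v c)\<^sup>2 - 2 * ((u - c) \<bullet> (v - c))"
      by (simp add: dist_norm power2_norm_eq_inner inner_diff_left inner_diff_right inner_commute algebra_simps)
    then show ?thesis using ab cross[OF jl(1,3,5) u v] by simp
  qed
  \<comment> \<open>Pythagoras for the pairs \<open>x\<close>, \<open>u\<close> and
    \<open>x\<close>, \<open>v\<close> and \<open>u\<close>, \<open>v\<close>: adding the first two
    equations and subtracting the third leaves only \<open>x\<close>.\<close>
  have rad: "2 * (dist x c)\<^sup>2 = t\<^sup>2" if "x \<in> X" for x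
    using pyth[OF that dt[OF that jl(1,2) u] uD[OF xcD[OF that]]]
      pyth[OF that dt[OF that jl(3,4) v] vD[OF xcD[OF that]]] uv by linarith
  define P where "P = (\<lambda>x. x - c) ` X"
  have inj: "inj_on (\<lambda>x. x - c) X" by (auto simp: inj_on_def)
  have "{(x, y) \<in> X \<times> X. dist x y = t} = (\<lambda>(p, q). (p + c, q + c)) ` {(p, q) \<in> P \<times> P. p \<bullet> q = 0}" (is "?L = ?R")
  proof -
    have iff: "dist x y = t \<longleftrightarrow> (x - c) \<bullet> (y - c) = 0" if "x \<in> X" "y \<in> X" for x y
    proof -
      have "(dist x y)\<^sup>2 = (dist x c)\<^sup>2 + (dist y c)\<^sup>2 - 2 * ((x - c) \<bullet> (y - c))"
        by (simp add: dist_norm power2_norm_eq_inner inner_diff_left inner_diff_right inner_commute algebra_simps)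
      then have "(dist x y)\<^sup>2 = t\<^sup>2 - 2 * ((x - c) \<bullet> (y - c))"
        using rad[OF that(1)] rad[OF that(2)] by linarith
      moreover have "dist x y = t \<longleftrightarrow> (dist x y)\<^sup>2 = t\<^sup>2" using t by (simp add: power2_eq_iff_nonneg)
      ultimately show ?thesis by simp
    qed
    show ?thesis
    proof (intro equalityI subsetI)
      fix w assume "w \<in> ?L"
      then obtain x y where "w = (x, y)" "x \<in> X" "y \<in> X" "dist x y = t" by blast
      then show "w \<in> ?R" using iff by (intro image_eqI[where x = "(x - c, y - c)"]) (auto simp: P_def)
    next
      fix w assume "w \<in> ?R"
      then show "w \<in> ?L" using iff by (auto simp: P_def)
    qed
  qed
  moreover have "finite {(p, q) \<in> P \<times> P. p \<bullet> q = 0}"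
    by (rule finite_subset[of _ "P \<times> P"]) (use X(2) in \<open>auto simp: P_def\<close>)
  ultimately have "card {(x, y) \<in> X \<times> X. dist x y = t} \<le> card {(p, q) \<in> P \<times> P. p \<bullet> q = 0}"
    by (simp only: card_image_le)
  moreover have "real (card {(p, q) \<in> P \<times> P. p \<bullet> q = 0}) \<le> 70 * real n powr (4/3)"
  proof (rule orthogonal_pairs_bound)
    show "subspace D" by (simp add: D_def)
    show "card P \<le> n" using card_image_le[OF X(2)] X(4) unfolding P_def by (metis le_trans)
    show "P \<subseteq> D" using xcD by (auto simp: P_def)
    show "norm p = t / sqrt 2" if "p \<in> P" for p
    proof -
      from that obtain x where "x \<in> X" "p = x - c" by (auto simp: P_def)
      then have "(norm p)\<^sup>2 = (t / sqrt 2)\<^sup>2" using rad[of x] by (simp add: dist_norm power_divide)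
      then show ?thesis using t by (simp add: power2_eq_iff_nonneg)
    qed
  qed (use X t dimD in \<open>auto simp: P_def\<close>)
  ultimately show ?thesis by linarith
qed

lemma distance_pairs:
  assumes i: "i \<in> I" and X: "X \<subseteq> \<Sigma> i" "finite X" "card X \<le> n"
  shows "real (card {(x, y) \<in> X \<times> X. dist x y = t}) \<le> 70 * real n powr (4/3)"
proof (cases "aff_dim X \<le> 2")
  case True
  have "real (card {(x, y) \<in> X \<times> X. dist x y = t}) \<le> 2 * real n"
    using distance_pairs_planar[OF i X(1,2) True] X(3) by linarith
  also have "2 * real n \<le> 70 * real n powr (4/3)"
  proof (cases "n = 0")
    case False
    then have "real n powr 1 \<le> real n powr (4/3)" by (intro powr_mono) auto
    then show ?thesis using False by simp
  qed simp
  finally show ?thesis .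
next
  case False
  then have "aff_dim X = 3" using aff_dim_subset[OF X(1)] aff_dim_\<Sigma>[OF i] by linarith
  then show ?thesis using distance_pairs_spatial[OF i X(1,2) _ X(3)] by blast
qed

end

section \<open>Boxes in dense relations\<close>

text \<open>Erdos's theorem on complete multipartite subhypergraphs, by induction on the
  coordinates: many tuples have many extensions in coordinate \<open>i\<close>, hence many
  \<open>m\<close>-subsets of extensions, and some \<open>m\<close>-set is common to a positive
  proportion of the tuples. The sides of the box may overlap.\<close>

lemma dense_relation_contains_box:
  fixes I :: "'i set" and \<delta> :: real
  assumes "finite I" "\<delta> > 0" "m > 0"
  shows "\<exists>n0. \<forall>X :: 'a set. \<forall>R. finite X \<longrightarrow> card X \<ge> n0 \<longrightarrow> R \<subseteq> (I \<rightarrow>\<^sub>E X) \<longrightarrow>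
     \<delta> * real (card X) ^ card I \<le> real (card R) \<longrightarrow>
     (\<exists>U. (\<forall>i\<in>I. U i \<subseteq> X \<and> card (U i) = m) \<and> Pi\<^sub>E I U \<subseteq> R)"
  using assms(1,2)
proof (induction I arbitrary: \<delta> rule: finite_induct)
  case empty
  have "(\<exists>U. (\<forall>i\<in>{}. U i \<subseteq> X \<and> card (U i) = m) \<and> Pi\<^sub>E {} U \<subseteq> R)"
    if "R \<subseteq> ({} \<rightarrow>\<^sub>E X)" "\<delta> * real (card X) ^ card ({} :: 'i set) \<le> real (card R)" for X :: "'a set" and R
  proof -
    have "card R > 0" using that empty by (simp add: zero_less_iff_neq_zero)
    then have "R \<noteq> {}" by auto
    then show ?thesis using that(1) by auto
  qed
  then show ?case by blast
next
  case (insert i I)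
  define \<delta>' where "\<delta>' = \<delta> / 2 * (\<delta> / (2 * m)) ^ m"
  have \<delta>': "\<delta>' > 0" using insert.prems assms(3) by (simp add: \<delta>'_def)
  from insert.IH[OF \<delta>'] obtain n1 where n1: "\<forall>X :: 'a set. \<forall>R. finite X \<longrightarrow> card X \<ge> n1 \<longrightarrow> R \<subseteq> (I \<rightarrow>\<^sub>E X) \<longrightarrow>
     \<delta>' * real (card X) ^ card I \<le> real (card R) \<longrightarrow>
     (\<exists>U. (\<forall>i\<in>I. U i \<subseteq> X \<and> card (U i) = m) \<and> Pi\<^sub>E I U \<subseteq> R)" ..
  \<comment> \<open>The second bound gives \<open>m \<le> \<delta> * n / 2\<close>, so the extension
    sets of the tuples in \<open>W\<close> have at least \<open>m\<close> elements.\<close>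
  define n0 where "n0 = max n1 (nat \<lceil>2 * m / \<delta>\<rceil> + 1)"
  have "\<exists>U. (\<forall>j\<in>insert i I. U j \<subseteq> X \<and> card (U j) = m) \<and> Pi\<^sub>E (insert i I) U \<subseteq> R"
    if X: "finite X" "card X \<ge> n0" and R: "R \<subseteq> (insert i I \<rightarrow>\<^sub>E X)"
      and dense: "\<delta> * real (card X) ^ card (insert i I) \<le> real (card R)" for X :: "'a set" and R
  proof -
    define n where "n = real (card X)"
    have "real (nat \<lceil>2 * m / \<delta>\<rceil> + 1) \<le> n" using X(2) by (simp add: n0_def n_def)
    then have nm: "2 * m / \<delta> \<le> n" "n > 0" by linarith+
    then have nm': "real m \<le> \<delta> * n / 2" using insert.prems by (simp add: field_simps)
    define \<Omega> where "\<Omega> = (I \<rightarrow>\<^sub>E X)"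
    have fin\<Omega>: "finite \<Omega>" using insert.hyps X by (simp add: \<Omega>_def finite_PiE)
    have c\<Omega>: "real (card \<Omega>) = n ^ card I" using insert.hyps by (simp add: \<Omega>_def card_PiE n_def)
    define N where "N w = {x \<in> X. w(i := x) \<in> R}" for w
    have finN: "finite (N w)" for w using X by (simp add: N_def)
    have Nle: "real (card (N w)) \<le> n" for w unfolding n_def N_def using X by (simp add: card_mono)
    have "card R \<le> card (Sigma \<Omega> N)"
    proof (rule card_inj_on_le[where f = "\<lambda>f. (f(i := undefined), f i)"])
      show "inj_on (\<lambda>f. (f(i := undefined), f i)) R"
        by (rule inj_onI) (metis fst_conv snd_conv fun_upd_triv fun_upd_upd)
      show "(\<lambda>f. (f(i := undefined), f i)) ` R \<subseteq> Sigma \<Omega> N"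
        using R insert.hyps by (fastforce simp: \<Omega>_def N_def PiE_def extensional_def Pi_def)
    qed (use fin\<Omega> finN in auto)
    also have "\<dots> = (\<Sum>w\<in>\<Omega>. card (N w))" using fin\<Omega> finN by simp
    finally have sumN: "\<delta> * n ^ card I * n \<le> (\<Sum>w\<in>\<Omega>. real (card (N w)))"
      using dense insert.hyps unfolding n_def by (simp add: mult_ac flip: of_nat_sum)
    define W where "W = {w \<in> \<Omega>. \<delta> * n / 2 \<le> real (card (N w))}"
    have finW: "finite W" using fin\<Omega> by (simp add: W_def)
    have "(\<Sum>w\<in>\<Omega>. real (card (N w))) \<le> (\<Sum>w\<in>\<Omega>. \<delta> * n / 2 + (if w \<in> W then n else 0))"
      using Nle insert.prems nm by (intro sum_mono) (auto simp: W_def add_increasing not_le less_imp_le)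
    also have "\<dots> = \<delta> * n / 2 * n ^ card I + real (card W) * n"
      using fin\<Omega> c\<Omega> by (simp add: sum.distrib sum.If_cases W_def Int_def mult.commute)
    finally have "\<delta> / 2 * n ^ card I * n \<le> real (card W) * n" using sumN by (simp add: field_simps)
    then have cW: "\<delta> / 2 * n ^ card I \<le> real (card W)" using nm by simp
    define \<S> where "\<S> = {S. S \<subseteq> X \<and> card S = m}"
    have fin\<S>: "finite \<S>" using X by (simp add: \<S>_def)
    have c\<S>: "real (card \<S>) \<le> n ^ m"
    proof -
      have "card \<S> \<le> card X ^ m"
        using n_subsets[OF X(1), of m] binomial_le_pow[of m "card X"]
        by (cases "m \<le> card X") (simp_all add: \<S>_def binomial_eq_0)
      then show ?thesis unfolding n_def using of_nat_le_iff[where ?'a = real] by fastforce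
    qed
    have many: "(\<delta> * n / (2 * m)) ^ m \<le> real (card {S \<in> \<S>. S \<subseteq> N w})" if "w \<in> W" for w
    proof -
      have w: "\<delta> * n / 2 \<le> real (card (N w))" using that by (simp add: W_def)
      then have mN: "m \<le> card (N w)" using nm' by linarith
      have "(\<delta> * n / (2 * m)) ^ m \<le> (real (card (N w)) / m) ^ m"
        using w assms(3) insert.prems nm by (intro power_mono) (auto simp: field_simps)
      also have "\<dots> \<le> real (card (N w) choose m)" using binomial_ge_n_over_k_pow_k[OF mN, where ?'a = real] .
      also have "\<dots> = real (card {S. S \<subseteq> N w \<and> card S = m})" using n_subsets[OF finN] by simp
      also have "{S. S \<subseteq> N w \<and> card S = m} = {S \<in> \<S>. S \<subseteq> N w}" by (auto simp: \<S>_def N_def)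
      finally show ?thesis .
    qed
    define R' where "R' S = {w \<in> \<Omega>. S \<subseteq> N w}" for S
    \<comment> \<open>Pigeonhole over at most \<open>n ^ m\<close> sets \<open>S\<close>, counting
      pairs of a tuple and an \<open>m\<close>-subset of its extensions.\<close>
    have "\<exists>S\<in>\<S>. \<delta>' * n ^ card I \<le> real (card (R' S))"
    proof (rule ccontr)
      assume "\<not> ?thesis"
      then have less: "real (card (R' S)) < \<delta>' * n ^ card I" if "S \<in> \<S>" for S using that by force
      have "0 < \<delta> / 2 * n ^ card I" using nm insert.prems by simp
      then have "0 < real (card W)" using cW by linarith
      then obtain w0 where "w0 \<in> W" by (cases "W = {}") auto
      moreover have "0 < (\<delta> * n / (2 * m)) ^ m" using nm insert.prems assms(3) by simp
      ultimately have "0 < real (card {S \<in> \<S>. S \<subseteq> N w0})" using many[of w0] by linarith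
      then have "\<S> \<noteq> {}" by (cases "\<S> = {}") auto
      have "\<delta>' * n ^ card I * n ^ m = \<delta> / 2 * n ^ card I * (\<delta> * n / (2 * m)) ^ m"
        by (simp add: \<delta>'_def power_mult_distrib power_divide)
      also have "\<dots> \<le> real (card W) * (\<delta> * n / (2 * m)) ^ m"
        using cW nm insert.prems by (intro mult_right_mono) auto
      also have "\<dots> = (\<Sum>w\<in>W. (\<delta> * n / (2 * m)) ^ m)" by simp
      also have "\<dots> \<le> (\<Sum>w\<in>W. real (card {S \<in> \<S>. S \<subseteq> N w}))" using many by (intro sum_mono)
      also have "\<dots> \<le> (\<Sum>w\<in>\<Omega>. real (card {S \<in> \<S>. S \<subseteq> N w}))"
        using fin\<Omega> by (intro sum_mono2) (auto simp: W_def)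
      also have "\<dots> = (\<Sum>w\<in>\<Omega>. \<Sum>S\<in>\<S>. if S \<subseteq> N w then 1 else 0)"
        using fin\<S> by (simp add: sum.If_cases Int_def)
      also have "\<dots> = (\<Sum>S\<in>\<S>. \<Sum>w\<in>\<Omega>. if S \<subseteq> N w then 1 else 0)" by (rule sum.swap)
      also have "\<dots> = (\<Sum>S\<in>\<S>. real (card (R' S)))"
        using fin\<Omega> by (simp add: sum.If_cases Int_def R'_def)
      also have "\<dots> < (\<Sum>S\<in>\<S>. \<delta>' * n ^ card I)" using fin\<S> \<open>\<S> \<noteq> {}\<close> less by (intro sum_strict_mono)
      also have "\<dots> = real (card \<S>) * (\<delta>' * n ^ card I)" by simp
      also have "\<dots> \<le> n ^ m * (\<delta>' * n ^ card I)" using c\<S> \<delta>' nm by (intro mult_right_mono) auto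
      finally show False by (simp add: mult_ac)
    qed
    then obtain S where S: "S \<in> \<S>" "\<delta>' * n ^ card I \<le> real (card (R' S))" by blast
    have "card X \<ge> n1" using X(2) by (simp add: n0_def)
    moreover have "R' S \<subseteq> (I \<rightarrow>\<^sub>E X)" unfolding R'_def \<Omega>_def by auto
    ultimately have "\<exists>U. (\<forall>j\<in>I. U j \<subseteq> X \<and> card (U j) = m) \<and> Pi\<^sub>E I U \<subseteq> R' S"
      by (intro n1[rule_format, OF X(1) _ _ S(2)[unfolded n_def]])
    then obtain U where U: "\<forall>j\<in>I. U j \<subseteq> X \<and> card (U j) = m" "Pi\<^sub>E I U \<subseteq> R' S"
      by (elim exE conjE)
    define U' where "U' = U(i := S)"
    have "Pi\<^sub>E (insert i I) U' \<subseteq> R"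
    proof
      fix f assume f: "f \<in> Pi\<^sub>E (insert i I) U'"
      have "f(i := undefined) \<in> Pi\<^sub>E I U"
        using f insert.hyps by (fastforce simp: U'_def PiE_def extensional_def Pi_def)
      then have "S \<subseteq> N (f(i := undefined))" using U(2) by (auto simp: R'_def)
      moreover have "f i \<in> S" using f by (auto simp: U'_def PiE_def)
      ultimately have "f(i := undefined, i := f i) \<in> R" by (auto simp: N_def)
      then show "f \<in> R" by simp
    qed
    moreover have "U' j \<subseteq> X \<and> card (U' j) = m" if "j \<in> insert i I" for j
      using that U(1) S(1) by (auto simp: U'_def \<S>_def)
    ultimately show ?thesis by (intro exI[of _ U']) simp
  qed
  then show ?case by (intro exI[of _ n0] allI impI)
qed

section \<open>The Moon--Moser inequality\<close>

text \<open>A simplicial complex on \<open>X\<close>. The counting is shared by heavy cliques,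
  regular cliques and transversals.\<close>

locale hereditary =
  fixes X :: "'a set" and P :: "'a set \<Rightarrow> bool"
  assumes fin: "finite X" and down: "\<And>S T. P T \<Longrightarrow> S \<subseteq> T \<Longrightarrow> P S"
begin

definition faces :: "nat \<Rightarrow> 'a set set" where
  "faces s = {S. S \<subseteq> X \<and> card S = s \<and> P S}"

definition ext :: "'a set \<Rightarrow> 'a set" where
  "ext C = {x \<in> X - C. P (insert x C)}"

text \<open>The feature of clique complexes on which the Moon--Moser argument rests: a point that
  can replace either of two vertices of \<open>C\<close> can be added to \<open>C\<close>. It makes
  the sets \<open>private_ext C v\<close> disjoint.\<close>

definition exchange :: "nat \<Rightarrow> bool" where
  "exchange s \<longleftrightarrow> (\<forall>C\<in>faces s. \<forall>v\<in>C. \<forall>w\<in>C. \<forall>x\<in>X - C. v \<noteq> w \<longrightarrow>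
     P (insert x (C - {v})) \<longrightarrow> P (insert x (C - {w})) \<longrightarrow> P (insert x C))"

definition private_ext :: "'a set \<Rightarrow> 'a \<Rightarrow> 'a set" where
  "private_ext C v = ext (C - {v}) - ext C"

lemma finite_faces [simp]: "finite (faces s)"
  by (rule finite_subset[of _ "Pow X"]) (use fin in \<open>auto simp: faces_def\<close>)

lemma faces_finite: "C \<in> faces s \<Longrightarrow> finite C"
  using fin finite_subset by (auto simp: faces_def)

lemma finite_ext [simp]: "finite (ext C)"
  using fin by (simp add: ext_def)

lemma ext_Diff: "ext C \<subseteq> ext (C - {v})"
proof
  fix x assume "x \<in> ext C"
  then have "x \<in> X - C" "P (insert x C)" by (auto simp: ext_def)
  then show "x \<in> ext (C - {v})" using down[of "insert x C" "insert x (C - {v})"] by (auto simp: ext_def)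
qed

text \<open>Double counting of pairs of a face and one of its vertices, listed once from the larger
  and once from the smaller face.\<close>

lemma sum_faces_Suc:
  fixes f :: "'a set \<Rightarrow> 'a \<Rightarrow> 'b::comm_monoid_add"
  shows "(\<Sum>C\<in>faces (Suc s). \<Sum>v\<in>C. f (C - {v}) v) = (\<Sum>C\<in>faces s. \<Sum>x\<in>ext C. f C x)"
proof -
  have "(\<Sum>C\<in>faces (Suc s). \<Sum>v\<in>C. f (C - {v}) v) = (\<Sum>(C, v)\<in>Sigma (faces (Suc s)) (\<lambda>C. C). f (C - {v}) v)"
    using faces_finite by (intro sum.Sigma) auto
  also have "\<dots> = (\<Sum>(C, x)\<in>Sigma (faces s) ext. f C x)"
  proof (rule sum.reindex_bij_witness[where i = "\<lambda>(C, x). (insert x C, x)" and j = "\<lambda>(C, v). (C - {v}, v)"])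
    fix a assume a: "a \<in> Sigma (faces (Suc s)) (\<lambda>C. C)"
    obtain C v where Cv: "a = (C, v)" by (cases a)
    then have C: "C \<in> faces (Suc s)" "v \<in> C" using a by auto
    then have "C - {v} \<in> faces s" using down[of C "C - {v}"] by (auto simp: faces_def)
    moreover have "v \<in> ext (C - {v})" using C by (auto simp: ext_def faces_def insert_absorb)
    ultimately show "(case a of (C, v) \<Rightarrow> (C - {v}, v)) \<in> Sigma (faces s) ext" using Cv by simp
    show "(case case a of (C, v) \<Rightarrow> (C - {v}, v) of (C, x) \<Rightarrow> (insert x C, x)) = a"
      using Cv C by (auto simp: insert_absorb)
    show "(case case a of (C, v) \<Rightarrow> (C - {v}, v) of (C, x) \<Rightarrow> f C x) = (case a of (C, v) \<Rightarrow> f (C - {v}) v)"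
      using Cv by simp
  next
    fix b assume b: "b \<in> Sigma (faces s) ext"
    obtain C x where Cx: "b = (C, x)" by (cases b)
    then have C: "C \<in> faces s" "x \<in> X" "x \<notin> C" "P (insert x C)" using b by (auto simp: ext_def)
    then show "(case case b of (C, x) \<Rightarrow> (insert x C, x) of (C, v) \<Rightarrow> (C - {v}, v)) = b" using Cx by auto
    show "(case b of (C, x) \<Rightarrow> (insert x C, x)) \<in> Sigma (faces (Suc s)) (\<lambda>C. C)"
      using Cx C faces_finite[OF C(1)] by (auto simp: faces_def)
  qed
  also have "\<dots> = (\<Sum>C\<in>faces s. \<Sum>x\<in>ext C. f C x)" by (subst sum.Sigma) auto
  finally show ?thesis .
qed

lemma card_faces_Suc: "Suc s * card (faces (Suc s)) = (\<Sum>C\<in>faces s. card (ext C))"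
proof -
  have "(\<Sum>C\<in>faces (Suc s). \<Sum>v\<in>C. 1 :: nat) = (\<Sum>C\<in>faces s. \<Sum>x\<in>ext C. 1)" by (rule sum_faces_Suc)
  moreover have "(\<Sum>C\<in>faces (Suc s). \<Sum>v\<in>C. 1 :: nat) = (\<Sum>C\<in>faces (Suc s). Suc s)"
    by (intro sum.cong) (auto simp: faces_def)
  ultimately show ?thesis by simp
qed

lemma private_ext_disjoint:
  assumes "exchange s" "C \<in> faces s" "v \<in> C" "w \<in> C" "v \<noteq> w"
  shows "private_ext C v \<inter> private_ext C w = {}"
proof (rule ccontr)
  assume "private_ext C v \<inter> private_ext C w \<noteq> {}"
  then obtain x where x: "x \<in> ext (C - {v})" "x \<in> ext (C - {w})" "x \<notin> ext C" by (auto simp: private_ext_def)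
  then have "x \<in> X - C" using assms(5) by (auto simp: ext_def)
  moreover have "P (insert x (C - {v}))" "P (insert x (C - {w}))" using x by (auto simp: ext_def)
  ultimately have "P (insert x C)" using assms unfolding exchange_def by blast
  then show False using x \<open>x \<in> X - C\<close> by (auto simp: ext_def)
qed

lemma card_private_ext: "card (private_ext C v) + card (ext C) = card (ext (C - {v}))"
  unfolding private_ext_def using ext_Diff[of C v] by (simp add: card_Diff_subset card_mono)

text \<open>In the sum, a point that extends \<open>C\<close> is counted for all \<open>s\<close>
  vertices, and a private point exactly once, as the private sets are disjoint.\<close>

lemma card_uncovered:
  assumes "exchange s" "C \<in> faces s"
  shows "card (X - (\<Union>v\<in>C. private_ext C v)) + (\<Sum>v\<in>C. card (ext (C - {v}))) = card X + s * card (ext C)"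
proof -
  have C: "finite C" "card C = s" using assms(2) faces_finite[OF assms(2)] by (auto simp: faces_def)
  have sub: "(\<Union>v\<in>C. private_ext C v) \<subseteq> X" by (auto simp: private_ext_def ext_def)
  have "card (\<Union>v\<in>C. private_ext C v) = (\<Sum>v\<in>C. card (private_ext C v))"
    using C private_ext_disjoint[OF assms] by (intro card_UN_disjoint) (auto simp: private_ext_def)
  moreover have "(\<Sum>v\<in>C. card (ext (C - {v}))) = (\<Sum>v\<in>C. card (private_ext C v)) + s * card (ext C)"
    by (simp add: card_private_ext[symmetric] sum.distrib C)
  moreover have "card (X - (\<Union>v\<in>C. private_ext C v)) + card (\<Union>v\<in>C. private_ext C v) = card X"
    using sub fin by (metis card_Diff_subset card_mono finite_subset le_add_diff_inverse2)
  ultimately show ?thesis by linarith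
qed

lemma sum_card_ext_faces:
  "(\<Sum>C\<in>faces (Suc s). \<Sum>v\<in>C. card (ext (C - {v}))) = (\<Sum>C\<in>faces s. (card (ext C))\<^sup>2)"
  using sum_faces_Suc[of "\<lambda>C v. card (ext C)" s] by (simp add: power2_eq_square)

lemma sum_squares_ext:
  "(real (Suc s) * real (card (faces (Suc s))))\<^sup>2 \<le> real (card (faces s)) * (\<Sum>C\<in>faces s. (real (card (ext C)))\<^sup>2)"
proof -
  have "real (Suc s) * real (card (faces (Suc s))) = (\<Sum>C\<in>faces s. real (card (ext C)))"
    using card_faces_Suc[of s] by (metis of_nat_mult of_nat_sum)
  moreover have "(\<Sum>C\<in>faces s. 1 * real (card (ext C)))\<^sup>2 \<le> (\<Sum>C\<in>faces s. 1\<^sup>2) * (\<Sum>C\<in>faces s. (real (card (ext C)))\<^sup>2)"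
    by (rule Cauchy_Schwarz_ineq_sum)
  ultimately show ?thesis by simp
qed

text \<open>The Moon--Moser inequality with its slack kept, from \<open>card_uncovered\<close> and
  Cauchy--Schwarz. A lower bound for the left side gives \<open>dens_moon_moser\<close>; read the
  other way, near equality leaves few uncovered points, which drives
  \<open>typical_regular_clique\<close>.\<close>

lemma sum_uncovered:
  assumes "exchange (Suc s)"
  shows "real (card (faces s)) * (\<Sum>C\<in>faces (Suc s). real (card (X - (\<Union>v\<in>C. private_ext C v))))
    \<le> real (card (faces s)) * (real (card X) * real (card (faces (Suc s))) + real (Suc s) * real (Suc (Suc s)) * real (card (faces (Suc (Suc s)))))
      - (real (Suc s) * real (card (faces (Suc s))))\<^sup>2"
proof -
  have "(\<Sum>C\<in>faces (Suc s). card (X - (\<Union>v\<in>C. private_ext C v))) + (\<Sum>C\<in>faces (Suc s). \<Sum>v\<in>C. card (ext (C - {v})))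
      = (\<Sum>C\<in>faces (Suc s). card X + Suc s * card (ext C))"
    unfolding sum.distrib[symmetric] by (intro sum.cong refl card_uncovered[OF assms])
  also have "\<dots> = card X * card (faces (Suc s)) + Suc s * (Suc (Suc s) * card (faces (Suc (Suc s))))"
    unfolding card_faces_Suc by (simp only: sum.distrib sum_distrib_left sum_constant mult.commute of_nat_id)
  finally have "(\<Sum>C\<in>faces (Suc s). card (X - (\<Union>v\<in>C. private_ext C v))) + (\<Sum>C\<in>faces s. (card (ext C))\<^sup>2)
      = card X * card (faces (Suc s)) + Suc s * (Suc (Suc s) * card (faces (Suc (Suc s))))"
    unfolding sum_card_ext_faces .
  from arg_cong[OF this, of real]
  have "real (\<Sum>C\<in>faces (Suc s). card (X - (\<Union>v\<in>C. private_ext C v))) + real (\<Sum>C\<in>faces s. (card (ext C))\<^sup>2)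
      = real (card X * card (faces (Suc s)) + Suc s * (Suc (Suc s) * card (faces (Suc (Suc s)))))"
    by (simp only: of_nat_add)
  then have "(\<Sum>C\<in>faces (Suc s). real (card (X - (\<Union>v\<in>C. private_ext C v)))) = real (card X) * real (card (faces (Suc s))) +
      real (Suc s) * real (Suc (Suc s)) * real (card (faces (Suc (Suc s)))) - (\<Sum>C\<in>faces s. (real (card (ext C)))\<^sup>2)"
    by (simp add: algebra_simps)
  then show ?thesis using sum_squares_ext[of s] by (simp add: right_diff_distrib)
qed

text \<open>The proportion of \<open>s\<close>-tuples of points that enumerate a face without
  repetition, a normalisation in which the limit values are the products
  \<open>turan_dens\<close>.\<close>

definition dens :: "nat \<Rightarrow> real" where
  "dens s = fact s * real (card (faces s)) / real (card X) ^ s"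

lemma dens_nonneg: "dens s \<ge> 0"
  by (simp add: dens_def)

lemma dens_Suc_le: "dens (Suc s) \<le> dens s"
proof (cases "card X = 0")
  case True
  then have "dens (Suc s) = 0" by (simp add: dens_def)
  then show ?thesis using dens_nonneg[of s] by simp
next
  case False
  have "Suc s * card (faces (Suc s)) \<le> (\<Sum>C\<in>faces s. card X)"
    unfolding card_faces_Suc using fin by (intro sum_mono card_mono) (auto simp: ext_def)
  then have "real (Suc s * card (faces (Suc s))) \<le> real (card (faces s) * card X)"
    unfolding of_nat_le_iff by simp
  then have "real (Suc s) * real (card (faces (Suc s))) \<le> real (card (faces s)) * real (card X)" by (simp only: of_nat_mult)
  then have "fact s * (real (Suc s) * real (card (faces (Suc s)))) \<le> fact s * (real (card (faces s)) * real (card X))"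
    by (intro mult_left_mono) auto
  then have "fact s * (real (Suc s) * real (card (faces (Suc s)))) / real (card X) ^ Suc s
      \<le> fact s * (real (card (faces s)) * real (card X)) / real (card X) ^ Suc s"
    by (rule divide_right_mono) simp
  then show ?thesis using False by (simp add: dens_def mult_ac)
qed

lemma dens_moon_moser:
  assumes "exchange (Suc s)" "card X > 0"
  shows "real (Suc s) * (dens (Suc s))\<^sup>2 \<le> dens s * (dens (Suc s) + real s * dens (Suc (Suc s)))"
proof -
  define n where "n = real (card X)"
  have n: "n > 0" using assms by (simp add: n_def)
  define a b c where "a = real (card (faces s))" and "b = real (card (faces (Suc s)))" and "c = real (card (faces (Suc (Suc s))))"
  \<comment> \<open>Points extending \<open>C\<close> are never private. Counting them as uncovered
    lowers the coefficient in front of the largest faces from \<open>real (Suc s)\<close> to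
    \<open>real s\<close>.\<close>
  have "(\<Sum>C\<in>faces (Suc s). real (card (X - (\<Union>v\<in>C. private_ext C v)))) \<ge> (\<Sum>C\<in>faces (Suc s). real (card (ext C)))"
  proof (intro sum_mono, unfold of_nat_le_iff, intro card_mono)
    fix C assume "C \<in> faces (Suc s)"
    show "finite (X - (\<Union>v\<in>C. private_ext C v))" using fin by simp
    show "ext C \<subseteq> X - (\<Union>v\<in>C. private_ext C v)" by (auto simp: ext_def private_ext_def)
  qed
  also have "(\<Sum>C\<in>faces (Suc s). real (card (ext C))) = real (Suc (Suc s)) * c"
    using card_faces_Suc[of "Suc s"] unfolding c_def by (metis of_nat_mult of_nat_sum)
  finally have "a * (real (Suc (Suc s)) * c) \<le> a * (n * b + real (Suc s) * real (Suc (Suc s)) * c) - (real (Suc s) * b)\<^sup>2"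
    using sum_uncovered[OF assms(1)] unfolding a_def b_def c_def n_def
    by (smt (verit) mult_left_mono of_nat_0_le_iff)
  then have main: "(real (Suc s) * b)\<^sup>2 \<le> a * (n * b + real s * real (Suc (Suc s)) * c)"
    by (simp add: algebra_simps)
  have d: "a = dens s * n ^ s / fact s" "b = dens (Suc s) * n ^ Suc s / fact (Suc s)" "c = dens (Suc (Suc s)) * n ^ Suc (Suc s) / fact (Suc (Suc s))"
    using n by (simp_all add: dens_def a_def b_def c_def n_def del: fact_Suc)
  have f: "real (Suc s) * b = dens (Suc s) * n ^ Suc s / fact s" "real (Suc (Suc s)) * c = dens (Suc (Suc s)) * n ^ Suc (Suc s) / fact (Suc s)"
    unfolding d by (simp_all add: divide_simps)
  have "(dens (Suc s))\<^sup>2 * (n ^ (2 * Suc s)) / (fact s)\<^sup>2 \<le> dens s * (dens (Suc s) + real s * dens (Suc (Suc s))) * n ^ (2 * Suc s) / (fact s * fact (Suc s))"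
  proof -
    have "(dens (Suc s))\<^sup>2 * (n ^ (2 * Suc s)) / (fact s)\<^sup>2 = (real (Suc s) * b)\<^sup>2"
      unfolding f by (simp add: power_divide power_mult_distrib power2_eq_square mult_ac flip: power_add mult_2)
    also have "\<dots> \<le> a * (n * b + real s * (real (Suc (Suc s)) * c))" using main by (simp add: mult.assoc)
    also have "\<dots> = dens s * (dens (Suc s) + real s * dens (Suc (Suc s))) * n ^ (2 * Suc s) / (fact s * fact (Suc s))"
      unfolding f unfolding d(1,2) by (simp add: field_simps mult_2 mult_2_right power_add del: fact_Suc)
    finally show ?thesis .
  qed
  then have "(dens (Suc s))\<^sup>2 / (fact s)\<^sup>2 * n ^ (2 * Suc s) \<le> dens s * (dens (Suc s) + real s * dens (Suc (Suc s))) / (fact s * fact (Suc s)) * n ^ (2 * Suc s)"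
    by (simp add: field_simps)
  then have "(dens (Suc s))\<^sup>2 / (fact s)\<^sup>2 \<le> dens s * (dens (Suc s) + real s * dens (Suc (Suc s))) / (fact s * fact (Suc s))"
    using n by (metis mult_le_cancel_right_pos zero_less_power)
  then have "(dens (Suc s))\<^sup>2 / (fact s)\<^sup>2 * (fact s * fact (Suc s)) \<le> dens s * (dens (Suc s) + real s * dens (Suc (Suc s)))"
    by (subst (asm) pos_le_divide_eq) (auto intro!: mult_pos_pos)
  moreover have "(dens (Suc s))\<^sup>2 / (fact s)\<^sup>2 * (fact s * fact (Suc s)) = real (Suc s) * (dens (Suc s))\<^sup>2"
    by (simp add: power2_eq_square)
  ultimately show ?thesis by simp
qed

end

section \<open>Stability of clique densities\<close>

text \<open>The limit density of \<open>s\<close>-cliques in balanced complete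
  \<open>r\<close>-partite graphs: the next vertex has to avoid the \<open>i\<close> classes already
  used.\<close>

definition turan_dens :: "nat \<Rightarrow> nat \<Rightarrow> real" where
  "turan_dens r s = (\<Prod>i<s. 1 - real i / real r)"

lemma turan_dens_Suc: "turan_dens r (Suc s) = turan_dens r s * (1 - real s / real r)"
  by (simp add: turan_dens_def)

lemma turan_dens_pos: "s \<le> r \<Longrightarrow> turan_dens r s > 0"
  unfolding turan_dens_def by (intro prod_pos) auto

lemma turan_dens_binomial:
  assumes "r > 0"
  shows "turan_dens r k = fact k * real (r choose k) / real r ^ k"
proof -
  have "turan_dens r k = (\<Prod>i<k. (real r - real i) / real r)"
    unfolding turan_dens_def using assms by (intro prod.cong) (auto simp: field_simps)
  also have "\<dots> = (\<Prod>i<k. real r - real i) / real r ^ k" by (simp add: prod_dividef)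
  also have "(\<Prod>i<k. real r - real i) = fact k * real (r choose k)"
    by (simp add: binomial_gbinomial gbinomial_prod_rev lessThan_atLeast0 flip: of_nat_prod)
  finally show ?thesis .
qed

text \<open>The ratios \<open>q s = p (s + 1) / p s\<close> satisfy \<open>s q (s - 1) \<le> 1 + (s - 1) q s\<close>, which propagates
  bounds of the form \<open>q s \<le> 1 - s / L\<close> downwards from the last nonzero term \<open>p L\<close>.\<close>

lemma moon_moser_last:
  fixes p :: "nat \<Rightarrow> real"
  assumes p: "\<And>s. 0 \<le> p s" and dec: "\<And>s. p (Suc s) \<le> p s"
    and mm: "\<And>s. a \<le> s \<Longrightarrow> s \<le> r \<Longrightarrow> real s * (p s)\<^sup>2 \<le> p (s - 1) * (p s + real (s - 1) * p (Suc s))"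
    and zero: "p (Suc r) = 0" and pos: "p b > 0" and a: "1 \<le> a"
  obtains L where "b \<le> L" "L \<le> r" "\<And>s. s \<le> L \<Longrightarrow> p s > 0"
    "\<And>s. a - 1 \<le> s \<Longrightarrow> s \<le> L \<Longrightarrow> p (Suc s) \<le> p s * (1 - real s / real L)"
proof -
  have anti: "p t \<le> p s" if "s \<le> t" for s t
    using lift_Suc_antimono_le[of p, OF dec that] .
  define L where "L = (GREATEST L. L \<le> r \<and> p L > 0)"
  have br: "b \<le> r"
  proof (rule ccontr)
    assume "\<not> b \<le> r"
    then have "p b \<le> p (Suc r)" by (intro anti) simp
    then show False using pos zero by simp
  qed
  have L: "L \<le> r \<and> p L > 0" unfolding L_def
    by (rule GreatestI_nat[where b = r and k = b]) (use br pos in auto)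
  have max: "M \<le> L" if "M \<le> r" "p M > 0" for M
    unfolding L_def by (rule Greatest_le_nat[where b = r]) (use that in auto)
  have bL: "b \<le> L" using max br pos by blast
  have posL: "p s > 0" if "s \<le> L" for s using anti[OF that] L by linarith
  have pL: "p (Suc L) = 0"
  proof (cases "L = r")
    case False
    then have "Suc L \<le> r" using L by simp
    then have "\<not> p (Suc L) > 0" using max[of "Suc L"] by auto
    then show ?thesis using p[of "Suc L"] by linarith
  qed (use zero in simp)
  have down: "p (Suc (L - d)) \<le> p (L - d) * (1 - real (L - d) / real L)" if "d \<le> L" "a - 1 \<le> L - d" for d
    using that
  proof (induction d)
    case 0
    \<comment> \<open>At \<open>s = L\<close> the factor is 0, matching
      \<open>p (Suc L) = 0\<close>. For \<open>L = 0\<close> division by zero makes the factor 1,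
      and the claim still holds.\<close>
    then show ?case using pL by (cases "L = 0") (auto simp: posL less_imp_le)
  next
    case (Suc d)
    define s where "s = L - d"
    have s: "s \<ge> 1" "L - Suc d = s - 1" "a \<le> s" "s \<le> L" using Suc.prems a by (auto simp: s_def)
    then have L0: "L > 0" by simp
    have "d \<le> L" "a - 1 \<le> L - d" using Suc.prems by linarith+
    then have IH: "p (Suc s) \<le> p s * (1 - real s / real L)" unfolding s_def by (rule Suc.IH)
    have ps: "p s > 0" "p (s - 1) > 0" using posL s by auto
    have "real s * (p s)\<^sup>2 \<le> p (s - 1) * (p s + real (s - 1) * p (Suc s))" using s L by (intro mm) auto
    also have "\<dots> \<le> p (s - 1) * (p s + real (s - 1) * (p s * (1 - real s / real L)))"
      using IH ps by (intro mult_left_mono add_left_mono) auto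
    also have "\<dots> = p (s - 1) * p s * (real s * (1 - real (s - 1) / real L))"
      using s L0 by (simp add: of_nat_diff field_simps)
    finally have "real s * p s * p s \<le> real s * p s * (p (s - 1) * (1 - real (s - 1) / real L))"
      by (simp add: power2_eq_square mult_ac)
    then have "p s \<le> p (s - 1) * (1 - real (s - 1) / real L)"
      using ps s by (simp add: mult_le_cancel_left_pos)
    then show ?case using s by simp
  qed
  have "p (Suc s) \<le> p s * (1 - real s / real L)" if "a - 1 \<le> s" "s \<le> L" for s
    using down[of "L - s"] that by simp
  with bL L posL show thesis by (intro that[of L]) auto
qed

text \<open>Turan's theorem for edge densities: as the inequality is available from
  \<open>s = 2\<close> on, the ratio bound reaches down to \<open>p 2 / p 1\<close>.\<close>

lemma moon_moser_edges:
  fixes p :: "nat \<Rightarrow> real"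
  assumes p: "\<And>s. 0 \<le> p s" and dec: "\<And>s. p (Suc s) \<le> p s" and p1: "p 1 = 1" and r: "r \<ge> 1"
    and mm: "\<And>s. 2 \<le> s \<Longrightarrow> s \<le> r \<Longrightarrow> real s * (p s)\<^sup>2 \<le> p (s - 1) * (p s + real (s - 1) * p (Suc s))"
    and zero: "p (Suc r) = 0"
  shows "p 2 \<le> 1 - 1 / real r"
proof -
  have "p 1 > 0" using p1 by simp
  then obtain L where L: "1 \<le> L" "L \<le> r"
    "\<And>s. 2 - 1 \<le> s \<Longrightarrow> s \<le> L \<Longrightarrow> p (Suc s) \<le> p s * (1 - real s / real L)"
    using moon_moser_last[of p 2 r 1, OF p dec mm zero] by (metis one_le_numeral)
  have "p 2 \<le> 1 - 1 / real L" using L(3)[of 1] L(1) p1 by (simp add: numeral_2_eq_2)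
  also have "\<dots> \<le> 1 - 1 / real r" using L by (simp add: frac_le)
  finally show ?thesis .
qed

text \<open>The inequality is available only from \<open>s = 3\<close> on, so the edge density
  enters as a hypothesis. If \<open>p k\<close> attains the bound, equality first moves down from
  \<open>k\<close> to 2; then \<open>L = r\<close>, since a smaller \<open>L\<close> would force
  smaller ratios; finally equality moves up from \<open>k\<close> to \<open>r\<close> by the
  inequality read as a lower bound for \<open>p (Suc s)\<close>.\<close>

lemma turan_dens_bound:
  fixes p :: "nat \<Rightarrow> real"
  assumes p: "\<And>s. 0 \<le> p s" and dec: "\<And>s. p (Suc s) \<le> p s"
    and p2: "p 2 \<le> 1 - 1 / real r" and k: "3 \<le> k" "k \<le> r"
    and mm: "\<And>s. 3 \<le> s \<Longrightarrow> s \<le> r \<Longrightarrow> real s * (p s)\<^sup>2 \<le> p (s - 1) * (p s + real (s - 1) * p (Suc s))"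
    and zero: "p (Suc r) = 0"
  shows "p k \<le> turan_dens r k"
    and "p k \<ge> turan_dens r k \<Longrightarrow> 2 \<le> s \<Longrightarrow> s \<le> r \<Longrightarrow> p s = turan_dens r s"
proof -
  have "p k \<le> turan_dens r k \<and> (p k \<ge> turan_dens r k \<longrightarrow> (\<forall>s. 2 \<le> s \<and> s \<le> r \<longrightarrow> p s = turan_dens r s))"
  proof (cases "p k > 0")
    case False
    then show ?thesis using turan_dens_pos[of k r] k by auto
  next
    case True
    obtain L where L: "k \<le> L" "L \<le> r" "\<And>s. s \<le> L \<Longrightarrow> p s > 0"
      "\<And>s. 3 - 1 \<le> s \<Longrightarrow> s \<le> L \<Longrightarrow> p (Suc s) \<le> p s * (1 - real s / real L)"
      using moon_moser_last[of p 3 r k, OF p dec mm zero True] by (metis one_le_numeral)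
    have L0: "L > 0" "r > 0" using L k by auto
    have step: "p (Suc s) \<le> p s * (1 - real s / real r)" if "2 \<le> s" "s \<le> L" for s
    proof -
      have "p (Suc s) \<le> p s * (1 - real s / real L)" using L(4)[of s] that by simp
      also have "\<dots> \<le> p s * (1 - real s / real r)" using L p[of s] L0 by (intro mult_left_mono diff_left_mono frac_le) auto
      finally show ?thesis .
    qed
    have ub: "p s \<le> turan_dens r s" if "2 \<le> s" "s \<le> L" for s using that
    proof (induction s rule: dec_induct)
      case base
      then show ?case using p2 by (simp add: turan_dens_def numeral_2_eq_2)
    next
      case (step s)
      have "p (Suc s) \<le> p s * (1 - real s / real r)" using \<open>\<And>s. 2 \<le> s \<Longrightarrow> s \<le> L \<Longrightarrow> p (Suc s) \<le> p s * (1 - real s / real r)\<close> step by simp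
      also have "\<dots> \<le> turan_dens r s * (1 - real s / real r)"
        using step L by (intro mult_right_mono) auto
      finally show ?case by (simp add: turan_dens_Suc)
    qed
    moreover have "p s = turan_dens r s" if eq: "p k \<ge> turan_dens r k" and s: "2 \<le> s" "s \<le> r" for s
    proof -
      have down: "p (k - d) = turan_dens r (k - d)" if "d \<le> k - 2" for d using that
      proof (induction d)
        case 0
        then show ?case using eq ub[of k] k L by simp
      next
        case (Suc d)
        define m where "m = k - Suc d"
        have m: "2 \<le> m" "m \<le> L" "Suc m = k - d" "m < r" using Suc.prems k L by (auto simp: m_def)
        have "turan_dens r m * (1 - real m / real r) \<le> p m * (1 - real m / real r)"
          using step[OF m(1,2)] Suc m by (simp add: turan_dens_Suc[symmetric])
        moreover have "1 - real m / real r > 0" using m by simp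
        ultimately have "turan_dens r m \<le> p m" by (simp add: mult_le_cancel_right_pos)
        then show ?case using ub[OF m(1,2)] by (simp add: m_def)
      qed
      have low: "p s = turan_dens r s" if "2 \<le> s" "s \<le> k" for s using down[of "k - s"] that by simp
      have "L = r"
      proof (rule ccontr)
        assume "L \<noteq> r"
        then have "L < r" using L by simp
        have pk: "p k = p (k - 1) * (1 - real (k - 1) / real r)"
          using low[of "k - 1"] low[of k] k turan_dens_Suc[of r "k - 1"] by simp
        have "p (Suc (k - 1)) \<le> p (k - 1) * (1 - real (k - 1) / real L)" using L k by (intro L(4)) auto
        then have "p (k - 1) * (1 - real (k - 1) / real r) \<le> p (k - 1) * (1 - real (k - 1) / real L)"
          using pk k by simp
        then have "real (k - 1) / real L \<le> real (k - 1) / real r"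
          using L(3)[of "k - 1"] L k by (simp add: mult_le_cancel_left_pos)
        moreover have "real (k - 1) / real r < real (k - 1) / real L"
          using \<open>L < r\<close> L0 k by (intro divide_strict_left_mono) auto
        ultimately show False by linarith
      qed
      have "p s = turan_dens r s \<and> p (Suc s) \<ge> p s * (1 - real s / real r)" if "k - 1 \<le> s" "s \<le> r" for s
        using that
      proof (induction s rule: dec_induct)
        case base
        show ?case using low[of "k - 1"] low[of k] k turan_dens_Suc[of r "k - 1"] by simp
      next
        case (step s)
        then have s: "2 \<le> s" "Suc s \<le> r" "s \<le> r" using k by auto
        have IH: "p s = turan_dens r s" "p (Suc s) \<ge> p s * (1 - real s / real r)" using step by auto
        then have eqs: "p (Suc s) = turan_dens r (Suc s)" using ub[of "Suc s"] s \<open>L = r\<close> by (simp add: turan_dens_Suc)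
        have pos: "p s > 0" "p (Suc s) > 0" using L(3) s \<open>L = r\<close> by auto
        have q: "p (Suc s) = p s * (1 - real s / real r)" using eqs IH by (simp add: turan_dens_Suc)
        have "p s * (real (Suc s) * (1 - real s / real r) * p (Suc s)) = real (Suc s) * (p (Suc s))\<^sup>2"
          by (subst (2) q) (simp add: power2_eq_square, subst q, simp)
        also have "\<dots> \<le> p s * (p (Suc s) + real s * p (Suc (Suc s)))" using mm[of "Suc s"] s by simp
        finally have "real (Suc s) * (1 - real s / real r) * p (Suc s) \<le> p (Suc s) + real s * p (Suc (Suc s))"
          using pos by (simp add: mult_le_cancel_left_pos)
        then have "real s * (p (Suc s) * (1 - real (Suc s) / real r)) \<le> real s * p (Suc (Suc s))"
          using L0 by (simp add: field_simps)
        then have "p (Suc s) * (1 - real (Suc s) / real r) \<le> p (Suc (Suc s))"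
          using s by (simp add: mult_le_cancel_left_pos)
        then show ?case using eqs by simp
      qed
      then show ?thesis using low s by (cases "s \<le> k") auto
    qed
    ultimately show ?thesis using L k by auto
  qed
  then show "p k \<le> turan_dens r k"
    and "p k \<ge> turan_dens r k \<Longrightarrow> 2 \<le> s \<Longrightarrow> s \<le> r \<Longrightarrow> p s = turan_dens r s" by auto
qed

lemma finite_convergent_subsequence:
  fixes f :: "nat \<Rightarrow> nat \<Rightarrow> real"
  assumes "\<And>m s. 0 \<le> f m s \<and> f m s \<le> 1"
  shows "\<exists>\<sigma>. strict_mono \<sigma> \<and> (\<forall>s<N. convergent (\<lambda>m. f (\<sigma> m) s))"
proof (induction N)
  case 0
  show ?case by (intro exI[of _ id]) (simp add: strict_mono_def)
next
  case (Suc N)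
  then obtain \<sigma> :: "nat \<Rightarrow> nat" where \<sigma>: "strict_mono \<sigma>" "\<forall>s<N. convergent (\<lambda>m. f (\<sigma> m) s)" by blast
  have "bounded (range (\<lambda>m. f (\<sigma> m) N))"
    using assms by (intro boundedI[of _ 1]) auto
  then obtain l \<tau> where \<tau>: "strict_mono (\<tau> :: nat \<Rightarrow> nat)" "((\<lambda>m. f (\<sigma> m) N) \<circ> \<tau>) \<longlonglongrightarrow> l"
    using bounded_imp_convergent_subsequence by blast
  have "convergent (\<lambda>m. f ((\<sigma> \<circ> \<tau>) m) s)" if "s < Suc N" for s
  proof (cases "s = N")
    case True
    then show ?thesis using \<tau>(2) by (auto simp: convergent_def o_def)
  next
    case False
    then have "convergent (\<lambda>m. f (\<sigma> m) s)" using that \<sigma> by simp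
    then show ?thesis using convergent_subseq_convergent[OF _ \<tau>(1)] by (auto simp: o_def)
  qed
  then show ?case using strict_mono_o[OF \<sigma>(1) \<tau>(1)] by blast
qed

text \<open>\<open>a\<close> is the size from which the Moon--Moser inequality is demanded: 2 for
  heavy cliques, 3 for regular ones.\<close>

definition density_profile :: "nat \<Rightarrow> nat \<Rightarrow> (nat \<Rightarrow> real) \<Rightarrow> bool" where
  "density_profile a r p \<longleftrightarrow> (\<forall>s. 0 \<le> p s \<and> p s \<le> 1 \<and> p (Suc s) \<le> p s) \<and> p 1 = 1 \<and>
     (\<forall>s. a \<le> s \<longrightarrow> s \<le> r \<longrightarrow> real s * (p s)\<^sup>2 \<le> p (s - 1) * (p s + real (s - 1) * p (Suc s)))"

text \<open>The stability version follows from the exact one by compactness.\<close>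

lemma turan_dens_stability:
  assumes k: "3 \<le> k" "k \<le> r" and \<delta>: "\<delta> > 0"
  shows "\<exists>\<epsilon>>0. \<forall>p g. density_profile 3 r p \<longrightarrow> density_profile 2 r g \<longrightarrow> p 2 \<le> g 2 \<longrightarrow>
     g (Suc r) \<le> \<epsilon> \<longrightarrow> p (Suc r) \<le> \<epsilon> \<longrightarrow> p k \<ge> turan_dens r k - \<epsilon> \<longrightarrow>
     (\<forall>s. 2 \<le> s \<longrightarrow> s \<le> r \<longrightarrow> \<bar>p s - turan_dens r s\<bar> < \<delta>)"
proof (rule ccontr)
  assume neg: "\<not> ?thesis"
  define bad where "bad \<epsilon> p g \<longleftrightarrow> density_profile 3 r p \<and> density_profile 2 r g \<and> p 2 \<le> g 2 \<and>
     g (Suc r) \<le> \<epsilon> \<and> p (Suc r) \<le> \<epsilon> \<and> p k \<ge> turan_dens r k - \<epsilon> \<and>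
     (\<exists>s. 2 \<le> s \<and> s \<le> r \<and> \<bar>p s - turan_dens r s\<bar> \<ge> \<delta>)" for \<epsilon> :: real and p g
  define e where "e m = 1 / real (Suc m)" for m
  have "\<forall>m. \<exists>p g. bad (e m) p g"
  proof
    fix m
    have "e m > 0" by (simp add: e_def)
    then have "\<not> (\<forall>p g. density_profile 3 r p \<longrightarrow> density_profile 2 r g \<longrightarrow> p 2 \<le> g 2 \<longrightarrow>
     g (Suc r) \<le> e m \<longrightarrow> p (Suc r) \<le> e m \<longrightarrow> p k \<ge> turan_dens r k - e m \<longrightarrow>
     (\<forall>s. 2 \<le> s \<longrightarrow> s \<le> r \<longrightarrow> \<bar>p s - turan_dens r s\<bar> < \<delta>))" using neg by simp
    then show "\<exists>p g. bad (e m) p g" unfolding bad_def by (simp add: not_less)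
  qed
  then obtain p0 where "\<forall>m. \<exists>g. bad (e m) (p0 m) g" using choice[of "\<lambda>m p. \<exists>g. bad (e m) p g"] by blast
  then obtain g0 where pg: "\<And>m. bad (e m) (p0 m) (g0 m)" using choice[of "\<lambda>m g. bad (e m) (p0 m) g"] by blast
  have prof: "density_profile 3 r (p0 m)" "density_profile 2 r (g0 m)" for m using pg[of m] by (auto simp: bad_def)
  then have bd: "0 \<le> p0 m s \<and> p0 m s \<le> 1" "0 \<le> g0 m s \<and> g0 m s \<le> 1" for m s by (auto simp: density_profile_def)
  obtain \<sigma> where \<sigma>: "strict_mono \<sigma>" "\<forall>s<r+2. convergent (\<lambda>m. p0 (\<sigma> m) s)"
    using finite_convergent_subsequence[of p0, OF bd(1)] by blast
  obtain \<tau> where \<tau>: "strict_mono \<tau>" "\<forall>s<r+2. convergent (\<lambda>m. g0 (\<sigma> (\<tau> m)) s)"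
    using finite_convergent_subsequence[of "\<lambda>m. g0 (\<sigma> m)", OF bd(2)] by blast
  define P where "P m = p0 (\<sigma> (\<tau> m))" for m
  define G where "G m = g0 (\<sigma> (\<tau> m))" for m
  define E where "E m = e (\<sigma> (\<tau> m))" for m
  have PG: "bad (E m) (P m) (G m)" for m using pg by (simp add: P_def G_def E_def)
  have "e \<longlonglongrightarrow> 0" unfolding e_def by (rule LIMSEQ_Suc[OF lim_1_over_n])
  then have E0: "E \<longlonglongrightarrow> 0" unfolding E_def
    using LIMSEQ_subseq_LIMSEQ[of e 0 "\<sigma> \<circ> \<tau>"] strict_mono_o[OF \<sigma>(1) \<tau>(1)] by (simp add: o_def)
  \<comment> \<open>Convergence is known only up to index \<open>r + 1\<close>; the value 0 beyond
    keeps the limit decreasing and nonnegative at all indices.\<close>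
  define lp where "lp s = (if s \<le> Suc r then lim (\<lambda>m. P m s) else 0)" for s
  define lg where "lg s = (if s \<le> Suc r then lim (\<lambda>m. G m s) else 0)" for s
  have Plim: "(\<lambda>m. P m s) \<longlonglongrightarrow> lp s" if "s \<le> Suc r" for s
  proof -
    have "convergent (\<lambda>m. p0 (\<sigma> m) s)" using \<sigma> that by simp
    then have "convergent (\<lambda>m. P m s)" unfolding P_def
      using convergent_subseq_convergent[OF _ \<tau>(1), of "\<lambda>m. p0 (\<sigma> m) s"] by (simp add: o_def)
    then show ?thesis using that by (simp add: lp_def convergent_LIMSEQ_iff)
  qed
  have Glim: "(\<lambda>m. G m s) \<longlonglongrightarrow> lg s" if "s \<le> Suc r" for s
    using \<tau>(2) that by (simp add: lg_def G_def convergent_LIMSEQ_iff)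
  have Pp: "density_profile 3 r (P m)" "density_profile 2 r (G m)" for m using prof by (simp_all add: P_def G_def)
  have nn: "0 \<le> lp s" "0 \<le> lg s" for s
  proof -
    show "0 \<le> lp s"
      using LIMSEQ_le_const[OF Plim[of s], of 0] Pp(1) by (cases "s \<le> Suc r") (auto simp: density_profile_def lp_def)
    show "0 \<le> lg s"
      using LIMSEQ_le_const[OF Glim[of s], of 0] Pp(2) by (cases "s \<le> Suc r") (auto simp: density_profile_def lg_def)
  qed
  have dec: "lp (Suc s) \<le> lp s" "lg (Suc s) \<le> lg s" for s
  proof -
    show "lp (Suc s) \<le> lp s"
      using LIMSEQ_le[OF Plim[of "Suc s"] Plim[of s]] Pp(1) nn[of s] by (cases "s \<le> r") (auto simp: density_profile_def lp_def)
    show "lg (Suc s) \<le> lg s"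
      using LIMSEQ_le[OF Glim[of "Suc s"] Glim[of s]] Pp(2) nn[of s] by (cases "s \<le> r") (auto simp: density_profile_def lg_def)
  qed
  have mmp: "real s * (lp s)\<^sup>2 \<le> lp (s - 1) * (lp s + real (s - 1) * lp (Suc s))" if "3 \<le> s" "s \<le> r" for s
  proof (rule LIMSEQ_le)
    show "(\<lambda>m. real s * (P m s)\<^sup>2) \<longlonglongrightarrow> real s * (lp s)\<^sup>2" using that by (intro tendsto_intros Plim) auto
    show "(\<lambda>m. P m (s - 1) * (P m s + real (s - 1) * P m (Suc s))) \<longlonglongrightarrow> lp (s - 1) * (lp s + real (s - 1) * lp (Suc s))"
      using that by (intro tendsto_intros Plim) auto
    show "\<exists>N. \<forall>n\<ge>N. real s * (P n s)\<^sup>2 \<le> P n (s - 1) * (P n s + real (s - 1) * P n (Suc s))"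
      using Pp(1) that by (auto simp: density_profile_def)
  qed
  have mmg: "real s * (lg s)\<^sup>2 \<le> lg (s - 1) * (lg s + real (s - 1) * lg (Suc s))" if "2 \<le> s" "s \<le> r" for s
  proof (rule LIMSEQ_le)
    show "(\<lambda>m. real s * (G m s)\<^sup>2) \<longlonglongrightarrow> real s * (lg s)\<^sup>2" using that by (intro tendsto_intros Glim) auto
    show "(\<lambda>m. G m (s - 1) * (G m s + real (s - 1) * G m (Suc s))) \<longlonglongrightarrow> lg (s - 1) * (lg s + real (s - 1) * lg (Suc s))"
      using that by (intro tendsto_intros Glim) auto
    show "\<exists>N. \<forall>n\<ge>N. real s * (G n s)\<^sup>2 \<le> G n (s - 1) * (G n s + real (s - 1) * G n (Suc s))"
      using Pp(2) that by (auto simp: density_profile_def)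
  qed
  have "lp (Suc r) \<le> 0" using LIMSEQ_le[OF Plim[of "Suc r"] E0] PG by (auto simp: bad_def)
  then have zp: "lp (Suc r) = 0" using nn(1)[of "Suc r"] by simp
  have "lg (Suc r) \<le> 0" using LIMSEQ_le[OF Glim[of "Suc r"] E0] PG by (auto simp: bad_def)
  then have zg: "lg (Suc r) = 0" using nn(2)[of "Suc r"] by simp
  have "(\<lambda>m. G m 1) \<longlonglongrightarrow> lg 1" using Glim[of 1] by simp
  moreover have "G m 1 = 1" for m using Pp(2)[of m] by (simp add: density_profile_def)
  ultimately have lg1: "lg 1 = 1" by (simp add: LIMSEQ_const_iff)
  \<comment> \<open>Here the graph controls the complex: the edge bound is proved for the heavy
    cliques, whose profile starts at 2, and passed on to \<open>lp\<close>.\<close>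
  have "lp 2 \<le> lg 2" using LIMSEQ_le[OF Plim[of 2] Glim[of 2]] PG k by (auto simp: bad_def)
  also have "\<dots> \<le> 1 - 1 / real r" using moon_moser_edges[of lg r, OF nn(2) dec(2) lg1 _ mmg zg] k by simp
  finally have lp2: "lp 2 \<le> 1 - 1 / real r" .
  have "lp k \<ge> turan_dens r k"
  proof -
    have "(\<lambda>m. turan_dens r k - E m) \<longlonglongrightarrow> turan_dens r k - 0" by (intro tendsto_intros E0)
    then show ?thesis using LIMSEQ_le[OF _ Plim[of k]] PG k by (auto simp: bad_def)
  qed
  then have eq: "lp s = turan_dens r s" if "2 \<le> s" "s \<le> r" for s
    using turan_dens_bound(2)[of lp r k, OF nn(1) dec(1) lp2 k mmp zp] that by blast
  have "eventually (\<lambda>m. \<forall>s\<in>{2..r}. \<bar>P m s - turan_dens r s\<bar> < \<delta>) sequentially"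
  proof (intro eventually_ball_finite ballI)
    fix s assume s: "s \<in> {2..r}"
    then have "(\<lambda>m. P m s) \<longlonglongrightarrow> turan_dens r s" using Plim[of s] eq by simp
    then show "eventually (\<lambda>m. \<bar>P m s - turan_dens r s\<bar> < \<delta>) sequentially"
      using tendstoD[OF _ \<delta>] by (fastforce simp: dist_real_def)
  qed simp
  then obtain m where m: "\<forall>s\<in>{2..r}. \<bar>P m s - turan_dens r s\<bar> < \<delta>" by (auto simp: eventually_sequentially)
  obtain s where "2 \<le> s" "s \<le> r" "\<bar>P m s - turan_dens r s\<bar> \<ge> \<delta>" using PG[of m] by (auto simp: bad_def)
  then show False using m by force
qed

section \<open>Regular cliques\<close>

definition apexes :: "'a::metric_space set \<Rightarrow> 'a \<Rightarrow> 'a \<Rightarrow> 'a set" where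
  "apexes X u v = {w \<in> X. dist u w = dist u v \<and> dist v w = dist u v}"

definition heavy :: "'a::metric_space set \<Rightarrow> real \<Rightarrow> 'a \<Rightarrow> 'a \<Rightarrow> bool" where
  "heavy X \<epsilon> u v \<longleftrightarrow> u \<noteq> v \<and> \<epsilon> * real (card X) \<le> real (card (apexes X u v))"

text \<open>Edge lengths may differ here, so this is the clique complex of a graph.\<close>

definition heavy_clique :: "'a::metric_space set \<Rightarrow> real \<Rightarrow> 'a set \<Rightarrow> bool" where
  "heavy_clique X \<epsilon> S \<longleftrightarrow> (\<forall>u\<in>S. \<forall>v\<in>S. u \<noteq> v \<longrightarrow> heavy X \<epsilon> u v)"

definition regular_clique :: "'a::metric_space set \<Rightarrow> real \<Rightarrow> 'a set \<Rightarrow> bool" where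
  "regular_clique X \<epsilon> S \<longleftrightarrow> (\<exists>t. \<forall>u\<in>S. \<forall>v\<in>S. u \<noteq> v \<longrightarrow> dist u v = t \<and> heavy X \<epsilon> u v)"

lemma apexes_commute: "apexes X u v = apexes X v u"
  by (auto simp: apexes_def dist_commute)

lemma heavy_commute: "heavy X \<epsilon> u v = heavy X \<epsilon> v u"
  unfolding heavy_def apexes_commute[of X u v] by auto

lemma regular_imp_heavy_clique: "regular_clique X \<epsilon> S \<Longrightarrow> heavy_clique X \<epsilon> S"
  unfolding regular_clique_def heavy_clique_def by blast

lemma hereditary_heavy: "finite X \<Longrightarrow> hereditary X (heavy_clique X \<epsilon>)"
  unfolding hereditary_def heavy_clique_def by blast

lemma hereditary_regular: "finite X \<Longrightarrow> hereditary X (regular_clique X \<epsilon>)"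
  unfolding hereditary_def regular_clique_def by (meson subsetD)

lemma heavy_insert_iff:
  "x \<notin> C \<Longrightarrow> heavy_clique X \<epsilon> (insert x C) \<longleftrightarrow> heavy_clique X \<epsilon> C \<and> (\<forall>u\<in>C. heavy X \<epsilon> x u)"
  unfolding heavy_clique_def using heavy_commute[of X \<epsilon>] by auto

lemma exchange_heavy:
  assumes "finite X"
  shows "hereditary.exchange X (heavy_clique X \<epsilon>) s"
  unfolding hereditary.exchange_def[OF hereditary_heavy[OF assms]]
proof (intro ballI impI)
  fix C v w x
  assume C: "C \<in> hereditary.faces X (heavy_clique X \<epsilon>) s" "x \<in> X - C" "v \<noteq> w"
    and h: "heavy_clique X \<epsilon> (insert x (C - {v}))" "heavy_clique X \<epsilon> (insert x (C - {w}))"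
  have "heavy_clique X \<epsilon> C" using C(1) by (simp add: hereditary.faces_def[OF hereditary_heavy[OF assms]])
  moreover have "heavy X \<epsilon> x u" if "u \<in> C" for u
  proof (cases "u = v")
    case True
    then have "u \<in> C - {w}" using that C by auto
    then show ?thesis using h(2) C by (subst (asm) heavy_insert_iff) auto
  next
    case False
    then have "u \<in> C - {v}" using that by auto
    then show ?thesis using h(1) C by (subst (asm) heavy_insert_iff) auto
  qed
  ultimately show "heavy_clique X \<epsilon> (insert x C)" using C(2) by (subst heavy_insert_iff) auto
qed

lemma regular_cliqueD:
  assumes "regular_clique X \<epsilon> S" "u \<in> S" "v \<in> S" "u \<noteq> v" "u' \<in> S" "v' \<in> S" "u' \<noteq> v'"
  shows "dist u v = dist u' v'" "heavy X \<epsilon> u v"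
  using assms unfolding regular_clique_def by (metis, metis)

text \<open>Each \<open>u\<close> in \<open>C\<close> lies, together with \<open>x\<close> and a
  further vertex \<open>a\<close> of \<open>C\<close>, in one of the two given cliques, so
  \<open>dist x u = dist a u\<close> is the side of \<open>C\<close>. For \<open>s = 2\<close> there
  is no such \<open>a\<close>, and the two given edges could have different lengths.\<close>

lemma exchange_regular:
  assumes "finite X" "s \<ge> 3"
  shows "hereditary.exchange X (regular_clique X \<epsilon>) s"
  unfolding hereditary.exchange_def[OF hereditary_regular[OF assms(1)]]
proof (intro ballI impI)
  fix C v w x
  assume C: "C \<in> hereditary.faces X (regular_clique X \<epsilon>) s" "v \<in> C" "w \<in> C" "x \<in> X - C" "v \<noteq> w"
    and h: "regular_clique X \<epsilon> (insert x (C - {v}))" "regular_clique X \<epsilon> (insert x (C - {w}))"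
  have Cr: "regular_clique X \<epsilon> C" and cC: "card C = s"
    using C(1) by (simp_all add: hereditary.faces_def[OF hereditary_regular[OF assms(1)]])
  from Cr obtain t where t0: "\<forall>u\<in>C. \<forall>v\<in>C. u \<noteq> v \<longrightarrow> dist u v = t \<and> heavy X \<epsilon> u v"
    unfolding regular_clique_def ..
  have t: "dist a b = t \<and> heavy X \<epsilon> a b" if "a \<in> C" "b \<in> C" "a \<noteq> b" for a b
    using t0 that by simp
  have two: "\<exists>a\<in>C - {y}. a \<noteq> u" for u y
  proof (rule ccontr)
    assume "\<not> ?thesis"
    then have "C \<subseteq> {y, u}" by auto
    then have "card C \<le> card {y, u}" by (intro card_mono) auto
    also have "\<dots> \<le> 2" by (simp add: card_insert_if)
    finally show False using cC assms(2) by simp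
  qed
  have "dist x u = t \<and> heavy X \<epsilon> x u" if "u \<in> C" for u
  proof -
    have "\<exists>y\<in>C. u \<in> C - {y} \<and> regular_clique X \<epsilon> (insert x (C - {y}))"
      using that C h by (cases "u = v") auto
    then obtain y where y: "y \<in> C" "u \<in> C - {y}" "regular_clique X \<epsilon> (insert x (C - {y}))" by blast
    obtain a where a: "a \<in> C - {y}" "a \<noteq> u" using two by blast
    have "dist x u = dist a u" "heavy X \<epsilon> x u"
      by (rule regular_cliqueD[OF y(3), of x u a u]; use y(2) a C(4) that in blast)+
    then show ?thesis using t[of a u] a y that by auto
  qed
  then have "dist a b = t \<and> heavy X \<epsilon> a b" if "a \<in> insert x C" "b \<in> insert x C" "a \<noteq> b" for a b
    using t[of a b] that by (auto simp: dist_commute heavy_commute)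
  then show "regular_clique X \<epsilon> (insert x C)" unfolding regular_clique_def by blast
qed

lemma card_supersets_le:
  assumes "finite X" "finite A" "card A \<le> k"
  shows "card {S. S \<subseteq> X \<and> card S = k \<and> A \<subseteq> S} \<le> card X ^ (k - card A)"
proof -
  have "card {S. S \<subseteq> X \<and> card S = k \<and> A \<subseteq> S} \<le> card {T. T \<subseteq> X \<and> card T = k - card A}"
  proof (rule card_inj_on_le[where f = "\<lambda>S. S - A"])
    show "inj_on (\<lambda>S. S - A) {S. S \<subseteq> X \<and> card S = k \<and> A \<subseteq> S}" by (rule inj_onI) blast
    show "(\<lambda>S. S - A) ` {S. S \<subseteq> X \<and> card S = k \<and> A \<subseteq> S} \<subseteq> {T. T \<subseteq> X \<and> card T = k - card A}"
      using assms by (auto simp: card_Diff_subset)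
    show "finite {T. T \<subseteq> X \<and> card T = k - card A}" using assms by simp
  qed
  also have "\<dots> = card X choose (k - card A)" using n_subsets[OF assms(1)] .
  also have "\<dots> \<le> card X ^ (k - card A)"
    using binomial_le_pow[of "k - card A" "card X"] by (cases "k - card A \<le> card X") (simp_all add: binomial_eq_0)
  finally show ?thesis .
qed

lemma finite_subset_family: "finite X \<Longrightarrow> finite {S. S \<subseteq> X \<and> Q S}"
  by (rule finite_subset[of _ "Pow X"]) auto

text \<open>A simplex with a light edge has a third vertex, an apex over this edge. There are at
  most \<open>n ^ 2\<close> such edges, each with at most \<open>\<epsilon> * n\<close> apexes, and
  \<open>n ^ (k - 3)\<close> completions of each triangle.\<close>

lemma light_simplices:
  fixes X :: "'a::metric_space set"
  assumes X: "finite X" and k: "k \<ge> 3" and \<epsilon>: "\<epsilon> \<ge> 0"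
  shows "real (card (spanned_simplices k X)) \<le> real (card (hereditary.faces X (regular_clique X \<epsilon>) k)) + \<epsilon> * real (card X) ^ k"
proof -
  define n where "n = real (card X)"
  define F where "F = hereditary.faces X (regular_clique X \<epsilon>) k"
  have F: "F = {S. S \<subseteq> X \<and> card S = k \<and> regular_clique X \<epsilon> S}"
    unfolding F_def hereditary.faces_def[OF hereditary_regular[OF X]] ..
  define T where "T = Sigma {p \<in> X \<times> X. fst p \<noteq> snd p \<and> \<not> heavy X \<epsilon> (fst p) (snd p)} (\<lambda>p. apexes X (fst p) (snd p))"
  define B where "B = (\<lambda>((u, v), w). {S. S \<subseteq> X \<and> card S = k \<and> {u, v, w} \<subseteq> S})"
  have finT: "finite T" unfolding T_def using X by (auto simp: apexes_def)
  have cT: "real (card T) \<le> n ^ 2 * (\<epsilon> * n)"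
  proof -
    have "real (card T) = (\<Sum>p\<in>{p \<in> X \<times> X. fst p \<noteq> snd p \<and> \<not> heavy X \<epsilon> (fst p) (snd p)}. real (card (apexes X (fst p) (snd p))))"
      unfolding T_def using X by (subst card_SigmaI) (auto simp: apexes_def)
    also have "\<dots> \<le> (\<Sum>p\<in>{p \<in> X \<times> X. fst p \<noteq> snd p \<and> \<not> heavy X \<epsilon> (fst p) (snd p)}. \<epsilon> * n)"
      by (intro sum_mono) (auto simp: heavy_def n_def)
    also have "\<dots> \<le> (\<Sum>p\<in>X \<times> X. \<epsilon> * n)" using X \<epsilon> by (intro sum_mono2) (auto simp: n_def)
    also have "\<dots> = n ^ 2 * (\<epsilon> * n)" by (simp add: card_cartesian_product n_def power2_eq_square)
    finally show ?thesis .
  qed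
  have "spanned_simplices k X \<subseteq> F \<union> (\<Union>q\<in>T. B q)"
  proof
    fix S assume S: "S \<in> spanned_simplices k X"
    then have "\<exists>d. \<forall>x\<in>S. \<forall>y\<in>S. x \<noteq> y \<longrightarrow> dist x y = d" and S': "S \<subseteq> X" "card S = k" "finite S"
      by (simp_all add: spanned_simplices_def regular_simplex_def)
    then obtain d where d: "\<forall>x\<in>S. \<forall>y\<in>S. x \<noteq> y \<longrightarrow> dist x y = d" by blast
    show "S \<in> F \<union> (\<Union>q\<in>T. B q)"
    proof (cases "regular_clique X \<epsilon> S")
      case True
      then show ?thesis using S' F by auto
    next
      case False
      then obtain u v where uv: "u \<in> S" "v \<in> S" "u \<noteq> v" "\<not> heavy X \<epsilon> u v"
        using d unfolding regular_clique_def by metis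
      have "card (S - {u, v}) > 0" using S' uv k by (simp add: card_Diff_subset)
      then obtain w where w: "w \<in> S" "w \<noteq> u" "w \<noteq> v" by (auto simp: card_gt_0_iff)
      have "((u, v), w) \<in> T" using uv w S' d by (auto simp: T_def apexes_def)
      moreover have "S \<in> B ((u, v), w)" using S' uv w by (auto simp: B_def)
      ultimately show ?thesis by blast
    qed
  qed
  moreover have "finite F" unfolding F using X by (rule finite_subset_family)
  moreover have finB: "finite (B q)" for q unfolding B_def using X by (auto split: prod.split intro: finite_subset_family)
  ultimately have "card (spanned_simplices k X) \<le> card (F \<union> (\<Union>q\<in>T. B q))" using finT by (intro card_mono) auto
  also have "\<dots> \<le> card F + card (\<Union>q\<in>T. B q)" by (rule card_Un_le)
  also have "\<dots> \<le> card F + (\<Sum>q\<in>T. card (B q))" by (intro add_left_mono card_UN_le finT)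
  also have "\<dots> \<le> card F + (\<Sum>q\<in>T. card X ^ (k - 3))"
  proof (intro add_left_mono sum_mono)
    fix q assume "q \<in> T"
    obtain u v w where q: "q = ((u, v), w)" by (metis surj_pair)
    have uvw: "u \<noteq> v" "dist u w = dist u v" "dist v w = dist u v" using \<open>q \<in> T\<close> q by (auto simp: T_def apexes_def)
    then have "u \<noteq> w" "v \<noteq> w" by auto
    then have "card {u, v, w} = 3" using uvw by simp
    then show "card (B q) \<le> card X ^ (k - 3)"
      using card_supersets_le[OF X, of "{u, v, w}" k] k by (simp add: q B_def)
  qed
  finally have "real (card (spanned_simplices k X)) \<le> real (card F) + real (card T) * n ^ (k - 3)"
  proof -
    assume *: "card (spanned_simplices k X) \<le> card F + (\<Sum>q\<in>T. card X ^ (k - 3))"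
    have "real (card (spanned_simplices k X)) \<le> real (card F + card T * card X ^ (k - 3))"
      unfolding of_nat_le_iff using * by simp
    then show ?thesis by (simp add: n_def)
  qed
  also have "real (card T) * n ^ (k - 3) \<le> n ^ 2 * (\<epsilon> * n) * n ^ (k - 3)"
    using cT by (intro mult_right_mono) (auto simp: n_def)
  also have "\<dots> = \<epsilon> * (n ^ 3 * n ^ (k - 3))" by (simp add: power2_eq_square power3_eq_cube)
  also have "n ^ 3 * n ^ (k - 3) = n ^ k" using k by (simp flip: power_add)
  finally show ?thesis by (simp add: F_def n_def)
qed

lemma profile_regular:
  assumes X: "finite X" "card X > 0"
  shows "density_profile 3 r (hereditary.dens X (regular_clique X \<epsilon>))"
proof -
  interpret hereditary X "regular_clique X \<epsilon>" by (rule hereditary_regular[OF X(1)])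
  have "S = {}" if "S \<subseteq> X" "card S = 0" for S using that finite_subset[OF that(1) X(1)] by simp
  then have "faces 0 = {{}}" by (auto simp: faces_def regular_clique_def)
  then have d0: "dens 0 = 1" by (simp add: dens_def)
  have "faces 1 = (\<lambda>x. {x}) ` X" by (auto simp: faces_def regular_clique_def card_1_singleton_iff)
  then have d1: "dens 1 = 1" using X by (simp add: dens_def card_image card_gt_0_iff)
  have "dens s \<le> dens 0" for s by (rule lift_Suc_antimono_le[of dens]) (auto simp: dens_Suc_le)
  moreover have "real s * (dens s)\<^sup>2 \<le> dens (s - 1) * (dens s + real (s - 1) * dens (Suc s))" if "3 \<le> s" for s
    using dens_moon_moser[of "s - 1"] exchange_regular[OF X(1) that] X that by simp
  ultimately show ?thesis unfolding density_profile_def using d0 d1 dens_nonneg dens_Suc_le by auto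
qed

lemma profile_heavy:
  assumes X: "finite X" "card X > 0"
  shows "density_profile 2 r (hereditary.dens X (heavy_clique X \<epsilon>))"
proof -
  interpret hereditary X "heavy_clique X \<epsilon>" by (rule hereditary_heavy[OF X(1)])
  have "S = {}" if "S \<subseteq> X" "card S = 0" for S using that finite_subset[OF that(1) X(1)] by simp
  then have "faces 0 = {{}}" by (auto simp: faces_def heavy_clique_def)
  then have d0: "dens 0 = 1" by (simp add: dens_def)
  have "faces 1 = (\<lambda>x. {x}) ` X" by (auto simp: faces_def heavy_clique_def card_1_singleton_iff)
  then have d1: "dens 1 = 1" using X by (simp add: dens_def card_image card_gt_0_iff)
  have "dens s \<le> dens 0" for s by (rule lift_Suc_antimono_le[of dens]) (auto simp: dens_Suc_le)
  moreover have "real s * (dens s)\<^sup>2 \<le> dens (s - 1) * (dens s + real (s - 1) * dens (Suc s))" if "2 \<le> s" for s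
    using dens_moon_moser[of "s - 1"] exchange_heavy[OF X(1), of \<epsilon> s] X that by simp
  ultimately show ?thesis unfolding density_profile_def using d0 d1 dens_nonneg dens_Suc_le by auto
qed

lemma dens_regular_le_heavy:
  assumes X: "finite X"
  shows "hereditary.dens X (regular_clique X \<epsilon>) s \<le> hereditary.dens X (heavy_clique X \<epsilon>) s"
proof -
  have "card (hereditary.faces X (regular_clique X \<epsilon>) s) \<le> card (hereditary.faces X (heavy_clique X \<epsilon>) s)"
    using hereditary.finite_faces[OF hereditary_heavy[OF X]]
    by (intro card_mono) (auto simp: hereditary.faces_def[OF hereditary_heavy[OF X]] hereditary.faces_def[OF hereditary_regular[OF X]] regular_imp_heavy_clique)
  then show ?thesis
    unfolding hereditary.dens_def[OF hereditary_heavy[OF X]] hereditary.dens_def[OF hereditary_regular[OF X]]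
    by (intro divide_right_mono mult_left_mono) auto
qed

text \<open>A positive density of heavy \<open>(r + 1)\<close>-cliques, together with apexes over their edges, would contain
  a box of side 3. The apexes make the distances constant between the parts of the box, which gives
  \<open>r + 1\<close> pairwise orthogonal planes.\<close>

lemma few_heavy_cliques:
  fixes \<delta> \<epsilon> :: real
  assumes dim: "DIM('a::euclidean_space) = 2 * r + 1" and r: "r \<ge> 1" and \<delta>: "\<delta> > 0" and \<epsilon>: "\<epsilon> > 0"
  shows "\<exists>n0. \<forall>X :: 'a set. finite X \<longrightarrow> card X \<ge> n0 \<longrightarrow> hereditary.dens X (heavy_clique X \<epsilon>) (Suc r) < \<delta>"
proof -
  \<comment> \<open>Coordinates of the relation: \<open>(i, i)\<close> carries the
    \<open>i\<close>-th clique vertex, and \<open>(i, j)\<close> with \<open>i < j\<close> an apex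
    over the edge between the \<open>i\<close>-th and the \<open>j\<close>-th vertex.\<close>
  define J where "J = {(i, j). i \<le> j \<and> j \<le> r}"
  define J' where "J' = {(i, j). i < j \<and> j \<le> r}"
  have finJ: "finite J" "finite J'" by (rule finite_subset[of _ "{..r} \<times> {..r}"]; auto simp: J_def J'_def)+
  have "J = J' \<union> (\<lambda>i. (i, i)) ` {..r}" by (auto simp: J_def J'_def)
  moreover have "J' \<inter> (\<lambda>i. (i, i)) ` {..r} = {}" by (auto simp: J'_def)
  ultimately have cJ: "card J = card J' + Suc r" using finJ by (simp add: card_Un_disjoint card_image inj_on_def)
  \<comment> \<open>Each clique contributes at least \<open>(\<epsilon> * n) ^ card J'\<close>
    tuples, one per choice of apexes; the factorial converts density into the number of
    cliques.\<close>
  define \<delta>' where "\<delta>' = \<delta> * \<epsilon> ^ card J' / fact (Suc r)"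
  have \<delta>': "\<delta>' > 0" using \<delta> \<epsilon> by (simp add: \<delta>'_def)
  from dense_relation_contains_box[OF finJ(1) \<delta>', of 3, where ?'a = 'a]
  obtain n0 where n0: "\<forall>X :: 'a set. \<forall>R. finite X \<longrightarrow> card X \<ge> n0 \<longrightarrow> R \<subseteq> (J \<rightarrow>\<^sub>E X) \<longrightarrow>
     \<delta>' * real (card X) ^ card J \<le> real (card R) \<longrightarrow>
     (\<exists>U. (\<forall>i\<in>J. U i \<subseteq> X \<and> card (U i) = 3) \<and> Pi\<^sub>E J U \<subseteq> R)" by auto
  have "hereditary.dens X (heavy_clique X \<epsilon>) (Suc r) < \<delta>" if X: "finite X" "card X \<ge> max 1 n0" for X :: "'a set"
  proof (rule ccontr)
    assume neg: "\<not> ?thesis"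
    interpret hereditary X "heavy_clique X \<epsilon>" by (rule hereditary_heavy[OF X(1)])
    define n where "n = real (card X)"
    have n: "n > 0" using X by (simp add: n_def)
    define R where "R = {f \<in> J \<rightarrow>\<^sub>E X. \<forall>(i, j)\<in>J'. f (i, i) \<noteq> f (j, j) \<and> f (i, j) \<in> apexes X (f (i, i)) (f (j, j))}"
    define e where "e S = (SOME h. bij_betw h {..r} S)" for S :: "'a set"
    have e: "bij_betw (e S) {..r} S" if "S \<in> faces (Suc r)" for S
    proof -
      have "card {..r} = card S" "finite S" using that faces_finite[OF that] by (auto simp: faces_def)
      then have "\<exists>h. bij_betw h {..r} S" by (intro finite_same_card_bij) auto
      then show ?thesis unfolding e_def by (rule someI_ex)
    qed
    define A where "A S = Pi\<^sub>E J' (\<lambda>(i, j). apexes X (e S i) (e S j))" for S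
    have heavyS: "heavy X \<epsilon> (e S i) (e S j)" if "S \<in> faces (Suc r)" "(i, j) \<in> J'" for S i j
    proof -
      have "e S i \<in> S" "e S j \<in> S" "e S i \<noteq> e S j"
        using e[OF that(1)] that(2) by (auto simp: bij_betw_def J'_def inj_on_def)
      then show ?thesis using that(1) by (auto simp: faces_def heavy_clique_def)
    qed
    have finA: "finite (A S)" for S unfolding A_def using X finJ by (intro finite_PiE) (auto simp: apexes_def split: prod.split)
    have cA: "(\<epsilon> * n) ^ card J' \<le> real (card (A S))" if "S \<in> faces (Suc r)" for S
    proof -
      have "(\<epsilon> * n) ^ card J' = (\<Prod>p\<in>J'. \<epsilon> * n)" by simp
      also have "\<dots> \<le> (\<Prod>(i, j)\<in>J'. real (card (apexes X (e S i) (e S j))))"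
        using heavyS[OF that] \<epsilon> n by (intro prod_mono) (auto simp: heavy_def n_def)
      also have "\<dots> = real (card (A S))" unfolding A_def using finJ
        by (simp add: card_PiE split_beta)
      finally show ?thesis .
    qed
    have finR: "finite R" by (rule finite_subset[of _ "J \<rightarrow>\<^sub>E X"]) (auto simp: R_def finJ X intro: finite_PiE)
    have "card (Sigma (faces (Suc r)) A) \<le> card R"
    proof (rule card_inj_on_le[where f = "\<lambda>(S, g) p. if p \<in> J' then g p else if p \<in> J then e S (fst p) else undefined"])
      let ?f = "\<lambda>(S, g) p. if p \<in> J' then g p else if p \<in> J then e S (fst p) else undefined"
      have diag: "?f (S, g) (i, i) = e S i" if "i \<le> r" for S g i using that by (simp add: J_def J'_def)
      show "inj_on ?f (Sigma (faces (Suc r)) A)"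
      proof (rule inj_onI)
        fix a b assume ab: "a \<in> Sigma (faces (Suc r)) A" "b \<in> Sigma (faces (Suc r)) A" "?f a = ?f b"
        obtain S g S' g' where a: "a = (S, g)" and b: "b = (S', g')" by (metis surj_pair)
        have "e S i = e S' i" if "i \<le> r" for i
          using fun_cong[OF ab(3), of "(i, i)"] diag[OF that, of S g] diag[OF that, of S' g'] a b by simp
        then have "e S ` {..r} = e S' ` {..r}" by (intro image_cong) auto
        then have "S = S'" using e[of S] e[of S'] ab a b by (simp add: bij_betw_def)
        moreover have "g = g'"
        proof (rule PiE_ext)
          show "g \<in> Pi\<^sub>E J' (\<lambda>(i, j). apexes X (e S i) (e S j))" "g' \<in> Pi\<^sub>E J' (\<lambda>(i, j). apexes X (e S i) (e S j))"
            using ab a b \<open>S = S'\<close> by (auto simp: A_def)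
          show "g p = g' p" if "p \<in> J'" for p using fun_cong[OF ab(3), of p] that a b by simp
        qed
        ultimately show "a = b" using a b by simp
      qed
      show "?f ` Sigma (faces (Suc r)) A \<subseteq> R"
      proof (rule image_subsetI)
        fix a assume a': "a \<in> Sigma (faces (Suc r)) A"
        obtain S g where a: "a = (S, g)" by (cases a)
        have S: "S \<in> faces (Suc r)" "g \<in> A S" using a' a by auto
        have SX: "S \<subseteq> X" using S by (simp add: faces_def)
        have eX: "e S i \<in> X" if "i \<le> r" for i using e[OF S(1)] that SX by (auto simp: bij_betw_def)
        have gp: "g (i, j) \<in> apexes X (e S i) (e S j)" if "(i, j) \<in> J'" for i j
          using S(2) that by (auto simp: A_def PiE_def Pi_def)
        have "?f (S, g) \<in> J \<rightarrow>\<^sub>E X"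
        proof (rule PiE_I)
          fix p assume p: "p \<in> J"
          show "?f (S, g) p \<in> X"
          proof (cases "p \<in> J'")
            case True
            then show ?thesis using gp[of "fst p" "snd p"] by (auto simp: apexes_def)
          next
            case False
            then show ?thesis using p eX[of "fst p"] by (auto simp: J_def)
          qed
        next
          fix p assume "p \<notin> J"
          then show "?f (S, g) p = undefined" by (auto simp: J_def J'_def)
        qed
        moreover have "?f (S, g) (i, i) \<noteq> ?f (S, g) (j, j) \<and> ?f (S, g) (i, j) \<in> apexes X (?f (S, g) (i, i)) (?f (S, g) (j, j))"
          if ij: "(i, j) \<in> J'" for i j
        proof -
          have "i \<le> r" "j \<le> r" using ij by (auto simp: J'_def)
          moreover have "e S i \<noteq> e S j" using heavyS[OF S(1) ij] by (simp add: heavy_def)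
          ultimately show ?thesis using diag[of i S g] diag[of j S g] gp[OF ij] ij by simp
        qed
        ultimately show "?f a \<in> R" unfolding R_def a by blast
      qed
    qed (fact finR)
    moreover have "real (card (Sigma (faces (Suc r)) A)) \<ge> real (card (faces (Suc r))) * (\<epsilon> * n) ^ card J'"
    proof -
      have "real (card (faces (Suc r))) * (\<epsilon> * n) ^ card J' = (\<Sum>S\<in>faces (Suc r). (\<epsilon> * n) ^ card J')" by simp
      also have "\<dots> \<le> (\<Sum>S\<in>faces (Suc r). real (card (A S)))" using cA by (intro sum_mono)
      also have "\<dots> = real (card (Sigma (faces (Suc r)) A))" using finA by (simp add: card_SigmaI)
      finally show ?thesis .
    qed
    ultimately have R1: "real (card (faces (Suc r))) * (\<epsilon> * n) ^ card J' \<le> real (card R)" by linarith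
    have "\<delta> \<le> fact (Suc r) * real (card (faces (Suc r))) / n ^ Suc r"
      using neg by (simp add: dens_def n_def not_less del: fact_Suc)
    then have "\<delta> * n ^ Suc r / fact (Suc r) \<le> real (card (faces (Suc r)))"
      using n by (simp add: field_simps del: fact_Suc)
    then have "\<delta> * n ^ Suc r / fact (Suc r) * (\<epsilon> * n) ^ card J' \<le> real (card (faces (Suc r))) * (\<epsilon> * n) ^ card J'"
      using \<epsilon> n by (intro mult_right_mono) auto
    moreover have "\<delta> * n ^ Suc r / fact (Suc r) * (\<epsilon> * n) ^ card J' = \<delta>' * n ^ card J"
      by (simp add: \<delta>'_def cJ power_mult_distrib power_add del: fact_Suc)
    ultimately have "\<delta>' * real (card X) ^ card J \<le> real (card R)" using R1 by (simp add: n_def)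
    moreover have "card X \<ge> n0" using X by simp
    moreover have "R \<subseteq> (J \<rightarrow>\<^sub>E X)" by (auto simp: R_def)
    ultimately have "\<exists>U. (\<forall>i\<in>J. U i \<subseteq> X \<and> card (U i) = 3) \<and> Pi\<^sub>E J U \<subseteq> R"
      by (intro n0[rule_format, OF X(1)])
    then obtain U where U: "\<forall>i\<in>J. U i \<subseteq> X \<and> card (U i) = 3" "Pi\<^sub>E J U \<subseteq> R" by (elim exE conjE)
    have ne: "\<exists>x. x \<in> U p" if "p \<in> J" for p using U(1) that by (metis card.empty ex_in_conv zero_neq_numeral)
    define w where "w p = (SOME x. x \<in> U p)" for p
    have w: "w p \<in> U p" if "p \<in> J" for p using someI_ex[OF ne[OF that]] by (simp add: w_def)
    define V where "V i = U (i, i)" for i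
    have key: "dist x z = dist x y \<and> dist y z = dist x y \<and> x \<noteq> y"
      if ij: "(i, j) \<in> J'" and x: "x \<in> V i" and y: "y \<in> V j" and z: "z \<in> U (i, j)" for i j x y z
    proof -
      define f where "f = (\<lambda>p. if p = (i, i) then x else if p = (j, j) then y else if p = (i, j) then z else if p \<in> J then w p else undefined)"
      have ij': "i \<noteq> j" "(i, i) \<in> J" "(j, j) \<in> J" "(i, j) \<in> J" using ij by (auto simp: J_def J'_def)
      have "f \<in> Pi\<^sub>E J U"
      proof (rule PiE_I)
        fix p assume "p \<in> J"
        then show "f p \<in> U p" using x y z w by (auto simp: f_def V_def)
      next
        fix p assume "p \<notin> J"
        then show "f p = undefined" using ij' by (auto simp: f_def)
      qed
      then have "f (i, i) \<noteq> f (j, j) \<and> f (i, j) \<in> apexes X (f (i, i)) (f (j, j))" using U(2) ij unfolding R_def by blast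
      then show ?thesis using ij' by (simp add: f_def apexes_def)
    qed
    have eqd: "equidistant_sets (V i) (V j)" if ij: "(i, j) \<in> J'" for i j
    proof -
      have m: "(i, i) \<in> J" "(j, j) \<in> J" "(i, j) \<in> J" using ij by (auto simp: J_def J'_def)
      have x0: "w (i, i) \<in> V i" using w m by (simp add: V_def)
      show ?thesis unfolding equidistant_sets_def
      proof (intro exI ballI)
        fix x y assume xy: "x \<in> V i" "y \<in> V j"
        \<comment> \<open>Both \<open>dist x y\<close> and \<open>dist (w (i, i)) y\<close> equal
          the distance of \<open>y\<close> from the fixed apex \<open>w (i, j)\<close>, and the
          latter is independent of \<open>y\<close>.\<close>
        show "dist x y = dist (w (i, i)) (w (i, j))"
          using key[OF ij xy w[OF m(3)]] key[OF ij x0 xy(2) w[OF m(3)]] by simp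
      qed
    qed
    have eqd': "equidistant_sets (V i) (V j)" if "i \<le> r" "j \<le> r" "i \<noteq> j" for i j
      using eqd[of i j] equidistant_sets_sym[OF eqd[of j i]] that by (cases "i < j") (auto simp: J'_def)
    have adV: "aff_dim (V i) \<ge> 2" if i: "i \<le> r" for i
    proof -
      have iJ: "(i, i) \<in> J" using i by (simp add: J_def)
      then have "card (V i) = 3" using U(1) by (simp add: V_def)
      then obtain x y z where xyz: "V i = {x, y, z}" "x \<noteq> y" "y \<noteq> z" "x \<noteq> z" by (auto simp: card_3_iff)
      define j where "j = (if i = 0 then 1 else 0 :: nat)"
      have j: "j \<le> r" "i \<noteq> j" using r by (auto simp: j_def)
      then have "w (j, j) \<in> V j" using w by (simp add: V_def J_def)
      then obtain d where "\<forall>a\<in>V i. dist a (w (j, j)) = d"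
        using eqd'[OF i j] unfolding equidistant_sets_def by blast
      then show ?thesis unfolding xyz(1) using xyz by (intro aff_dim_three_on_sphere[of _ "w (j, j)" d]) auto
    qed
    have "(\<Sum>i\<in>{..r}. aff_dim (V i)) \<le> aff_dim (\<Union>i\<in>{..r}. V i)"
    proof (rule aff_dim_equidistant_family)
      show "V i \<noteq> {}" if "i \<in> {..r}" for i using adV[of i] that by auto
    qed (use eqd' in auto)
    \<comment> \<open>The \<open>r + 1\<close> orthogonal planes would need \<open>2 * r + 2\<close>
      dimensions.\<close>
    also have "\<dots> \<le> 2 * int r + 1" using aff_dim_le_DIM[of "\<Union>i\<in>{..r}. V i"] dim by simp
    finally have "(\<Sum>i\<in>{..r}. 2 :: int) \<le> 2 * int r + 1"
      using sum_mono[of "{..r}" "\<lambda>_. 2 :: int" "\<lambda>i. aff_dim (V i)"] adV by (meson atMost_iff order_trans)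
    then show False by simp
  qed
  then show ?thesis by blast
qed

lemma regular_densities:
  fixes \<delta> :: real
  assumes dim: "DIM('a::euclidean_space) = 2 * r + 1" and k: "3 \<le> k" "k \<le> r" and \<delta>: "\<delta> > 0"
  shows "\<exists>\<epsilon> \<epsilon>1 n0. \<epsilon> > 0 \<and> \<epsilon>1 > 0 \<and> (\<forall>X :: 'a set. finite X \<longrightarrow> card X \<ge> n0 \<longrightarrow>
     turan_dens r k - \<epsilon>1 \<le> fact k * real (card (spanned_simplices k X)) / real (card X) ^ k \<longrightarrow>
     (\<forall>s. 2 \<le> s \<longrightarrow> s \<le> r \<longrightarrow> \<bar>hereditary.dens X (regular_clique X \<epsilon>) s - turan_dens r s\<bar> < \<delta>) \<and>
     hereditary.dens X (regular_clique X \<epsilon>) (Suc r) < \<delta>)"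
proof -
  obtain \<epsilon>0 where \<epsilon>0: "\<epsilon>0 > 0" and stab: "\<forall>p g. density_profile 3 r p \<longrightarrow> density_profile 2 r g \<longrightarrow> p 2 \<le> g 2 \<longrightarrow>
     g (Suc r) \<le> \<epsilon>0 \<longrightarrow> p (Suc r) \<le> \<epsilon>0 \<longrightarrow> p k \<ge> turan_dens r k - \<epsilon>0 \<longrightarrow>
     (\<forall>s. 2 \<le> s \<longrightarrow> s \<le> r \<longrightarrow> \<bar>p s - turan_dens r s\<bar> < \<delta>)"
    using turan_dens_stability[OF k \<delta>] by auto
  \<comment> \<open>Half of the slack \<open>\<epsilon>0\<close> pays for the simplices with a light
    edge, the other half is the permitted deficit of the simplex density.\<close>
  define \<epsilon> where "\<epsilon> = \<epsilon>0 / (2 * fact k)"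
  have \<epsilon>: "\<epsilon> > 0" using \<epsilon>0 by (simp add: \<epsilon>_def)
  have "min \<epsilon>0 \<delta> > 0" using \<epsilon>0 \<delta> by simp
  from few_heavy_cliques[OF dim _ this \<epsilon>] k obtain n0 where n0: "\<forall>X :: 'a set. finite X \<longrightarrow> card X \<ge> n0 \<longrightarrow>
     hereditary.dens X (heavy_clique X \<epsilon>) (Suc r) < min \<epsilon>0 \<delta>" by auto
  have "(\<forall>s. 2 \<le> s \<longrightarrow> s \<le> r \<longrightarrow> \<bar>hereditary.dens X (regular_clique X \<epsilon>) s - turan_dens r s\<bar> < \<delta>) \<and>
     hereditary.dens X (regular_clique X \<epsilon>) (Suc r) < \<delta>"
    if X: "finite X" "card X \<ge> max 1 n0"
      and H: "turan_dens r k - \<epsilon>0 / 2 \<le> fact k * real (card (spanned_simplices k X)) / real (card X) ^ k" for X :: "'a set"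
  proof -
    have n: "card X > 0" using X by simp
    define p where "p = hereditary.dens X (regular_clique X \<epsilon>)"
    define g where "g = hereditary.dens X (heavy_clique X \<epsilon>)"
    have pg: "density_profile 3 r p" "density_profile 2 r g" "p s \<le> g s" for s
      unfolding p_def g_def using profile_regular[OF X(1) n] profile_heavy[OF X(1) n] dens_regular_le_heavy[OF X(1)] by auto
    have g: "g (Suc r) < min \<epsilon>0 \<delta>" using n0 X by (simp add: g_def)
    then have p: "p (Suc r) < min \<epsilon>0 \<delta>" using pg(3)[of "Suc r"] by linarith
    have "turan_dens r k - \<epsilon>0 \<le> p k"
    proof -
      have "fact k * real (card (spanned_simplices k X)) / real (card X) ^ k
        \<le> fact k * (real (card (hereditary.faces X (regular_clique X \<epsilon>) k)) + \<epsilon> * real (card X) ^ k) / real (card X) ^ k"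
        using light_simplices[OF X(1) k(1), of \<epsilon>] \<epsilon> by (intro divide_right_mono mult_left_mono) auto
      also have "\<dots> = p k + fact k * \<epsilon>"
        using n by (simp add: p_def hereditary.dens_def[OF hereditary_regular[OF X(1)]] field_simps)
      also have "fact k * \<epsilon> = \<epsilon>0 / 2" by (simp add: \<epsilon>_def)
      finally show ?thesis using H by linarith
    qed
    then have "\<forall>s. 2 \<le> s \<longrightarrow> s \<le> r \<longrightarrow> \<bar>p s - turan_dens r s\<bar> < \<delta>"
      using stab[rule_format, OF pg(1) pg(2) pg(3)] g p by simp
    then show ?thesis using p by (simp add: p_def)
  qed
  then show ?thesis using \<epsilon> \<epsilon>0 by (intro exI[of _ \<epsilon>] exI[of _ "\<epsilon>0 / 2"] exI[of _ "max 1 n0"]) simp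
qed

text \<open>The sets \<open>private_ext C v\<close> for \<open>v\<close> in a typical regular \<open>r\<close>-clique \<open>C\<close> are the approximate parts.\<close>

definition side :: "'a::metric_space set \<Rightarrow> real" where
  "side C = (SOME t. \<forall>u\<in>C. \<forall>v\<in>C. u \<noteq> v \<longrightarrow> dist u v = t)"

definition bad_pairs :: "real \<Rightarrow> 'i set \<Rightarrow> ('i \<Rightarrow> 'a::metric_space set) \<Rightarrow> ('a \<times> 'a) set" where
  "bad_pairs t I Y = {(x, y). \<exists>v\<in>I. \<exists>w\<in>I. v \<noteq> w \<and> x \<in> Y v \<and> y \<in> Y w \<and> dist x y \<noteq> t}"

lemma side_eq:
  assumes "regular_clique X \<epsilon> C" "u \<in> C" "v \<in> C" "u \<noteq> v"
  shows "dist u v = side C"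
proof -
  have "\<exists>t. \<forall>u\<in>C. \<forall>v\<in>C. u \<noteq> v \<longrightarrow> dist u v = t" using assms(1) unfolding regular_clique_def by auto
  from someI_ex[OF this] show ?thesis using assms unfolding side_def by blast
qed

text \<open>The clique obtained from \<open>C\<close> by replacing \<open>v\<close> by
  \<open>x\<close> detects the pair. If \<open>y\<close> were private to it at \<open>u\<close>,
  then either \<open>u = w\<close> and a third vertex \<open>z\<close> fixes
  \<open>dist x y\<close>, or \<open>y\<close> would extend \<open>C\<close>, which a private point
  does not. So bad pairs are paid for by uncovered points of neighbouring cliques.\<close>

lemma bad_pair_uncovered:
  fixes X :: "'a::metric_space set" and \<epsilon> :: real
  defines "priv \<equiv> hereditary.private_ext X (regular_clique X \<epsilon>)"
  assumes X: "finite X" and r: "3 \<le> r" and C: "C \<in> hereditary.faces X (regular_clique X \<epsilon>) r"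
    and v: "v \<in> C" and w: "w \<in> C" and vw: "v \<noteq> w" and x: "x \<in> priv C v" and y: "y \<in> priv C w"
    and bad: "dist x y \<noteq> side C"
  shows "y \<in> X - (\<Union>u\<in>insert x (C - {v}). priv (insert x (C - {v})) u)"
proof -
  interpret hereditary X "regular_clique X \<epsilon>" by (rule hereditary_regular[OF X])
  have Cr: "regular_clique X \<epsilon> C" "C \<subseteq> X" "card C = r" using C by (auto simp: faces_def)
  have exch: "exchange r" using exchange_regular[OF X r] .
  have xe: "x \<in> X" "x \<notin> C - {v}" "regular_clique X \<epsilon> (insert x (C - {v}))" "x \<notin> ext C"
    using x unfolding priv_def private_ext_def by (auto simp: ext_def)
  have ye: "y \<in> X" "y \<notin> C - {w}" "regular_clique X \<epsilon> (insert y (C - {w}))" "y \<notin> ext C"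
    using y unfolding priv_def private_ext_def by (auto simp: ext_def)
  define D where "D = insert x (C - {v})"
  have no: "False" if u: "u \<in> D" "y \<in> priv D u" for u
  proof -
    have yD: "y \<notin> D - {u}" "regular_clique X \<epsilon> (insert y (D - {u}))"
      using u unfolding priv_def private_ext_def by (auto simp: ext_def)
    have "card (C - {v, w}) > 0" using v w vw Cr r by (simp add: card_Diff_subset)
    then obtain z where z: "z \<in> C" "z \<noteq> v" "z \<noteq> w" by (auto simp: card_gt_0_iff)
    have yz: "y \<noteq> z" "dist y z = side C"
    proof -
      show "y \<noteq> z" using ye z by auto
      have "card (C - {z, w}) > 0" using v w vw Cr r z by (simp add: card_Diff_subset)
      then obtain z' where z': "z' \<in> C" "z' \<noteq> z" "z' \<noteq> w" by (auto simp: card_gt_0_iff)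
      have "dist y z = dist z' z" using regular_cliqueD(1)[OF ye(3), of y z z' z] z z' \<open>y \<noteq> z\<close> by auto
      then show "dist y z = side C" using side_eq[OF Cr(1) z'(1) z(1) z'(2)] by simp
    qed
    have xz: "x \<noteq> z" "x \<noteq> w" using xe z w vw by auto
    show False
    proof (cases "u = w")
      case True
      then have "x \<in> D - {u}" "z \<in> D - {u}" using xz z by (auto simp: D_def)
      then have "x \<noteq> y" "dist y x = dist y z" using regular_cliqueD(1)[OF yD(2), of y x y z] yD(1) yz by auto
      then show False using bad yz by (simp add: dist_commute)
    next
      case False
      have yC: "y \<in> ext C"
      proof (cases "u = x")
        case True
        then have "D - {u} = C - {v}" using xe(2) by (auto simp: D_def)
        then have y1: "y \<notin> C - {v}" "regular_clique X \<epsilon> (insert y (C - {v}))" using yD by auto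
        then have "y \<notin> C" using ye(2) vw by auto
        then have "regular_clique X \<epsilon> (insert y C)"
          using exch C v w vw y1 ye unfolding exchange_def by blast
        then show ?thesis using ye \<open>y \<notin> C\<close> by (auto simp: ext_def)
      next
        case False
        then have uC: "u \<in> C" "u \<noteq> v" using u by (auto simp: D_def)
        \<comment> \<open>Now \<open>w\<close> and \<open>x\<close> are both still present and give
          \<open>y\<close> the right distance to \<open>w\<close>; its distances to the rest of
          \<open>C\<close> are right because \<open>y\<close> can replace \<open>w\<close>.\<close>
        have wD: "w \<in> D - {u}" "x \<in> D - {u}" using \<open>u \<noteq> w\<close> False w vw by (auto simp: D_def)
        then have "y \<noteq> w" using yD by auto
        then have yC: "y \<notin> C" using ye by auto
        have yw: "dist y w = dist x w" "heavy X \<epsilon> y w"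
          using regular_cliqueD[OF yD(2), of y w x w] wD \<open>y \<noteq> w\<close> xz by auto
        have "dist x w = dist z w" using regular_cliqueD(1)[OF xe(3), of x w z w] w vw z xz by auto
        then have yw': "dist y w = side C" using yw(1) side_eq[OF Cr(1) z(1) w z(3)] by simp
        have yc: "dist y c = side C \<and> heavy X \<epsilon> y c" if "c \<in> C" for c
        proof (cases "c = w")
          case True
          then show ?thesis using yw yw' by simp
        next
          case False
          have "y \<noteq> c" using that yC by auto
          then have "dist y c = dist y z" "heavy X \<epsilon> y c"
            using regular_cliqueD[OF ye(3), of y c y z] False that z yz by auto
          then show ?thesis using yz by simp
        qed
        have "dist a b = side C \<and> heavy X \<epsilon> a b" if "a \<in> insert y C" "b \<in> insert y C" "a \<noteq> b" for a b
        proof (cases "a = y \<or> b = y")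
          case True
          then show ?thesis using that yc[of a] yc[of b] by (auto simp: dist_commute heavy_commute)
        next
          case False
          then show ?thesis using that side_eq[OF Cr(1), of a b] regular_cliqueD(2)[OF Cr(1), of a b a b] by auto
        qed
        then have "regular_clique X \<epsilon> (insert y C)" unfolding regular_clique_def by auto
        then show ?thesis using ye yC by (auto simp: ext_def)
      qed
      then show False using ye(4) by simp
    qed
  qed
  then show ?thesis using ye(1) unfolding D_def by auto
qed

lemma divide_fact_le: "0 \<le> y \<Longrightarrow> y / fact m \<le> (y :: real)"
  using fact_ge_1[of m, where ?'a = real] mult_left_mono[of 1 "fact m" y] by (simp add: divide_le_eq)

text \<open>Averaging over all \<open>r\<close>-cliques: with nearly extremal densities, the total
  numbers of uncovered points, bad pairs and extensions are small, while a positive proportion of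
  the cliques has only facets with many extensions.\<close>

lemma typical_regular_clique:
  fixes X :: "'a::metric_space set" and \<delta> \<eta> :: real
  defines "\<theta> \<equiv> \<lambda>r. turan_dens r r / (16 * fact r)"
  assumes X: "finite X" "card X > 0" and r: "3 \<le> r" and \<eta>: "\<eta> > 0"
    and dens: "\<And>s. 2 \<le> s \<Longrightarrow> s \<le> r \<Longrightarrow> \<bar>hereditary.dens X (regular_clique X \<epsilon>) s - turan_dens r s\<bar> < \<delta>"
      "hereditary.dens X (regular_clique X \<epsilon>) (Suc r) < \<delta>"
    and \<delta>: "\<delta> \<le> turan_dens r r / 2" "\<delta> * ((real r + 1) * (2 * real r + 1) + 1) \<le> 2 * \<theta> r * min \<eta> (\<theta> r)"
  shows "\<exists>C\<in>hereditary.faces X (regular_clique X \<epsilon>) r.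
     (let Y = hereditary.private_ext X (regular_clique X \<epsilon>) C in
     real (card (X - (\<Union>v\<in>C. Y v))) \<le> \<eta> * real (card X) \<and>
     real (card (bad_pairs (side C) C Y)) \<le> \<eta> * real (card X) ^ 2 \<and>
     (\<forall>v\<in>C. \<theta> r * real (card X) \<le> real (card (Y v))))"
proof -
  interpret hereditary X "regular_clique X \<epsilon>" by (rule hereditary_regular[OF X(1)])
  define n where "n = real (card X)"
  have n: "n > 0" using X by (simp add: n_def)
  define \<tau> where "\<tau> = turan_dens r r"
  have \<tau>: "\<tau> > 0" using turan_dens_pos[of r r] by (simp add: \<tau>_def)
  have \<theta>: "\<theta> r = \<tau> / (16 * fact r)" "\<theta> r > 0" using \<tau> by (simp_all add: \<theta>_def \<tau>_def)
  have exch: "exchange r" using exchange_regular[OF X(1) r] .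
  obtain q where q: "r = Suc q" using r by (cases r) auto
  define W where "W C = real (card (X - (\<Union>v\<in>C. private_ext C v)))" for C
  define N where "N s = real (card (faces s))" for s
  have Ndens: "N s = dens s * n ^ s / fact s" for s using n by (simp add: N_def dens_def n_def)
  have dens_le1: "dens s \<le> 1" for s
    using profile_regular[OF X] by (simp add: density_profile_def)
  \<comment> \<open>The last Turan ratio is \<open>1 - (r - 1) / r = 1 / r\<close>, so the density
    one size below is close to \<open>r * \<tau>\<close>.\<close>
  have dq: "\<bar>dens q - real r * \<tau>\<bar> < \<delta>"
  proof -
    have "\<tau> = turan_dens r q / real r" unfolding \<tau>_def
      using turan_dens_Suc[of r q] q r by (simp add: field_simps)
    then have "turan_dens r q = real r * \<tau>" using r by simp
    then show ?thesis using dens(1)[of q] q r by simp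
  qed
  have dr: "\<bar>dens r - \<tau>\<bar> < \<delta>" using dens(1)[of r] r by (simp add: \<tau>_def)
  have \<delta>0: "\<delta> > 0" using dr by linarith
  have dr2: "dens r \<ge> \<tau> / 2" using dr \<delta>(1) unfolding \<tau>_def[symmetric] by linarith
  have dq0: "dens q > 0" using dens_Suc_le[of q] dr2 \<tau> q by simp
  then have Nq: "N q > 0" using n by (simp add: Ndens)
  have SN: "real (Suc r) * N (Suc r) = dens (Suc r) * n ^ Suc r / fact r"
    unfolding Ndens by (simp add: divide_simps)
  \<comment> \<open>With \<open>dens r\<close> near \<open>\<tau>\<close>, \<open>dens q\<close>
    near \<open>r * \<tau>\<close> and \<open>dens (Suc r)\<close> near 0, the inequality at
    \<open>r\<close> is nearly an equality, and its slack bounds the uncovered points.\<close>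
  have sumW: "(\<Sum>C\<in>faces r. W C) \<le> (2 * real r + 1) * \<delta> * n ^ Suc r / fact r"
  proof -
    have "N q * (\<Sum>C\<in>faces r. W C) \<le> N q * (n * N r + real r * real (Suc r) * N (Suc r)) - (real r * N r)\<^sup>2"
      using sum_uncovered[of q] exch unfolding q W_def N_def n_def by simp
    then have "(\<Sum>C\<in>faces r. W C) \<le> n * N r + real r * real (Suc r) * N (Suc r) - (real r * N r)\<^sup>2 / N q"
      using Nq by (simp add: field_simps)
    also have "\<dots> = n ^ Suc r / fact r * (dens r + real r * dens (Suc r) - real r * (dens r)\<^sup>2 / dens q)"
    proof -
      have "(real r * N r)\<^sup>2 / N q = n ^ Suc r / fact r * (real r * (dens r)\<^sup>2 / dens q)"
      proof -
        have a: "real r * N r = dens r * n ^ Suc q / fact q" unfolding Ndens q by (simp add: divide_simps)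
        have b: "n ^ Suc r / fact r * real r = n ^ Suc r / fact q" unfolding q by (simp add: divide_simps)
        have "(real r * N r)\<^sup>2 / N q = n ^ Suc r / fact q * ((dens r)\<^sup>2 / dens q)"
          unfolding a Ndens using n dq0 by (simp add: q power2_eq_square divide_simps)
        also have "\<dots> = n ^ Suc r / fact r * real r * ((dens r)\<^sup>2 / dens q)" unfolding b ..
        finally show ?thesis by (simp add: mult.assoc)
      qed
      moreover have "real r * real (Suc r) * N (Suc r) = n ^ Suc r / fact r * (real r * dens (Suc r))"
        using SN by (simp add: mult_ac)
      moreover have "n * N r = n ^ Suc r / fact r * dens r" by (simp add: Ndens)
      ultimately show ?thesis by (simp add: algebra_simps)
    qed
    also have "\<dots> \<le> n ^ Suc r / fact r * ((2 * real r + 1) * \<delta>)"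
    proof (intro mult_left_mono)
      have "dens r - real r * (dens r)\<^sup>2 / dens q = dens r / dens q * (dens q - real r * dens r)"
        using dq0 by (simp add: power2_eq_square field_simps)
      also have "\<dots> \<le> dens r / dens q * ((real r + 1) * \<delta>)"
      proof (rule mult_left_mono)
        have "real r * dens r \<ge> real r * (\<tau> - \<delta>)" using dr by (intro mult_left_mono) linarith+
        then show "dens q - real r * dens r \<le> (real r + 1) * \<delta>" using dq by (simp add: algebra_simps)
      qed (use dq0 dens_nonneg in simp)
      also have "\<dots> \<le> 1 * ((real r + 1) * \<delta>)"
        using dens_Suc_le[of q] dq0 q \<delta>0 by (intro mult_right_mono) auto
      finally have "dens r - real r * (dens r)\<^sup>2 / dens q \<le> (real r + 1) * \<delta>" by simp
      moreover have "real r * dens (Suc r) \<le> real r * \<delta>" using dens(2) by (intro mult_left_mono) auto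
      ultimately show "dens r + real r * dens (Suc r) - real r * (dens r)\<^sup>2 / dens q \<le> (2 * real r + 1) * \<delta>"
        by (simp add: algebra_simps)
    qed (use n in simp)
    finally show ?thesis by (simp add: field_simps)
  qed
  define B where "B C = real (card (bad_pairs (side C) C (private_ext C)))" for C
  \<comment> \<open>A bad pair \<open>(x, y)\<close> at \<open>v\<close> is counted at the facet
    \<open>C - {v}\<close>, which \<open>x\<close> extends to a clique that leaves \<open>y\<close>
    uncovered. A facet lies in at most \<open>n\<close> cliques, and a clique has \<open>r\<close>
    facets.\<close>
  have sumB: "(\<Sum>C\<in>faces r. B C) \<le> n * real r * (\<Sum>C\<in>faces r. W C)"
  proof -
    define F where "F C' = (\<Sum>x\<in>ext C'. W (insert x C'))" for C'
    have F0: "F C' \<ge> 0" for C' by (auto simp: F_def W_def intro: sum_nonneg)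
    have "B C \<le> (\<Sum>v\<in>C. F (C - {v}))" if C: "C \<in> faces r" for C
    proof -
      define M where "M v = Sigma (ext (C - {v})) (\<lambda>x. X - (\<Union>u\<in>insert x (C - {v}). private_ext (insert x (C - {v})) u))" for v
      have fM: "finite (M v)" for v using X by (simp add: M_def)
      have "bad_pairs (side C) C (private_ext C) \<subseteq> (\<Union>v\<in>C. M v)"
      proof
        fix a assume "a \<in> bad_pairs (side C) C (private_ext C)"
        then obtain x y v w where a: "a = (x, y)" "v \<in> C" "w \<in> C" "v \<noteq> w" "x \<in> private_ext C v" "y \<in> private_ext C w" "dist x y \<noteq> side C"
          unfolding bad_pairs_def by blast
        have "y \<in> X - (\<Union>u\<in>insert x (C - {v}). private_ext (insert x (C - {v})) u)"
          using bad_pair_uncovered[OF X(1) r C a(2-7)] .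
        moreover have "x \<in> ext (C - {v})" using a(5) by (simp add: private_ext_def)
        ultimately show "a \<in> (\<Union>v\<in>C. M v)" using a(1,2) unfolding M_def by blast
      qed
      then have "card (bad_pairs (side C) C (private_ext C)) \<le> card (\<Union>v\<in>C. M v)"
        using fM faces_finite[OF C] by (intro card_mono) auto
      also have "\<dots> \<le> (\<Sum>v\<in>C. card (M v))" by (intro card_UN_le faces_finite[OF C])
      finally have "B C \<le> (\<Sum>v\<in>C. real (card (M v)))" unfolding B_def by (simp flip: of_nat_sum)
      also have "\<dots> = (\<Sum>v\<in>C. F (C - {v}))"
        using X by (intro sum.cong refl) (simp add: M_def F_def W_def card_SigmaI)
      finally show ?thesis .
    qed
    then have "(\<Sum>C\<in>faces r. B C) \<le> (\<Sum>C\<in>faces r. \<Sum>v\<in>C. F (C - {v}))" by (intro sum_mono)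
    also have "\<dots> = (\<Sum>C'\<in>faces q. \<Sum>x\<in>ext C'. F C')"
      using sum_faces_Suc[of "\<lambda>C' x. F C'" q] by (simp add: q)
    also have "\<dots> \<le> (\<Sum>C'\<in>faces q. n * F C')"
    proof (intro sum_mono)
      fix C'
      have "card (ext C') \<le> card X" using X by (intro card_mono) (auto simp: ext_def)
      then show "(\<Sum>x\<in>ext C'. F C') \<le> n * F C'" using F0[of C'] by (simp add: n_def mult_right_mono)
    qed
    also have "\<dots> = n * (\<Sum>C'\<in>faces q. \<Sum>x\<in>ext C'. W (insert x C'))" by (simp add: sum_distrib_left F_def)
    also have "(\<Sum>C'\<in>faces q. \<Sum>x\<in>ext C'. W (insert x C')) = (\<Sum>C\<in>faces r. \<Sum>x\<in>C. W (insert x (C - {x})))"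
      using sum_faces_Suc[of "\<lambda>C' x. W (insert x C')" q] by (simp add: q)
    also have "\<dots> = (\<Sum>C\<in>faces r. real r * W C)"
    proof (intro sum.cong refl)
      fix C assume "C \<in> faces r"
      then have "(\<Sum>x\<in>C. W (insert x (C - {x}))) = (\<Sum>x\<in>C. W C)" by (intro sum.cong refl) (simp add: insert_absorb)
      then show "(\<Sum>x\<in>C. W (insert x (C - {x}))) = real r * W C" using \<open>C \<in> faces r\<close> by (simp add: faces_def)
    qed
    finally show ?thesis by (simp add: sum_distrib_left mult_ac)
  qed
  define E where "E C = real (card (ext C))" for C
  have sumE: "(\<Sum>C\<in>faces r. E C) \<le> \<delta> * n ^ Suc r / fact r"
  proof -
    have "(\<Sum>C\<in>faces r. E C) = real (Suc r) * N (Suc r)"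
      using arg_cong[OF card_faces_Suc[of r], of real] unfolding E_def N_def
      by (simp only: of_nat_sum of_nat_mult)
    also have "\<dots> = dens (Suc r) * n ^ Suc r / fact r" by (rule SN)
    also have "\<dots> \<le> \<delta> * n ^ Suc r / fact r" using dens(2) n by (intro divide_right_mono mult_right_mono) auto
    finally show ?thesis .
  qed
  \<comment> \<open>A facet with fewer than \<open>2 * \<theta> r * n\<close> extensions lies in
    fewer than that many cliques, and there are at most \<open>n ^ (r - 1)\<close> facets.\<close>
  define low where "low = {C \<in> faces r. \<exists>v\<in>C. real (card (ext (C - {v}))) < 2 * \<theta> r * n}"
  have low: "real (card low) \<le> 2 * \<theta> r * n ^ r"
  proof -
    define g where "g C' = (if real (card (ext C')) < 2 * \<theta> r * n then 1 else 0 :: real)" for C'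
    have "real (card low) = (\<Sum>C\<in>low. 1)" by simp
    also have "\<dots> \<le> (\<Sum>C\<in>low. \<Sum>v\<in>C. g (C - {v}))"
    proof (intro sum_mono)
      fix C assume C: "C \<in> low"
      then obtain v where v: "v \<in> C" "real (card (ext (C - {v}))) < 2 * \<theta> r * n" by (auto simp: low_def)
      have "g (C - {v}) \<le> (\<Sum>v\<in>C. g (C - {v}))"
        using C v faces_finite by (intro member_le_sum) (auto simp: low_def g_def)
      then show "1 \<le> (\<Sum>v\<in>C. g (C - {v}))" using v by (simp add: g_def)
    qed
    also have "\<dots> \<le> (\<Sum>C\<in>faces r. \<Sum>v\<in>C. g (C - {v}))"
      by (intro sum_mono2) (auto simp: low_def g_def intro: sum_nonneg)
    also have "\<dots> = (\<Sum>C'\<in>faces q. \<Sum>x\<in>ext C'. g C')" using sum_faces_Suc[of "\<lambda>C' x. g C'" q] by (simp add: q)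
    also have "\<dots> \<le> (\<Sum>C'\<in>faces q. 2 * \<theta> r * n)"
      using \<theta>(2) n by (intro sum_mono) (auto simp: g_def)
    also have "\<dots> = N q * (2 * \<theta> r * n)" by (simp add: N_def)
    also have "\<dots> \<le> n ^ q * (2 * \<theta> r * n)"
    proof (intro mult_right_mono)
      have "N q \<le> n ^ q / fact q" using dens_le1[of q] n by (simp add: Ndens divide_right_mono mult_left_le_one_le dens_nonneg)
      also have "\<dots> \<le> n ^ q" using n fact_ge_1[of q, where ?'a = real] by (simp add: divide_le_eq mult_le_cancel_left1)
      finally show "N q \<le> n ^ q" .
    qed (use \<theta>(2) n in simp)
    finally show ?thesis by (simp add: q mult_ac)
  qed
  define \<G> where "\<G> = faces r - low"
  have c\<G>: "real (card \<G>) \<ge> 6 * \<theta> r * n ^ r"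
  proof -
    \<comment> \<open>The 16 in \<open>\<theta>\<close> comes from here:
      \<open>dens r \<ge> \<tau> / 2\<close> gives \<open>8 * \<theta> r * n ^ r\<close> cliques, of
      which \<open>low\<close> takes at most \<open>2 * \<theta> r * n ^ r\<close>.\<close>
    have "N r \<ge> 8 * \<theta> r * n ^ r"
      using dr2 n unfolding Ndens \<theta>(1) by (simp add: divide_right_mono mult_right_mono field_simps)
    moreover have "real (card \<G>) = N r - real (card low)"
    proof -
      have "low \<subseteq> faces r" by (auto simp: low_def)
      then have "finite low" "card low \<le> card (faces r)" "card \<G> = card (faces r) - card low"
        unfolding \<G>_def by (simp_all add: finite_subset card_mono card_Diff_subset)
      then show ?thesis by (simp add: N_def of_nat_diff)
    qed
    ultimately show ?thesis using low by linarith
  qed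
  define \<mu> where "\<mu> = min \<eta> (\<theta> r)"
  have \<mu>: "\<mu> > 0" "\<mu> \<le> \<eta>" "\<mu> \<le> \<theta> r" using \<eta> \<theta>(2) by (auto simp: \<mu>_def)
  have "\<exists>C\<in>\<G>. n * W C + B C + n * E C \<le> \<mu> * n ^ 2"
  proof (rule ccontr)
    assume neg: "\<not> ?thesis"
    have "6 * \<theta> r * n ^ r * (\<mu> * n ^ 2) \<le> real (card \<G>) * (\<mu> * n ^ 2)"
      using c\<G> \<mu> n by (intro mult_right_mono) auto
    also have "\<dots> = (\<Sum>C\<in>\<G>. \<mu> * n ^ 2)" by simp
    also have "\<dots> \<le> (\<Sum>C\<in>\<G>. n * W C + B C + n * E C)" using neg by (intro sum_mono) (simp add: not_le less_imp_le)
    also have "\<dots> \<le> (\<Sum>C\<in>faces r. n * W C + B C + n * E C)"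
      using n by (intro sum_mono2) (auto simp: \<G>_def W_def B_def E_def)
    also have "\<dots> = n * (\<Sum>C\<in>faces r. W C) + (\<Sum>C\<in>faces r. B C) + n * (\<Sum>C\<in>faces r. E C)"
      by (simp add: sum.distrib sum_distrib_left)
    also have "\<dots> \<le> n * (real r + 1) * (\<Sum>C\<in>faces r. W C) + n * (\<Sum>C\<in>faces r. E C)"
      using sumB by (simp add: algebra_simps)
    also have "\<dots> \<le> n * (real r + 1) * ((2 * real r + 1) * \<delta> * n ^ Suc r / fact r) + n * (\<delta> * n ^ Suc r / fact r)"
      using sumW sumE n by (intro add_mono mult_left_mono) auto
    also have "\<dots> = (\<delta> * ((real r + 1) * (2 * real r + 1) + 1)) * n ^ (r + 2) / fact r"
      by (simp add: algebra_simps add_divide_distrib)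
    also have "\<dots> \<le> (2 * \<theta> r * \<mu>) * n ^ (r + 2) / fact r"
      using \<delta>(2) n by (intro divide_right_mono mult_right_mono) (auto simp: \<mu>_def)
    also have "\<dots> \<le> (2 * \<theta> r * \<mu>) * n ^ (r + 2)"
      using \<theta>(2) \<mu>(1) n by (intro divide_fact_le) simp
    finally have "6 * \<theta> r * n ^ r * (\<mu> * n ^ 2) \<le> (2 * \<theta> r * \<mu>) * n ^ (r + 2)" .
    moreover have "6 * \<theta> r * n ^ r * (\<mu> * n ^ 2) = 6 * (\<theta> r * \<mu> * n ^ (r + 2))"
      by (simp add: power_add power2_eq_square mult_ac)
    moreover have "\<theta> r * \<mu> * n ^ (r + 2) > 0" using \<theta>(2) \<mu>(1) n by simp
    ultimately show False by linarith
  qed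
  then obtain C where C: "C \<in> \<G>" "n * W C + B C + n * E C \<le> \<mu> * n ^ 2" by blast
  have nn: "n * W C \<ge> 0" "B C \<ge> 0" "n * E C \<ge> 0" using n by (auto simp: W_def B_def E_def)
  have "\<mu> * n ^ 2 = n * (\<mu> * n)" by (simp add: power2_eq_square)
  then have "n * W C \<le> n * (\<mu> * n)" "n * E C \<le> n * (\<mu> * n)" using C(2) nn by linarith+
  then have WE: "W C \<le> \<mu> * n" "E C \<le> \<mu> * n" using n by (simp_all add: mult_le_cancel_left_pos)
  have "W C \<le> \<eta> * n" using WE(1) \<mu> n by (smt (verit) mult_right_mono)
  moreover have "B C \<le> \<eta> * n ^ 2" using C(2) nn \<mu> mult_right_mono[of \<mu> \<eta> "n ^ 2"] by auto
  moreover have "\<theta> r * n \<le> real (card (private_ext C v))" if "v \<in> C" for v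
  proof -
    have "2 * \<theta> r * n \<le> real (card (ext (C - {v})))" using C(1) that by (auto simp: \<G>_def low_def not_less)
    moreover have "real (card (private_ext C v)) + E C = real (card (ext (C - {v})))"
      using card_private_ext[of C v] by (simp add: E_def flip: of_nat_add)
    moreover have "E C \<le> \<theta> r * n" using WE(2) \<mu> n by (smt (verit) mult_right_mono)
    ultimately show ?thesis by linarith
  qed
  ultimately show ?thesis using C(1) unfolding \<G>_def W_def B_def n_def Let_def by (intro bexI[of _ C]) auto
qed

section \<open>From typical cliques to Lenz configurations\<close>

text \<open>Minimising a combination of the number of deleted points and the affine dimension makes the affine
  hull of each part robust under small deletions; since distance \<open>t\<close> to a point propagates to affine
  hulls inside a sphere, almost all cross distances being \<open>t\<close> then implies that all of them are.\<close>

lemma complete_parts: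
  fixes Y :: "'i \<Rightarrow> 'a::euclidean_space set" and \<kappa> \<eta> n t :: real
  assumes Y: "\<And>i. i \<in> I \<Longrightarrow> finite (Y i)" "\<And>i. i \<in> I \<Longrightarrow> \<exists>p. \<forall>x\<in>Y i. dist x p = t"
    and finbad: "finite (bad_pairs t I Y)" and bad: "real (card (bad_pairs t I Y)) \<le> \<eta> * n ^ 2"
    and n: "n > 0" and \<kappa>: "\<kappa> > 0" "\<eta> < \<kappa>\<^sup>2"
  obtains Z where "\<And>i. i \<in> I \<Longrightarrow> Z i \<subseteq> Y i"
    "\<And>i. i \<in> I \<Longrightarrow> real (card (Y i - Z i)) \<le> \<kappa> * (real DIM('a) + 1) * n"
    "\<And>i j x y. i \<in> I \<Longrightarrow> j \<in> I \<Longrightarrow> i \<noteq> j \<Longrightarrow> x \<in> Z i \<Longrightarrow> y \<in> Z j \<Longrightarrow> dist x y = t"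
proof -
  \<comment> \<open>A dimension is worth \<open>\<kappa> * n\<close> points: deleting fewer points
    from a minimiser cannot lower its dimension, and since dimensions differ by at most
    \<open>DIM('a) + 1\<close>, a minimiser omits few points of \<open>Y i\<close>.\<close>
  define \<Phi> where "\<Phi> i A = real (card (Y i - A)) + \<kappa> * n * real_of_int (aff_dim A)" for i and A :: "'a set"
  define Z where "Z i = arg_min_on (\<Phi> i) (Pow (Y i))" for i
  have Zs: "Z i \<subseteq> Y i" if "i \<in> I" for i
    using arg_min_if_finite(1)[of "Pow (Y i)" "\<Phi> i"] Y(1)[OF that] unfolding Z_def by auto
  have Zmin: "\<Phi> i (Z i) \<le> \<Phi> i A" if "i \<in> I" "A \<subseteq> Y i" for i A
    using arg_min_least[of "Pow (Y i)" A "\<Phi> i"] Y(1)[OF that(1)] that(2) unfolding Z_def by auto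
  have kn: "\<kappa> * n > 0" using \<kappa> n by simp
  have hull: "affine hull B = affine hull (Z i)" if i: "i \<in> I" and B: "B \<subseteq> Z i" "real (card (Z i - B)) < \<kappa> * n" for i B
  proof (rule ccontr)
    assume "affine hull B \<noteq> affine hull (Z i)"
    then have "aff_dim B \<noteq> aff_dim (Z i)" using aff_dim_eq_full_gen[OF B(1)] by blast
    then have "aff_dim B \<le> aff_dim (Z i) - 1" using aff_dim_subset[OF B(1)] by linarith
    then have "real_of_int (aff_dim B) \<le> real_of_int (aff_dim (Z i)) - 1" by linarith
    then have "\<kappa> * n * real_of_int (aff_dim B) \<le> \<kappa> * n * (real_of_int (aff_dim (Z i)) - 1)"
      using kn by (intro mult_left_mono) auto
    moreover have "card (Y i - B) \<le> card (Y i - Z i) + card (Z i - B)"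
    proof -
      have "Y i - B \<subseteq> (Y i - Z i) \<union> (Z i - B)" by blast
      moreover have "finite (Z i)" using finite_subset[OF Zs[OF i] Y(1)[OF i]] .
      ultimately have "card (Y i - B) \<le> card ((Y i - Z i) \<union> (Z i - B))" using Y(1)[OF i] by (intro card_mono) auto
      then show ?thesis using card_Un_le[of "Y i - Z i" "Z i - B"] by linarith
    qed
    ultimately have "\<Phi> i B < \<Phi> i (Z i)" using B(2) by (simp add: \<Phi>_def algebra_simps)
    then show False using Zmin[OF i, of B] B(1) Zs[OF i] by auto
  qed
  have small: "real (card (Y i - Z i)) \<le> \<kappa> * (real DIM('a) + 1) * n" if i: "i \<in> I" for i
  proof -
    have "\<Phi> i (Z i) \<le> \<Phi> i (Y i)" using Zmin[OF i] by simp
    moreover have "real_of_int (aff_dim (Y i)) - real_of_int (aff_dim (Z i)) \<le> real DIM('a) + 1"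
      using aff_dim_le_DIM[of "Y i"] aff_dim_geq[of "Z i"] by linarith
    then have "\<kappa> * n * (real_of_int (aff_dim (Y i)) - real_of_int (aff_dim (Z i))) \<le> \<kappa> * n * (real DIM('a) + 1)"
      using kn by (intro mult_left_mono) auto
    ultimately show ?thesis by (simp add: \<Phi>_def algebra_simps)
  qed
  have finZ: "finite (Z i)" if "i \<in> I" for i using finite_subset[OF Zs[OF that] Y(1)[OF that]] .
  \<comment> \<open>On the sphere of radius \<open>t\<close> about \<open>p\<close>, having distance
    \<open>t\<close> from \<open>x\<close> means being equidistant from \<open>x\<close> and
    \<open>p\<close>, and this passes to affine hulls.\<close>
  have spread: "dist y x = t" if i: "i \<in> I" and B: "B \<subseteq> Z i" "real (card (Z i - B)) < \<kappa> * n" "\<And>b. b \<in> B \<Longrightarrow> dist b x = t"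
    and y: "y \<in> Z i" for i B x y
  proof -
    obtain p where p: "\<forall>x\<in>Y i. dist x p = t" using Y(2)[OF i] by blast
    have "y \<in> affine hull B" using hull[OF i B(1,2)] hull_inc[OF y] by metis
    moreover have "dist b x = dist b p" if "b \<in> B" for b using B(3)[OF that] p that B(1) Zs[OF i] by auto
    ultimately have "dist y x = dist y p" using equidistant_affine_hull'[of B x p y] by blast
    then show ?thesis using p y Zs[OF i] by auto
  qed
  have "dist x y = t" if ij: "i \<in> I" "j \<in> I" "i \<noteq> j" and xy: "x \<in> Z i" "y \<in> Z j" for i j x y
  proof -
    \<comment> \<open>Two rounds: a good point has distance \<open>t\<close> to most of
      \<open>Z j\<close>, hence to all of it; then each \<open>y\<close> in \<open>Z j\<close> has
      distance \<open>t\<close> to most of \<open>Z i\<close>, hence to all of it. Fewer than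
      \<open>\<kappa> * n\<close> points fail to be good because
      \<open>\<eta> < \<kappa>\<^sup>2\<close>.\<close>
    define good where "good = {x \<in> Z i. real (card {y \<in> Z j. dist x y \<noteq> t}) < \<kappa> * n}"
    have gd: "dist x y = t" if "x \<in> good" "y \<in> Z j" for x y
    proof -
      have "Z j - {y \<in> Z j. dist y x = t} = {y \<in> Z j. dist x y \<noteq> t}" by (auto simp: dist_commute)
      then have "real (card (Z j - {y \<in> Z j. dist y x = t})) < \<kappa> * n" using that(1) by (simp add: good_def)
      then have "dist y x = t" by (rule spread[OF ij(2) _ _ _ that(2), rotated]) auto
      then show ?thesis by (simp add: dist_commute)
    qed
    have "real (card (Z i - good)) < \<kappa> * n"
    proof (rule ccontr)
      assume neg: "\<not> ?thesis"
      have "Sigma (Z i - good) (\<lambda>x. {y \<in> Z j. dist x y \<noteq> t}) \<subseteq> bad_pairs t I Y"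
        using ij Zs by (auto simp: bad_pairs_def)
      then have "card (Sigma (Z i - good) (\<lambda>x. {y \<in> Z j. dist x y \<noteq> t})) \<le> card (bad_pairs t I Y)"
        using finbad by (intro card_mono)
      moreover have "card (Sigma (Z i - good) (\<lambda>x. {y \<in> Z j. dist x y \<noteq> t})) = (\<Sum>x\<in>Z i - good. card {y \<in> Z j. dist x y \<noteq> t})"
        using finZ ij by (intro card_SigmaI) auto
      ultimately have "(\<Sum>x\<in>Z i - good. real (card {y \<in> Z j. dist x y \<noteq> t})) \<le> \<eta> * n ^ 2"
        using bad by (simp flip: of_nat_sum)
      moreover have "(\<Sum>x\<in>Z i - good. real (card {y \<in> Z j. dist x y \<noteq> t})) \<ge> (\<Sum>x\<in>Z i - good. \<kappa> * n)"
        by (intro sum_mono) (auto simp: good_def)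
      ultimately have "real (card (Z i - good)) * (\<kappa> * n) \<le> \<eta> * n ^ 2" by simp
      moreover have "\<kappa> * n * (\<kappa> * n) \<le> real (card (Z i - good)) * (\<kappa> * n)" using neg kn by (intro mult_right_mono) auto
      moreover have "\<eta> * n ^ 2 < \<kappa>\<^sup>2 * n ^ 2" using \<kappa> n by (intro mult_strict_right_mono) auto
      ultimately show False by (simp add: power2_eq_square mult_ac)
    qed
    moreover have "good \<subseteq> Z i" by (auto simp: good_def)
    ultimately show ?thesis using spread[OF ij(1), of good y x] gd xy by blast
  qed
  then show thesis using that[of Z] Zs small by blast
qed

text \<open>A dense relation contains a box with sides of three points; if boxes of \<open>Q\<close>
  are equidistant, this yields two orthogonal planes, too much for affine dimension 3. It serves
  both for pairs at distance \<open>t\<close> inside a part and for \<open>fan v\<close>.\<close>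

lemma few_pairs:
  fixes \<eta> :: real
  assumes \<eta>: "\<eta> > 0"
  shows "\<exists>n0. \<forall>X :: 'a::euclidean_space set. \<forall>A Q. finite X \<longrightarrow> card X \<ge> n0 \<longrightarrow> A \<subseteq> X \<longrightarrow> aff_dim A \<le> 3 \<longrightarrow>
     (\<forall>U U'. U \<noteq> {} \<longrightarrow> U' \<noteq> {} \<longrightarrow> (\<forall>x\<in>U. \<forall>y\<in>U'. Q x y) \<longrightarrow> equidistant_sets U U') \<longrightarrow>
     real (card {(x, y) \<in> A \<times> A. Q x y}) \<le> \<eta> * real (card X) ^ 2"
proof -
  define J where "J = {0, 1 :: nat}"
  have J: "finite J" "card J = 2" by (simp_all add: J_def)
  from dense_relation_contains_box[OF J(1) \<eta>, of 3, where ?'a = 'a]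
  obtain n0 where n0: "\<forall>X :: 'a set. \<forall>R. finite X \<longrightarrow> card X \<ge> n0 \<longrightarrow> R \<subseteq> (J \<rightarrow>\<^sub>E X) \<longrightarrow>
     \<eta> * real (card X) ^ card J \<le> real (card R) \<longrightarrow>
     (\<exists>U. (\<forall>i\<in>J. U i \<subseteq> X \<and> card (U i) = 3) \<and> Pi\<^sub>E J U \<subseteq> R)" by auto
  have "real (card {(x, y) \<in> A \<times> A. Q x y}) \<le> \<eta> * real (card X) ^ 2"
    if X: "finite X" "card X \<ge> n0" and A: "A \<subseteq> X" "aff_dim A \<le> 3"
      and Q: "\<forall>U U'. U \<noteq> {} \<longrightarrow> U' \<noteq> {} \<longrightarrow> (\<forall>x\<in>U. \<forall>y\<in>U'. Q x y) \<longrightarrow> equidistant_sets U U'"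
    for X A :: "'a set" and Q
  proof (rule ccontr)
    assume neg: "\<not> ?thesis"
    define R where "R = {f \<in> J \<rightarrow>\<^sub>E X. f 0 \<in> A \<and> f 1 \<in> A \<and> Q (f 0) (f 1)}"
    have finR: "finite R" by (rule finite_subset[of _ "J \<rightarrow>\<^sub>E X"]) (auto simp: R_def J X intro: finite_PiE)
    have "card {(x, y) \<in> A \<times> A. Q x y} \<le> card R"
    proof (rule card_inj_on_le[where f = "\<lambda>(x, y) i. if i = 0 then x else if i = 1 then y else undefined"])
      show "inj_on (\<lambda>(x, y) i. if i = 0 then x else if i = (1 :: nat) then y else undefined) {(x, y) \<in> A \<times> A. Q x y}"
      proof (rule inj_onI)
        fix a b :: "'a \<times> 'a"
        assume eq: "(case a of (x, y) \<Rightarrow> \<lambda>i. if i = 0 then x else if i = (1 :: nat) then y else undefined)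
          = (case b of (x, y) \<Rightarrow> \<lambda>i. if i = 0 then x else if i = (1 :: nat) then y else undefined)"
        show "a = b" using fun_cong[OF eq, of 0] fun_cong[OF eq, of 1] by (cases a; cases b) simp
      qed
      show "(\<lambda>(x, y) i. if i = 0 then x else if i = (1 :: nat) then y else undefined) ` {(x, y) \<in> A \<times> A. Q x y} \<subseteq> R"
        using A(1) by (auto simp: R_def J_def PiE_def extensional_def)
    qed (fact finR)
    then have "\<eta> * real (card X) ^ card J \<le> real (card R)" using neg J(2) by simp
    moreover have "R \<subseteq> (J \<rightarrow>\<^sub>E X)" by (auto simp: R_def)
    ultimately have "\<exists>U. (\<forall>i\<in>J. U i \<subseteq> X \<and> card (U i) = 3) \<and> Pi\<^sub>E J U \<subseteq> R"
      by (intro n0[rule_format, OF X])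
    then obtain U where U: "\<forall>i\<in>J. U i \<subseteq> X \<and> card (U i) = 3" "Pi\<^sub>E J U \<subseteq> R" by (elim exE conjE)
    have UQ: "x \<in> A \<and> y \<in> A \<and> Q x y" if "x \<in> U 0" "y \<in> U 1" for x y
    proof -
      define f where "f = (\<lambda>i :: nat. if i = 0 then x else if i = 1 then y else undefined)"
      have "f \<in> Pi\<^sub>E J U" using that by (auto simp: f_def J_def PiE_def extensional_def)
      then have "f \<in> R" using U(2) by blast
      then show ?thesis by (simp add: R_def f_def)
    qed
    have c3: "card (U 0) = 3" "card (U 1) = 3" using U(1) by (auto simp: J_def)
    then have ne: "U 0 \<noteq> {}" "U 1 \<noteq> {}" by auto
    have "equidistant_sets (U 0) (U 1)" using Q ne UQ by blast
    then have eq: "equidistant_sets (U i) (U j)" if "i \<in> J" "j \<in> J" "i \<noteq> j" for i j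
      using that equidistant_sets_sym by (auto simp: J_def)
    have ad: "aff_dim (U i) \<ge> 2" if i: "i \<in> J" for i
    proof -
      have "card (U i) = 3" using U(1) i by auto
      then obtain x y z where xyz: "U i = {x, y, z}" "x \<noteq> y" "y \<noteq> z" "x \<noteq> z" by (auto simp: card_3_iff)
      define j where "j = 1 - i"
      have j: "j \<in> J" "i \<noteq> j" using i by (auto simp: J_def j_def)
      have "U j \<noteq> {}" using ne j by (auto simp: J_def)
      then obtain p where "p \<in> U j" by blast
      then obtain d where "\<forall>a\<in>U i. dist a p = d" using eq[OF i j] unfolding equidistant_sets_def by blast
      then show ?thesis unfolding xyz(1) using xyz by (intro aff_dim_three_on_sphere[of _ p d]) auto
    qed
    have "(\<Sum>i\<in>J. aff_dim (U i)) \<le> aff_dim (\<Union>i\<in>J. U i)"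
      by (rule aff_dim_equidistant_family) (use J ne eq in \<open>auto simp: J_def\<close>)
    also have "\<dots> \<le> aff_dim A" using UQ ne by (intro aff_dim_subset) (auto simp: J_def)
    finally have "aff_dim (U 0) + aff_dim (U 1) \<le> 3" using A(2) by (simp add: J_def)
    then show False using ad[of 0] ad[of 1] by (simp add: J_def)
  qed
  then show ?thesis by (intro exI[of _ n0] allI impI)
qed

section \<open>Transversals of a family of parts\<close>

definition transversals :: "'i set \<Rightarrow> ('i \<Rightarrow> 'a set) \<Rightarrow> nat \<Rightarrow> 'a set set" where
  "transversals I A m = {S. S \<subseteq> (\<Union>i\<in>I. A i) \<and> card S = m \<and> (\<forall>i\<in>I. \<forall>x\<in>S \<inter> A i. \<forall>y\<in>S \<inter> A i. x = y)}"

lemma finite_transversals: "finite I \<Longrightarrow> (\<And>i. i \<in> I \<Longrightarrow> finite (A i)) \<Longrightarrow> finite (transversals I A m)"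
  unfolding transversals_def by (rule finite_subset[of _ "Pow (\<Union>i\<in>I. A i)"]) auto

text \<open>A transversal amounts to the set of indices that it meets and a choice function on
  it.\<close>

lemma card_transversals_le_sum:
  fixes A :: "'i \<Rightarrow> 'a set"
  assumes I: "finite I" "\<And>i. i \<in> I \<Longrightarrow> finite (A i)"
    and disj: "\<And>i j. i \<in> I \<Longrightarrow> j \<in> I \<Longrightarrow> i \<noteq> j \<Longrightarrow> A i \<inter> A j = {}"
  shows "card (transversals I A m) \<le> (\<Sum>J\<in>{J. J \<subseteq> I \<and> card J = m}. \<Prod>j\<in>J. card (A j))"
proof -
  define F where "F = Sigma {J. J \<subseteq> I \<and> card J = m} (\<lambda>J. Pi\<^sub>E J A)"
  have finJ: "finite J" if "J \<subseteq> I" for J using that I finite_subset by blast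
  have finF: "finite F" unfolding F_def
    using I finJ by (intro finite_SigmaI finite_subset_family finite_PiE) auto
  define h where "h S i = (if S \<inter> A i \<noteq> {} then (THE x. x \<in> S \<inter> A i) else undefined)" for S i
  have hS: "S \<inter> A i = {h S i}" if "S \<in> transversals I A m" "i \<in> I" "S \<inter> A i \<noteq> {}" for S i
  proof -
    from that(3) obtain x where x: "x \<in> S \<inter> A i" by blast
    have u: "\<forall>x\<in>S \<inter> A i. \<forall>y\<in>S \<inter> A i. x = y" using that(1,2) by (simp add: transversals_def)
    have "y = x" if "y \<in> S \<inter> A i" for y using u x that by auto
    then have "S \<inter> A i = {x}" using x by blast
    then show ?thesis by (simp add: h_def)
  qed
  have "card (transversals I A m) \<le> card F"
  proof (rule card_inj_on_le[where f = "\<lambda>S. ({i \<in> I. S \<inter> A i \<noteq> {}}, restrict (h S) {i \<in> I. S \<inter> A i \<noteq> {}})"])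
    have rec: "S = restrict (h S) {i \<in> I. S \<inter> A i \<noteq> {}} ` {i \<in> I. S \<inter> A i \<noteq> {}}" if S: "S \<in> transversals I A m" for S
    proof -
      have "S \<subseteq> (\<Union>i\<in>I. A i)" using S by (simp add: transversals_def)
      then have "S = (\<Union>i\<in>{i \<in> I. S \<inter> A i \<noteq> {}}. S \<inter> A i)" by blast
      also have "\<dots> = (\<Union>i\<in>{i \<in> I. S \<inter> A i \<noteq> {}}. {h S i})" using hS[OF S] by (intro SUP_cong) auto
      also have "\<dots> = h S ` {i \<in> I. S \<inter> A i \<noteq> {}}" by blast
      also have "\<dots> = restrict (h S) {i \<in> I. S \<inter> A i \<noteq> {}} ` {i \<in> I. S \<inter> A i \<noteq> {}}" by (simp only: image_restrict_eq)
      finally show ?thesis .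
    qed
    show "inj_on (\<lambda>S. ({i \<in> I. S \<inter> A i \<noteq> {}}, restrict (h S) {i \<in> I. S \<inter> A i \<noteq> {}})) (transversals I A m)"
    proof (rule inj_onI)
      fix S S' assume S: "S \<in> transversals I A m" "S' \<in> transversals I A m"
        and eq: "({i \<in> I. S \<inter> A i \<noteq> {}}, restrict (h S) {i \<in> I. S \<inter> A i \<noteq> {}}) = ({i \<in> I. S' \<inter> A i \<noteq> {}}, restrict (h S') {i \<in> I. S' \<inter> A i \<noteq> {}})"
      have "S = restrict (h S) {i \<in> I. S \<inter> A i \<noteq> {}} ` {i \<in> I. S \<inter> A i \<noteq> {}}" by (rule rec[OF S(1)])
      also have "\<dots> = restrict (h S') {i \<in> I. S' \<inter> A i \<noteq> {}} ` {i \<in> I. S' \<inter> A i \<noteq> {}}"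
        using arg_cong[OF eq, of "\<lambda>q. snd q ` fst q"] by (simp only: fst_conv snd_conv)
      also have "\<dots> = S'" by (rule rec[OF S(2), symmetric])
      finally show "S = S'" .
    qed
    show "(\<lambda>S. ({i \<in> I. S \<inter> A i \<noteq> {}}, restrict (h S) {i \<in> I. S \<inter> A i \<noteq> {}})) ` transversals I A m \<subseteq> F"
    proof (rule image_subsetI)
      fix S assume S: "S \<in> transversals I A m"
      let ?J = "{i \<in> I. S \<inter> A i \<noteq> {}}"
      have hA: "h S i \<in> S \<inter> A i" if "i \<in> ?J" for i using hS[OF S, of i] that by blast
      have "inj_on (restrict (h S) ?J) ?J"
      proof (rule inj_onI)
        fix i j assume ij: "i \<in> ?J" "j \<in> ?J" "restrict (h S) ?J i = restrict (h S) ?J j"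
        then have "h S i \<in> A i \<inter> A j" using hA[OF ij(1)] hA[OF ij(2)] by simp
        then show "i = j" using disj[of i j] ij by blast
      qed
      then have "card ?J = card (restrict (h S) ?J ` ?J)" by (simp add: card_image)
      also have "\<dots> = card S" using rec[OF S] by simp
      finally have "card ?J = m" using S by (simp add: transversals_def)
      moreover have "restrict (h S) ?J \<in> Pi\<^sub>E ?J A" using hA by auto
      ultimately show "(?J, restrict (h S) ?J) \<in> F" by (auto simp: F_def)
    qed
  qed (fact finF)
  also have "card F = (\<Sum>J\<in>{J. J \<subseteq> I \<and> card J = m}. card (Pi\<^sub>E J A))"
    unfolding F_def using I finJ by (intro card_SigmaI finite_subset_family ballI finite_PiE) auto
  also have "\<dots> = (\<Sum>J\<in>{J. J \<subseteq> I \<and> card J = m}. \<Prod>j\<in>J. card (A j))"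
    using finJ by (intro sum.cong refl card_PiE) auto
  finally show ?thesis .
qed

text \<open>In effect an inequality for elementary symmetric functions of the part sizes.
  Transversals are the cliques of a complete multipartite graph, so the Moon--Moser machinery
  applies, with no face of size \<open>card I + 1\<close>.\<close>

lemma card_transversals_turan:
  fixes A :: "'i \<Rightarrow> 'a set"
  assumes I: "finite I" "\<And>i. i \<in> I \<Longrightarrow> finite (A i)" and m: "2 \<le> m" "m \<le> card I"
    and disj: "\<And>i j. i \<in> I \<Longrightarrow> j \<in> I \<Longrightarrow> i \<noteq> j \<Longrightarrow> A i \<inter> A j = {}"
  shows "real (card (transversals I A m)) \<le> real (card I choose m) * (real (card (\<Union>i\<in>I. A i)) / real (card I)) ^ m"
proof -
  define X where "X = (\<Union>i\<in>I. A i)"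
  define P where "P S \<longleftrightarrow> (\<forall>i\<in>I. \<forall>x\<in>S \<inter> A i. \<forall>y\<in>S \<inter> A i. x = y)" for S :: "'a set"
  define r where "r = card I"
  have finX: "finite X" using I by (simp add: X_def)
  interpret hereditary X P by unfold_locales (use finX in \<open>auto simp: P_def\<close>)
  have faces_eq: "faces s = transversals I A s" for s
    unfolding faces_def unfolding transversals_def X_def[symmetric] P_def[symmetric] by blast
  show ?thesis
  proof (cases "card X = 0")
    case True
    then have "X = {}" using finX by simp
    then have "transversals I A m = {}" using m by (auto simp: transversals_def X_def)
    then show ?thesis by simp
  next
    case False
    then have n: "card X > 0" by simp
    have exch: "exchange s" for s
      unfolding exchange_def
    proof (intro ballI impI)
      fix C v w x
      assume C: "C \<in> faces s" "v \<noteq> w" and h: "P (insert x (C - {v}))" "P (insert x (C - {w}))"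
      have PC: "P C" using C by (simp add: faces_def)
      have PD: "a = b" if "P S" "i \<in> I" "a \<in> S" "a \<in> A i" "b \<in> S" "b \<in> A i" for S i a b
        using that unfolding P_def by (meson IntI)
      have xb: "x = b" if b: "b \<in> C" "i \<in> I" "x \<in> A i" "b \<in> A i" for b i
      proof (cases "b = v")
        case True
        then show ?thesis using b C(2) by (intro PD[OF h(2) b(2) _ b(3) _ b(4)]) auto
      next
        case False
        then show ?thesis using b by (intro PD[OF h(1) b(2) _ b(3) _ b(4)]) auto
      qed
      show "P (insert x C)" unfolding P_def
      proof (intro ballI)
        fix i a b assume i: "i \<in> I" "a \<in> insert x C \<inter> A i" "b \<in> insert x C \<inter> A i"
        show "a = b"
        proof (cases "a = x \<or> b = x")
          case True
          then show ?thesis using xb[of b i] xb[of a i] i by auto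
        next
          case False
          then show ?thesis using i by (intro PD[OF PC i(1)]) auto
        qed
      qed
    qed
    have "S = {}" if "S \<subseteq> X" "card S = 0" for S using that finite_subset[OF that(1) finX] by simp
    then have "faces 0 = {{}}" by (auto simp: faces_def P_def)
    then have d0: "dens 0 = 1" by (simp add: dens_def)
    have "faces 1 = (\<lambda>x. {x}) ` X" by (auto simp: faces_def P_def card_1_singleton_iff)
    then have d1: "dens 1 = 1" using n by (simp add: dens_def card_image card_gt_0_iff)
    have mm: "real s * (dens s)\<^sup>2 \<le> dens (s - 1) * (dens s + real (s - 1) * dens (Suc s))" if "2 \<le> s" for s
      using dens_moon_moser[of "s - 1"] exch[of s] n that by simp
    have zero: "dens (Suc r) = 0"
    proof -
      have "(\<Sum>J\<in>{J. J \<subseteq> I \<and> card J = Suc r}. \<Prod>j\<in>J. card (A j)) = 0"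
      proof -
        have "{J. J \<subseteq> I \<and> card J = Suc r} = {}" using card_mono[OF I(1)] by (auto simp: r_def) (metis Suc_n_not_le_n)
        then show ?thesis by (simp only: sum.empty)
      qed
      moreover have "card (transversals I A (Suc r)) \<le> (\<Sum>J\<in>{J. J \<subseteq> I \<and> card J = Suc r}. \<Prod>j\<in>J. card (A j))"
        by (rule card_transversals_le_sum[OF I disj])
      ultimately have "card (faces (Suc r)) = 0" unfolding faces_eq by linarith
      then show ?thesis by (simp add: dens_def)
    qed
    have d2: "dens 2 \<le> 1 - 1 / real r"
      by (rule moon_moser_edges[OF dens_nonneg dens_Suc_le d1 _ mm zero]) (use m r_def in auto)
    have "dens m \<le> turan_dens r m"
    proof (cases "m = 2")
      case True
      then show ?thesis using d2 by (simp add: turan_dens_def numeral_2_eq_2)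
    next
      case False
      then show ?thesis
        by (intro turan_dens_bound(1)[OF dens_nonneg dens_Suc_le d2 _ _ mm zero]) (use m r_def in auto)
    qed
    also have "\<dots> = fact m * real (r choose m) / real r ^ m" using m r_def by (intro turan_dens_binomial) auto
    finally have "fact m * real (card (faces m)) / real (card X) ^ m \<le> fact m * real (r choose m) / real r ^ m"
      by (simp add: dens_def)
    then have "fact m * (real (card (faces m)) / real (card X) ^ m) \<le> fact m * (real (r choose m) / real r ^ m)" by simp
    then have "real (card (faces m)) / real (card X) ^ m \<le> real (r choose m) / real r ^ m"
      by (rule mult_left_le_imp_le) simp
    then have "real (card (faces m)) \<le> real (r choose m) / real r ^ m * real (card X) ^ m"
      using n by (simp add: pos_divide_le_eq)
    then show ?thesis unfolding faces_eq by (simp add: power_divide r_def X_def)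
  qed
qed

section \<open>Vertex degrees and approximate Lenz configurations\<close>

definition simplex_degree :: "nat \<Rightarrow> 'a::metric_space set \<Rightarrow> 'a \<Rightarrow> nat" where
  "simplex_degree k X v = card {S \<in> spanned_simplices k X. v \<in> S}"

text \<open>The coefficient of \<open>n ^ (k - 1)\<close> in the degree of a vertex of a balanced
  configuration: the other vertices choose \<open>k - 1\<close> of the remaining
  \<open>r - 1\<close> parts, each of size \<open>n / r\<close>.\<close>

definition limit_degree :: "nat \<Rightarrow> nat \<Rightarrow> real" where
  "limit_degree r k = real ((r - 1) choose (k - 1)) / real r ^ (k - 1)"

lemma finite_spanned: "finite X \<Longrightarrow> finite (spanned_simplices k X)"
  unfolding spanned_simplices_def by (rule finite_subset_family)

lemma sum_simplex_degree:
  assumes "finite X"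
  shows "(\<Sum>v\<in>X. simplex_degree k X v) = k * card (spanned_simplices k X)"
proof -
  have "(\<Sum>v\<in>X. simplex_degree k X v) = (\<Sum>v\<in>X. \<Sum>S\<in>spanned_simplices k X. if v \<in> S then 1 else 0)"
    unfolding simplex_degree_def using finite_spanned[OF assms] by (simp add: sum.If_cases Int_def)
  also have "\<dots> = (\<Sum>S\<in>spanned_simplices k X. \<Sum>v\<in>X. if v \<in> S then 1 else 0)" by (rule sum.swap)
  also have "\<dots> = (\<Sum>S\<in>spanned_simplices k X. k)"
  proof (intro sum.cong refl)
    fix S assume "S \<in> spanned_simplices k X"
    then have "S \<subseteq> X" "card S = k" by (auto simp: spanned_simplices_def regular_simplex_def)
    then show "(\<Sum>v\<in>X. if v \<in> S then 1 else 0) = k" using assms by (simp add: sum.If_cases Int_absorb1)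
  qed
  finally show ?thesis by simp
qed

lemma limit_degree_turan:
  assumes "1 \<le> k" "k \<le> r"
  shows "turan_dens r k = fact (k - 1) * limit_degree r k"
proof -
  obtain m where m: "k = Suc m" using assms by (cases k) auto
  obtain q where q: "r = Suc q" using assms by (cases r) auto
  have "real (Suc m) * real (r choose k) = real r * real (q choose m)"
    using Suc_times_binomial[of m q] unfolding m q by (metis of_nat_mult)
  then have "fact k * real (r choose k) / real r ^ k = fact m * real (q choose m) / real r ^ m"
  proof -
    assume *: "real (Suc m) * real (r choose k) = real r * real (q choose m)"
    have "fact k * real (r choose k) = fact m * (real (Suc m) * real (r choose k))"
      by (simp add: m algebra_simps)
    also have "\<dots> = real r * (fact m * real (q choose m))" unfolding * by simp
    finally have e: "fact k * real (r choose k) = real r * (fact m * real (q choose m))" .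
    show ?thesis unfolding e by (simp add: m q)
  qed
  then show ?thesis using turan_dens_binomial[of r k] assms by (simp add: limit_degree_def m q)
qed

definition fan :: "'a::metric_space \<Rightarrow> 'a \<Rightarrow> 'a \<Rightarrow> bool" where
  "fan v x y \<longleftrightarrow> x \<noteq> y \<and> dist v x = dist x y \<and> dist v y = dist x y"

text \<open>The three sides of the triangle agree, so one reference point \<open>x0\<close> fixes
  every distance of the box. This is the hypothesis of \<open>few_pairs\<close> for
  \<open>fan v\<close>.\<close>

lemma fan_equidistant:
  assumes "U \<noteq> {}" "U' \<noteq> {}" "\<forall>x\<in>U. \<forall>y\<in>U'. fan v x y"
  shows "equidistant_sets U U'"
proof -
  obtain x0 where x0: "x0 \<in> U" using assms by blast
  have "dist x y = dist v x0" if "x \<in> U" "y \<in> U'" for x y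
  proof -
    have "dist x y = dist v y" "dist x0 y = dist v y" "dist x0 y = dist v x0"
      using assms(3) that x0 unfolding fan_def by metis+
    then show ?thesis by simp
  qed
  then show ?thesis unfolding equidistant_sets_def by blast
qed

lemma card_transversals_split:
  fixes A :: "'i \<Rightarrow> 'a set"
  assumes I: "finite I" "\<And>j. j \<in> I \<Longrightarrow> finite (A j)" and i: "i \<in> I" and m: "m \<ge> 1" and X: "finite X" "(\<Union>j\<in>I. A j) \<subseteq> X"
  shows "card (transversals I A m) \<le> card (A i) * card X ^ (m - 1) + card (transversals (I - {i}) A m)"
proof -
  define B where "B x = {S. S \<subseteq> X \<and> card S = m \<and> {x} \<subseteq> S}" for x
  have finB: "finite (B x)" for x unfolding B_def using X by (intro finite_subset_family)
  have "transversals I A m \<subseteq> (\<Union>x\<in>A i. B x) \<union> transversals (I - {i}) A m"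
  proof
    fix S assume S: "S \<in> transversals I A m"
    show "S \<in> (\<Union>x\<in>A i. B x) \<union> transversals (I - {i}) A m"
    proof (cases "S \<inter> A i = {}")
      case True
      moreover have "S \<subseteq> (\<Union>j\<in>I. A j)" using S by (simp add: transversals_def)
      ultimately have "S \<subseteq> (\<Union>j\<in>I - {i}. A j)" by blast
      moreover from S have u: "\<forall>j\<in>I. \<forall>x\<in>S \<inter> A j. \<forall>y\<in>S \<inter> A j. x = y" "card S = m"
        by (simp_all add: transversals_def)
      moreover from u(1) have "\<forall>j\<in>I - {i}. \<forall>x\<in>S \<inter> A j. \<forall>y\<in>S \<inter> A j. x = y" by (meson DiffD1)
      ultimately have "S \<in> transversals (I - {i}) A m" unfolding transversals_def by simp
      then show ?thesis by blast
    next
      case False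
      then obtain x where "x \<in> S" "x \<in> A i" by blast
      moreover have "S \<subseteq> X" "card S = m" using S X(2) by (auto simp: transversals_def)
      ultimately have "x \<in> A i" "S \<in> B x" by (simp_all add: B_def)
      then show ?thesis by blast
    qed
  qed
  then have "card (transversals I A m) \<le> card ((\<Union>x\<in>A i. B x) \<union> transversals (I - {i}) A m)"
    using I i finB by (intro card_mono finite_UnI finite_transversals) auto
  also have "\<dots> \<le> card (\<Union>x\<in>A i. B x) + card (transversals (I - {i}) A m)" by (rule card_Un_le)
  also have "card (\<Union>x\<in>A i. B x) \<le> (\<Sum>x\<in>A i. card (B x))" using I i by (intro card_UN_le) auto
  also have "\<dots> \<le> (\<Sum>x\<in>A i. card X ^ (m - 1))"
  proof (rule sum_mono)
    fix x show "card (B x) \<le> card X ^ (m - 1)" using card_supersets_le[OF X(1), of "{x}" m] m by (simp add: B_def)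
  qed
  finally show ?thesis by simp
qed

text \<open>Three kinds of simplices through \<open>v\<close>: with another vertex outside the core,
  with two other vertices in one part, or with the rest a transversal. In the last case at least two
  vertices in different parts force the side \<open>t\<close>, so the rest consists of points at
  distance \<open>t\<close> from \<open>v\<close>.\<close>

lemma simplex_degree_upper:
  fixes Z :: "'i \<Rightarrow> 'a::euclidean_space set"
  assumes X: "finite X" and L: "lenz I Z t" and ZX: "\<And>i. i \<in> I \<Longrightarrow> Z i \<subseteq> X" and v: "v \<in> X" and k: "k \<ge> 3"
  shows "simplex_degree k X v \<le> card (X - (\<Union>i\<in>I. Z i)) * card X ^ (k - 2)
     + (\<Sum>i\<in>I. card {(x, y) \<in> Z i \<times> Z i. fan v x y}) * card X ^ (k - 3)
     + card (transversals I (\<lambda>i. {x \<in> Z i. dist x v = t}) (k - 1))"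
proof -
  interpret lenz I Z t by (rule L)
  define Lo where "Lo = X - (\<Union>i\<in>I. Z i)"
  define R where "R = (\<Union>i\<in>I. {(x, y) \<in> Z i \<times> Z i. fan v x y})"
  define A where "A i = {x \<in> Z i. dist x v = t}" for i
  define B1 where "B1 x = {S. S \<subseteq> X \<and> card S = k \<and> {v, x} \<subseteq> S}" for x
  define B2 where "B2 = (\<lambda>(x, y). {S. S \<subseteq> X \<and> card S = k \<and> {v, x, y} \<subseteq> S})"
  have finZ: "finite (Z i)" if "i \<in> I" for i using finite_subset[OF ZX[OF that] X] .
  have finRi: "finite {(x, y) \<in> Z i \<times> Z i. fan v x y}" if "i \<in> I" for i
    by (rule finite_subset[of _ "Z i \<times> Z i"]) (use finZ[OF that] in auto)
  have finR: "finite R" unfolding R_def using I(1) finRi by blast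
  have finB1: "finite (B1 x)" for x unfolding B1_def using X by (intro finite_subset_family)
  have finB2: "finite (B2 p)" for p unfolding B2_def using X by (auto split: prod.split intro: finite_subset_family)
  have finT: "finite (transversals I A (k - 1))" using I finZ by (intro finite_transversals) (auto simp: A_def)
  have "{S \<in> spanned_simplices k X. v \<in> S} \<subseteq> (\<Union>x\<in>Lo - {v}. B1 x) \<union> (\<Union>p\<in>R. B2 p) \<union> insert v ` transversals I A (k - 1)"
  proof
    fix S assume S: "S \<in> {S \<in> spanned_simplices k X. v \<in> S}"
    then have S': "S \<subseteq> X" "card S = k" "finite S" "v \<in> S" and "\<exists>d. \<forall>x\<in>S. \<forall>y\<in>S. x \<noteq> y \<longrightarrow> dist x y = d"
      by (simp_all add: spanned_simplices_def regular_simplex_def)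
    then obtain d where d: "\<forall>x\<in>S. \<forall>y\<in>S. x \<noteq> y \<longrightarrow> dist x y = d" by blast
    define S0 where "S0 = S - {v}"
    have cS0: "card S0 = k - 1" using S' by (simp add: S0_def)
    show "S \<in> (\<Union>x\<in>Lo - {v}. B1 x) \<union> (\<Union>p\<in>R. B2 p) \<union> insert v ` transversals I A (k - 1)"
    proof (cases "S0 \<subseteq> (\<Union>i\<in>I. Z i)")
      case False
      then obtain x where "x \<in> S0" "x \<notin> (\<Union>i\<in>I. Z i)" by blast
      then have "x \<in> Lo - {v}" "S \<in> B1 x" using S' by (auto simp: S0_def Lo_def B1_def)
      then show ?thesis by blast
    next
      case sub: True
      show ?thesis
      proof (cases "\<forall>i\<in>I. \<forall>x\<in>S0 \<inter> Z i. \<forall>y\<in>S0 \<inter> Z i. x = y")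
        case False
        then obtain i x y where xy: "i \<in> I" "x \<in> S0" "x \<in> Z i" "y \<in> S0" "y \<in> Z i" "x \<noteq> y" by blast
        then have "x \<in> S" "y \<in> S" "v \<noteq> x" "v \<noteq> y" by (auto simp: S0_def)
        then have "fan v x y" using d \<open>v \<in> S\<close> \<open>x \<noteq> y\<close> by (simp add: fan_def)
        then have "(x, y) \<in> R" using xy by (auto simp: R_def)
        moreover have "S \<in> B2 (x, y)" using S' xy by (simp add: B2_def S0_def)
        ultimately show ?thesis by blast
      next
        case uniq: True
        have "card S0 \<ge> 2" using cS0 k by simp
        then obtain P where "P \<subseteq> S0" "card P = 2" by (meson obtain_subset_with_card_n)
        then obtain x y where xy: "x \<in> S0" "y \<in> S0" "x \<noteq> y" by (auto simp: card_2_iff)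
        obtain i j where ij: "i \<in> I" "x \<in> Z i" "j \<in> I" "y \<in> Z j" using xy sub by blast
        have "i \<noteq> j" using uniq ij xy by blast
        then have "d = t" using cross[OF ij(1,3) _ ij(2,4)] d xy by (simp add: S0_def)
        have inA: "S0 \<inter> Z i = S0 \<inter> A i" for i using d S' \<open>d = t\<close> by (auto simp: A_def S0_def)
        have "S0 \<subseteq> (\<Union>i\<in>I. A i)" using sub inA by blast
        moreover have "\<forall>i\<in>I. \<forall>x\<in>S0 \<inter> A i. \<forall>y\<in>S0 \<inter> A i. x = y" using uniq inA by simp
        ultimately have "S0 \<in> transversals I A (k - 1)" using cS0 by (simp add: transversals_def)
        moreover have "S = insert v S0" using S' by (auto simp: S0_def)
        ultimately show ?thesis by blast
      qed
    qed
  qed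
  then have "simplex_degree k X v \<le> card ((\<Union>x\<in>Lo - {v}. B1 x) \<union> (\<Union>p\<in>R. B2 p) \<union> insert v ` transversals I A (k - 1))"
    unfolding simplex_degree_def using X finB1 finB2 finR finT by (intro card_mono) (auto simp: Lo_def)
  also have "\<dots> \<le> card (\<Union>x\<in>Lo - {v}. B1 x) + card (\<Union>p\<in>R. B2 p) + card (insert v ` transversals I A (k - 1))"
    by (meson add_right_mono card_Un_le order_trans)
  also have "\<dots> \<le> card Lo * card X ^ (k - 2) + (\<Sum>i\<in>I. card {(x, y) \<in> Z i \<times> Z i. fan v x y}) * card X ^ (k - 3) + card (transversals I A (k - 1))"
  proof (intro add_mono)
    have "card (\<Union>x\<in>Lo - {v}. B1 x) \<le> (\<Sum>x\<in>Lo - {v}. card (B1 x))" using X by (intro card_UN_le) (auto simp: Lo_def)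
    also have "\<dots> \<le> (\<Sum>x\<in>Lo - {v}. card X ^ (k - 2))"
    proof (rule sum_mono)
      fix x assume "x \<in> Lo - {v}"
      then have "card {v, x} = 2" by auto
      then show "card (B1 x) \<le> card X ^ (k - 2)" using card_supersets_le[OF X, of "{v, x}" k] k by (simp add: B1_def)
    qed
    also have "\<dots> \<le> card Lo * card X ^ (k - 2)" using X by (auto simp: Lo_def intro!: mult_right_mono card_mono)
    finally show "card (\<Union>x\<in>Lo - {v}. B1 x) \<le> card Lo * card X ^ (k - 2)" .
    have "card (\<Union>p\<in>R. B2 p) \<le> (\<Sum>p\<in>R. card (B2 p))" using finR by (intro card_UN_le)
    also have "\<dots> \<le> (\<Sum>p\<in>R. card X ^ (k - 3))"
    proof (rule sum_mono)
      fix p assume p: "p \<in> R"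
      obtain x y where xy: "p = (x, y)" by (cases p)
      then have f: "fan v x y" using p by (auto simp: R_def)
      then have "x \<noteq> y" "v \<noteq> x" "v \<noteq> y" by (auto simp: fan_def)
      then have "card {v, x, y} = 3" by simp
      then show "card (B2 p) \<le> card X ^ (k - 3)" using card_supersets_le[OF X, of "{v, x, y}" k] k by (simp add: B2_def xy)
    qed
    also have "\<dots> = card R * card X ^ (k - 3)" by simp
    also have "card R \<le> (\<Sum>i\<in>I. card {(x, y) \<in> Z i \<times> Z i. fan v x y})" unfolding R_def using I(1) by (rule card_UN_le)
    finally show "card (\<Union>p\<in>R. B2 p) \<le> (\<Sum>i\<in>I. card {(x, y) \<in> Z i \<times> Z i. fan v x y}) * card X ^ (k - 3)"
      by (simp add: mult_right_mono)
    show "card (insert v ` transversals I A (k - 1)) \<le> card (transversals I A (k - 1))" by (rule card_image_le[OF finT])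
  qed
  finally show ?thesis unfolding Lo_def A_def .
qed

text \<open>The lower bound \<open>\<theta>\<close> for part sizes is separate from the error
  \<open>\<epsilon>\<close>, which is chosen small only after \<open>\<theta>\<close> is
  fixed.\<close>

definition near_lenz :: "nat \<Rightarrow> nat \<Rightarrow> real \<Rightarrow> real \<Rightarrow> 'a::euclidean_space set \<Rightarrow> 'i set \<Rightarrow> ('i \<Rightarrow> 'a set) \<Rightarrow> real \<Rightarrow> bool" where
  "near_lenz r k \<epsilon> \<theta> X I Z t \<longleftrightarrow> finite X \<and> lenz I Z t \<and> card I = r \<and> (\<forall>i\<in>I. Z i \<subseteq> X) \<and>
     real (card (X - (\<Union>i\<in>I. Z i))) \<le> \<epsilon> * real (card X) \<and> (\<forall>i\<in>I. \<theta> * real (card X) \<le> real (card (Z i))) \<and>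
     (\<forall>v\<in>X. (limit_degree r k - \<epsilon>) * real (card X) ^ (k - 1) \<le> real (simplex_degree k X v))"

lemma near_lenz_mono: "near_lenz r k \<epsilon> \<theta> X I Z t \<Longrightarrow> \<epsilon> \<le> \<epsilon>' \<Longrightarrow> \<theta>' \<le> \<theta> \<Longrightarrow> near_lenz r k \<epsilon>' \<theta>' X I Z t"
  unfolding near_lenz_def
proof (elim conjE, intro conjI ballI)
  assume e: "\<epsilon> \<le> \<epsilon>'" "\<theta>' \<le> \<theta>"
  assume a: "real (card (X - (\<Union>i\<in>I. Z i))) \<le> \<epsilon> * real (card X)" "\<forall>i\<in>I. \<theta> * real (card X) \<le> real (card (Z i))"
    "\<forall>v\<in>X. (limit_degree r k - \<epsilon>) * real (card X) ^ (k - 1) \<le> real (simplex_degree k X v)"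
  have "\<epsilon> * real (card X) \<le> \<epsilon>' * real (card X)" using e by (intro mult_right_mono) auto
  then show "real (card (X - (\<Union>i\<in>I. Z i))) \<le> \<epsilon>' * real (card X)" using a by linarith
  show "\<theta>' * real (card X) \<le> real (card (Z i))" if "i \<in> I" for i
    using mult_right_mono[OF e(2), of "real (card X)"] a(2) that by force
  show "(limit_degree r k - \<epsilon>') * real (card X) ^ (k - 1) \<le> real (simplex_degree k X v)" if "v \<in> X" for v
    using mult_right_mono[of "limit_degree r k - \<epsilon>'" "limit_degree r k - \<epsilon>" "real (card X) ^ (k - 1)"] a(3) that e(1) by force
qed auto

text \<open>In \<open>(2 + real r) * \<epsilon>\<close>, one \<open>\<epsilon>\<close> is the slack
  of the degree, one pays for the points outside the parts, and each part takes one for its pairs in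
  \<open>fan v\<close>.\<close>

lemma near_lenz_transversals:
  fixes \<epsilon> :: real
  assumes k: "3 \<le> k" and \<epsilon>: "\<epsilon> > 0"
  shows "\<exists>n0. \<forall>X :: 'a::euclidean_space set. \<forall>(I :: 'i set) Z t v. near_lenz r k \<epsilon> \<theta> X I Z t \<longrightarrow> card X \<ge> n0 \<longrightarrow> v \<in> X \<longrightarrow>
     (limit_degree r k - (2 + real r) * \<epsilon>) * real (card X) ^ (k - 1)
       \<le> real (card (transversals I (\<lambda>i. {x \<in> Z i. dist x v = t}) (k - 1)))"
proof -
  from few_pairs[OF \<epsilon>, where ?'a = 'a] obtain n0 where n0: "\<forall>X :: 'a set. \<forall>A Q. finite X \<longrightarrow> card X \<ge> n0 \<longrightarrow> A \<subseteq> X \<longrightarrow> aff_dim A \<le> 3 \<longrightarrow>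
     (\<forall>U U'. U \<noteq> {} \<longrightarrow> U' \<noteq> {} \<longrightarrow> (\<forall>x\<in>U. \<forall>y\<in>U'. Q x y) \<longrightarrow> equidistant_sets U U') \<longrightarrow>
     real (card {(x, y) \<in> A \<times> A. Q x y}) \<le> \<epsilon> * real (card X) ^ 2" by auto
  have "(limit_degree r k - (2 + real r) * \<epsilon>) * real (card X) ^ (k - 1)
       \<le> real (card (transversals I (\<lambda>i. {x \<in> Z i. dist x v = t}) (k - 1)))"
    if N: "near_lenz r k \<epsilon> \<theta> X I Z t" and X: "card X \<ge> n0" and v: "v \<in> X" for X :: "'a set" and I :: "'i set" and Z t v
  proof -
    have N': "finite X" "lenz I Z t" "card I = r" "\<And>i. i \<in> I \<Longrightarrow> Z i \<subseteq> X"
      "real (card (X - (\<Union>i\<in>I. Z i))) \<le> \<epsilon> * real (card X)"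
      "(limit_degree r k - \<epsilon>) * real (card X) ^ (k - 1) \<le> real (simplex_degree k X v)"
      using N v by (auto simp: near_lenz_def)
    interpret lenz I Z t by (rule N'(2))
    define n where "n = real (card X)"
    have ad: "aff_dim (Z i) \<le> 3" if "i \<in> I" for i
      using aff_dim_subset[OF Z_subset[OF that]] aff_dim_\<Sigma>[OF that] by linarith
    have fans: "real (card {(x, y) \<in> Z i \<times> Z i. fan v x y}) \<le> \<epsilon> * n ^ 2" if "i \<in> I" for i
      unfolding n_def by (intro n0[rule_format] N' X that ad fan_equidistant) auto
    have "real (simplex_degree k X v) \<le> real (card (X - (\<Union>i\<in>I. Z i))) * n ^ (k - 2)
       + (\<Sum>i\<in>I. real (card {(x, y) \<in> Z i \<times> Z i. fan v x y})) * n ^ (k - 3)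
       + real (card (transversals I (\<lambda>i. {x \<in> Z i. dist x v = t}) (k - 1)))"
      using simplex_degree_upper[OF N'(1,2,4) v k] unfolding n_def
      by (simp flip: of_nat_sum of_nat_mult of_nat_power of_nat_add)
    also have "\<dots> \<le> \<epsilon> * n * n ^ (k - 2) + (\<Sum>i\<in>I. \<epsilon> * n ^ 2) * n ^ (k - 3) + real (card (transversals I (\<lambda>i. {x \<in> Z i. dist x v = t}) (k - 1)))"
      using N'(5) fans by (intro add_mono mult_right_mono sum_mono order_refl) (auto simp: n_def)
    also have "\<epsilon> * n * n ^ (k - 2) = \<epsilon> * n ^ (k - 1)"
    proof -
      have "Suc (k - 2) = k - 1" using k by simp
      then have "n * n ^ (k - 2) = n ^ (k - 1)" by (metis power_Suc)
      then show ?thesis by (simp add: mult.assoc)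
    qed
    also have "(\<Sum>i\<in>I. \<epsilon> * n ^ 2) * n ^ (k - 3) = real r * \<epsilon> * n ^ (k - 1)"
    proof -
      have "2 + (k - 3) = k - 1" using k by simp
      then have "n ^ 2 * n ^ (k - 3) = n ^ (k - 1)" by (metis power_add)
      then show ?thesis using N'(3) by (simp add: mult.assoc)
    qed
    finally show ?thesis using N'(6) by (simp add: n_def algebra_simps)
  qed
  then show ?thesis by blast
qed

text \<open>Pairs at distance \<open>t\<close> inside \<open>Z i\<close> are rare, so some
  \<open>v\<close> in \<open>Z i\<close> has few partners there, and its transversals essentially
  use the other \<open>r - 1\<close> parts. If \<open>Z i\<close> were too large, those would hold
  too few points for the degree of \<open>v\<close>.\<close>

lemma part_size_bound:
  fixes \<xi> \<theta> :: real
  assumes k: "3 \<le> k" "k \<le> r" and \<xi>: "\<xi> > 0" and \<theta>: "\<theta> > 0"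
  shows "\<exists>\<epsilon>0>0. \<forall>\<epsilon>. 0 < \<epsilon> \<longrightarrow> \<epsilon> \<le> \<epsilon>0 \<longrightarrow> (\<exists>n0. \<forall>X :: 'a::euclidean_space set. \<forall>(I :: 'i set) Z t i. near_lenz r k \<epsilon> \<theta> X I Z t \<longrightarrow> card X \<ge> n0 \<longrightarrow> i \<in> I \<longrightarrow>
     real (card (Z i)) \<le> (1 / real r + \<xi>) * real (card X))"
proof -
  define c where "c = real ((r - 1) choose (k - 1))"
  have c: "c > 0" using k by (simp add: c_def zero_less_binomial)
  have r: "real r > 1" using k by simp
  \<comment> \<open>An oversized part leaves at most \<open>(r - 1) * y * n\<close> points to the
    others, on average \<open>y * n\<close> and so less than the fair share \<open>n / r\<close>.
    The maximum with 0 covers large \<open>\<xi>\<close>.\<close>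
  define y where "y = max 0 (1 / real r - \<xi> / (real r - 1))"
  have y: "0 \<le> y" "y < 1 / real r" using \<xi> r by (auto simp: y_def)
  define g where "g = c * (1 / real r) ^ (k - 1) - c * y ^ (k - 1)"
  have "y ^ (k - 1) < (1 / real r) ^ (k - 1)" using y k by (intro power_strict_mono) auto
  then have g: "g > 0" using c by (simp add: g_def)
  define K where "K = 2 + real r + 1 / \<theta>"
  have K: "K > 0" using \<theta> by (simp add: K_def add_pos_pos)
  define \<epsilon>0 where "\<epsilon>0 = g / (2 * K)"
  have "\<exists>n0. \<forall>X :: 'a set. \<forall>(I :: 'i set) Z t i. near_lenz r k \<epsilon> \<theta> X I Z t \<longrightarrow> card X \<ge> n0 \<longrightarrow> i \<in> I \<longrightarrow>
     real (card (Z i)) \<le> (1 / real r + \<xi>) * real (card X)" if \<epsilon>: "0 < \<epsilon>" "\<epsilon> \<le> \<epsilon>0" for \<epsilon>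
  proof -
    from near_lenz_transversals[OF k(1) \<epsilon>(1), where ?'a = 'a and ?'i = 'i] obtain n1 where n1: "\<forall>X :: 'a::euclidean_space set. \<forall>(I :: 'i set) Z t v. near_lenz r k \<epsilon> \<theta> X I Z t \<longrightarrow> card X \<ge> n1 \<longrightarrow> v \<in> X \<longrightarrow>
     (limit_degree r k - (2 + real r) * \<epsilon>) * real (card X) ^ (k - 1)
       \<le> real (card (transversals I (\<lambda>i. {x \<in> Z i. dist x v = t}) (k - 1)))" ..
    from few_pairs[OF \<epsilon>(1), where ?'a = 'a] obtain n2 where n2: "\<forall>X :: 'a set. \<forall>A Q. finite X \<longrightarrow> card X \<ge> n2 \<longrightarrow> A \<subseteq> X \<longrightarrow> aff_dim A \<le> 3 \<longrightarrow>
     (\<forall>U U'. U \<noteq> {} \<longrightarrow> U' \<noteq> {} \<longrightarrow> (\<forall>x\<in>U. \<forall>y\<in>U'. Q x y) \<longrightarrow> equidistant_sets U U') \<longrightarrow>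
     real (card {(x, y) \<in> A \<times> A. Q x y}) \<le> \<epsilon> * real (card X) ^ 2" by auto
    have "real (card (Z i)) \<le> (1 / real r + \<xi>) * real (card X)"
      if N: "near_lenz r k \<epsilon> \<theta> X I Z t" and X: "card X \<ge> Max {1, n1, n2}" and i: "i \<in> I" for X :: "'a set" and I :: "'i set" and Z t i
    proof (rule ccontr)
      assume neg: "\<not> ?thesis"
      have X': "card X \<ge> 1" "card X \<ge> n1" "card X \<ge> n2" using X by auto
      have N': "finite X" "lenz I Z t" "card I = r" "\<And>i. i \<in> I \<Longrightarrow> Z i \<subseteq> X" "\<theta> * real (card X) \<le> real (card (Z i))"
        using N i by (auto simp: near_lenz_def)
      interpret lenz I Z t by (rule N'(2))
      define n where "n = real (card X)"
      have n: "n > 0" using X' by (simp add: n_def)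
      have finZ: "finite (Z j)" if "j \<in> I" for j using finite_subset[OF N'(4)[OF that] N'(1)] .
      have ad: "aff_dim (Z i) \<le> 3"
        using aff_dim_subset[OF Z_subset[OF i]] aff_dim_\<Sigma>[OF i] by linarith
      have "real (card {(x, y) \<in> Z i \<times> Z i. dist x y = t}) \<le> \<epsilon> * n ^ 2"
        unfolding n_def
      proof (intro n2[rule_format] N' X' i ad)
        fix U U' :: "'a set" assume "\<And>x y. x \<in> U \<Longrightarrow> y \<in> U' \<Longrightarrow> dist x y = t"
        then show "equidistant_sets U U'" unfolding equidistant_sets_def by (intro exI[of _ t] ballI)
      qed
      moreover have "{(x, y) \<in> Z i \<times> Z i. dist x y = t} = Sigma (Z i) (\<lambda>v. {x \<in> Z i. dist x v = t})"
        by (auto simp: dist_commute)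
      ultimately have tot: "(\<Sum>v\<in>Z i. real (card {x \<in> Z i. dist x v = t})) \<le> \<epsilon> * n ^ 2"
        using finZ[OF i] by (simp add: card_SigmaI)
      have "\<exists>v\<in>Z i. real (card {x \<in> Z i. dist x v = t}) \<le> \<epsilon> / \<theta> * n"
      proof (rule ccontr)
        assume "\<not> ?thesis"
        then have "(\<Sum>v\<in>Z i. real (card {x \<in> Z i. dist x v = t})) > (\<Sum>v\<in>Z i. \<epsilon> / \<theta> * n)"
          using finZ[OF i] Z_ne[OF i] by (intro sum_strict_mono) (auto simp: not_le)
        then have "real (card (Z i)) * (\<epsilon> / \<theta> * n) < \<epsilon> * n ^ 2" using tot by simp
        moreover have "\<theta> * n * (\<epsilon> / \<theta> * n) \<le> real (card (Z i)) * (\<epsilon> / \<theta> * n)"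
          using N'(5) \<epsilon> \<theta> n by (intro mult_right_mono) (auto simp: n_def)
        moreover have "\<theta> * n * (\<epsilon> / \<theta> * n) = \<epsilon> * n ^ 2" using \<theta> by (simp add: power2_eq_square)
        ultimately show False by linarith
      qed
      then obtain v where v: "v \<in> Z i" "real (card {x \<in> Z i. dist x v = t}) \<le> \<epsilon> / \<theta> * n" by blast
      define A where "A j = {x \<in> Z j. dist x v = t}" for j
      have finA: "finite (A j)" if "j \<in> I" for j using finZ[OF that] by (simp add: A_def)
      have disjA: "A j \<inter> A l = {}" if "j \<in> I" "l \<in> I" "j \<noteq> l" for j l
      proof -
        have "x \<notin> Z l" if "x \<in> Z j" for x using cross[OF \<open>j \<in> I\<close> \<open>l \<in> I\<close> \<open>j \<noteq> l\<close> that, of x] t by auto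
        then show ?thesis by (auto simp: A_def)
      qed
      have AX: "(\<Union>j\<in>I. A j) \<subseteq> X" using N'(4) by (auto simp: A_def)
      define m where "m = card (\<Union>j\<in>I-{i}. A j)"
      have mZ: "real m \<le> n - real (card (Z i))"
      proof -
        have "(\<Union>j\<in>I-{i}. A j) \<inter> Z i = {}"
        proof -
          have "x \<notin> Z i" if "j \<in> I - {i}" "x \<in> Z j" for x j using cross[of j i x x] that i t by auto
          then show ?thesis by (auto simp: A_def)
        qed
        then have "m + card (Z i) = card ((\<Union>j\<in>I-{i}. A j) \<union> Z i)"
          unfolding m_def using I(1) finA finZ i by (subst card_Un_disjoint) auto
        also have "\<dots> \<le> card X" using AX N'(4)[OF i] N'(1) by (intro card_mono) auto
        finally show ?thesis by (simp add: n_def)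
      qed
      have "real m \<le> (real r - 1) * (y * n)"
      proof -
        have "real m < n - (1 / real r + \<xi>) * n" using mZ neg by (simp add: n_def)
        also have "\<dots> = (real r - 1) * (1 / real r - \<xi> / (real r - 1)) * n" using r by (simp add: field_simps)
        also have "\<dots> \<le> (real r - 1) * y * n" using r n by (intro mult_right_mono mult_left_mono) (auto simp: y_def)
        finally show ?thesis by (simp add: mult.assoc)
      qed
      then have my: "real m / (real r - 1) \<le> y * n" using r by (simp add: pos_divide_le_eq mult.commute)
      have "card (transversals I A (k - 1)) \<le> card (A i) * card X ^ (k - 1 - 1) + card (transversals (I - {i}) A (k - 1))"
        using finA I(1) i N'(1) AX k by (intro card_transversals_split) auto
      then have "real (card (transversals I A (k - 1))) \<le> real (card (A i)) * n ^ (k - 2) + real (card (transversals (I - {i}) A (k - 1)))"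
      proof -
        assume le: "card (transversals I A (k - 1)) \<le> card (A i) * card X ^ (k - 1 - 1) + card (transversals (I - {i}) A (k - 1))"
        have "k - 1 - 1 = k - 2" by simp
        then show ?thesis using le unfolding n_def by (simp flip: of_nat_mult of_nat_power of_nat_add)
      qed
      also have "real (card (transversals (I - {i}) A (k - 1))) \<le> real (card (I - {i}) choose (k - 1)) * (real m / real (card (I - {i}))) ^ (k - 1)"
        unfolding m_def using I(1) finA disjA k N'(3) i by (intro card_transversals_turan) auto
      also have "\<dots> = c * (real m / (real r - 1)) ^ (k - 1)" using N'(3) i I(1) k by (simp add: c_def of_nat_diff)
      also have "\<dots> \<le> c * (y * n) ^ (k - 1)" using c my r by (intro mult_left_mono power_mono) auto
      also have "real (card (A i)) * n ^ (k - 2) \<le> \<epsilon> / \<theta> * n * n ^ (k - 2)" using v(2) n by (intro mult_right_mono) (auto simp: A_def)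
      also have "\<epsilon> / \<theta> * n * n ^ (k - 2) = \<epsilon> / \<theta> * n ^ (k - 1)"
      proof -
        have "Suc (k - 2) = k - 1" using k by simp
        then have "n * n ^ (k - 2) = n ^ (k - 1)" by (metis power_Suc)
        then show ?thesis by (simp add: mult.assoc)
      qed
      finally have up: "real (card (transversals I A (k - 1))) \<le> \<epsilon> / \<theta> * n ^ (k - 1) + c * (y * n) ^ (k - 1)" by simp
      have "v \<in> X" using v N'(4)[OF i] by blast
      then have "(limit_degree r k - (2 + real r) * \<epsilon>) * n ^ (k - 1) \<le> real (card (transversals I A (k - 1)))"
        unfolding n_def A_def by (intro n1[rule_format, OF N X'(2)])
      then have "(limit_degree r k - (2 + real r) * \<epsilon>) * n ^ (k - 1) \<le> (\<epsilon> / \<theta> + c * y ^ (k - 1)) * n ^ (k - 1)"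
        using up by (simp add: power_mult_distrib algebra_simps)
      then have "limit_degree r k - (2 + real r) * \<epsilon> \<le> \<epsilon> / \<theta> + c * y ^ (k - 1)" using n by simp
      moreover have "limit_degree r k = c * (1 / real r) ^ (k - 1)" by (simp add: limit_degree_def c_def power_divide)
      ultimately have "g \<le> K * \<epsilon>" by (simp add: g_def K_def algebra_simps)
      also have "\<dots> \<le> K * \<epsilon>0" using K \<epsilon> by (intro mult_left_mono) auto
      also have "\<dots> = g / 2" using K by (simp add: \<epsilon>0_def)
      finally show False using g by simp
    qed
    then show ?thesis by blast
  qed
  moreover have "\<epsilon>0 > 0" using g K by (simp add: \<epsilon>0_def)
  ultimately show ?thesis by blast
qed

text \<open>Deficits in two parts destroy a positive proportion of the transversals at
  \<open>v\<close>, contrary to its degree. The bound with \<open>max 2\<close> treats two kinds of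
  deficit at once: at most two partners, as in a planar part, or \<open>\<mu> * n\<close> missing
  ones.\<close>

lemma not_both_deficient:
  fixes \<mu> \<theta> :: real
  assumes k: "3 \<le> k" "k \<le> r" and \<theta>: "\<theta> > 0" and \<mu>: "0 < \<mu>" "\<mu> \<le> 1 / (2 * real r)"
  shows "\<exists>\<epsilon>>0. \<exists>n0. \<forall>X :: 'a::euclidean_space set. \<forall>(I :: 'i set) Z t v i j. near_lenz r k \<epsilon> \<theta> X I Z t \<longrightarrow> card X \<ge> n0 \<longrightarrow>
     v \<in> X \<longrightarrow> i \<in> I \<longrightarrow> j \<in> I \<longrightarrow> i \<noteq> j \<longrightarrow> card {x \<in> Z i. dist x v = t} \<le> 2 \<longrightarrow>
     \<not> real (card {x \<in> Z j. dist x v = t}) \<le> max 2 (real (card (Z j)) - \<mu> * real (card X))"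
proof -
  define c where "c = real ((r - 1) choose (k - 1))"
  have c: "c \<ge> 0" by (simp add: c_def)
  have r: "real r \<ge> 3" using k by simp
  \<comment> \<open>The least loss, in units of \<open>n ^ (k - 1)\<close>, in a product of part
    sizes that involves part \<open>j\<close>.\<close>
  define h where "h = \<mu> * (1 / real r) ^ (k - 2)"
  have h: "h > 0" using \<mu> r by (simp add: h_def)
  define f where "f x = c * (1 / real r + x) ^ (k - 1)" for x
  have "isCont f 0" unfolding f_def by (intro continuous_intros)
  then have "(f \<longlongrightarrow> f 0) (at 0)" by (simp add: isCont_def)
  then have "eventually (\<lambda>x. f x < f 0 + h / 4) (at 0)" using h by (intro order_tendstoD) auto
  then obtain d where d: "d > 0" "\<And>x. x \<noteq> 0 \<Longrightarrow> dist x 0 < d \<Longrightarrow> f x < f 0 + h / 4"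
    unfolding eventually_at by auto
  \<comment> \<open>Parts may exceed \<open>n / r\<close> by \<open>\<xi> * n\<close>; by continuity
    this raises the main term by less than \<open>h / 4\<close>.\<close>
  define \<xi> where "\<xi> = d / 2"
  have \<xi>: "\<xi> > 0" "f \<xi> < f 0 + h / 4" using d by (auto simp: \<xi>_def)
  have f0: "f 0 = limit_degree r k" by (simp add: f_def limit_degree_def c_def power_divide)
  obtain \<epsilon>0 where \<epsilon>0: "\<epsilon>0 > 0" and size: "\<forall>\<epsilon>. 0 < \<epsilon> \<longrightarrow> \<epsilon> \<le> \<epsilon>0 \<longrightarrow> (\<exists>n0. \<forall>X :: 'a set. \<forall>(I :: 'i set) Z t i. near_lenz r k \<epsilon> \<theta> X I Z t \<longrightarrow> card X \<ge> n0 \<longrightarrow> i \<in> I \<longrightarrow>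
     real (card (Z i)) \<le> (1 / real r + \<xi>) * real (card X))"
    using part_size_bound[OF k \<xi>(1) \<theta>, where ?'a = 'a and ?'i = 'i] by (elim exE conjE)
  define \<epsilon> where "\<epsilon> = min \<epsilon>0 (h / (8 * (2 + real r)))"
  have \<epsilon>: "\<epsilon> > 0" "\<epsilon> \<le> \<epsilon>0" using \<epsilon>0 h by (auto simp: \<epsilon>_def)
  have "\<epsilon> \<le> h / (8 * (2 + real r))" by (simp add: \<epsilon>_def)
  then have \<epsilon>h: "(2 + real r) * \<epsilon> \<le> h / 8" by (simp add: field_simps)
  from size[rule_format, OF \<epsilon>] obtain n1 where n1: "\<forall>X :: 'a set. \<forall>(I :: 'i set) Z t i. near_lenz r k \<epsilon> \<theta> X I Z t \<longrightarrow> card X \<ge> n1 \<longrightarrow> i \<in> I \<longrightarrow>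
     real (card (Z i)) \<le> (1 / real r + \<xi>) * real (card X)" ..
  from near_lenz_transversals[OF k(1) \<epsilon>(1), where ?'a = 'a and ?'i = 'i] obtain n2 where n2: "\<forall>X :: 'a::euclidean_space set. \<forall>(I :: 'i set) Z t v. near_lenz r k \<epsilon> \<theta> X I Z t \<longrightarrow> card X \<ge> n2 \<longrightarrow> v \<in> X \<longrightarrow>
     (limit_degree r k - (2 + real r) * \<epsilon>) * real (card X) ^ (k - 1)
       \<le> real (card (transversals I (\<lambda>i. {x \<in> Z i. dist x v = t}) (k - 1)))" ..
  define n0 where "n0 = Max {n1, n2, 4 * r, nat \<lceil>16 / h\<rceil>}"
  have False
    if N: "near_lenz r k \<epsilon> \<theta> X I Z t" and X: "card X \<ge> n0" and v: "v \<in> X" and ij: "i \<in> I" "j \<in> I" "i \<noteq> j"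
      and di: "card {x \<in> Z i. dist x v = t} \<le> 2"
      and dj: "real (card {x \<in> Z j. dist x v = t}) \<le> max 2 (real (card (Z j)) - \<mu> * real (card X))"
    for X :: "'a set" and I :: "'i set" and Z t v i j
  proof -
    have X': "card X \<ge> n1" "card X \<ge> n2" "card X \<ge> 4 * r" "card X \<ge> nat \<lceil>16 / h\<rceil>" using X by (auto simp: n0_def)
    have N': "finite X" "lenz I Z t" "card I = r" "\<And>i. i \<in> I \<Longrightarrow> Z i \<subseteq> X" using N by (auto simp: near_lenz_def)
    interpret lenz I Z t by (rule N'(2))
    define n where "n = real (card X)"
    have n: "n \<ge> 4 * real r" "n \<ge> 16 / h" using X'(3,4) unfolding n_def by linarith+
    have npos: "n > 0" using n r by linarith
    have finZ: "finite (Z l)" if "l \<in> I" for l using finite_subset[OF N'(4)[OF that] N'(1)] .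
    define A where "A l = {x \<in> Z l. dist x v = t}" for l
    have finA: "finite (A l)" if "l \<in> I" for l using finZ[OF that] by (simp add: A_def)
    have disjA: "A l \<inter> A l' = {}" if "l \<in> I" "l' \<in> I" "l \<noteq> l'" for l l'
    proof -
      have "x \<notin> Z l'" if "x \<in> Z l" for x using cross[OF \<open>l \<in> I\<close> \<open>l' \<in> I\<close> \<open>l \<noteq> l'\<close> that, of x] t by auto
      then show ?thesis by (auto simp: A_def)
    qed
    have AX: "(\<Union>l\<in>I. A l) \<subseteq> X" using N'(4) by (auto simp: A_def)
    define M where "M = (1 / real r + \<xi>) * n"
    have Mr: "M \<ge> n / real r" using \<xi> npos by (simp add: M_def field_simps)
    have M0: "M > 0" using \<xi> npos r by (simp add: M_def add_pos_pos)
    have ZM: "real (card (Z l)) \<le> M" if "l \<in> I" for l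
      unfolding M_def n_def by (intro n1[rule_format, OF N X'(1) that])
    have AM: "real (card (A l)) \<le> M" if "l \<in> I" for l
    proof -
      have "card (A l) \<le> card (Z l)" using finZ[OF that] by (intro card_mono) (auto simp: A_def)
      then show ?thesis using ZM[OF that] by linarith
    qed
    have AjM: "real (card (A j)) \<le> M - \<mu> * n"
    proof -
      have "\<mu> * n \<le> 1 / (2 * real r) * n" using \<mu> npos by (intro mult_right_mono) auto
      moreover have "n / real r = 2 * (1 / (2 * real r) * n)" using r by simp
      moreover have "1 / (2 * real r) * n \<ge> 2" using n r by (simp add: field_simps)
      ultimately have "2 \<le> M - \<mu> * n" using Mr by linarith
      then show ?thesis using dj ZM[OF ij(2)] by (simp add: A_def n_def max_def split: if_splits)
    qed
    define \<J> where "\<J> = {J. J \<subseteq> I - {i} \<and> card J = k - 1}"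
    have fin\<J>: "finite \<J>" unfolding \<J>_def using I(1) by (intro finite_subset_family) simp
    have c\<J>: "real (card \<J>) = c" unfolding \<J>_def using n_subsets[of "I - {i}" "k - 1"] I(1) N'(3) ij by (simp add: c_def)
    have "\<exists>J0\<in>\<J>. j \<in> J0"
    proof -
      have "k - 2 \<le> card (I - {i, j})" using I(1) ij N'(3) k by simp
      then obtain J1 where J1: "J1 \<subseteq> I - {i, j}" "card J1 = k - 2" by (meson obtain_subset_with_card_n)
      then have "finite J1" "j \<notin> J1" using I(1) finite_subset by auto
      then have "card (insert j J1) = k - 1" using J1(2) k by simp
      then have "insert j J1 \<in> \<J>" using J1 ij by (auto simp: \<J>_def)
      then show ?thesis by blast
    qed
    then obtain J0 where J0: "J0 \<in> \<J>" "j \<in> J0" by blast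
    have prodJ: "(\<Prod>l\<in>J. real (card (A l))) \<le> M ^ (k - 1) - (if j \<in> J then \<mu> * n * M ^ (k - 2) else 0)" if J: "J \<in> \<J>" for J
    proof -
      have J': "J \<subseteq> I" "card J = k - 1" "finite J" using J I(1) finite_subset[of J I] by (auto simp: \<J>_def)
      show ?thesis
      proof (cases "j \<in> J")
        case False
        have "(\<Prod>l\<in>J. real (card (A l))) \<le> (\<Prod>l\<in>J. M)" using J' AM by (intro prod_mono) auto
        then show ?thesis using False J' by simp
      next
        case True
        have "(\<Prod>l\<in>J. real (card (A l))) = real (card (A j)) * (\<Prod>l\<in>J - {j}. real (card (A l)))"
          using J' True by (simp add: prod.remove)
        also have "\<dots> \<le> (M - \<mu> * n) * (\<Prod>l\<in>J - {j}. M)"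
          using J' AM AjM by (intro mult_mono prod_mono prod_nonneg) (auto intro: order_trans[OF _ AjM])
        also have "(\<Prod>l\<in>J - {j}. M) = M ^ (k - 2)" using J' True by (simp add: numeral_2_eq_2)
        also have "(M - \<mu> * n) * M ^ (k - 2) = M ^ (k - 1) - \<mu> * n * M ^ (k - 2)"
        proof -
          have "Suc (k - 2) = k - 1" using k by simp
          then have "M * M ^ (k - 2) = M ^ (k - 1)" by (metis power_Suc)
          then show ?thesis by (simp add: left_diff_distrib)
        qed
        finally show ?thesis using True by simp
      qed
    qed
    have "real (card (transversals (I - {i}) A (k - 1))) \<le> (\<Sum>J\<in>\<J>. \<Prod>l\<in>J. real (card (A l)))"
    proof -
      have "card (transversals (I - {i}) A (k - 1)) \<le> (\<Sum>J\<in>\<J>. \<Prod>l\<in>J. card (A l))"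
        unfolding \<J>_def using I(1) finA disjA by (intro card_transversals_le_sum) auto
      then have "real (card (transversals (I - {i}) A (k - 1))) \<le> real (\<Sum>J\<in>\<J>. \<Prod>l\<in>J. card (A l))" by (simp only: of_nat_le_iff)
      then show ?thesis by simp
    qed
    also have "\<dots> \<le> (\<Sum>J\<in>\<J>. M ^ (k - 1) - (if j \<in> J then \<mu> * n * M ^ (k - 2) else 0))"
      by (intro sum_mono prodJ)
    also have "\<dots> = c * M ^ (k - 1) - (\<Sum>J\<in>\<J>. if j \<in> J then \<mu> * n * M ^ (k - 2) else 0)"
      by (simp add: sum_subtractf c\<J>)
    finally have T0: "real (card (transversals (I - {i}) A (k - 1)))
        \<le> c * M ^ (k - 1) - (\<Sum>J\<in>\<J>. if j \<in> J then \<mu> * n * M ^ (k - 2) else 0)" .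
    have "(\<Sum>J\<in>\<J>. if j \<in> J then \<mu> * n * M ^ (k - 2) else 0) \<ge> \<mu> * n * M ^ (k - 2)"
      using member_le_sum[of J0 \<J> "\<lambda>J. if j \<in> J then \<mu> * n * M ^ (k - 2) else 0"] J0 fin\<J> \<mu> npos M0 by simp
    moreover have "\<mu> * n * M ^ (k - 2) \<ge> \<mu> * n * (n / real r) ^ (k - 2)"
      using \<mu> npos Mr r by (intro mult_left_mono power_mono) auto
    ultimately have T1: "real (card (transversals (I - {i}) A (k - 1))) \<le> c * M ^ (k - 1) - \<mu> * n * (n / real r) ^ (k - 2)"
      using T0 by linarith
    have kk: "n * n ^ (k - 2) = n ^ (k - 1)"
    proof -
      have "Suc (k - 2) = k - 1" using k by simp
      then show ?thesis by (metis power_Suc)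
    qed
    have "\<mu> * n * (n / real r) ^ (k - 2) = h * n ^ (k - 1)"
      unfolding kk[symmetric] by (simp add: h_def power_divide)
    moreover have "c * M ^ (k - 1) = f \<xi> * n ^ (k - 1)" by (simp add: M_def f_def power_mult_distrib)
    ultimately have T2: "real (card (transversals (I - {i}) A (k - 1))) \<le> (f \<xi> - h) * n ^ (k - 1)"
      using T1 by (simp add: left_diff_distrib)
    have "card (transversals I A (k - 1)) \<le> card (A i) * card X ^ (k - 1 - 1) + card (transversals (I - {i}) A (k - 1))"
      using finA I(1) ij N'(1) AX k by (intro card_transversals_split) auto
    also have "card (A i) * card X ^ (k - 1 - 1) \<le> 2 * card X ^ (k - 1 - 1)" using di by (intro mult_right_mono) (simp_all add: A_def)
    also have "k - 1 - 1 = k - 2" by simp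
    finally have "real (card (transversals I A (k - 1))) \<le> 2 * n ^ (k - 2) + real (card (transversals (I - {i}) A (k - 1)))"
      unfolding n_def by (simp flip: of_nat_mult of_nat_power of_nat_add)
    moreover have "2 * n ^ (k - 2) \<le> h / 8 * n ^ (k - 1)"
    proof -
      have "2 \<le> h / 8 * n" using n(2) h by (simp add: field_simps)
      then have "2 * n ^ (k - 2) \<le> h / 8 * n * n ^ (k - 2)" using npos by (intro mult_right_mono) auto
      then show ?thesis unfolding kk[symmetric] by (simp only: mult.assoc)
    qed
    ultimately have "real (card (transversals I A (k - 1))) \<le> (h / 8 + (f \<xi> - h)) * n ^ (k - 1)"
      using T2 by (simp only: distrib_right)
    moreover have "(limit_degree r k - (2 + real r) * \<epsilon>) * n ^ (k - 1) \<le> real (card (transversals I A (k - 1)))"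
      unfolding n_def A_def by (intro n2[rule_format, OF N X'(2) v])
    ultimately have "(limit_degree r k - (2 + real r) * \<epsilon>) * n ^ (k - 1) \<le> (h / 8 + (f \<xi> - h)) * n ^ (k - 1)" by linarith
    then have "limit_degree r k - (2 + real r) * \<epsilon> \<le> h / 8 + (f \<xi> - h)" using npos by (simp add: mult_le_cancel_right_pos)
    \<comment> \<open>The errors \<open>h / 8\<close>, \<open>h / 8\<close> and \<open>h / 4\<close>
      stay below the loss \<open>h\<close>.\<close>
    then show False using \<xi>(2) \<epsilon>h h f0 by linarith
  qed
  then show ?thesis using \<epsilon>(1) by blast
qed

lemma near_lenz_exists:
  assumes dim: "DIM('a::euclidean_space) = 2 * r + 1" and k: "3 \<le> k" "k \<le> r"
  shows "\<exists>\<theta>>0. \<forall>\<nu>>0. \<exists>\<epsilon>>0. \<exists>n0. \<forall>X :: 'a set. finite X \<longrightarrow> card X \<ge> n0 \<longrightarrow>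
     (\<forall>v\<in>X. (limit_degree r k - \<epsilon>) * real (card X) ^ (k - 1) \<le> real (simplex_degree k X v)) \<longrightarrow>
     (\<exists>(I :: 'a set) Z t. near_lenz r k \<nu> \<theta> X I Z t)"
proof -
  define \<theta> where "\<theta> = turan_dens r r / (16 * fact r)"
  have \<tau>: "turan_dens r r > 0" by (rule turan_dens_pos) simp
  then have \<theta>: "\<theta> > 0" by (simp add: \<theta>_def)
  define D where "D = real DIM('a) + 1"
  have D: "D > 0" by (simp add: D_def add_pos_pos)
  have r: "real r > 0" "r \<ge> 3" using k by auto
  have "\<exists>\<epsilon>>0. \<exists>n0. \<forall>X :: 'a set. finite X \<longrightarrow> card X \<ge> n0 \<longrightarrow>
     (\<forall>v\<in>X. (limit_degree r k - \<epsilon>) * real (card X) ^ (k - 1) \<le> real (simplex_degree k X v)) \<longrightarrow>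
     (\<exists>(I :: 'a set) Z t. near_lenz r k \<nu> (\<theta> / 2) X I Z t)" if \<nu>: "\<nu> > 0" for \<nu>
  proof -
    \<comment> \<open>All parts together may lose at most \<open>\<nu> / 2 * n\<close> points, and a
      single part at most \<open>\<theta> / 2 * n\<close>.\<close>
    define \<kappa> where "\<kappa> = min (\<nu> / (2 * D * real r)) (\<theta> / (2 * D))"
    have \<kappa>: "\<kappa> > 0" using \<nu> \<theta> D r by (simp add: \<kappa>_def)
    have "\<kappa> \<le> \<nu> / (2 * D * real r)" "\<kappa> \<le> \<theta> / (2 * D)" by (simp_all add: \<kappa>_def)
    then have \<kappa>': "real r * (\<kappa> * D) \<le> \<nu> / 2" "\<kappa> * D \<le> \<theta> / 2" using D r by (simp_all add: field_simps)
    define \<eta> where "\<eta> = min (\<kappa>\<^sup>2 / 2) (\<nu> / 2)"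
    have \<eta>: "\<eta> > 0" "\<eta> < \<kappa>\<^sup>2" "\<eta> \<le> \<nu> / 2" using \<kappa> \<nu> by (auto simp: \<eta>_def min_def)
    define K where "K = (real r + 1) * (2 * real r + 1) + 1"
    have K: "K > 0" by (simp add: K_def add_pos_pos)
    define \<delta> where "\<delta> = min (turan_dens r r / 2) (2 * \<theta> * min \<eta> \<theta> / K)"
    have \<delta>: "\<delta> > 0" "\<delta> \<le> turan_dens r r / 2" using \<tau> \<theta> \<eta> K by (simp_all add: \<delta>_def)
    have "\<delta> \<le> 2 * \<theta> * min \<eta> \<theta> / K" by (simp add: \<delta>_def)
    then have \<delta>K: "\<delta> * K \<le> 2 * \<theta> * min \<eta> \<theta>" using K by (simp add: pos_le_divide_eq)
    obtain e \<epsilon>1 n1 where e: "e > 0" "\<epsilon>1 > 0" and n1: "\<forall>X :: 'a set. finite X \<longrightarrow> card X \<ge> n1 \<longrightarrow>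
       turan_dens r k - \<epsilon>1 \<le> fact k * real (card (spanned_simplices k X)) / real (card X) ^ k \<longrightarrow>
       (\<forall>s. 2 \<le> s \<longrightarrow> s \<le> r \<longrightarrow> \<bar>hereditary.dens X (regular_clique X e) s - turan_dens r s\<bar> < \<delta>) \<and>
       hereditary.dens X (regular_clique X e) (Suc r) < \<delta>"
      using regular_densities[OF dim k \<delta>(1)] by (elim exE conjE)
    \<comment> \<open>Degrees within \<open>\<epsilon>\<close> of the limit give a simplex density
      within \<open>fact (k - 1) * \<epsilon>\<close> of \<open>turan_dens r k\<close>.\<close>
    define \<epsilon> where "\<epsilon> = min \<nu> (\<epsilon>1 / fact (k - 1))"
    have \<epsilon>: "\<epsilon> > 0" "\<epsilon> \<le> \<nu>" "fact (k - 1) * \<epsilon> \<le> \<epsilon>1" using \<nu> e by (auto simp: \<epsilon>_def min_def field_simps)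
    define n0 where "n0 = Max {1, n1, nat \<lceil>6 / \<theta>\<rceil>}"
    have "\<exists>(I :: 'a set) Z t. near_lenz r k \<nu> (\<theta> / 2) X I Z t"
      if X: "finite X" "card X \<ge> n0"
        and deg: "\<forall>v\<in>X. (limit_degree r k - \<epsilon>) * real (card X) ^ (k - 1) \<le> real (simplex_degree k X v)" for X :: "'a set"
    proof -
      define n where "n = real (card X)"
      have X': "card X > 0" "card X \<ge> n1" "card X \<ge> nat \<lceil>6 / \<theta>\<rceil>" using X(2) by (auto simp: n0_def)
      have n: "n > 0" "n \<ge> 6 / \<theta>" using X' unfolding n_def by linarith+
      have "turan_dens r k - \<epsilon>1 \<le> fact k * real (card (spanned_simplices k X)) / real (card X) ^ k"
      proof -
        have "n * ((limit_degree r k - \<epsilon>) * n ^ (k - 1)) = (\<Sum>v\<in>X. (limit_degree r k - \<epsilon>) * n ^ (k - 1))" by (simp add: n_def)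
        also have "\<dots> \<le> (\<Sum>v\<in>X. real (simplex_degree k X v))" using deg by (intro sum_mono) (simp add: n_def)
        also have "\<dots> = real (k * card (spanned_simplices k X))" using sum_simplex_degree[OF X(1), of k] by (simp only: of_nat_sum[symmetric])
        finally have "(limit_degree r k - \<epsilon>) * (n * n ^ (k - 1)) \<le> real k * real (card (spanned_simplices k X))" by (simp add: mult_ac)
        moreover have "n * n ^ (k - 1) = n ^ k" using k by (metis Suc_diff_1 power_Suc gr0I not_numeral_le_zero)
        ultimately have "limit_degree r k - \<epsilon> \<le> real k * real (card (spanned_simplices k X)) / n ^ k"
          using n by (simp add: pos_le_divide_eq)
        then have "fact (k - 1) * (limit_degree r k - \<epsilon>) \<le> fact (k - 1) * (real k * real (card (spanned_simplices k X)) / n ^ k)"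
          by (intro mult_left_mono) auto
        also have "\<dots> = fact k * real (card (spanned_simplices k X)) / n ^ k"
          using fact_reduce[of k, where ?'a = real] k by simp
        finally have "fact (k - 1) * limit_degree r k - fact (k - 1) * \<epsilon> \<le> fact k * real (card (spanned_simplices k X)) / n ^ k"
          by (simp add: right_diff_distrib)
        then show ?thesis using \<epsilon>(3) limit_degree_turan[of k r] k by (simp add: n_def)
      qed
      then have dens: "(\<forall>s. 2 \<le> s \<longrightarrow> s \<le> r \<longrightarrow> \<bar>hereditary.dens X (regular_clique X e) s - turan_dens r s\<bar> < \<delta>) \<and>
         hereditary.dens X (regular_clique X e) (Suc r) < \<delta>"
        using n1 X(1) X'(2) by blast
      interpret hereditary X "regular_clique X e" by (rule hereditary_regular[OF X(1)])
      have "\<exists>C\<in>faces r. (let Y = private_ext C in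
         real (card (X - (\<Union>v\<in>C. Y v))) \<le> \<eta> * real (card X) \<and>
         real (card (bad_pairs (side C) C Y)) \<le> \<eta> * real (card X) ^ 2 \<and>
         (\<forall>v\<in>C. turan_dens r r / (16 * fact r) * real (card X) \<le> real (card (Y v))))"
        by (rule typical_regular_clique[OF X(1) X'(1) r(2) \<eta>(1), of e \<delta>])
           (use dens \<delta>(2) \<delta>K in \<open>auto simp: \<theta>_def K_def\<close>)
      then obtain C where C0: "C \<in> faces r" "let Y = private_ext C in
         real (card (X - (\<Union>v\<in>C. Y v))) \<le> \<eta> * real (card X) \<and>
         real (card (bad_pairs (side C) C Y)) \<le> \<eta> * real (card X) ^ 2 \<and>
         (\<forall>v\<in>C. turan_dens r r / (16 * fact r) * real (card X) \<le> real (card (Y v)))" by (elim bexE)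
      then have C: "C \<in> faces r" "real (card (X - (\<Union>v\<in>C. private_ext C v))) \<le> \<eta> * n"
        "real (card (bad_pairs (side C) C (private_ext C))) \<le> \<eta> * n ^ 2"
        "\<And>v. v \<in> C \<Longrightarrow> \<theta> * n \<le> real (card (private_ext C v))"
        by (simp_all add: Let_def \<theta>_def n_def)
      have Cr: "regular_clique X e C" "C \<subseteq> X" "card C = r" "finite C" using C(1) faces_finite[OF C(1)] by (auto simp: faces_def)
      define t where "t = side C"
      have other: "\<exists>p\<in>C. p \<noteq> a \<and> p \<noteq> b" for a b
      proof (rule ccontr)
        assume "\<not> ?thesis"
        then have "C \<subseteq> {a, b}" by auto
        then have "card C \<le> card {a, b}" by (intro card_mono) auto
        then show False using Cr(3) r(2) by (simp add: card_insert_if split: if_splits)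
      qed
      have t: "t > 0"
      proof -
        obtain p where p: "p \<in> C" using other by blast
        obtain q where q: "q \<in> C" "q \<noteq> p" using other by blast
        have "dist q p = t" unfolding t_def by (rule side_eq[OF Cr(1) q(1) p q(2)])
        moreover have "dist q p > 0" using q(2) by simp
        ultimately show ?thesis by (simp only:)
      qed
      have YX: "private_ext C v \<subseteq> X" for v by (auto simp: private_ext_def ext_def)
      \<comment> \<open>Any other vertex of \<open>C\<close> is a centre of the sphere that
        \<open>complete_parts\<close> asks for; a third vertex identifies the radius as
        \<open>t\<close>.\<close>
      have centre: "\<exists>p. \<forall>x\<in>private_ext C v. dist x p = t" if v: "v \<in> C" for v
      proof -
        obtain p where p: "p \<in> C" "p \<noteq> v" using other by blast
        obtain p' where p': "p' \<in> C" "p' \<noteq> v" "p' \<noteq> p" using other by blast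
        have "dist x p = t" if "x \<in> private_ext C v" for x
        proof -
          have x: "x \<notin> C - {v}" "regular_clique X e (insert x (C - {v}))" using that by (auto simp: private_ext_def ext_def)
          have "dist x p = dist p' p" using regular_cliqueD(1)[OF x(2), of x p p' p] p p' x(1) by auto
          then show ?thesis using side_eq[OF Cr(1) p'(1) p(1) p'(3)] by (simp add: t_def)
        qed
        then show ?thesis by blast
      qed
      have finbad: "finite (bad_pairs t C (private_ext C))"
        by (rule finite_subset[of _ "X \<times> X"]) (use X(1) YX in \<open>auto simp: bad_pairs_def\<close>)
      have finY: "finite (private_ext C v)" for v using finite_subset[OF YX X(1)] .
      obtain Z where Z: "\<And>i. i \<in> C \<Longrightarrow> Z i \<subseteq> private_ext C i"
        "\<And>i. i \<in> C \<Longrightarrow> real (card (private_ext C i - Z i)) \<le> \<kappa> * (real DIM('a) + 1) * n"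
        "\<And>i j x y. i \<in> C \<Longrightarrow> j \<in> C \<Longrightarrow> i \<noteq> j \<Longrightarrow> x \<in> Z i \<Longrightarrow> y \<in> Z j \<Longrightarrow> dist x y = t"
        using complete_parts[OF finY centre finbad C(3)[folded t_def] n(1) \<kappa> \<eta>(2)] by blast
      have sizeZ: "\<theta> / 2 * n \<le> real (card (Z i))" if i: "i \<in> C" for i
      proof -
        have "card (private_ext C i) = card (Z i) + card (private_ext C i - Z i)"
          using Z(1)[OF i] finY by (metis card_Diff_subset card_mono finite_subset le_add_diff_inverse)
        moreover have "\<kappa> * (real DIM('a) + 1) * n \<le> \<theta> / 2 * n" using \<kappa>'(2) n by (intro mult_right_mono) (auto simp: D_def)
        ultimately show ?thesis using C(4)[OF i] Z(2)[OF i] by (simp add: algebra_simps)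
      qed
      have lz: "lenz C Z t"
      proof
        show "finite C" "3 \<le> card C" "DIM('a) = 2 * card C + 1" "t > 0" using Cr r dim t by auto
        show "dist x y = t" if "i \<in> C" "j \<in> C" "i \<noteq> j" "x \<in> Z i" "y \<in> Z j" for i j x y using Z(3) that by blast
        show "2 \<le> aff_dim (Z i)" if i: "i \<in> C" for i
        proof -
          have "3 \<le> \<theta> / 2 * n" using n(2) \<theta> by (simp add: field_simps)
          then have "3 \<le> card (Z i)" using sizeZ[OF i] by linarith
          then obtain S where S: "S \<subseteq> Z i" "card S = 3" by (meson obtain_subset_with_card_n)
          then obtain x y z where xyz: "S = {x, y, z}" "x \<noteq> y" "y \<noteq> z" "x \<noteq> z" by (auto simp: card_3_iff)
          obtain p where p: "\<forall>x\<in>private_ext C i. dist x p = t" using centre[OF i] by blast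
          have "aff_dim S \<ge> 2" unfolding xyz(1) using xyz p S Z(1)[OF i] by (intro aff_dim_three_on_sphere[of _ p t]) auto
          then show ?thesis using aff_dim_subset[OF S(1)] by linarith
        qed
      qed
      have left: "real (card (X - (\<Union>i\<in>C. Z i))) \<le> \<nu> * n"
      proof -
        have "X - (\<Union>i\<in>C. Z i) \<subseteq> (X - (\<Union>i\<in>C. private_ext C i)) \<union> (\<Union>i\<in>C. private_ext C i - Z i)" by blast
        then have "card (X - (\<Union>i\<in>C. Z i)) \<le> card ((X - (\<Union>i\<in>C. private_ext C i)) \<union> (\<Union>i\<in>C. private_ext C i - Z i))"
          using X(1) finY Cr(4) by (intro card_mono) auto
        also have "\<dots> \<le> card (X - (\<Union>i\<in>C. private_ext C i)) + card (\<Union>i\<in>C. private_ext C i - Z i)" by (rule card_Un_le)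
        also have "card (\<Union>i\<in>C. private_ext C i - Z i) \<le> (\<Sum>i\<in>C. card (private_ext C i - Z i))" by (rule card_UN_le[OF Cr(4)])
        finally have "real (card (X - (\<Union>i\<in>C. Z i))) \<le> real (card (X - (\<Union>i\<in>C. private_ext C i))) + (\<Sum>i\<in>C. real (card (private_ext C i - Z i)))"
          by (simp flip: of_nat_sum of_nat_add)
        also have "\<dots> \<le> \<eta> * n + (\<Sum>i\<in>C. \<kappa> * (real DIM('a) + 1) * n)" using C(2) Z(2) by (intro add_mono sum_mono)
        also have "\<dots> = (\<eta> + real r * (\<kappa> * D)) * n" by (simp add: Cr(3) D_def algebra_simps)
        also have "\<dots> \<le> \<nu> * n" using \<kappa>'(1) \<eta>(3) n by (intro mult_right_mono) auto
        finally show ?thesis .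
      qed
      have "(limit_degree r k - \<nu>) * n ^ (k - 1) \<le> real (simplex_degree k X v)" if "v \<in> X" for v
      proof -
        have "(limit_degree r k - \<nu>) * n ^ (k - 1) \<le> (limit_degree r k - \<epsilon>) * n ^ (k - 1)"
          using \<epsilon>(2) n by (intro mult_right_mono) auto
        then show ?thesis using deg that by (force simp: n_def)
      qed
      moreover have "\<forall>i\<in>C. Z i \<subseteq> X" using Z(1) YX by blast
      ultimately have "near_lenz r k \<nu> (\<theta> / 2) X C Z t"
        unfolding near_lenz_def using X(1) lz Cr(3) left sizeZ by (simp add: n_def)
      then show ?thesis by blast
    qed
    then show ?thesis using \<epsilon>(1) by blast
  qed
  then show ?thesis using \<theta> by (intro exI[of _ "\<theta> / 2"]) auto
qed

section \<open>Points outside a Lenz configuration\<close>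

context lenz
begin

text \<open>Not lying in \<open>\<Sigma> i\<close> exhibits a wrong distance to a part other than
  \<open>i\<close>; applied twice, this yields two different parts.\<close>

lemma two_deficient:
  assumes "v \<notin> (\<Union>i\<in>I. \<Sigma> i)"
  shows "\<exists>i\<in>I. \<exists>j\<in>I. i \<noteq> j \<and> (\<exists>z\<in>Z i. dist z v \<noteq> t) \<and> (\<exists>z\<in>Z j. dist z v \<noteq> t)"
proof -
  have ex: "\<exists>j\<in>I - {i}. \<exists>z\<in>Z j. dist z v \<noteq> t" if "i \<in> I" for i
    using assms that unfolding sphere_part_def by (auto simp: dist_commute)
  have "I \<noteq> {}" using I by auto
  then obtain i0 where "i0 \<in> I" by blast
  then obtain i where i: "i \<in> I" "\<exists>z\<in>Z i. dist z v \<noteq> t" using ex by blast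
  then obtain j where "j \<in> I - {i}" "\<exists>z\<in>Z j. dist z v \<noteq> t" using ex by blast
  then show ?thesis using i by blast
qed

text \<open>A point of another part has distance \<open>t\<close> from all of \<open>Z i\<close>. If
  the points of \<open>Z i\<close> at distance \<open>t\<close> from \<open>v\<close> spanned its
  hull, being equidistant from \<open>v\<close> and that point would extend to
  \<open>z\<close>.\<close>

lemma deficient_hull:
  assumes i: "i \<in> I" and z: "z \<in> Z i" "dist z v \<noteq> t"
  shows "aff_dim {x \<in> Z i. dist x v = t} < aff_dim (Z i)"
proof (rule ccontr)
  let ?B = "{x \<in> Z i. dist x v = t}"
  assume "\<not> ?thesis"
  moreover have sub: "?B \<subseteq> Z i" by blast
  ultimately have "aff_dim ?B = aff_dim (Z i)" using aff_dim_subset[OF sub] by linarith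
  then have "affine hull ?B = affine hull (Z i)" using aff_dim_eq_full_gen[OF sub] by blast
  then have zh: "z \<in> affine hull ?B" using hull_inc[OF z(1)] by metis
  obtain l where l: "l \<in> I" "l \<noteq> i" using other[OF i] by blast
  obtain u where u: "u \<in> Z l" using Z_ne l by blast
  have "dist z v = dist z u"
    by (rule equidistant_affine_hull'[OF _ zh]) (use cross[OF i l(1) l(2)[symmetric] _ u] in auto)
  then show False using cross[OF i l(1) l(2)[symmetric] z(1) u] z by simp
qed

lemma deficient_planar:
  assumes i: "i \<in> I" and z: "z \<in> Z i" "dist z v \<noteq> t" and planar: "aff_dim (Z i) \<le> 2"
  shows "card {x \<in> Z i. dist x v = t} \<le> 2"
proof (rule ccontr)
  assume "\<not> ?thesis"
  then have "3 \<le> card {x \<in> Z i. dist x v = t}" by linarith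
  then obtain S where S: "S \<subseteq> {x \<in> Z i. dist x v = t}" "card S = 3" by (meson obtain_subset_with_card_n)
  then obtain x y w where xyz: "S = {x, y, w}" "x \<noteq> y" "y \<noteq> w" "x \<noteq> w" by (auto simp: card_3_iff)
  have "aff_dim S \<ge> 2" unfolding xyz(1) using xyz S by (intro aff_dim_three_on_sphere[of _ v t]) auto
  then show False using aff_dim_subset[OF S(1)] deficient_hull[OF i z] planar by linarith
qed

text \<open>Two spatial parts would need \<open>3 + 3 + 2 * (card I - 2)\<close> dimensions, one too
  many.\<close>

lemma one_nonplanar:
  assumes ij: "i \<in> I" "j \<in> I" "i \<noteq> j" and i3: "aff_dim (Z i) > 2"
  shows "aff_dim (Z j) \<le> 2"
proof -
  have "aff_dim (Z i) + (\<Sum>l\<in>I-{i}. aff_dim (Z l)) \<le> 2 * int (card I) + 1"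
    using aff_dim_sum_le[OF ij(1) Z_subset[OF ij(1)] Z_ne[OF ij(1)]] .
  moreover have "(\<Sum>l\<in>I-{i}. aff_dim (Z l)) = aff_dim (Z j) + (\<Sum>l\<in>I-{i}-{j}. aff_dim (Z l))"
    using I ij by (intro sum.remove) auto
  moreover have "(\<Sum>l\<in>I-{i}-{j}. 2 :: int) \<le> (\<Sum>l\<in>I-{i}-{j}. aff_dim (Z l))" using Z2 by (intro sum_mono) auto
  moreover have "(\<Sum>l\<in>I-{i}-{j}. 2 :: int) = 2 * int (card I) - 4"
    using I ij by (simp add: of_nat_diff)
  ultimately show ?thesis using i3 by linarith
qed

end

text \<open>At most one part is not planar. If some configuration at the coarse scale \<open>\<nu>'\<close> has only planar parts,
  it covers everything. Otherwise, in a configuration at the much finer scale \<open>\<nu>\<close>, no point can be at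
  distance \<open>t\<close> to almost all but not all of the spatial part, since shrinking that part would make it planar.\<close>

lemma lenz_cover:
  assumes dim: "DIM('a::euclidean_space) = 2 * r + 1" and k: "3 \<le> k" "k \<le> r"
  shows "\<exists>\<epsilon>>0. \<exists>n0. \<forall>X :: 'a set. finite X \<longrightarrow> card X \<ge> n0 \<longrightarrow>
     (\<forall>v\<in>X. (limit_degree r k - \<epsilon>) * real (card X) ^ (k - 1) \<le> real (simplex_degree k X v)) \<longrightarrow>
     (\<exists>(I :: 'a set) Z t. lenz I Z t \<and> card I = r \<and> X \<subseteq> (\<Union>i\<in>I. sphere_part I Z t i))"
proof -
  have r: "real r \<ge> 3" using k by simp
  obtain \<theta> where \<theta>: "\<theta> > 0" and ex: "\<forall>\<nu>>0. \<exists>\<epsilon>>0. \<exists>n0. \<forall>X :: 'a set. finite X \<longrightarrow> card X \<ge> n0 \<longrightarrow>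
     (\<forall>v\<in>X. (limit_degree r k - \<epsilon>) * real (card X) ^ (k - 1) \<le> real (simplex_degree k X v)) \<longrightarrow>
     (\<exists>(I :: 'a set) Z t. near_lenz r k \<nu> \<theta> X I Z t)"
    using near_lenz_exists[OF dim k] by (elim exE conjE)
  define \<mu>1 where "\<mu>1 = 1 / (2 * real r)"
  have \<mu>1: "0 < \<mu>1" "\<mu>1 \<le> 1 / (2 * real r)" using r by (simp_all add: \<mu>1_def)
  have \<theta>2: "\<theta> / 2 > 0" using \<theta> by simp
  obtain \<epsilon>1 n1 where \<epsilon>1: "\<epsilon>1 > 0" and n1: "\<forall>X :: 'a set. \<forall>(I :: 'a set) Z t v i j. near_lenz r k \<epsilon>1 (\<theta> / 2) X I Z t \<longrightarrow> card X \<ge> n1 \<longrightarrow>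
     v \<in> X \<longrightarrow> i \<in> I \<longrightarrow> j \<in> I \<longrightarrow> i \<noteq> j \<longrightarrow> card {x \<in> Z i. dist x v = t} \<le> 2 \<longrightarrow>
     \<not> real (card {x \<in> Z j. dist x v = t}) \<le> max 2 (real (card (Z j)) - \<mu>1 * real (card X))"
    using not_both_deficient[OF k \<theta>2 \<mu>1, where ?'a = 'a and ?'i = 'a] by (elim exE conjE)
  \<comment> \<open>Order of choice: \<open>\<epsilon>1\<close> for parts of size
    \<open>\<theta> / 2\<close>, the coarse scale \<open>\<nu>'\<close>, the deficit
    \<open>\<mu>2\<close>, its \<open>\<epsilon>2\<close>, the fine scale \<open>\<nu>\<close>. The
    halves ensure that deleting fewer than \<open>\<nu>' / 2 * n\<close> points from one part turns
    scale \<open>\<nu>\<close> into \<open>\<nu>'\<close> and \<open>\<theta>\<close> into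
    \<open>\<theta> / 2\<close>.\<close>
  define \<nu>' where "\<nu>' = min \<epsilon>1 \<theta>"
  have \<nu>': "\<nu>' > 0" "\<nu>' \<le> \<epsilon>1" "\<nu>' \<le> \<theta>" using \<epsilon>1 \<theta> by (auto simp: \<nu>'_def)
  define \<mu>2 where "\<mu>2 = min (\<nu>' / 2) (1 / (2 * real r))"
  have \<mu>2: "0 < \<mu>2" "\<mu>2 \<le> 1 / (2 * real r)" "\<mu>2 \<le> \<nu>' / 2" using \<nu>' r by (auto simp: \<mu>2_def)
  obtain \<epsilon>2 n2 where \<epsilon>2: "\<epsilon>2 > 0" and n2: "\<forall>X :: 'a set. \<forall>(I :: 'a set) Z t v i j. near_lenz r k \<epsilon>2 \<theta> X I Z t \<longrightarrow> card X \<ge> n2 \<longrightarrow>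
     v \<in> X \<longrightarrow> i \<in> I \<longrightarrow> j \<in> I \<longrightarrow> i \<noteq> j \<longrightarrow> card {x \<in> Z i. dist x v = t} \<le> 2 \<longrightarrow>
     \<not> real (card {x \<in> Z j. dist x v = t}) \<le> max 2 (real (card (Z j)) - \<mu>2 * real (card X))"
    using not_both_deficient[OF k \<theta> \<mu>2(1,2), where ?'a = 'a and ?'i = 'a] by (elim exE conjE)
  define \<nu> where "\<nu> = min \<epsilon>2 (\<nu>' / 2)"
  have \<nu>: "\<nu> > 0" "\<nu> \<le> \<epsilon>2" "\<nu> \<le> \<nu>' / 2" using \<epsilon>2 \<nu>' by (auto simp: \<nu>_def)
  obtain \<epsilon> n3 where \<epsilon>: "\<epsilon> > 0" and n3: "\<forall>X :: 'a set. finite X \<longrightarrow> card X \<ge> n3 \<longrightarrow>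
     (\<forall>v\<in>X. (limit_degree r k - \<epsilon>) * real (card X) ^ (k - 1) \<le> real (simplex_degree k X v)) \<longrightarrow>
     (\<exists>(I :: 'a set) Z t. near_lenz r k \<nu> \<theta> X I Z t)"
    using ex[rule_format, OF \<nu>(1)] by (elim exE conjE)
  define n0 where "n0 = Max {n1, n2, n3, nat \<lceil>6 / \<theta>\<rceil>}"
  have "\<exists>(I :: 'a set) Z t. lenz I Z t \<and> card I = r \<and> X \<subseteq> (\<Union>i\<in>I. sphere_part I Z t i)"
    if X: "finite X" "card X \<ge> n0" and deg: "\<forall>v\<in>X. (limit_degree r k - \<epsilon>) * real (card X) ^ (k - 1) \<le> real (simplex_degree k X v)" for X :: "'a set"
  proof -
    have X': "card X \<ge> n1" "card X \<ge> n2" "card X \<ge> n3" "card X \<ge> nat \<lceil>6 / \<theta>\<rceil>" using X(2) by (auto simp: n0_def)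
    define n where "n = real (card X)"
    have "n \<ge> 6 / \<theta>" using X'(4) unfolding n_def by linarith
    then have n6: "\<theta> / 2 * n \<ge> 3" using \<theta> by (simp add: field_simps)
    show ?thesis
    proof (cases "\<exists>(I :: 'a set) Z t. near_lenz r k \<nu>' (\<theta> / 2) X I Z t \<and> (\<forall>i\<in>I. aff_dim (Z i) \<le> 2)")
      case True
      then obtain I :: "'a set" and Z t where N: "near_lenz r k \<nu>' (\<theta> / 2) X I Z t" and pl: "\<And>i. i \<in> I \<Longrightarrow> aff_dim (Z i) \<le> 2" by blast
      have N1: "near_lenz r k \<epsilon>1 (\<theta> / 2) X I Z t" using near_lenz_mono[OF N] \<nu>' by simp
      have lz: "lenz I Z t" "card I = r" using N by (auto simp: near_lenz_def)
      interpret lenz I Z t by (rule lz(1))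
      have "v \<in> (\<Union>i\<in>I. sphere_part I Z t i)" if v: "v \<in> X" for v
      proof (rule ccontr)
        assume "\<not> ?thesis"
        then obtain i j zi zj where ij: "i \<in> I" "j \<in> I" "i \<noteq> j" "zi \<in> Z i" "dist zi v \<noteq> t" "zj \<in> Z j" "dist zj v \<noteq> t"
          using two_deficient by blast
        have "card {x \<in> Z i. dist x v = t} \<le> 2" "card {x \<in> Z j. dist x v = t} \<le> 2"
          using deficient_planar[OF ij(1,4,5) pl[OF ij(1)]] deficient_planar[OF ij(2,6,7) pl[OF ij(2)]] by auto
        then show False using n1[rule_format, OF N1 X'(1) v ij(1-3)] by simp
      qed
      then show ?thesis using lz by blast
    next
      case False
      obtain I :: "'a set" and Z t where N: "near_lenz r k \<nu> \<theta> X I Z t"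
        using n3[rule_format, OF X(1) X'(3)] deg by blast
      have N2: "near_lenz r k \<epsilon>2 \<theta> X I Z t" using near_lenz_mono[OF N] \<nu> by simp
      have N': "lenz I Z t" "card I = r" "\<And>i. i \<in> I \<Longrightarrow> Z i \<subseteq> X" "real (card (X - (\<Union>i\<in>I. Z i))) \<le> \<nu> * n"
        "\<And>i. i \<in> I \<Longrightarrow> \<theta> * n \<le> real (card (Z i))"
        "\<And>v. v \<in> X \<Longrightarrow> (limit_degree r k - \<nu>) * n ^ (k - 1) \<le> real (simplex_degree k X v)"
        using N by (auto simp: near_lenz_def n_def)
      interpret lenz I Z t by (rule N'(1))
      have finZ: "finite (Z i)" if "i \<in> I" for i using finite_subset[OF N'(3)[OF that] X(1)] .
      have shrink: "real (card {x \<in> Z j. dist x v = t}) \<le> real (card (Z j)) - \<mu>2 * n"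
        if v: "v \<in> X" and j: "j \<in> I" and z: "z \<in> Z j" "dist z v \<noteq> t" and j3: "aff_dim (Z j) > 2" for v j z
      proof (rule ccontr)
        assume neg: "\<not> ?thesis"
        define B where "B = {x \<in> Z j. dist x v = t}"
        have BZ: "B \<subseteq> Z j" by (auto simp: B_def)
        have cB: "real (card B) > real (card (Z j)) - \<nu>' / 2 * n"
        proof -
          have "\<mu>2 * n \<le> \<nu>' / 2 * n" using \<mu>2 by (intro mult_right_mono) (auto simp: n_def)
          then show ?thesis using neg by (simp add: B_def)
        qed
        have "\<nu>' / 2 * n \<le> \<theta> / 2 * n" using \<nu>' by (intro mult_right_mono) (auto simp: n_def)
        then have cB2: "\<theta> / 2 * n \<le> real (card B)" using cB N'(5)[OF j] by (simp add: field_simps)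
        then have "3 \<le> card B" using n6 by linarith
        then obtain S where S: "S \<subseteq> B" "card S = 3" by (meson obtain_subset_with_card_n)
        then obtain x y w where xyz: "S = {x, y, w}" "x \<noteq> y" "y \<noteq> w" "x \<noteq> w" by (auto simp: card_3_iff)
        have "aff_dim S \<ge> 2" unfolding xyz(1) using xyz S by (intro aff_dim_three_on_sphere[of _ v t]) (auto simp: B_def)
        then have B2: "aff_dim B \<ge> 2" using aff_dim_subset[OF S(1)] by linarith
        have B3: "aff_dim B \<le> 2"
          using deficient_hull[OF j z] aff_dim_subset[OF Z_subset[OF j]] aff_dim_\<Sigma>[OF j] unfolding B_def by linarith
        define Z' where "Z' = Z(j := B)"
        have Z'Z: "Z' i \<subseteq> Z i" for i using BZ by (auto simp: Z'_def)
        have lz': "lenz I Z' t"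
        proof
          show "2 \<le> aff_dim (Z' i)" if "i \<in> I" for i using Z2[OF that] B2 by (simp add: Z'_def)
          show "dist x y = t" if "i \<in> I" "l \<in> I" "i \<noteq> l" "x \<in> Z' i" "y \<in> Z' l" for i l x y
            using cross[OF that(1-3)] that(4,5) Z'Z by blast
        qed (use I t in auto)
        have left': "real (card (X - (\<Union>i\<in>I. Z' i))) \<le> \<nu>' * n"
        proof -
          have "X - (\<Union>i\<in>I. Z' i) \<subseteq> (X - (\<Union>i\<in>I. Z i)) \<union> (Z j - B)"
            by (auto simp: Z'_def split: if_splits)
          then have "card (X - (\<Union>i\<in>I. Z' i)) \<le> card ((X - (\<Union>i\<in>I. Z i)) \<union> (Z j - B))"
            using X(1) finZ[OF j] by (intro card_mono) auto
          also have "\<dots> \<le> card (X - (\<Union>i\<in>I. Z i)) + card (Z j - B)" by (rule card_Un_le)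
          also have "card (Z j - B) = card (Z j) - card B" using BZ finZ[OF j] by (simp add: card_Diff_subset finite_subset)
          finally have "real (card (X - (\<Union>i\<in>I. Z' i))) \<le> real (card (X - (\<Union>i\<in>I. Z i))) + (real (card (Z j)) - real (card B))"
            using card_mono[OF finZ[OF j] BZ] by linarith
          then have "real (card (X - (\<Union>i\<in>I. Z' i))) \<le> \<nu> * n + \<nu>' / 2 * n" using N'(4) cB by linarith
          also have "\<nu> * n \<le> \<nu>' / 2 * n" using \<nu> by (intro mult_right_mono) (auto simp: n_def)
          finally show ?thesis by (simp add: field_simps)
        qed
        have size': "\<theta> / 2 * n \<le> real (card (Z' i))" if "i \<in> I" for i
        proof (cases "i = j")
          case True
          then show ?thesis using cB2 by (simp add: Z'_def)
        next
          case False
          have "\<theta> / 2 * n \<le> \<theta> * n" using \<theta> by (simp add: n_def)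
          then show ?thesis using N'(5)[OF that] False by (simp add: Z'_def)
        qed
        have deg': "(limit_degree r k - \<nu>') * n ^ (k - 1) \<le> real (simplex_degree k X v)" if "v \<in> X" for v
        proof -
          have "(limit_degree r k - \<nu>') * n ^ (k - 1) \<le> (limit_degree r k - \<nu>) * n ^ (k - 1)"
            using \<nu> \<nu>' by (intro mult_right_mono) (auto simp: n_def)
          then show ?thesis using N'(6)[OF that] by linarith
        qed
        have Z'X: "\<forall>i\<in>I. Z' i \<subseteq> X" using N'(3) Z'Z by blast
        have "near_lenz r k \<nu>' (\<theta> / 2) X I Z' t"
          unfolding near_lenz_def using X(1) lz' N'(2) Z'X left' size' deg' by (simp add: n_def)
        moreover have "\<forall>i\<in>I. aff_dim (Z' i) \<le> 2"
        proof
          fix i assume "i \<in> I"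
          then show "aff_dim (Z' i) \<le> 2" using B3 one_nonplanar[OF j _ _ j3, of i] by (simp add: Z'_def)
        qed
        ultimately show False using False by blast
      qed
      have "v \<in> (\<Union>i\<in>I. sphere_part I Z t i)" if v: "v \<in> X" for v
      proof (rule ccontr)
        assume "\<not> ?thesis"
        then obtain i j zi zj where ij: "i \<in> I" "j \<in> I" "i \<noteq> j" "zi \<in> Z i" "dist zi v \<noteq> t" "zj \<in> Z j" "dist zj v \<noteq> t"
          using two_deficient by blast
        have bound: "real (card {x \<in> Z l. dist x v = t}) \<le> max 2 (real (card (Z l)) - \<mu>2 * real (card X))"
          if l: "l \<in> I" "z \<in> Z l" "dist z v \<noteq> t" for l z
        proof (cases "aff_dim (Z l) \<le> 2")
          case True
          then show ?thesis using deficient_planar[OF l True] by simp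
        next
          case False
          then show ?thesis using shrink[OF v l] by (simp add: n_def)
        qed
        show False
        proof (cases "aff_dim (Z i) \<le> 2")
          case True
          then show False
            using n2[rule_format, OF N2 X'(2) v ij(1-3) deficient_planar[OF ij(1,4,5) True]] bound[OF ij(2,6,7)] by blast
        next
          case False
          then have "aff_dim (Z j) \<le> 2" using one_nonplanar[OF ij(1-3)] by simp
          then show False
            using n2[rule_format, OF N2 X'(2) v ij(2,1) ij(3)[symmetric] deficient_planar[OF ij(2,6,7)]] bound[OF ij(1,4,5)] by blast
        qed
      qed
      then show ?thesis using N'(1,2) by blast
    qed
  qed
  then show ?thesis using \<epsilon> by blast
qed

section \<open>The upper bound\<close>

lemma lenz_simplex_count:
  fixes Z :: "'i \<Rightarrow> 'a::euclidean_space set"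
  assumes L: "lenz I Z t" and X: "finite X" "X \<subseteq> (\<Union>i\<in>I. sphere_part I Z t i)" and k: "3 \<le> k" "k \<le> card I"
  shows "real (card (spanned_simplices k X)) \<le> real (card I choose k) * (real (card X) / real (card I)) ^ k
     + (70 * real (card I) + 2) * real (card X) powr (real k - 2 / 3)"
proof (cases "card X = 0")
  case True
  then have "spanned_simplices k X = {}" using X k by (auto simp: spanned_simplices_def regular_simplex_def)
  then show ?thesis by simp
next
  case False
  interpret lenz I Z t by (rule L)
  define n where "n = real (card X)"
  have n: "n \<ge> 1" using False by (simp add: n_def)
  \<comment> \<open>The sets \<open>\<Sigma> i\<close> need not be disjoint, so each point is
    assigned to one of those that contain it.\<close>
  define \<pi> where "\<pi> x = (SOME i. i \<in> I \<and> x \<in> \<Sigma> i)" for x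
  have \<pi>: "\<pi> x \<in> I" "x \<in> \<Sigma> (\<pi> x)" if "x \<in> X" for x
  proof -
    have "\<exists>i. i \<in> I \<and> x \<in> \<Sigma> i" using that X by blast
    from someI_ex[OF this] show "\<pi> x \<in> I" "x \<in> \<Sigma> (\<pi> x)" by (simp_all add: \<pi>_def)
  qed
  define A where "A i = {x \<in> X. \<pi> x = i}" for i
  have A: "A i \<subseteq> \<Sigma> i" "A i \<subseteq> X" for i using \<pi> by (auto simp: A_def)
  have finA: "finite (A i)" for i using finite_subset[OF A(2) X(1)] .
  have UA: "(\<Union>i\<in>I. A i) = X" using \<pi> by (auto simp: A_def)
  \<comment> \<open>For simplices with two vertices \<open>x\<close>, \<open>y\<close> in one part:
    if the side is \<open>t\<close>, the pair is counted by \<open>T1\<close>; otherwise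
    \<open>x\<close> and a third vertex \<open>z\<close>, in any part, leave at most two positions
    for \<open>y\<close>, and \<open>T2\<close> has at most \<open>2 * n ^ 2\<close>
    elements.\<close>
  define T1 where "T1 = (\<Union>i\<in>I. {(x, y) \<in> A i \<times> A i. dist x y = t})"
  define T2 where "T2 = Sigma {(x, z) \<in> X \<times> X. dist x z > 0 \<and> dist x z \<noteq> t}
     (\<lambda>(x, z). {y \<in> A (\<pi> x). dist y x = dist x z \<and> dist y z = dist x z})"
  define B1 where "B1 = (\<lambda>(x, y). {S. S \<subseteq> X \<and> card S = k \<and> {x, y} \<subseteq> S})"
  define B2 where "B2 = (\<lambda>((x, z), y). {S. S \<subseteq> X \<and> card S = k \<and> {x, y, z} \<subseteq> S})"
  have finB1: "finite (B1 p)" for p unfolding B1_def using X by (auto split: prod.split intro: finite_subset_family)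
  have finB2: "finite (B2 p)" for p unfolding B2_def using X by (auto split: prod.split intro: finite_subset_family)
  have finT1i: "finite {(x, y) \<in> A i \<times> A i. dist x y = t}" for i
    by (rule finite_subset[of _ "A i \<times> A i"]) (use finA in auto)
  then have finT1: "finite T1" unfolding T1_def using I by blast
  have finP: "finite {(x, z) \<in> X \<times> X. dist x z > 0 \<and> dist x z \<noteq> t}"
    by (rule finite_subset[of _ "X \<times> X"]) (use X in auto)
  then have finT2: "finite T2" unfolding T2_def using finA by (intro finite_SigmaI) auto
  have cT1: "real (card T1) \<le> real (card I) * (70 * n powr (4/3))"
  proof -
    have "card T1 \<le> (\<Sum>i\<in>I. card {(x, y) \<in> A i \<times> A i. dist x y = t})" unfolding T1_def using I by (intro card_UN_le)
    then have "real (card T1) \<le> (\<Sum>i\<in>I. real (card {(x, y) \<in> A i \<times> A i. dist x y = t}))" by (simp flip: of_nat_sum)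
    also have "\<dots> \<le> (\<Sum>i\<in>I. 70 * n powr (4/3))"
    proof (rule sum_mono)
      fix i assume i: "i \<in> I"
      show "real (card {(x, y) \<in> A i \<times> A i. dist x y = t}) \<le> 70 * n powr (4/3)"
        unfolding n_def by (rule distance_pairs[OF i A(1) finA card_mono[OF X(1) A(2)]])
    qed
    finally show ?thesis by simp
  qed
  have cT2: "real (card T2) \<le> 2 * n ^ 2"
  proof -
    have "card T2 = (\<Sum>(x, z)\<in>{(x, z) \<in> X \<times> X. dist x z > 0 \<and> dist x z \<noteq> t}. card {y \<in> A (\<pi> x). dist y x = dist x z \<and> dist y z = dist x z})"
      unfolding T2_def using finP finA by (subst card_SigmaI) (auto simp: split_beta)
    also have "\<dots> \<le> (\<Sum>(x, z)\<in>{(x, z) \<in> X \<times> X. dist x z > 0 \<and> dist x z \<noteq> t}. 2)"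
    proof (rule sum_mono, clarify)
      fix x z assume xz: "x \<in> X" "z \<in> X" "dist x z > 0" "dist x z \<noteq> t"
      have "card {y \<in> A (\<pi> x). dist y x = dist x z \<and> dist y z = dist x z} \<le> card {y \<in> \<Sigma> (\<pi> x). dist y x = dist x z \<and> dist y z = dist x z}"
        using equilateral_count(1)[OF \<pi>(1)[OF xz(1)] \<pi>(1)[OF xz(2)] \<pi>(2)[OF xz(1)] \<pi>(2)[OF xz(2)] refl xz(3,4)] A(1)
        by (intro card_mono) auto
      also have "\<dots> \<le> 2" by (rule equilateral_count(2)[OF \<pi>(1)[OF xz(1)] \<pi>(1)[OF xz(2)] \<pi>(2)[OF xz(1)] \<pi>(2)[OF xz(2)] refl xz(3,4)])
      finally show "card {y \<in> A (\<pi> x). dist y x = dist x z \<and> dist y z = dist x z} \<le> 2" .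
    qed
    also have "\<dots> = 2 * card {(x, z) \<in> X \<times> X. dist x z > 0 \<and> dist x z \<noteq> t}" by (simp add: split_beta)
    also have "\<dots> \<le> 2 * card (X \<times> X)" using X by (intro mult_left_mono card_mono) auto
    finally have "real (card T2) \<le> real (2 * (card X * card X))" unfolding card_cartesian_product by (simp only: of_nat_le_iff)
    then show ?thesis by (simp add: n_def power2_eq_square)
  qed
  have "spanned_simplices k X \<subseteq> transversals I A k \<union> (\<Union>p\<in>T1. B1 p) \<union> (\<Union>p\<in>T2. B2 p)"
  proof
    fix S assume "S \<in> spanned_simplices k X"
    then have S: "S \<subseteq> X" "card S = k" "finite S" and "\<exists>d. \<forall>x\<in>S. \<forall>y\<in>S. x \<noteq> y \<longrightarrow> dist x y = d"
      by (simp_all add: spanned_simplices_def regular_simplex_def)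
    then obtain d where d: "\<forall>x\<in>S. \<forall>y\<in>S. x \<noteq> y \<longrightarrow> dist x y = d" by blast
    show "S \<in> transversals I A k \<union> (\<Union>p\<in>T1. B1 p) \<union> (\<Union>p\<in>T2. B2 p)"
    proof (cases "\<forall>i\<in>I. \<forall>x\<in>S \<inter> A i. \<forall>y\<in>S \<inter> A i. x = y")
      case True
      then have "S \<in> transversals I A k" using S UA by (simp add: transversals_def)
      then show ?thesis by blast
    next
      case False
      then obtain i x y where xy: "i \<in> I" "x \<in> S" "x \<in> A i" "y \<in> S" "y \<in> A i" "x \<noteq> y" by blast
      show ?thesis
      proof (cases "d = t")
        case True
        then have "dist x y = t" using d xy by simp
        then have "(x, y) \<in> T1" using xy by (auto simp: T1_def)
        moreover have "S \<in> B1 (x, y)" using S xy by (simp add: B1_def)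
        ultimately show ?thesis by blast
      next
        case False
        have "card (S - {x, y}) > 0" using S xy k by (simp add: card_Diff_subset)
        then obtain z where z: "z \<in> S" "z \<noteq> x" "z \<noteq> y" by (auto simp: card_gt_0_iff)
        have ds: "dist x z = d" "dist y x = d" "dist y z = d" using d xy z by simp_all
        have "dist x z > 0" using z by simp
        then have "((x, z), y) \<in> T2" using ds xy z S False by (auto simp: T2_def A_def)
        moreover have "S \<in> B2 ((x, z), y)" using S xy z by (simp add: B2_def)
        ultimately show ?thesis by blast
      qed
    qed
  qed
  then have "card (spanned_simplices k X) \<le> card (transversals I A k \<union> (\<Union>p\<in>T1. B1 p) \<union> (\<Union>p\<in>T2. B2 p))"
    using finT1 finT2 finB1 finB2 I finA by (intro card_mono finite_UnI finite_UN_I finite_transversals) auto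
  also have "\<dots> \<le> card (transversals I A k) + card (\<Union>p\<in>T1. B1 p) + card (\<Union>p\<in>T2. B2 p)"
    by (meson add_right_mono card_Un_le order_trans)
  also have "\<dots> \<le> card (transversals I A k) + card T1 * card X ^ (k - 2) + card T2 * card X ^ (k - 3)"
  proof (intro add_mono order_refl)
    have "card (\<Union>p\<in>T1. B1 p) \<le> (\<Sum>p\<in>T1. card (B1 p))" by (rule card_UN_le[OF finT1])
    also have "\<dots> \<le> (\<Sum>p\<in>T1. card X ^ (k - 2))"
    proof (rule sum_mono)
      fix p assume p: "p \<in> T1"
      obtain x y where xy: "p = (x, y)" by (cases p)
      then have "dist x y = t" using p by (auto simp: T1_def)
      then have "x \<noteq> y" using t by auto
      then have "card {x, y} = 2" by simp
      then show "card (B1 p) \<le> card X ^ (k - 2)" using card_supersets_le[OF X(1), of "{x, y}" k] k by (simp add: B1_def xy)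
    qed
    finally show "card (\<Union>p\<in>T1. B1 p) \<le> card T1 * card X ^ (k - 2)" by simp
    have "card (\<Union>p\<in>T2. B2 p) \<le> (\<Sum>p\<in>T2. card (B2 p))" by (rule card_UN_le[OF finT2])
    also have "\<dots> \<le> (\<Sum>p\<in>T2. card X ^ (k - 3))"
    proof (rule sum_mono)
      fix p assume p: "p \<in> T2"
      obtain x z y where xyz: "p = ((x, z), y)" by (metis surj_pair)
      then have "dist x z > 0" "dist y x = dist x z" "dist y z = dist x z" using p by (auto simp: T2_def)
      then have "x \<noteq> z" "x \<noteq> y" "y \<noteq> z" by auto
      then have "card {x, y, z} = 3" by simp
      then show "card (B2 p) \<le> card X ^ (k - 3)" using card_supersets_le[OF X(1), of "{x, y, z}" k] k by (simp add: B2_def xyz)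
    qed
    finally show "card (\<Union>p\<in>T2. B2 p) \<le> card T2 * card X ^ (k - 3)" by simp
  qed
  finally have "real (card (spanned_simplices k X)) \<le> real (card (transversals I A k)) + real (card T1) * n ^ (k - 2) + real (card T2) * n ^ (k - 3)"
    unfolding n_def by (simp flip: of_nat_mult of_nat_power of_nat_add)
  also have "real (card (transversals I A k)) \<le> real (card I choose k) * (real (card X) / real (card I)) ^ k"
    using card_transversals_turan[of I A k] I finA k UA by (auto simp: A_def)
  also have "real (card T1) * n ^ (k - 2) \<le> real (card I) * (70 * n powr (4/3)) * n ^ (k - 2)"
    using cT1 n by (intro mult_right_mono) auto
  also have "\<dots> = 70 * real (card I) * n powr (real k - 2 / 3)"
  proof -
    have "n ^ (k - 2) = n powr (real k - 2)" using n k by (simp add: powr_realpow[symmetric] of_nat_diff)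
    then have "n powr (4/3) * n ^ (k - 2) = n powr (4/3 + (real k - 2))" by (simp only: powr_add)
    also have "4/3 + (real k - 2) = real k - 2 / 3" by simp
    finally show ?thesis by (simp add: mult_ac)
  qed
  also have "real (card T2) * n ^ (k - 3) \<le> 2 * n ^ 2 * n ^ (k - 3)" using cT2 n by (intro mult_right_mono) auto
  also have "\<dots> \<le> 2 * n powr (real k - 2 / 3)"
  proof -
    have "2 + (k - 3) = k - 1" using k by simp
    then have "n ^ 2 * n ^ (k - 3) = n ^ (k - 1)" by (metis power_add)
    also have "\<dots> = n powr (real k - 1)" using n k by (simp add: powr_realpow[symmetric] of_nat_diff)
    also have "\<dots> \<le> n powr (real k - 2 / 3)" using n by (intro powr_mono) auto
    finally show ?thesis by simp
  qed
  finally show ?thesis by (simp add: n_def algebra_simps)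
qed

text \<open>The first two binomial terms, by Bernoulli; this bounds the growth of the main term from
  \<open>m\<close> to \<open>m + 1\<close> points.\<close>

lemma power_add_ge: "(m :: real) \<ge> 0 \<Longrightarrow> k \<ge> 2 \<Longrightarrow> m ^ k + real k * m ^ (k - 1) \<le> (m + 1) ^ k"
proof (cases "m = 0")
  case True
  moreover assume "k \<ge> 2"
  ultimately show ?thesis by (simp add: power_0_left)
next
  case False
  assume "m \<ge> 0" "k \<ge> 2"
  with False have m: "m > 0" by simp
  have kk: "m ^ k = m ^ (k - 1) * m" using \<open>k \<ge> 2\<close> by (metis Suc_diff_1 power_Suc2 zero_less_numeral order_less_le_trans)
  have "1 + real k * (1 / m) \<le> (1 + 1 / m) ^ k" by (rule Bernoulli_inequality) (use m in \<open>simp add: order_trans[of _ 0]\<close>)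
  then have "m ^ k * (1 + real k * (1 / m)) \<le> m ^ k * (1 + 1 / m) ^ k" using m by (intro mult_left_mono) auto
  also have "\<dots> = (m + 1) ^ k" using m by (simp add: power_mult_distrib[symmetric] distrib_left)
  also have "m ^ k * (1 + real k * (1 / m)) = m ^ k + real k * m ^ (k - 1)"
    unfolding kk using m by (simp add: field_simps)
  finally show ?thesis .
qed

text \<open>Induction on the number of points. A vertex of degree below
  \<open>c * (n - 1) ^ (k - 1)\<close> is deleted, and the main term grows by at least that much
  from \<open>n - 1\<close> to \<open>n\<close>. Without such a vertex, \<open>lenz_cover\<close>
  puts all points into one configuration.\<close>

lemma spanned_simplices_upper_bound:
  assumes dim: "DIM('a::euclidean_space) = 2 * r + 1" and k: "3 \<le> k" "k \<le> r"
  shows "\<exists>C>0. \<forall>X :: 'a set. finite X \<longrightarrow> real (card (spanned_simplices k X))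
     \<le> real (r choose k) * (real (card X) / real r) ^ k + C * real (card X) powr (real k - 2 / 3)"
proof -
  obtain \<epsilon> n0 where \<epsilon>: "\<epsilon> > 0" and cover: "\<forall>X :: 'a set. finite X \<longrightarrow> card X \<ge> n0 \<longrightarrow>
     (\<forall>v\<in>X. (limit_degree r k - \<epsilon>) * real (card X) ^ (k - 1) \<le> real (simplex_degree k X v)) \<longrightarrow>
     (\<exists>(I :: 'a set) Z t. lenz I Z t \<and> card I = r \<and> X \<subseteq> (\<Union>i\<in>I. sphere_part I Z t i))"
    using lenz_cover[OF dim k] by (elim exE conjE)
  define c where "c = limit_degree r k"
  have c0: "c \<ge> 0" by (simp add: c_def limit_degree_def)
  \<comment> \<open>So \<open>c * m ^ (k - 1)\<close> is the derivative of the main term at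
    \<open>m\<close>.\<close>
  have cb: "c = real k * (real (r choose k) / real r ^ k)"
  proof -
    have "fact (k - 1) * c = fact k * real (r choose k) / real r ^ k"
      using limit_degree_turan[of k r] turan_dens_binomial[of r k] k by (simp add: c_def)
    also have "\<dots> = fact (k - 1) * (real k * (real (r choose k) / real r ^ k))"
      using fact_reduce[of k, where ?'a = real] k by simp
    finally have "fact (k - 1) * c = fact (k - 1) * (real k * (real (r choose k) / real r ^ k))" .
    then show ?thesis by (simp only: mult_left_cancel[OF fact_nonzero])
  qed
  \<comment> \<open>From here on \<open>(n - 1) ^ (k - 1)\<close> is so close to
    \<open>n ^ (k - 1)\<close> that the deletion threshold implies the degree hypothesis of
    \<open>lenz_cover\<close>.\<close>
  define N where "N = Max {1, n0, nat \<lceil>c * real k / \<epsilon>\<rceil>}"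
  have N: "N \<ge> 1" "N \<ge> n0" "N \<ge> nat \<lceil>c * real k / \<epsilon>\<rceil>"
    unfolding N_def by (intro Max_ge; simp)+
  \<comment> \<open>\<open>real N\<close> covers fewer than \<open>N\<close> points through the
    trivial bound \<open>n ^ k\<close>, which is at most \<open>n\<close> times the error term; the
    rest is the constant of \<open>lenz_simplex_count\<close>.\<close>
  define C where "C = real N + 70 * real r + 2"
  define b where "b n = real (r choose k) * (real n / real r) ^ k + C * real n powr (real k - 2 / 3)" for n :: nat
  have "real (card (spanned_simplices k X)) \<le> b (card X)" if "finite X" for X :: "'a set"
    using that
  proof (induction "card X" arbitrary: X rule: less_induct)
    case less
    define n where "n = real (card X)"
    show ?case
    proof (cases "card X < N")
      case True
      have "spanned_simplices k X \<subseteq> {S. S \<subseteq> X \<and> card S = k \<and> {} \<subseteq> S}"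
        by (auto simp: spanned_simplices_def regular_simplex_def)
      then have "card (spanned_simplices k X) \<le> card {S. S \<subseteq> X \<and> card S = k \<and> {} \<subseteq> S}"
        using less.prems by (intro card_mono finite_subset_family)
      also have "\<dots> \<le> card X ^ k" using card_supersets_le[OF less.prems, of "{}" k] by simp
      finally have le: "real (card (spanned_simplices k X)) \<le> n ^ k" unfolding n_def by (simp flip: of_nat_power)
      show ?thesis
      proof (cases "card X = 0")
        case True
        then show ?thesis using le k by (simp add: b_def n_def power_0_left)
      next
        case False
        then have n: "n \<ge> 1" by (simp add: n_def)
        have "n ^ k = n powr (2 / 3 + (real k - 2 / 3))" using n by (simp add: powr_realpow)
        also have "\<dots> = n powr (2 / 3) * n powr (real k - 2 / 3)" by (rule powr_add)
        also have "\<dots> \<le> C * n powr (real k - 2 / 3)"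
        proof (rule mult_right_mono)
          have "n powr (2 / 3) \<le> n powr 1" using n by (intro powr_mono) auto
          also have "\<dots> \<le> real N" using True n by (simp add: n_def)
          also have "\<dots> \<le> C" by (simp add: C_def)
          finally show "n powr (2 / 3) \<le> C" .
        qed simp
        also have "\<dots> \<le> b (card X)" by (simp add: b_def n_def)
        finally show ?thesis using le by simp
      qed
    next
      case False
      then have X1: "card X \<ge> 1" "card X \<ge> n0" "card X \<ge> nat \<lceil>c * real k / \<epsilon>\<rceil>" using N by auto
      have n: "n \<ge> 1" "n \<ge> c * real k / \<epsilon>" using X1(1,3) unfolding n_def by linarith+
      show ?thesis
      proof (cases "\<forall>v\<in>X. c * (n - 1) ^ (k - 1) \<le> real (simplex_degree k X v)")
        case True
        have "(c - \<epsilon>) * n ^ (k - 1) \<le> c * (n - 1) ^ (k - 1)"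
        proof -
          have "1 + real (k - 1) * (- 1 / n) \<le> (1 + (- 1 / n)) ^ (k - 1)"
            by (rule Bernoulli_inequality) (use n in \<open>simp add: field_simps\<close>)
          moreover have "real (k - 1) * (1 / n) \<le> real k / n" using n by (simp add: divide_right_mono)
          ultimately have "1 - real k / n \<le> (1 - 1 / n) ^ (k - 1)" by simp
          then have "c * (1 - real k / n) \<le> c * (1 - 1 / n) ^ (k - 1)" using c0 by (rule mult_left_mono)
          moreover have "c * real k / n \<le> \<epsilon>" using n \<epsilon> by (simp add: field_simps)
          ultimately have "c - \<epsilon> \<le> c * (1 - 1 / n) ^ (k - 1)" by (simp add: right_diff_distrib)
          then have "(c - \<epsilon>) * n ^ (k - 1) \<le> c * (1 - 1 / n) ^ (k - 1) * n ^ (k - 1)" using n by (intro mult_right_mono) auto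
          also have "\<dots> = c * ((1 - 1 / n) * n) ^ (k - 1)" by (simp add: power_mult_distrib)
          also have "(1 - 1 / n) * n = n - 1" using n by (simp add: field_simps)
          finally show ?thesis .
        qed
        then have "\<forall>v\<in>X. (limit_degree r k - \<epsilon>) * real (card X) ^ (k - 1) \<le> real (simplex_degree k X v)"
          using True unfolding c_def n_def by (meson order_trans)
        then obtain I :: "'a set" and Z t where L: "lenz I Z t" "card I = r" "X \<subseteq> (\<Union>i\<in>I. sphere_part I Z t i)"
          using cover[rule_format, OF less.prems X1(2)] by blast
        have "real (card (spanned_simplices k X)) \<le> real (r choose k) * (real (card X) / real r) ^ k
           + (70 * real r + 2) * real (card X) powr (real k - 2 / 3)"
          using lenz_simplex_count[OF L(1) less.prems L(3) k(1)] k L(2) by simp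
        also have "\<dots> \<le> b (card X)" unfolding b_def C_def by (intro add_left_mono mult_right_mono) auto
        finally show ?thesis .
      next
        case False
        then obtain v where v: "v \<in> X" "real (simplex_degree k X v) < c * (n - 1) ^ (k - 1)" by (auto simp: not_le)
        have cX: "card (X - {v}) = card X - 1" using v less.prems by simp
        have "spanned_simplices k X = spanned_simplices k (X - {v}) \<union> {S \<in> spanned_simplices k X. v \<in> S}"
          by (auto simp: spanned_simplices_def)
        then have "card (spanned_simplices k X) \<le> card (spanned_simplices k (X - {v})) + simplex_degree k X v"
          unfolding simplex_degree_def by (metis card_Un_le)
        then have "real (card (spanned_simplices k X)) \<le> real (card (spanned_simplices k (X - {v}))) + c * (n - 1) ^ (k - 1)"
          using v(2) by linarith
        also have "real (card (spanned_simplices k (X - {v}))) \<le> b (card X - 1)"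
          using less.hyps[of "X - {v}"] less.prems cX X1(1) by simp
        also have "b (card X - 1) + c * (n - 1) ^ (k - 1) \<le> b (card X)"
        proof -
          define m where "m = n - 1"
          have m: "real (card X - 1) = m" "n = m + 1" "m \<ge> 0" using X1(1) by (simp_all add: m_def n_def of_nat_diff)
          have "m powr (real k - 2 / 3) \<le> n powr (real k - 2 / 3)" using m k by (intro powr_mono2) auto
          then have p: "C * m powr (real k - 2 / 3) \<le> C * n powr (real k - 2 / 3)" by (intro mult_left_mono) (auto simp: C_def)
          have "real (r choose k) * (m / real r) ^ k + c * m ^ (k - 1) = real (r choose k) / real r ^ k * (m ^ k + real k * m ^ (k - 1))"
            unfolding cb by (simp add: power_divide algebra_simps)
          also have "\<dots> \<le> real (r choose k) / real r ^ k * (m + 1) ^ k"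
            using power_add_ge[of m k] m k by (intro mult_left_mono) auto
          also have "\<dots> = real (r choose k) * (n / real r) ^ k" by (simp add: m(2) power_divide)
          finally show ?thesis using p unfolding b_def m(1) n_def[symmetric] m_def by linarith
        qed
        finally show ?thesis by simp
      qed
    qed
  qed
  moreover have "C > 0" by (simp add: C_def add_nonneg_pos)
  ultimately show ?thesis unfolding b_def by blast
qed

section \<open>The lower bound\<close>

text \<open>The classical grid with many incidences:
  \<open>v (x, y) \<bullet> w (m, z) = m * x - y + z\<close>, so orthogonality says that the point
  \<open>(x, y)\<close> lies on the line with slope \<open>m\<close> and intercept \<open>z\<close>.
  Of the order of \<open>M ^ 3\<close> points and lines have \<open>M ^ 4\<close> incidences, and
  normalising puts both on one unit sphere.\<close>

lemma grid_orthogonal_pairs: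
  fixes a b c :: "'a::euclidean_space" and M :: nat
  assumes on: "a \<bullet> a = 1" "b \<bullet> b = 1" "c \<bullet> c = 1" "a \<bullet> b = 0" "a \<bullet> c = 0" "b \<bullet> c = 0"
  shows "\<exists>P L. finite P \<and> finite L \<and> P \<inter> L = {} \<and> card (P \<union> L) \<le> 3 * M ^ 3 \<and>
     (\<forall>x\<in>P \<union> L. norm x = 1 \<and> x \<in> span {a, b, c}) \<and> M ^ 4 \<le> card {(p, l) \<in> P \<times> L. p \<bullet> l = 0}"
proof -
  have on': "b \<bullet> a = 0" "c \<bullet> a = 0" "c \<bullet> b = 0" using on by (simp_all add: inner_commute)
  define v where "v = (\<lambda>(x, y). real x *\<^sub>R a + real y *\<^sub>R b + c)"
  define w where "w = (\<lambda>(m, z). real m *\<^sub>R a - b + real z *\<^sub>R c)"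
  have vi: "v (x, y) \<bullet> a = real x" "v (x, y) \<bullet> b = real y" "v (x, y) \<bullet> c = 1" for x y
    using on on' by (simp_all add: v_def inner_add_left)
  have wi: "w (x, y) \<bullet> a = real x" "w (x, y) \<bullet> b = - 1" "w (x, y) \<bullet> c = real y" for x y
    using on on' by (simp_all add: w_def inner_add_left inner_diff_left)
  have sgn_eq: "u = u'" if s: "sgn u = sgn u'" and d: "u \<bullet> d = u' \<bullet> d" "u \<bullet> d \<noteq> 0" for u u' d :: 'a
  proof -
    have "u \<noteq> 0" "u' \<noteq> 0" using d by auto
    have "inverse (norm u) * (u \<bullet> d) = inverse (norm u') * (u' \<bullet> d)"
      using arg_cong[OF s, of "\<lambda>x. x \<bullet> d"] by (simp add: sgn_div_norm)
    then have "norm u = norm u'" using d by simp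
    then show ?thesis using s \<open>u \<noteq> 0\<close> \<open>u' \<noteq> 0\<close> by (simp add: sgn_div_norm)
  qed
  have inj_v: "p = p'" if "sgn (v p) = sgn (v p')" for p p'
  proof -
    obtain x y x' y' where p: "p = (x, y)" "p' = (x', y')" by (metis surj_pair)
    have "v p = v p'" by (rule sgn_eq[OF that, of c]) (simp_all add: p vi)
    then have "v p \<bullet> a = v p' \<bullet> a" "v p \<bullet> b = v p' \<bullet> b" by simp_all
    then show ?thesis by (simp add: p vi)
  qed
  have inj_w: "p = p'" if "sgn (w p) = sgn (w p')" for p p'
  proof -
    obtain x y x' y' where p: "p = (x, y)" "p' = (x', y')" by (metis surj_pair)
    have "w p = w p'" by (rule sgn_eq[OF that, of b]) (simp_all add: p wi)
    then have "w p \<bullet> a = w p' \<bullet> a" "w p \<bullet> c = w p' \<bullet> c" by simp_all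
    then show ?thesis by (simp add: p wi)
  qed
  \<comment> \<open>Ordinates up to \<open>2 * M\<^sup>2\<close> leave room for
    \<open>m * x + z\<close>.\<close>
  define P where "P = (\<lambda>p. sgn (v p)) ` ({1..M} \<times> {1..2 * M\<^sup>2})"
  define L where "L = (\<lambda>p. sgn (w p)) ` ({1..M} \<times> {1..M\<^sup>2})"
  have "finite P" "finite L" by (simp_all add: P_def L_def)
  have "card P \<le> M * (2 * M\<^sup>2)" unfolding P_def
    using card_image_le[of "{1..M} \<times> {1..2 * M\<^sup>2}" "\<lambda>p. sgn (v p)"] by (simp add: card_cartesian_product)
  moreover have "card L \<le> M * M\<^sup>2" unfolding L_def
    using card_image_le[of "{1..M} \<times> {1..M\<^sup>2}" "\<lambda>p. sgn (w p)"] by (simp add: card_cartesian_product)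
  moreover have "card (P \<union> L) \<le> card P + card L" by (rule card_Un_le)
  ultimately have cPL: "card (P \<union> L) \<le> 3 * M ^ 3" by (simp add: power2_eq_square power3_eq_cube)
  have disj: "P \<inter> L = {}"
  proof -
    have "p \<bullet> b > 0" if p: "p \<in> P" for p
    proof -
      from p obtain x y where q: "p = sgn (v (x, y))" "y \<ge> 1" by (auto simp: P_def)
      have "v (x, y) \<bullet> b > 0" using q(2) by (simp add: vi)
      moreover from this have "v (x, y) \<noteq> 0" by auto
      ultimately show ?thesis by (simp add: q(1) sgn_div_norm)
    qed
    moreover have "p \<bullet> b < 0" if p: "p \<in> L" for p
    proof -
      from p obtain x y where q: "p = sgn (w (x, y))" by (auto simp: L_def)
      have "w (x, y) \<bullet> b < 0" by (simp add: wi)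
      moreover from this have "w (x, y) \<noteq> 0" by auto
      ultimately show ?thesis by (simp add: q sgn_div_norm mult_pos_neg)
    qed
    ultimately show ?thesis by force
  qed
  have unit: "norm x = 1 \<and> x \<in> span {a, b, c}" if "x \<in> P \<union> L" for x
  proof -
    have sp: "a \<in> span {a, b, c}" "b \<in> span {a, b, c}" "c \<in> span {a, b, c}" by (simp_all add: span_base)
    have "\<exists>u. u \<noteq> 0 \<and> u \<in> span {a, b, c} \<and> x = sgn u"
    proof (cases "x \<in> P")
      case True
      then obtain p where "x = sgn (v p)" by (auto simp: P_def)
      moreover obtain i j where p: "p = (i, j)" by (metis surj_pair)
      moreover have "v (i, j) \<noteq> 0" using vi(3)[of i j] by auto
      moreover have "v (i, j) \<in> span {a, b, c}" unfolding v_def prod.case by (intro span_add span_scale sp)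
      ultimately show ?thesis by blast
    next
      case False
      with that have "x \<in> L" by simp
      then obtain p where "x = sgn (w p)" by (auto simp: L_def)
      moreover obtain i j where p: "p = (i, j)" by (metis surj_pair)
      moreover have "w (i, j) \<noteq> 0" using wi(2)[of i j] by auto
      moreover have "w (i, j) \<in> span {a, b, c}" unfolding w_def prod.case by (intro span_add span_diff span_scale sp)
      ultimately show ?thesis by blast
    qed
    then obtain u where u: "u \<noteq> 0" "u \<in> span {a, b, c}" "x = sgn u" by blast
    have "norm x = 1" using u by (simp add: norm_sgn)
    moreover have "x \<in> span {a, b, c}" unfolding u(3) sgn_div_norm using u(2) by (rule span_scale)
    ultimately show ?thesis by blast
  qed
  have inc: "M ^ 4 \<le> card {(p, l) \<in> P \<times> L. p \<bullet> l = 0}"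
  proof -
    let ?D = "{1..M} \<times> {1..M} \<times> {1..M\<^sup>2}"
    have "card ?D \<le> card {(p, l) \<in> P \<times> L. p \<bullet> l = 0}"
    proof (rule card_inj_on_le[where f = "\<lambda>(x, m, z). (sgn (v (x, m * x + z)), sgn (w (m, z)))"])
      show "inj_on (\<lambda>(x, m, z). (sgn (v (x, m * x + z)), sgn (w (m, z)))) ?D"
      proof (rule inj_onI)
        fix s s' assume eq: "(case s of (x, m, z) \<Rightarrow> (sgn (v (x, m * x + z)), sgn (w (m, z))))
          = (case s' of (x, m, z) \<Rightarrow> (sgn (v (x, m * x + z)), sgn (w (m, z))))"
        obtain x m z x' m' z' where s: "s = (x, m, z)" "s' = (x', m', z')" by (metis surj_pair)
        have "(x, m * x + z) = (x', m' * x' + z')" "(m, z) = (m', z')"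
          using eq inj_v[of "(x, m * x + z)" "(x', m' * x' + z')"] inj_w[of "(m, z)" "(m', z')"] by (simp_all add: s)
        then show "s = s'" by (simp add: s)
      qed
      show "(\<lambda>(x, m, z). (sgn (v (x, m * x + z)), sgn (w (m, z)))) ` ?D \<subseteq> {(p, l) \<in> P \<times> L. p \<bullet> l = 0}"
      proof (rule image_subsetI)
        fix s assume sD: "s \<in> ?D"
        obtain x m z where s: "s = (x, m, z)" by (metis surj_pair)
        have b: "1 \<le> x" "x \<le> M" "1 \<le> m" "m \<le> M" "1 \<le> z" "z \<le> M\<^sup>2" using sD s by auto
        have "m * x \<le> M * M" using b by (intro mult_mono) auto
        then have "m * x + z \<le> 2 * M\<^sup>2" using b by (simp add: power2_eq_square)
        then have "sgn (v (x, m * x + z)) \<in> P" using b by (auto simp: P_def)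
        moreover have "sgn (w (m, z)) \<in> L" using b by (auto simp: L_def)
        moreover have "v (x, m * x + z) \<bullet> w (m, z) = 0"
        proof -
          have "v (x, m * x + z) \<bullet> w (m, z) = real m * (v (x, m * x + z) \<bullet> a) - v (x, m * x + z) \<bullet> b + real z * (v (x, m * x + z) \<bullet> c)"
            by (simp add: w_def inner_add_right inner_diff_right)
          also have "\<dots> = 0" by (simp add: vi)
          finally show ?thesis .
        qed
        ultimately show "(case s of (x, m, z) \<Rightarrow> (sgn (v (x, m * x + z)), sgn (w (m, z)))) \<in> {(p, l) \<in> P \<times> L. p \<bullet> l = 0}"
          by (simp add: s sgn_div_norm)
      qed
      show "finite {(p, l) \<in> P \<times> L. p \<bullet> l = 0}"
        by (rule finite_subset[of _ "P \<times> L"]) (use \<open>finite P\<close> \<open>finite L\<close> in auto)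
    qed
    moreover have "card ?D = M ^ 4" by (simp add: card_cartesian_product power2_eq_square power4_eq_xxxx)
    ultimately show ?thesis by simp
  qed
  show ?thesis using \<open>finite P\<close> \<open>finite L\<close> disj cPL unit inc by blast
qed

text \<open>By disjointness, every element of the image reveals its index.\<close>

lemma inj_sections:
  assumes disj: "\<And>i j. i \<in> I \<Longrightarrow> j \<in> I \<Longrightarrow> i \<noteq> j \<Longrightarrow> A i \<inter> A j = {}"
  shows "inj_on (\<lambda>(J, f). f ` J) (Sigma {J. J \<subseteq> I} (\<lambda>J. Pi\<^sub>E J A))"
proof (rule inj_onI)
  fix a b assume ab: "a \<in> Sigma {J. J \<subseteq> I} (\<lambda>J. Pi\<^sub>E J A)" "b \<in> Sigma {J. J \<subseteq> I} (\<lambda>J. Pi\<^sub>E J A)"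
    and eq: "(case a of (J, f) \<Rightarrow> f ` J) = (case b of (J, f) \<Rightarrow> f ` J)"
  obtain J f J' f' where a: "a = (J, f)" and b: "b = (J', f')" by (metis surj_pair)
  have m: "J \<subseteq> I" "f \<in> Pi\<^sub>E J A" "J' \<subseteq> I" "f' \<in> Pi\<^sub>E J' A" and im: "f ` J = f' ` J'" using ab eq a b by auto
  have key: "j \<in> J' \<and> f j = f' j"
    if JJ: "J \<subseteq> I" "f \<in> Pi\<^sub>E J A" "J' \<subseteq> I" "f' \<in> Pi\<^sub>E J' A" "f ` J = f' ` J'" and j: "j \<in> J" for J J' f f' j
  proof -
    have "f j \<in> f' ` J'" using JJ(5) j by blast
    then obtain j' where j': "j' \<in> J'" "f j = f' j'" by blast
    have "f j \<in> A j" "f j \<in> A j'" using JJ(2,4) j j' by (auto simp: PiE_def Pi_def)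
    then have "j = j'" using disj[of j j'] JJ(1,3) j j'(1) by blast
    then show ?thesis using j' by simp
  qed
  have "J = J'" using key[OF m im] key[OF m(3,4,1,2) im[symmetric]] by blast
  moreover have "f = f'"
    by (rule PiE_ext[OF m(2)]) (use m(4) \<open>J = J'\<close> key[OF m im] in auto)
  ultimately show "a = b" using a b by simp
qed

lemma section_inj_on:
  assumes disj: "\<And>i j. i \<in> J \<Longrightarrow> j \<in> J \<Longrightarrow> i \<noteq> j \<Longrightarrow> A i \<inter> A j = {}" and f: "f \<in> Pi\<^sub>E J A"
  shows "inj_on f J"
proof (rule inj_onI)
  fix i j assume ij: "i \<in> J" "j \<in> J" "f i = f j"
  have "f i \<in> A i" "f j \<in> A j" using f ij by (auto simp: PiE_def Pi_def)
  then show "i = j" using disj[of i j] ij by auto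
qed

text \<open>Two families of simplices of side \<open>sqrt 2\<close>: one vertex in each of
  \<open>k\<close> different parts, or one in each of the first \<open>k - 2\<close> parts and an
  orthogonal pair from \<open>P \<times> L\<close> in the last. The second family has two vertices
  in one part, so the families are disjoint.\<close>

lemma lenz_construction:
  fixes q M :: nat
  assumes dim: "DIM('a::euclidean_space) = 2 * r + 1" and k: "3 \<le> k" "k \<le> r" and qM: "3 * M ^ 3 \<le> q" and n: "r * q \<le> n"
  shows "\<exists>X :: 'a set. finite X \<and> card X = n \<and> (r choose k) * q ^ k + M ^ 4 * q ^ (k - 2) \<le> card (spanned_simplices k X)"
proof -
  obtain e where e: "bij_betw e {0..<2 * r + 1} (Basis :: 'a set)"
    using ex_bij_betw_nat_finite[of "Basis :: 'a set"] dim by auto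
  have eB: "e i \<in> Basis" if "i < 2 * r + 1" for i using e that by (auto simp: bij_betw_def)
  have ee: "e i \<bullet> e j = (if i = j then 1 else 0)" if "i < 2 * r + 1" "j < 2 * r + 1" for i j
  proof -
    have "e i = e j \<longleftrightarrow> i = j" using e that by (auto simp: bij_betw_def inj_on_def)
    then show ?thesis using eB that by (simp add: inner_Basis)
  qed
  \<comment> \<open>Coordinate blocks of the parts: two coordinates each, except that the last block
    takes three, so that it supports a 2-sphere.\<close>
  define K where "K i = (if i = r - 1 then {2 * r - 2, 2 * r - 1, 2 * r} else {2 * i, 2 * i + 1})" for i
  have Kd: "K i \<inter> K j = {}" if "i < r" "j < r" "i \<noteq> j" for i j using that by (auto simp: K_def)
  define U where "U i = {x :: 'a. norm x = 1 \<and> (\<forall>l<2 * r + 1. l \<notin> K i \<longrightarrow> x \<bullet> e l = 0)}" for i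
  have orth: "x \<bullet> y = 0" if ij: "i < r" "j < r" "i \<noteq> j" and xy: "x \<in> U i" "y \<in> U j" for i j x y
  proof -
    have "(x \<bullet> b) * (y \<bullet> b) = 0" if "b \<in> Basis" for b
    proof -
      have "b \<in> e ` {0..<2 * r + 1}" using that e by (simp add: bij_betw_def)
      then obtain l where l: "l < 2 * r + 1" "b = e l" by auto
      have "l \<notin> K i \<or> l \<notin> K j" using Kd[OF ij] by blast
      then show ?thesis using xy l by (auto simp: U_def)
    qed
    then show ?thesis by (subst euclidean_inner) (simp add: sum.neutral)
  qed
  have Udisj: "U i \<inter> U j = {}" if "i < r" "j < r" "i \<noteq> j" for i j
  proof -
    have False if "x \<in> U i" "x \<in> U j" for x
    proof -
      have "x \<bullet> x = 0" by (rule orth[OF \<open>i < r\<close> \<open>j < r\<close> \<open>i \<noteq> j\<close> that])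
      then show False using that by (simp add: U_def)
    qed
    then show ?thesis by blast
  qed
  have d2: "dist x y = sqrt 2" if "norm x = 1" "norm y = 1" "x \<bullet> y = 0" for x y :: 'a
  proof -
    have "(dist x y)\<^sup>2 = 2"
      using that by (simp add: dist_norm power2_norm_eq_inner inner_diff_left inner_diff_right inner_commute norm_eq_1)
    then show ?thesis by (metis real_sqrt_abs abs_of_nonneg zero_le_dist)
  qed
  have Uinf: "infinite (U i)" if i: "i < r" for i
  proof -
    define g where "g \<phi> = cos \<phi> *\<^sub>R e (2 * i) + sin \<phi> *\<^sub>R e (2 * i + 1)" for \<phi>
    have il: "2 * i < 2 * r + 1" "2 * i + 1 < 2 * r + 1" using i by auto
    have ge: "g \<phi> \<bullet> e l = (if l = 2 * i then cos \<phi> else if l = 2 * i + 1 then sin \<phi> else 0)" if "l < 2 * r + 1" for \<phi> l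
      using ee[OF il(1) that] ee[OF il(2) that] by (simp add: g_def inner_add_left)
    have "g \<phi> \<bullet> g \<phi> = 1" for \<phi>
    proof -
      have "g \<phi> \<bullet> g \<phi> = cos \<phi> * (g \<phi> \<bullet> e (2 * i)) + sin \<phi> * (g \<phi> \<bullet> e (2 * i + 1))"
        by (subst (2) g_def) (simp add: inner_add_right)
      also have "\<dots> = 1" using ge[OF il(1)] ge[OF il(2)] by (simp flip: power2_eq_square)
      finally show ?thesis .
    qed
    moreover have "2 * i \<in> K i" "2 * i + 1 \<in> K i" using i by (auto simp: K_def)
    ultimately have gU: "g \<phi> \<in> U i" for \<phi> using ge by (auto simp: U_def norm_eq_1)
    have "inj_on g {0..1}"
    proof (rule inj_onI)
      fix \<phi> \<psi> :: real assume "\<phi> \<in> {0..1}" "\<psi> \<in> {0..1}" "g \<phi> = g \<psi>"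
      then have "cos \<phi> = cos \<psi>" using ge[OF il(1), of \<phi>] ge[OF il(1), of \<psi>] by simp
      moreover have "\<phi> \<le> pi" "\<psi> \<le> pi" using \<open>\<phi> \<in> {0..1}\<close> \<open>\<psi> \<in> {0..1}\<close> pi_ge_two by auto
      ultimately show "\<phi> = \<psi>" using \<open>\<phi> \<in> {0..1}\<close> \<open>\<psi> \<in> {0..1}\<close> cos_inj_pi[of \<phi> \<psi>] by auto
    qed
    then have "infinite (g ` {0..1})" using infinite_Icc[of "0 :: real" 1] by (simp add: finite_image_iff)
    then show ?thesis using gU by (meson finite_subset image_subsetI)
  qed
  have r: "2 * r - 2 < 2 * r + 1" "2 * r - 1 < 2 * r + 1" "2 * r < 2 * r + 1" "2 * r - 2 \<noteq> 2 * r - 1" "2 * r - 2 \<noteq> 2 * r" "2 * r - 1 \<noteq> 2 * r"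
    using k by auto
  obtain P L where PL: "finite P" "finite L" "P \<inter> L = {}" "card (P \<union> L) \<le> 3 * M ^ 3"
    "\<And>x. x \<in> P \<union> L \<Longrightarrow> norm x = 1 \<and> x \<in> span {e (2 * r - 2), e (2 * r - 1), e (2 * r)}"
    "M ^ 4 \<le> card {(p, l) \<in> P \<times> L. p \<bullet> l = 0}"
    using grid_orthogonal_pairs[of "e (2 * r - 2)" "e (2 * r - 1)" "e (2 * r)" M] ee r by auto
  have PLU: "P \<union> L \<subseteq> U (r - 1)"
  proof
    fix x assume x: "x \<in> P \<union> L"
    have "x \<bullet> e l = 0" if l: "l < 2 * r + 1" "l \<notin> K (r - 1)" for l
    proof -
      have "l \<noteq> 2 * r - 2" "l \<noteq> 2 * r - 1" "l \<noteq> 2 * r" using l by (auto simp: K_def)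
      then have "span {e (2 * r - 2), e (2 * r - 1), e (2 * r)} \<subseteq> {x. x \<bullet> e l = 0}"
        using ee l r by (intro span_minimal subspace_hyperplane2) auto
      then show ?thesis using PL(5)[OF x] by blast
    qed
    then show "x \<in> U (r - 1)" using PL(5)[OF x] by (simp add: U_def)
  qed
  have "\<exists>A. A \<subseteq> U i \<and> finite A \<and> card A = q \<and> (i = r - 1 \<longrightarrow> P \<union> L \<subseteq> A)" if i: "i < r" for i
  proof (cases "i = r - 1")
    case True
    have "infinite (U i - (P \<union> L))" using Uinf[OF i] PL(1,2) by simp
    then obtain B where B: "finite B" "card B = q - card (P \<union> L)" "B \<subseteq> U i - (P \<union> L)"
      using infinite_arbitrarily_large by blast
    have "card ((P \<union> L) \<union> B) = card (P \<union> L) + card B" using B PL(1,2) by (intro card_Un_disjoint) auto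
    then have "card ((P \<union> L) \<union> B) = q" using B(2) PL(4) qM by simp
    then show ?thesis using B PLU True PL(1,2) by (intro exI[of _ "(P \<union> L) \<union> B"]) auto
  next
    case False
    then show ?thesis using infinite_arbitrarily_large[OF Uinf[OF i]] by metis
  qed
  then obtain A where A: "\<And>i. i < r \<Longrightarrow> A i \<subseteq> U i" "\<And>i. i < r \<Longrightarrow> finite (A i)" "\<And>i. i < r \<Longrightarrow> card (A i) = q" "P \<union> L \<subseteq> A (r - 1)"
  proof -
    assume *: "\<And>A. (\<And>i. i < r \<Longrightarrow> A i \<subseteq> U i) \<Longrightarrow> (\<And>i. i < r \<Longrightarrow> finite (A i)) \<Longrightarrow> (\<And>i. i < r \<Longrightarrow> card (A i) = q) \<Longrightarrow> P \<union> L \<subseteq> A (r - 1) \<Longrightarrow> thesis"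
    assume "\<And>i. i < r \<Longrightarrow> \<exists>A. A \<subseteq> U i \<and> finite A \<and> card A = q \<and> (i = r - 1 \<longrightarrow> P \<union> L \<subseteq> A)"
    then have "\<forall>i\<in>{..<r}. \<exists>A. A \<subseteq> U i \<and> finite A \<and> card A = q \<and> (i = r - 1 \<longrightarrow> P \<union> L \<subseteq> A)" by simp
    from bchoice[OF this] obtain A where "\<forall>i\<in>{..<r}. A i \<subseteq> U i \<and> finite (A i) \<and> card (A i) = q \<and> (i = r - 1 \<longrightarrow> P \<union> L \<subseteq> A i)" by blast
    then show thesis using k by (intro *[of A]) auto
  qed
  have Adisj: "A i \<inter> A j = {}" if "i < r" "j < r" "i \<noteq> j" for i j
    using Udisj[OF that] A(1)[OF that(1)] A(1)[OF that(2)] by blast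
  define X0 where "X0 = (\<Union>i<r. A i)"
  have finX0: "finite X0" using A(2) by (simp add: X0_def)
  have "card X0 \<le> (\<Sum>i<r. card (A i))" unfolding X0_def by (intro card_UN_le) simp
  also have "\<dots> = r * q" using A(3) by simp
  finally have cX0: "card X0 \<le> n" using n by simp
  \<comment> \<open>The remaining \<open>n - card X0\<close> points are arbitrary; they cannot
    destroy simplices.\<close>
  have "infinite (UNIV - X0)"
  proof
    assume "finite (UNIV - X0)"
    then have "finite (UNIV :: 'a set)" using finX0 by simp
    then have "finite (U 0)" by (rule finite_subset[OF subset_UNIV])
    then show False using Uinf[of 0] k by simp
  qed
  then obtain Y where Y: "finite Y" "card Y = n - card X0" "Y \<subseteq> UNIV - X0" using infinite_arbitrarily_large by blast
  define X where "X = X0 \<union> Y"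
  have finX: "finite X" using finX0 Y by (simp add: X_def)
  have cX: "card X = n" unfolding X_def using finX0 Y cX0 by (subst card_Un_disjoint) auto
  have AX: "A i \<subseteq> X" if "i < r" for i using that by (auto simp: X_def X0_def)
  have simplexI: "S \<in> spanned_simplices k X"
    if "S \<subseteq> X" "finite S" "card S = k" "\<And>x y. x \<in> S \<Longrightarrow> y \<in> S \<Longrightarrow> x \<noteq> y \<Longrightarrow> dist x y = sqrt 2" for S
    using that unfolding spanned_simplices_def regular_simplex_def by blast
  have distA: "dist x y = sqrt 2" if "i < r" "j < r" "i \<noteq> j" "x \<in> A i" "y \<in> A j" for i j x y
  proof -
    have xy: "x \<in> U i" "y \<in> U j" using A(1)[OF that(1)] A(1)[OF that(2)] that(4,5) by auto
    then have "norm x = 1" "norm y = 1" by (simp_all add: U_def)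
    then show ?thesis using orth[OF that(1-3) xy] by (rule d2)
  qed
  define R1 where "R1 = Sigma {J. J \<subseteq> {..<r} \<and> card J = k} (\<lambda>J. Pi\<^sub>E J A)"
  define T1 where "T1 = (\<lambda>(J, f). f ` J) ` R1"
  have "inj_on (\<lambda>(J, f). f ` J) R1"
    by (rule inj_on_subset[OF inj_sections[of "{..<r}" A]]) (use Adisj in \<open>auto simp: R1_def\<close>)
  then have "card T1 = card R1" by (simp add: T1_def card_image)
  also have "card R1 = (\<Sum>J\<in>{J. J \<subseteq> {..<r} \<and> card J = k}. card (Pi\<^sub>E J A))"
    unfolding R1_def using A(2) finite_subset[of _ "{..<r}"]
    by (intro card_SigmaI finite_subset_family ballI finite_PiE) auto
  also have "\<dots> = (\<Sum>J\<in>{J. J \<subseteq> {..<r} \<and> card J = k}. q ^ k)"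
  proof (rule sum.cong[OF refl])
    fix J assume "J \<in> {J. J \<subseteq> {..<r} \<and> card J = k}"
    then have J: "J \<subseteq> {..<r}" "card J = k" "finite J" using finite_subset[of J "{..<r}"] by auto
    then have "card (Pi\<^sub>E J A) = (\<Prod>j\<in>J. card (A j))" by (intro card_PiE)
    also have "\<dots> = (\<Prod>j\<in>J. q)" using J A(3) by (intro prod.cong) auto
    finally show "card (Pi\<^sub>E J A) = q ^ k" using J by simp
  qed
  also have "\<dots> = (r choose k) * q ^ k" using n_subsets[of "{..<r}" k] by simp
  finally have cT1: "card T1 = (r choose k) * q ^ k" .
  have T1s: "T1 \<subseteq> spanned_simplices k X"
  proof
    fix S assume "S \<in> T1"
    then obtain J f where S: "J \<subseteq> {..<r}" "card J = k" "f \<in> Pi\<^sub>E J A" "S = f ` J" by (auto simp: T1_def R1_def)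
    have finJ: "finite J" using S(1) finite_subset by blast
    have fA: "f j \<in> A j" if "j \<in> J" for j using S(3) that by (auto simp: PiE_def Pi_def)
    show "S \<in> spanned_simplices k X"
    proof (rule simplexI)
      show "S \<subseteq> X" using fA AX S by auto
      show "finite S" using finJ S by simp
      have "inj_on f J" by (rule section_inj_on[OF _ S(3)]) (use Adisj S(1) in auto)
      then show "card S = k" using S by (simp add: card_image)
      fix x y assume "x \<in> S" "y \<in> S" "x \<noteq> y"
      then obtain i j where "i \<in> J" "j \<in> J" "x = f i" "y = f j" "i \<noteq> j" using S(4) by blast
      then show "dist x y = sqrt 2" using distA[of i j x y] fA S(1) by auto
    qed
  qed
  \<comment> \<open>The last part contributes \<open>P\<close> at index \<open>r - 1\<close> and
    \<open>L\<close> at a new index \<open>r\<close>, so that the second family also consists of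
    sections over disjoint sets.\<close>
  define A' where "A' i = (if i = r - 1 then P else if i = r then L else A i)" for i
  define J2 where "J2 = {..<k - 2} \<union> {r - 1, r}"
  have kr: "k - 2 \<le> r - 1" "k - 2 < r" using k by auto
  have J2: "finite J2" "card J2 = k"
  proof -
    have "card ({..<k - 2} \<union> {r - 1, r}) = card {..<k - 2} + card {r - 1, r}" using kr by (intro card_Un_disjoint) auto
    also have "card {r - 1, r} = 2" using k by simp
    finally show "card J2 = k" "finite J2" using k by (simp_all add: J2_def)
  qed
  have A'disj: "A' i \<inter> A' j = {}" if "i \<in> J2" "j \<in> J2" "i \<noteq> j" for i j
  proof -
    have rr: "r - 1 < r" using k by simp
    have small: "A' i = A i \<and> i < r - 1 \<and> i < r" if "i \<in> J2" "i \<noteq> r - 1" "i \<noteq> r" for i using that kr by (auto simp: A'_def J2_def)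
    have big: "A' i \<subseteq> A (r - 1)" if "i = r - 1 \<or> i = r" for i using that A(4) by (auto simp: A'_def)
    consider "i \<noteq> r - 1" "i \<noteq> r" "j \<noteq> r - 1" "j \<noteq> r" | "i \<noteq> r - 1" "i \<noteq> r" "j = r - 1 \<or> j = r"
      | "j \<noteq> r - 1" "j \<noteq> r" "i = r - 1 \<or> i = r" | "i = r - 1 \<or> i = r" "j = r - 1 \<or> j = r" by blast
    then show ?thesis
    proof cases
      case 1
      then show ?thesis using small[OF that(1)] small[OF that(2)] Adisj[of i j] that(3) by metis
    next
      case 2
      then have "A' i = A i" "i < r" "A' j \<subseteq> A (r - 1)" using small[OF that(1)] big[of j] by auto
      then show ?thesis using Adisj[OF _ rr, of i] 2 by blast
    next
      case 3
      then have "A' j = A j" "j < r" "A' i \<subseteq> A (r - 1)" using small[OF that(2)] big[of i] by auto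
      then show ?thesis using Adisj[OF _ rr, of j] 3 by blast
    next
      case 4
      then show ?thesis using that(3) PL(3) by (auto simp: A'_def)
    qed
  qed
  have rne: "r - 1 \<noteq> r" using k by simp
  define R2 where "R2 = {f \<in> Pi\<^sub>E J2 A'. f (r - 1) \<bullet> f r = 0}"
  define T2 where "T2 = (\<lambda>f. f ` J2) ` R2"
  have finA': "finite (A' i)" if "i \<in> J2" for i using that A(2)[of i] PL(1,2) kr by (auto simp: A'_def J2_def)
  have finR2: "finite R2" by (rule finite_subset[of _ "Pi\<^sub>E J2 A'"]) (auto simp: R2_def J2 finA' intro!: finite_PiE)
  have "inj_on (\<lambda>f. f ` J2) R2"
  proof (rule inj_onI)
    fix f f' assume "f \<in> R2" "f' \<in> R2" "f ` J2 = f' ` J2"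
    then have "(J2, f) = (J2, f')"
      using A'disj by (intro inj_onD[OF inj_sections[of J2 A']]) (auto simp: R2_def)
    then show "f = f'" by simp
  qed
  then have "card T2 = card R2" by (simp add: T2_def card_image)
  moreover have "card ({(p, l) \<in> P \<times> L. p \<bullet> l = 0} \<times> Pi\<^sub>E {..<k - 2} A) \<le> card R2"
  proof (rule card_inj_on_le[where f = "\<lambda>((p, l), f). f(r - 1 := p, r := l)"])
    show "inj_on (\<lambda>((p, l), f). f(r - 1 := p, r := l)) ({(p, l) \<in> P \<times> L. p \<bullet> l = 0} \<times> Pi\<^sub>E {..<k - 2} A)"
    proof (rule inj_onI)
      fix a b assume ab: "a \<in> {(p, l) \<in> P \<times> L. p \<bullet> l = 0} \<times> Pi\<^sub>E {..<k - 2} A" "b \<in> {(p, l) \<in> P \<times> L. p \<bullet> l = 0} \<times> Pi\<^sub>E {..<k - 2} A"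
        "(\<lambda>((p, l), f). f(r - 1 := p, r := l)) a = (\<lambda>((p, l), f). f(r - 1 := p, r := l)) b"
      obtain p l f p' l' f' where a: "a = ((p, l), f)" and b: "b = ((p', l'), f')" by (metis surj_pair)
      have eq: "f(r - 1 := p, r := l) = f'(r - 1 := p', r := l')" using ab(3) a b by simp
      have "f i = f' i" if "i \<in> {..<k - 2}" for i using fun_cong[OF eq, of i] that kr by auto
      then have "f = f'" using ab(1,2) a b by (intro PiE_ext[of f "{..<k - 2}" A]) auto
      moreover have "p = p'" "l = l'" using fun_cong[OF eq, of "r - 1"] fun_cong[OF eq, of r] rne by simp_all
      ultimately show "a = b" using a b by simp
    qed
    show "(\<lambda>((p, l), f). f(r - 1 := p, r := l)) ` ({(p, l) \<in> P \<times> L. p \<bullet> l = 0} \<times> Pi\<^sub>E {..<k - 2} A) \<subseteq> R2"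
    proof (rule image_subsetI)
      fix a assume aa: "a \<in> {(p, l) \<in> P \<times> L. p \<bullet> l = 0} \<times> Pi\<^sub>E {..<k - 2} A"
      obtain p l f where a: "a = ((p, l), f)" by (metis surj_pair)
      have m: "p \<in> P" "l \<in> L" "p \<bullet> l = 0" "f \<in> Pi\<^sub>E {..<k - 2} A" using aa a by auto
      have "f(r - 1 := p, r := l) \<in> Pi\<^sub>E J2 A'"
      proof (rule PiE_I)
        fix i assume "i \<in> J2"
        then show "(f(r - 1 := p, r := l)) i \<in> A' i" using m kr k by (auto simp: J2_def A'_def PiE_def Pi_def)
      next
        fix i assume "i \<notin> J2"
        then show "(f(r - 1 := p, r := l)) i = undefined" using m(4) by (auto simp: J2_def PiE_def extensional_def)
      qed
      then show "(\<lambda>((p, l), f). f(r - 1 := p, r := l)) a \<in> R2" using m rne by (simp add: a R2_def)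
    qed
  qed (fact finR2)
  moreover have "card (Pi\<^sub>E {..<k - 2} A) = q ^ (k - 2)"
  proof -
    have "card (Pi\<^sub>E {..<k - 2} A) = (\<Prod>j\<in>{..<k - 2}. card (A j))" by (intro card_PiE) simp
    also have "\<dots> = (\<Prod>j\<in>{..<k - 2}. q)" using A(3) kr by (intro prod.cong) auto
    finally show ?thesis by simp
  qed
  ultimately have "card {(p, l) \<in> P \<times> L. p \<bullet> l = 0} * q ^ (k - 2) \<le> card T2"
    by (simp only: card_cartesian_product)
  moreover have "M ^ 4 * q ^ (k - 2) \<le> card {(p, l) \<in> P \<times> L. p \<bullet> l = 0} * q ^ (k - 2)"
    using PL(6) by (rule mult_right_mono) simp
  ultimately have cT2: "M ^ 4 * q ^ (k - 2) \<le> card T2" by (rule order_trans[rotated])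
  have T2e: "\<exists>p l f. p \<in> P \<and> l \<in> L \<and> p \<bullet> l = 0 \<and> f \<in> Pi\<^sub>E J2 A' \<and> S = f ` J2 \<and> p = f (r - 1) \<and> l = f r" if S: "S \<in> T2" for S
  proof -
    from S obtain f where f: "f \<in> Pi\<^sub>E J2 A'" "f (r - 1) \<bullet> f r = 0" "S = f ` J2" by (auto simp: T2_def R2_def)
    have "f (r - 1) \<in> A' (r - 1)" "f r \<in> A' r" using f(1) by (auto simp: PiE_def Pi_def J2_def)
    then have "f (r - 1) \<in> P" "f r \<in> L" using rne by (simp_all add: A'_def)
    then show ?thesis using f by blast
  qed
  have T2s: "T2 \<subseteq> spanned_simplices k X"
  proof
    fix S assume "S \<in> T2"
    then obtain p l f where f: "p \<in> P" "l \<in> L" "p \<bullet> l = 0" "f \<in> Pi\<^sub>E J2 A'" "S = f ` J2" "p = f (r - 1)" "l = f r"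
      using T2e by blast
    have fA: "f j \<in> A' j" if "j \<in> J2" for j using f(4) that by (auto simp: PiE_def Pi_def)
    have plA: "p \<in> A (r - 1)" "l \<in> A (r - 1)" using f(1,2) A(4) by auto
    have loc: "\<exists>i'<r. f i \<in> A i' \<and> (i' = r - 1 \<longrightarrow> i = r - 1 \<or> i = r) \<and> (i' \<noteq> r - 1 \<longrightarrow> i' = i)" if "i \<in> J2" for i
    proof (cases "i = r - 1 \<or> i = r")
      case True
      then show ?thesis using plA f(6,7) k by (intro exI[of _ "r - 1"]) auto
    next
      case False
      then have "i < r - 1" using that kr by (auto simp: J2_def)
      then show ?thesis using fA[OF that] False by (intro exI[of _ i]) (auto simp: A'_def)
    qed
    show "S \<in> spanned_simplices k X"
    proof (rule simplexI)
      show "S \<subseteq> X"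
      proof
        fix x assume "x \<in> S"
        then obtain i where "i \<in> J2" "x = f i" using f(5) by blast
        then show "x \<in> X" using loc[of i] AX by blast
      qed
      show "finite S" using J2 f by simp
      have "inj_on f J2" by (rule section_inj_on[OF _ f(4)]) (use A'disj in auto)
      then show "card S = k" using f J2 by (simp add: card_image)
      fix x y assume xy: "x \<in> S" "y \<in> S" "x \<noteq> y"
      then obtain i j where ij: "i \<in> J2" "j \<in> J2" "x = f i" "y = f j" "i \<noteq> j" using f(5) by blast
      obtain i' where i': "i' < r" "f i \<in> A i'" "i' = r - 1 \<longrightarrow> i = r - 1 \<or> i = r" "i' \<noteq> r - 1 \<longrightarrow> i' = i" using loc[OF ij(1)] by blast
      obtain j' where j': "j' < r" "f j \<in> A j'" "j' = r - 1 \<longrightarrow> j = r - 1 \<or> j = r" "j' \<noteq> r - 1 \<longrightarrow> j' = j" using loc[OF ij(2)] by blast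
      show "dist x y = sqrt 2"
      proof (cases "i' = j'")
        case False
        then show ?thesis using distA[OF i'(1) j'(1) False] i' j' ij by simp
      next
        case True
        then have "(i = r - 1 \<and> j = r) \<or> (i = r \<and> j = r - 1)" using i' j' ij(5) by metis
        then have "(x = p \<and> y = l) \<or> (x = l \<and> y = p)" using ij f by auto
        moreover have "dist p l = sqrt 2" using PL(5)[of p] PL(5)[of l] f by (intro d2) auto
        ultimately show ?thesis by (auto simp: dist_commute)
      qed
    qed
  qed
  have "T1 \<inter> T2 = {}"
  proof -
    have False if S: "S \<in> T1" "S \<in> T2" for S
    proof -
      from S(1) obtain J g where g: "J \<subseteq> {..<r}" "g \<in> Pi\<^sub>E J A" "S = g ` J" by (auto simp: T1_def R1_def)
      from T2e[OF S(2)] obtain p l f where f: "p \<in> P" "l \<in> L" "p \<in> S" "l \<in> S" by (auto simp: J2_def)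
      obtain i j where ij: "i \<in> J" "j \<in> J" "p = g i" "l = g j" using f(3,4) g(3) by blast
      have "g i \<in> A i" "g j \<in> A j" using g(2) ij by (auto simp: PiE_def Pi_def)
      moreover have "g i \<in> A (r - 1)" "g j \<in> A (r - 1)" using f ij A(4) by auto
      ultimately have "i = r - 1" "j = r - 1" using Adisj[of i "r - 1"] Adisj[of j "r - 1"] g(1) ij by auto
      then have "p = l" using ij by simp
      then show False using f PL(3) by blast
    qed
    then show ?thesis by blast
  qed
  moreover have fins: "finite (spanned_simplices k X)" unfolding spanned_simplices_def using finX by (rule finite_subset_family)
  ultimately have "card (T1 \<union> T2) = card T1 + card T2" using T1s T2s finite_subset by (intro card_Un_disjoint) blast+
  moreover have "card (T1 \<union> T2) \<le> card (spanned_simplices k X)" using T1s T2s fins by (intro card_mono) auto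
  ultimately have "(r choose k) * q ^ k + M ^ 4 * q ^ (k - 2) \<le> card (spanned_simplices k X)" using cT1 cT2 by linarith
  then show ?thesis using finX cX by blast
qed

lemma lenz_lower_bound:
  assumes dim: "DIM('a::euclidean_space) = 2 * r + 1" and k: "3 \<le> k" "k \<le> r"
  shows "\<exists>c>0. \<exists>n0. \<forall>n\<ge>n0. \<exists>X :: 'a set. finite X \<and> card X = n \<and>
     real (r choose k) * (real n / real r) ^ k + c * real n powr (real k - 2 / 3) \<le> real (card (spanned_simplices k X))"
proof -
  define R where "R = real r"
  have R: "R \<ge> 3" using k by (simp add: R_def)
  define B where "B = real (r choose k)"
  \<comment> \<open>From \<open>q \<ge> n / (2 * r)\<close> and \<open>q < 24 * M ^ 3\<close>
    follows \<open>M ^ 3 \<ge> n / (48 * r)\<close>. This gives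
    \<open>2 * c * n powr (k - 2 / 3)\<close> extra simplices, half of which are spent on
    rounding.\<close>
  define c where "c = (1 / (48 * R)) powr (real k - 2 / 3) / 2"
  have c: "c > 0" using R by (simp add: c_def)
  \<comment> \<open>Rounding \<open>n / r\<close> down to \<open>q\<close> loses at most
    \<open>B * k * (n / r) ^ (k - 1)\<close>; for \<open>n \<ge> D ^ 3\<close> this is at most
    \<open>c * n powr (k - 2 / 3)\<close>.\<close>
  define D where "D = B * real k / (R ^ (k - 1) * c)"
  have D: "D \<ge> 0" using R c by (simp add: D_def B_def)
  define n0 where "n0 = Max {3 * r, 2 * r, nat \<lceil>D ^ 3\<rceil>}"
  have "\<exists>X :: 'a set. finite X \<and> card X = n \<and>
     B * (real n / R) ^ k + c * real n powr (real k - 2 / 3) \<le> real (card (spanned_simplices k X))" if n: "n \<ge> n0" for n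
  proof -
    have "3 * r \<le> n0" "nat \<lceil>D ^ 3\<rceil> \<le> n0" unfolding n0_def by (intro Max_ge; simp)+
    then have n': "n \<ge> 3 * r" "n \<ge> nat \<lceil>D ^ 3\<rceil>" using n by auto
    define m where "m = real n"
    have m: "m \<ge> 3 * R" "m \<ge> D ^ 3" using n' unfolding m_def R_def by linarith+
    have m0: "m > 0" using m R by linarith
    define q where "q = n div r"
    have rq: "r * q \<le> n" by (simp add: q_def)
    have q3: "q \<ge> 3" using n'(1) k by (simp add: q_def less_eq_div_iff_mult_less_eq)
    have "n < r * q + r" using k by (simp add: q_def) (metis div_mult_mod_eq mod_less_divisor add_less_cancel_left mult.commute not_gr_zero not_numeral_le_zero order_trans le_zero_eq)
    then have "m < R * real q + R" unfolding m_def R_def by (metis of_nat_add of_nat_less_iff of_nat_mult)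
    then have qm: "real q \<ge> m / R - 1" using R by (simp add: field_simps)
    moreover have "m / R \<ge> 3" using m R by (simp add: field_simps)
    ultimately have q2: "real q \<ge> m / (2 * R)" by (simp add: field_simps)
    \<comment> \<open>The largest grid that fits into a part of \<open>q\<close> points.\<close>
    define M where "M = (GREATEST M. 3 * M ^ 3 \<le> q)"
    have bnd: "y \<le> q" if "3 * y ^ 3 \<le> q" for y :: nat
    proof (cases "y = 0")
      case False
      then have "y \<le> y ^ 3" by (simp add: self_le_power)
      then show ?thesis using that by linarith
    qed simp
    have M: "3 * M ^ 3 \<le> q" unfolding M_def
      using GreatestI_nat[where P = "\<lambda>M. 3 * M ^ 3 \<le> q" and k = 1 and b = q, OF _ bnd] q3 by simp
    have Mmax: "y \<le> M" if "3 * y ^ 3 \<le> q" for y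
      unfolding M_def by (rule Greatest_le_nat[where P = "\<lambda>M. 3 * M ^ 3 \<le> q" and b = q, OF that bnd])
    have M1: "M \<ge> 1" using Mmax[of 1] q3 by simp
    have "\<not> 3 * (M + 1) ^ 3 \<le> q" using Mmax[of "M + 1"] by auto
    then have "q < 3 * (M + 1) ^ 3" by simp
    also have "(M + 1) ^ 3 \<le> (2 * M) ^ 3" using M1 by (intro power_mono) auto
    finally have "q < 24 * M ^ 3" by (simp add: power_mult_distrib)
    then have "real q < 24 * real M ^ 3" by (metis of_nat_less_iff of_nat_mult of_nat_numeral of_nat_power)
    moreover have "m / (48 * R) = m / (2 * R) / 24" by simp
    ultimately have M3: "real M ^ 3 \<ge> m / (48 * R)" using q2 by linarith
    obtain X :: "'a set" where X: "finite X" "card X = n" "(r choose k) * q ^ k + M ^ 4 * q ^ (k - 2) \<le> card (spanned_simplices k X)"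
      using lenz_construction[OF dim k M rq] by blast
    define z where "z = m / (48 * R)"
    have z: "z > 0" using m0 R by (simp add: z_def)
    have "real M ^ 4 \<ge> z powr (4/3)"
    proof -
      have "real M ^ 4 = real M powr (3 * (4/3))" by simp
      also have "\<dots> = (real M powr 3) powr (4/3)" by (simp only: powr_powr)
      also have "real M powr 3 = real M ^ 3" using M1 by simp
      finally show ?thesis using M3 z unfolding z_def by (simp add: powr_mono2)
    qed
    moreover have "real q ^ (k - 2) \<ge> z powr (real k - 2)"
    proof -
      have "z \<le> m / (2 * R)" unfolding z_def using m0 R by (simp add: field_simps)
      then have "z ^ (k - 2) \<le> real q ^ (k - 2)" using q2 z by (intro power_mono) auto
      moreover have "z ^ (k - 2) = z powr (real k - 2)" using z k by (simp add: powr_realpow[symmetric] of_nat_diff)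
      ultimately show ?thesis by simp
    qed
    ultimately have "z powr (4/3) * z powr (real k - 2) \<le> real M ^ 4 * real q ^ (k - 2)" by (intro mult_mono) auto
    moreover have "z powr (4/3) * z powr (real k - 2) = z powr (real k - 2 / 3)"
    proof -
      have "4/3 + (real k - 2) = real k - 2 / 3" by simp
      then show ?thesis by (metis powr_add)
    qed
    moreover have "z powr (real k - 2 / 3) = 2 * c * m powr (real k - 2 / 3)"
    proof -
      have "z = 1 / (48 * R) * m" by (simp add: z_def)
      then show ?thesis using R m0 by (simp only: powr_mult) (simp add: c_def)
    qed
    ultimately have extra: "2 * c * m powr (real k - 2 / 3) \<le> real M ^ 4 * real q ^ (k - 2)" by simp
    have loss: "B * (m / R) ^ k - B * real k * (m / R) ^ (k - 1) \<le> B * real q ^ k"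
    proof -
      define y where "y = m / R"
      have y: "y \<ge> 3" using m R by (simp add: y_def field_simps)
      have "1 + real k * (- 1 / y) \<le> (1 + (- 1 / y)) ^ k" by (rule Bernoulli_inequality) (use y in \<open>simp add: field_simps\<close>)
      then have "y ^ k * (1 + real k * (- 1 / y)) \<le> y ^ k * (1 + (- 1 / y)) ^ k" using y by (intro mult_left_mono) auto
      also have "\<dots> = (y * (1 + (- 1 / y))) ^ k" by (simp only: power_mult_distrib)
      also have "y * (1 + (- 1 / y)) = y - 1" using y by (simp add: field_simps)
      also have "(y - 1) ^ k \<le> real q ^ k" using qm y by (intro power_mono) (auto simp: y_def)
      also have "y ^ k * (1 + real k * (- 1 / y)) = y ^ k - real k * y ^ (k - 1)"
      proof -
        have "Suc (k - 1) = k" using k by simp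
        then have "y ^ k = y * y ^ (k - 1)" by (metis power_Suc)
        then show ?thesis using y by (simp add: field_simps)
      qed
      finally have "B * (y ^ k - real k * y ^ (k - 1)) \<le> B * real q ^ k" by (intro mult_left_mono) (simp_all add: B_def)
      then show ?thesis by (simp add: y_def right_diff_distrib mult.assoc)
    qed
    have small: "B * real k * (m / R) ^ (k - 1) \<le> c * m powr (real k - 2 / 3)"
    proof -
      have "D = (D ^ 3) powr (1/3)" using D by (cases "D = 0") (simp_all add: powr_powr flip: powr_numeral)
      also have "\<dots> \<le> m powr (1/3)" using m D by (intro powr_mono2) auto
      finally have Dm: "D \<le> m powr (1/3)" .
      have "B * real k * (m / R) ^ (k - 1) = c * D * m ^ (k - 1)" using c R by (simp add: D_def power_divide)
      also have "\<dots> \<le> c * m powr (1/3) * m ^ (k - 1)" using Dm c m0 by (intro mult_right_mono mult_left_mono) auto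
      also have "m ^ (k - 1) = m powr (real k - 1)" using m0 k by (simp add: powr_realpow[symmetric] of_nat_diff)
      also have "c * m powr (1/3) * m powr (real k - 1) = c * m powr (1/3 + (real k - 1))" by (simp only: powr_add mult.assoc)
      also have "1/3 + (real k - 1) = real k - 2 / 3" by simp
      finally show ?thesis .
    qed
    have "B * (m / R) ^ k + c * m powr (real k - 2 / 3) \<le> B * real q ^ k + real M ^ 4 * real q ^ (k - 2)"
      using loss small extra by linarith
    also have "\<dots> = real ((r choose k) * q ^ k + M ^ 4 * q ^ (k - 2))" by (simp add: B_def)
    also have "\<dots> \<le> real (card (spanned_simplices k X))" using X(3) by (simp only: of_nat_le_iff)
    finally show ?thesis using X(1,2) by (auto simp: m_def)
  qed
  then show ?thesis using c unfolding B_def R_def by blast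
qed

theorem theorem2:
  fixes r k :: nat
  assumes "3 \<le> k" and "k \<le> r" and "CARD('d::finite) = 2 * r + 1"
  shows "\<exists>c1 c2 :: real. \<exists>n0 :: nat. 0 < c1 \<and> 0 < c2 \<and> (\<forall>n\<ge>n0.
      real (r choose k) * (real n / real r) ^ k + c1 * real n powr (real k - 2 / 3)
        \<le> real (max_simplices TYPE('d) k n) \<and>
      real (max_simplices TYPE('d) k n)
        \<le> real (r choose k) * (real n / real r) ^ k + c2 * real n powr (real k - 2 / 3))"
proof -
  have dim: "DIM(real ^ 'd) = 2 * r + 1" using assms(3) by simp
  obtain c1 n0 where c1: "c1 > 0" and lower: "\<And>n. n \<ge> n0 \<Longrightarrow> \<exists>X :: (real ^ 'd) set. finite X \<and> card X = n \<and>
     real (r choose k) * (real n / real r) ^ k + c1 * real n powr (real k - 2 / 3) \<le> real (card (spanned_simplices k X))"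
    using lenz_lower_bound[OF dim assms(1,2)] by blast
  obtain c2 where c2: "c2 > 0" and upper: "\<And>X :: (real ^ 'd) set. finite X \<Longrightarrow> real (card (spanned_simplices k X))
     \<le> real (r choose k) * (real (card X) / real r) ^ k + c2 * real (card X) powr (real k - 2 / 3)"
    using spanned_simplices_upper_bound[OF dim assms(1,2)] by blast
  have "real (r choose k) * (real n / real r) ^ k + c1 * real n powr (real k - 2 / 3)
        \<le> real (max_simplices TYPE('d) k n)" if n: "n \<ge> n0" for n
  proof -
    obtain X :: "(real ^ 'd) set" where X: "finite X" "card X = n"
      "real (r choose k) * (real n / real r) ^ k + c1 * real n powr (real k - 2 / 3) \<le> real (card (spanned_simplices k X))"
      using lower[OF n] by blast
    then show ?thesis using max_simplices_ge[OF X(1,2), of k] by linarith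
  qed
  moreover have "real (max_simplices TYPE('d) k n)
        \<le> real (r choose k) * (real n / real r) ^ k + c2 * real n powr (real k - 2 / 3)" for n
  proof -
    obtain X :: "(real ^ 'd) set" where X: "finite X" "card X = n" "card (spanned_simplices k X) = max_simplices TYPE('d) k n"
      using max_simplices_attained by blast
    then show ?thesis using upper[OF X(1)] by simp
  qed
  ultimately show ?thesis using c1 c2 by blast
qed

end
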